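(* Let $Q$ be a finite connected acyclic quiver which is not of type $A_1$ and let $\Lambda=\mathbb{F}Q$ be its path algebra over a field $\mathbb{F}$. Let $\Pi$ be the $2$-preprojective algebra of $\Lambda$. Then the natural morphism $\phi:\Pi^!\to\operatorname{Triv}_2(\Lambda^!)$ of $\mathbb{Z}$-graded $\mathbb{F}$-algebras is an isomorphism if and only if $Q$ is not of type $A_2$.
   Context: "Type $A_n$" refers to the underlying graph of $Q$. $(-)^*=\operatorname{Hom}_{\mathbb{F}}(-,\mathbb{F})$. $\Lambda=T_S(V)$ with $S=\mathbb{F}Q_0$, $V=\mathbb{F}Q_1$, is Koszul of global dimension $1$ with the path length grading. For an $S$-bimodule $X$ put $X^{*\ell}=\operatorname{Hom}_S(X,S)$, $X^\vee=\operatorname{Hom}_{S^{\mathrm{en}}}(X,S^{\mathrm{en}})$, $S^{\mathrm{en}}=S\otimes_{\mathbb{F}}S^{\mathrm{op}}$. **Quadratic dual.** For a quadratic algebra $A=T_S(U)/(R)$ with $R\subset U\otimes_SU$, $A^!=T_S(U^{*\ell})/(R^\perp)$, where $U^{*\ell}\otimes_SU^{*\ell}\cong(U\otimes_SU)^{*\ell}$ via $f\otimes g\mapsto(x\otimes y\mapsto g(xf(y)))$ and $R^\perp=\{f\mid f(R)=0\}$. **Preprojective algebra.** $\Pi=T_\Lambda(\operatorname{Ext}^1_\Lambda(\Lambda^*,\Lambda))$; it is a quadratic algebra, a quotient of $T_S(\overline V)$ with $\overline V=V\oplus V^\vee$ in degree 1. **Graded trivial extension.** $\operatorname{Triv}_2(\Gamma)=\Gamma\oplus\Gamma^*(-2)$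 with $(\Gamma_i)^*$ in degree $2-i$ and multiplication $(a,f)(b,g)=(ab,ag+(-1)^ifb)$ for $b\in\Gamma_i$. **The natural morphism $\phi$.** $\Pi^!$ is a quotient of $T_S(\overline V^{*\ell})$; $\operatorname{Triv}_2(\Lambda^!)$ has degree 0 part $S$ and degree 1 part $(\Lambda^!)_1\oplus((\Lambda^!)_1)^*$, identified with $\overline V^{*\ell}=V^{*\ell}\oplus V^{\vee*\ell}$ via $(\Lambda^!)_1=V^{*\ell}$ and $(V^{*\ell})^*\cong V\cong V^{\vee*\ell}$ (the isomorphisms between the duals coming from the standard symmetrizing form on $S$, taking value 1 on each vertex idempotent). $\phi$ is the graded algebra morphism induced by these identifications in degrees 0 and 1. *)

theory Defs
  imports "Graph_Theory.Graph_Theory" "HOL-Algebra.QuotRing" "HOL-Algebra.Module" "HOL-Library.FuncSet"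
begin

section \<open>Algebras, bimodules, quotients\<close>

text \<open>
  The ground field is a type of class \<^class>\<open>field\<close>.  An algebra over it, not necessarily commutative,
  is a HOL-Algebra record of type \<^type>\<open>module\<close> (a ring record with scalar multiplication).
  Gradings are indexed by the integers.
\<close>

record ('f, 'a) graded_algebra = "('f, 'a) module" +
  degs :: "int \<Rightarrow> 'a set"

text \<open>As for modules in HOL-Algebra, the fields for product and unit are irrelevant for bimodules.\<close>

record ('f, 'a, 'm) bimod = "('f, 'm) module" +
  lact :: "'a \<Rightarrow> 'm \<Rightarrow> 'm"
  ract :: "'m \<Rightarrow> 'a \<Rightarrow> 'm"

definition quot_algebra ::
    "('f, 'a, 'z) graded_algebra_scheme \<Rightarrow> 'a set \<Rightarrow> ('f, 'a set) graded_algebra" where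
  "quot_algebra A I =
    \<lparr>carrier = a_rcosets\<^bsub>A\<^esub> I, mult = rcoset_mult A I, one = I +>\<^bsub>A\<^esub> \<one>\<^bsub>A\<^esub>,
     zero = I, add = set_add A,
     smult = (\<lambda>c X. \<Union>x\<in>X. I +>\<^bsub>A\<^esub> (c \<odot>\<^bsub>A\<^esub> x)),
     degs = (\<lambda>n. (\<lambda>x. I +>\<^bsub>A\<^esub> x) ` degs A n)\<rparr>"

definition quot_bimod ::
    "('f, 'a, 'm, 'z) bimod_scheme \<Rightarrow> 'm set \<Rightarrow> ('f, 'a, 'm set) bimod" where
  "quot_bimod M N =
    \<lparr>carrier = a_rcosets\<^bsub>M\<^esub> N, mult = undefined, one = undefined,
     zero = N, add = set_add M,
     smult = (\<lambda>c X. \<Union>x\<in>X. N +>\<^bsub>M\<^esub> (c \<odot>\<^bsub>M\<^esub> x)),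
     lact = (\<lambda>a X. \<Union>x\<in>X. N +>\<^bsub>M\<^esub> (lact M a x)),
     ract = (\<lambda>X a. \<Union>x\<in>X. N +>\<^bsub>M\<^esub> (ract M x a))\<rparr>"

definition direct_sum ::
    "('f, 'a, 'm) bimod \<Rightarrow> ('f, 'a, 'n) bimod \<Rightarrow> ('f, 'a, 'm \<times> 'n) bimod" where
  "direct_sum M N =
    \<lparr>carrier = carrier M \<times> carrier N, mult = undefined, one = undefined,
     zero = (\<zero>\<^bsub>M\<^esub>, \<zero>\<^bsub>N\<^esub>),
     add = (\<lambda>(x, y) (x', y'). (x \<oplus>\<^bsub>M\<^esub> x', y \<oplus>\<^bsub>N\<^esub> y')),
     smult = (\<lambda>c (x, y). (c \<odot>\<^bsub>M\<^esub> x, c \<odot>\<^bsub>N\<^esub> y)),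
     lact = (\<lambda>a (x, y). (lact M a x, lact N a y)),
     ract = (\<lambda>(x, y) a. (ract M x a, ract N y a))\<rparr>"

definition regular_bimod :: "('f, 'a, 'z) module_scheme \<Rightarrow> ('f, 'a, 'a) bimod" where
  "regular_bimod A =
    \<lparr>carrier = carrier A, mult = undefined, one = undefined, zero = \<zero>\<^bsub>A\<^esub>, add = add A,
     smult = smult A, lact = mult A, ract = mult A\<rparr>"

definition graded_hom ::
    "('f, 'a) graded_algebra \<Rightarrow> ('f, 'b) graded_algebra \<Rightarrow> ('a \<Rightarrow> 'b) set" where
  "graded_hom A B = {h \<in> ring_hom A B.
     (\<forall>c. \<forall>x\<in>carrier A. h (c \<odot>\<^bsub>A\<^esub> x) = c \<odot>\<^bsub>B\<^esub> h x) \<and>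
     (\<forall>n. h ` degs A n \<subseteq> degs B n)}"

definition graded_iso ::
    "('f, 'a) graded_algebra \<Rightarrow> ('f, 'b) graded_algebra \<Rightarrow> ('a \<Rightarrow> 'b) set" where
  "graded_iso A B = {h \<in> graded_hom A B.
     bij_betw h (carrier A) (carrier B) \<and> (\<forall>n. h ` degs A n = degs B n)}"


section \<open>Linear duals\<close>

text \<open>Maps out of a module are represented by functions extensional on its carrier.\<close>

definition linear_maps ::
    "('f, 'm, 'y) module_scheme \<Rightarrow> ('f, 'n, 'z) module_scheme \<Rightarrow> ('m \<Rightarrow> 'n) set" where
  "linear_maps M N = {h \<in> carrier M \<rightarrow>\<^sub>E carrier N.
     (\<forall>x\<in>carrier M. \<forall>y\<in>carrier M. h (x \<oplus>\<^bsub>M\<^esub> y) = h x \<oplus>\<^bsub>N\<^esub> h y) \<and>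
     (\<forall>c. \<forall>x\<in>carrier M. h (c \<odot>\<^bsub>M\<^esub> x) = c \<odot>\<^bsub>N\<^esub> h x)}"

definition ground_algebra :: "('f::field, 'f) module" where
  "ground_algebra =
    \<lparr>carrier = UNIV, mult = (*), one = 1, zero = 0, add = (+), smult = (*)\<rparr>"

definition dual_bimod :: "('f::field, 'a, 'z) module_scheme \<Rightarrow> ('f, 'a, 'a \<Rightarrow> 'f) bimod" where
  "dual_bimod A =
    \<lparr>carrier = linear_maps A ground_algebra, mult = undefined, one = undefined,
     zero = (\<lambda>x\<in>carrier A. 0),
     add = (\<lambda>f g. \<lambda>x\<in>carrier A. f x + g x),
     smult = (\<lambda>c f. \<lambda>x\<in>carrier A. c * f x),
     lact = (\<lambda>a f. \<lambda>x\<in>carrier A. f (x \<otimes>\<^bsub>A\<^esub> a)),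
     ract = (\<lambda>f a. \<lambda>x\<in>carrier A. f (a \<otimes>\<^bsub>A\<^esub> x))\<rparr>"

text \<open>The left dual of an \<open>A\<close>-bimodule \<open>X\<close>: the left \<open>A\<close>-linear maps from \<open>X\<close> to \<open>A\<close>.\<close>

definition left_dual ::
    "('f, 'a, 'z) module_scheme \<Rightarrow> ('f, 'a, 'm) bimod \<Rightarrow> ('f, 'a, 'm \<Rightarrow> 'a) bimod" where
  "left_dual A X =
    \<lparr>carrier = {f \<in> linear_maps X A.
       \<forall>a\<in>carrier A. \<forall>x\<in>carrier X. f (lact X a x) = a \<otimes>\<^bsub>A\<^esub> f x},
     mult = undefined, one = undefined,
     zero = (\<lambda>x\<in>carrier X. \<zero>\<^bsub>A\<^esub>),
     add = (\<lambda>f g. \<lambda>x\<in>carrier X. f x \<oplus>\<^bsub>A\<^esub> g x),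
     smult = (\<lambda>c f. \<lambda>x\<in>carrier X. c \<odot>\<^bsub>A\<^esub> f x),
     lact = (\<lambda>a f. \<lambda>x\<in>carrier X. f (ract X x a)),
     ract = (\<lambda>f a. \<lambda>x\<in>carrier X. f x \<otimes>\<^bsub>A\<^esub> a)\<rparr>"


section \<open>Tensor algebras\<close>

text \<open>
  The tensor algebra of an \<open>A\<close>-bimodule \<open>M\<close> is the free algebra on the disjoint union of \<open>A\<close> and \<open>M\<close>
  modulo the relations that make \<open>A\<close> a subalgebra, \<open>M\<close> a subspace, and the product of
  elements of \<open>A\<close> with elements of \<open>M\<close> the given action.  Its degree counts the letters from \<open>M\<close>;
  the part of degree 2 is the tensor square of \<open>M\<close> over \<open>A\<close>.
\<close>

definition free_algebra ::
    "('f::field, 'a, 'y) module_scheme \<Rightarrow> ('f, 'a, 'm, 'z) bimod_scheme \<Rightarrow>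
     ('f, ('a + 'm) list \<Rightarrow> 'f) graded_algebra" where
  "free_algebra A M =
    (let C = {x. finite {w. x w \<noteq> 0} \<and> (\<forall>w. x w \<noteq> 0 \<longrightarrow> set w \<subseteq> carrier A <+> carrier M)} in
    \<lparr>carrier = C,
     mult = (\<lambda>x y w. \<Sum>k\<le>length w. x (take k w) * y (drop k w)),
     one = (\<lambda>w. if w = [] then 1 else 0),
     zero = (\<lambda>w. 0),
     add = (\<lambda>x y w. x w + y w),
     smult = (\<lambda>c x w. c * x w),
     degs = (\<lambda>n. {x \<in> C. \<forall>w. x w \<noteq> 0 \<longrightarrow> int (length (filter (\<lambda>l. \<not> isl l) w)) = n})\<rparr>)"

definition word :: "'l list \<Rightarrow> 'l list \<Rightarrow> 'f::field" where
  "word w = (\<lambda>u. if u = w then 1 else 0)"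

definition tensor_rels ::
    "('f::field, 'a, 'y) module_scheme \<Rightarrow> ('f, 'a, 'm, 'z) bimod_scheme \<Rightarrow>
     (('a + 'm) list \<Rightarrow> 'f) set" where
  "tensor_rels A M = (let F = free_algebra A M in
     {word [Inl (a \<oplus>\<^bsub>A\<^esub> b)] \<ominus>\<^bsub>F\<^esub> (word [Inl a] \<oplus>\<^bsub>F\<^esub> word [Inl b])
        |a b. a \<in> carrier A \<and> b \<in> carrier A} \<union>
     {word [Inl (c \<odot>\<^bsub>A\<^esub> a)] \<ominus>\<^bsub>F\<^esub> (c \<odot>\<^bsub>F\<^esub> word [Inl a]) |c a. a \<in> carrier A} \<union>
     {word [Inl (a \<otimes>\<^bsub>A\<^esub> b)] \<ominus>\<^bsub>F\<^esub> word [Inl a, Inl b] |a b. a \<in> carrier A \<and> b \<in> carrier A} \<union>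
     {word [Inl \<one>\<^bsub>A\<^esub>] \<ominus>\<^bsub>F\<^esub> \<one>\<^bsub>F\<^esub>} \<union>
     {word [Inr (m \<oplus>\<^bsub>M\<^esub> n)] \<ominus>\<^bsub>F\<^esub> (word [Inr m] \<oplus>\<^bsub>F\<^esub> word [Inr n])
        |m n. m \<in> carrier M \<and> n \<in> carrier M} \<union>
     {word [Inr (c \<odot>\<^bsub>M\<^esub> m)] \<ominus>\<^bsub>F\<^esub> (c \<odot>\<^bsub>F\<^esub> word [Inr m]) |c m. m \<in> carrier M} \<union>
     {word [Inr (lact M a m)] \<ominus>\<^bsub>F\<^esub> word [Inl a, Inr m] |a m. a \<in> carrier A \<and> m \<in> carrier M} \<union>
     {word [Inr (ract M m a)] \<ominus>\<^bsub>F\<^esub> word [Inr m, Inl a] |a m. a \<in> carrier A \<and> m \<in> carrier M})"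

definition tensor_ideal ::
    "('f::field, 'a, 'y) module_scheme \<Rightarrow> ('f, 'a, 'm, 'z) bimod_scheme \<Rightarrow>
     (('a + 'm) list \<Rightarrow> 'f) set" where
  "tensor_ideal A M = genideal (free_algebra A M) (tensor_rels A M)"

definition tensor_algebra ::
    "('f::field, 'a, 'y) module_scheme \<Rightarrow> ('f, 'a, 'm, 'z) bimod_scheme \<Rightarrow>
     ('f, (('a + 'm) list \<Rightarrow> 'f) set) graded_algebra" where
  "tensor_algebra A M = quot_algebra (free_algebra A M) (tensor_ideal A M)"

definition tensor_letter ::
    "('f::field, 'a, 'y) module_scheme \<Rightarrow> ('f, 'a, 'm, 'z) bimod_scheme \<Rightarrow> 'a + 'm \<Rightarrow>
     (('a + 'm) list \<Rightarrow> 'f) set" where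
  "tensor_letter A M l = tensor_ideal A M +>\<^bsub>free_algebra A M\<^esub> word [l]"

text \<open>Substitution of elements of an algebra \<open>B\<close> for the letters.\<close>

definition subst ::
    "('f::field, 'b, 'z) module_scheme \<Rightarrow> ('l \<Rightarrow> 'b) \<Rightarrow> ('l list \<Rightarrow> 'f) \<Rightarrow> 'b" where
  "subst B g x =
    finsum B (\<lambda>w. x w \<odot>\<^bsub>B\<^esub> foldr (mult B) (map g w) \<one>\<^bsub>B\<^esub>) {w. x w \<noteq> 0}"


section \<open>Quadratic duals\<close>

text \<open>
  The quadratic relations among generators \<open>g (Inr u)\<close> of degree one of an algebra \<open>B\<close>, whose part of
  degree zero is given by \<open>g (Inl a)\<close>: the kernel in degree 2 of the induced map from the tensor
  algebra to \<open>B\<close>.  If this map is surjective and its kernel is generated by a set \<open>R\<close> of degree 2,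
  closed under the bimodule operations, then \<open>R\<close> is this kernel.
\<close>

definition quadratic_relations ::
    "('f::field, 'a, 'y) module_scheme \<Rightarrow> ('f, 'a, 'm) bimod \<Rightarrow>
     ('f, 'b, 'z) module_scheme \<Rightarrow> ('a + 'm \<Rightarrow> 'b) \<Rightarrow> (('a + 'm) list \<Rightarrow> 'f) set set" where
  "quadratic_relations A U B g =
    {X \<in> degs (tensor_algebra A U) 2. \<forall>x\<in>X. subst B g x = \<zero>\<^bsub>B\<^esub>}"

text \<open>
  The pairing of formal sums \<open>\<xi>\<close> of words \<open>[f, g]\<close> over the left dual with formal sums \<open>x\<close> of words
  \<open>[u, v]\<close> over \<open>U\<close>, bilinearly extending \<open>g (u f(v))\<close>.
\<close>

definition quadratic_pairing ::
    "('f::field, 'a, 'y) module_scheme \<Rightarrow> ('f, 'a, 'm) bimod \<Rightarrow>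
     (('a + ('m \<Rightarrow> 'a)) list \<Rightarrow> 'f) \<Rightarrow> (('a + 'm) list \<Rightarrow> 'f) \<Rightarrow> 'a" where
  "quadratic_pairing A U \<xi> x =
    finsum A (\<lambda>(f, g, u, v). (\<xi> [Inr f, Inr g] * x [Inr u, Inr v]) \<odot>\<^bsub>A\<^esub> g (ract U u (f v)))
      {(f, g, u, v). \<xi> [Inr f, Inr g] \<noteq> 0 \<and> x [Inr u, Inr v] \<noteq> 0}"

definition two_letter_sums ::
    "('f::field, 'a, 'y) module_scheme \<Rightarrow> ('f, 'a, 'm) bimod \<Rightarrow> (('a + 'm) list \<Rightarrow> 'f) set" where
  "two_letter_sums A U =
    {x \<in> carrier (free_algebra A U). \<forall>w. x w \<noteq> 0 \<longrightarrow> (\<exists>u v. w = [Inr u, Inr v])}"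

text \<open>
  Every class of degree 2 contains a sum of words with two letters from \<open>U\<close>, and the pairing
  does not depend on the choice of such representatives.
\<close>

definition quadratic_perp ::
    "('f::field, 'a, 'y) module_scheme \<Rightarrow> ('f, 'a, 'm) bimod \<Rightarrow> (('a + 'm) list \<Rightarrow> 'f) set set \<Rightarrow>
     (('a + ('m \<Rightarrow> 'a)) list \<Rightarrow> 'f) set set" where
  "quadratic_perp A U R =
    {Y \<in> degs (tensor_algebra A (left_dual A U)) 2.
       \<forall>X\<in>R. \<forall>\<xi> \<in> Y \<inter> two_letter_sums A (left_dual A U). \<forall>x \<in> X \<inter> two_letter_sums A U.
         quadratic_pairing A U \<xi> x = \<zero>\<^bsub>A\<^esub>}"

definition quadratic_ideal ::
    "('f::field, 'a, 'y) module_scheme \<Rightarrow> ('f, 'a, 'm) bimod \<Rightarrow> (('a + 'm) list \<Rightarrow> 'f) set set \<Rightarrow>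
     (('a + ('m \<Rightarrow> 'a)) list \<Rightarrow> 'f) set set" where
  "quadratic_ideal A U R =
    genideal (tensor_algebra A (left_dual A U)) (quadratic_perp A U R)"

text \<open>The quadratic dual of the quadratic algebra with relations \<open>R\<close> in the tensor square of \<open>U\<close>.\<close>

definition quadratic_dual ::
    "('f::field, 'a, 'y) module_scheme \<Rightarrow> ('f, 'a, 'm) bimod \<Rightarrow> (('a + 'm) list \<Rightarrow> 'f) set set \<Rightarrow>
     ('f, (('a + ('m \<Rightarrow> 'a)) list \<Rightarrow> 'f) set set) graded_algebra" where
  "quadratic_dual A U R =
    quot_algebra (tensor_algebra A (left_dual A U)) (quadratic_ideal A U R)"

definition dual_letter ::
    "('f::field, 'a, 'y) module_scheme \<Rightarrow> ('f, 'a, 'm) bimod \<Rightarrow> (('a + 'm) list \<Rightarrow> 'f) set set \<Rightarrow>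
     'a + ('m \<Rightarrow> 'a) \<Rightarrow> (('a + ('m \<Rightarrow> 'a)) list \<Rightarrow> 'f) set set" where
  "dual_letter A U R l =
    quadratic_ideal A U R +>\<^bsub>tensor_algebra A (left_dual A U)\<^esub> tensor_letter A (left_dual A U) l"


section \<open>First extension groups\<close>

text \<open>
  For \<open>A\<close>-bimodules \<open>M\<close> and \<open>N\<close>, the group of first extensions of the left module \<open>M\<close> by the
  left module \<open>N\<close>, computed by the bar resolution of \<open>M\<close>, which is projective because
  \<open>A\<close> is an algebra over a field.  The remaining right actions on \<open>M\<close> and \<open>N\<close> make
  it an \<open>A\<close>-bimodule.
\<close>

definition bar_cocycles ::
    "('f, 'a, 'z) module_scheme \<Rightarrow> ('f, 'a, 'm) bimod \<Rightarrow> ('f, 'a, 'n) bimod \<Rightarrow>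
     ('f, 'a, 'a \<times> 'm \<Rightarrow> 'n) bimod" where
  "bar_cocycles A M N =
    \<lparr>carrier = {c \<in> carrier A \<times> carrier M \<rightarrow>\<^sub>E carrier N.
       (\<forall>a\<in>carrier A. (\<lambda>m\<in>carrier M. c (a, m)) \<in> linear_maps M N) \<and>
       (\<forall>m\<in>carrier M. (\<lambda>a\<in>carrier A. c (a, m)) \<in> linear_maps A N) \<and>
       (\<forall>a\<in>carrier A. \<forall>b\<in>carrier A. \<forall>m\<in>carrier M.
          c (a \<otimes>\<^bsub>A\<^esub> b, m) = lact N a (c (b, m)) \<oplus>\<^bsub>N\<^esub> c (a, lact M b m))},
     mult = undefined, one = undefined,
     zero = (\<lambda>z\<in>carrier A \<times> carrier M. \<zero>\<^bsub>N\<^esub>),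
     add = (\<lambda>c d. \<lambda>z\<in>carrier A \<times> carrier M. c z \<oplus>\<^bsub>N\<^esub> d z),
     smult = (\<lambda>k c. \<lambda>z\<in>carrier A \<times> carrier M. k \<odot>\<^bsub>N\<^esub> c z),
     lact = (\<lambda>a c. \<lambda>(x, m)\<in>carrier A \<times> carrier M. c (x, ract M m a)),
     ract = (\<lambda>c a. \<lambda>z\<in>carrier A \<times> carrier M. ract N (c z) a)\<rparr>"

definition bar_coboundaries ::
    "('f, 'a, 'z) module_scheme \<Rightarrow> ('f, 'a, 'm) bimod \<Rightarrow> ('f, 'a, 'n) bimod \<Rightarrow>
     ('a \<times> 'm \<Rightarrow> 'n) set" where
  "bar_coboundaries A M N =
    (\<lambda>h. \<lambda>(a, m)\<in>carrier A \<times> carrier M. lact N a (h m) \<ominus>\<^bsub>N\<^esub> h (lact M a m)) ` linear_maps M N"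

definition ext1 ::
    "('f, 'a, 'z) module_scheme \<Rightarrow> ('f, 'a, 'm) bimod \<Rightarrow> ('f, 'a, 'n) bimod \<Rightarrow>
     ('f, 'a, ('a \<times> 'm \<Rightarrow> 'n) set) bimod" where
  "ext1 A M N = quot_bimod (bar_cocycles A M N) (bar_coboundaries A M N)"


section \<open>Graded trivial extensions\<close>

text \<open>The linear map multiplying the homogeneous part of degree \<open>i\<close> by the \<open>i\<close>-th power of \<open>-1\<close>.\<close>

definition sign_twist :: "('f::field, 'a) graded_algebra \<Rightarrow> 'a \<Rightarrow> 'a" where
  "sign_twist A b = (THE c. \<exists>I h. finite I \<and> (\<forall>i\<in>I. h i \<in> degs A i) \<and> b = finsum A h I \<and>
     c = finsum A (\<lambda>i. (if even i then 1 else - 1) \<odot>\<^bsub>A\<^esub> h i) I)"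

text \<open>
  For finite-dimensional \<open>\<Gamma>\<close>.  The dual of the part of degree \<open>2 - n\<close>, which sits in degree \<open>n\<close>,
  consists of the functionals vanishing on all other homogeneous parts.
\<close>

definition triv2 ::
    "('f::field, 'a) graded_algebra \<Rightarrow> ('f, 'a \<times> ('a \<Rightarrow> 'f)) graded_algebra" where
  "triv2 \<Gamma> = (let D = dual_bimod \<Gamma> in
    \<lparr>carrier = carrier \<Gamma> \<times> carrier D,
     mult = (\<lambda>(a, f) (b, g).
       (a \<otimes>\<^bsub>\<Gamma>\<^esub> b, lact D a g \<oplus>\<^bsub>D\<^esub> ract D f (sign_twist \<Gamma> b))),
     one = (\<one>\<^bsub>\<Gamma>\<^esub>, \<zero>\<^bsub>D\<^esub>),
     zero = (\<zero>\<^bsub>\<Gamma>\<^esub>, \<zero>\<^bsub>D\<^esub>),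
     add = (\<lambda>(a, f) (b, g). (a \<oplus>\<^bsub>\<Gamma>\<^esub> b, f \<oplus>\<^bsub>D\<^esub> g)),
     smult = (\<lambda>c (a, f). (c \<odot>\<^bsub>\<Gamma>\<^esub> a, c \<odot>\<^bsub>D\<^esub> f)),
     degs = (\<lambda>n. degs \<Gamma> n \<times> {f \<in> carrier D. \<forall>i. i \<noteq> 2 - n \<longrightarrow> (\<forall>x\<in>degs \<Gamma> i. f x = 0)})\<rparr>)"


section \<open>Quivers\<close>

definition acyclic_quiver :: "('v, 'e) pre_digraph \<Rightarrow> bool" where
  "acyclic_quiver Q \<longleftrightarrow> \<not> (\<exists>p. pre_digraph.cycle Q p)"

definition of_type_A :: "nat \<Rightarrow> ('v, 'e) pre_digraph \<Rightarrow> bool" where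
  "of_type_A n Q \<longleftrightarrow> (\<exists>f g. bij_betw f {..<n} (verts Q) \<and> bij_betw g {..<n - 1} (arcs Q) \<and>
     (\<forall>k<n - 1. {tail Q (g k), head Q (g k)} = {f k, f (Suc k)}))"

text \<open>
  Paths are pairs of a starting vertex and a list of arcs, and the product of two paths is the
  first followed by the second.
\<close>

definition quiver_paths :: "('v, 'e) pre_digraph \<Rightarrow> ('v \<times> 'e list) set" where
  "quiver_paths Q = {(u, p). \<exists>w. pre_digraph.awalk Q u p w}"

definition path_algebra :: "('v, 'e) pre_digraph \<Rightarrow> ('f::field, 'v \<times> 'e list \<Rightarrow> 'f) module" where
  "path_algebra Q =
    \<lparr>carrier = {x. finite {p. x p \<noteq> 0} \<and> (\<forall>p. x p \<noteq> 0 \<longrightarrow> p \<in> quiver_paths Q)},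
     mult = (\<lambda>x y (u, p). \<Sum>k\<le>length p.
       x (u, take k p) * y (last (pre_digraph.awalk_verts Q u (take k p)), drop k p)),
     one = (\<lambda>(u, p). if u \<in> verts Q \<and> p = [] then 1 else 0),
     zero = (\<lambda>p. 0),
     add = (\<lambda>x y p. x p + y p),
     smult = (\<lambda>c x p. c * x p)\<rparr>"

text \<open>
  The algebra of functions on a finite set.  For the set of vertices it is the algebra \<open>S\<close> with basis
  the vertex idempotents; for the set of pairs of vertices it is the enveloping algebra of \<open>S\<close>, where the pair
  \<open>(i, j)\<close> stands for the tensor product of the idempotents at \<open>i\<close> and \<open>j\<close>.
\<close>

definition fun_algebra :: "'x set \<Rightarrow> ('f::field, 'x \<Rightarrow> 'f) module" where
  "fun_algebra X =
    \<lparr>carrier = {s. \<forall>x. x \<notin> X \<longrightarrow> s x = 0},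
     mult = (\<lambda>s t x. s x * t x),
     one = (\<lambda>x. if x \<in> X then 1 else 0),
     zero = (\<lambda>x. 0),
     add = (\<lambda>s t x. s x + t x),
     smult = (\<lambda>c s x. c * s x)\<rparr>"

abbreviation vertex_algebra :: "('v, 'e) pre_digraph \<Rightarrow> ('f::field, 'v \<Rightarrow> 'f) module" where
  "vertex_algebra Q \<equiv> fun_algebra (verts Q)"

abbreviation vertex_env :: "('v, 'e) pre_digraph \<Rightarrow> ('f::field, 'v \<times> 'v \<Rightarrow> 'f) module" where
  "vertex_env Q \<equiv> fun_algebra (verts Q \<times> verts Q)"

definition pure_tensor :: "('v \<Rightarrow> 'f::field) \<Rightarrow> ('v \<Rightarrow> 'f) \<Rightarrow> 'v \<times> 'v \<Rightarrow> 'f" where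
  "pure_tensor s t = (\<lambda>(i, j). s i * t j)"

definition arrow_bimod :: "('v, 'e) pre_digraph \<Rightarrow> ('f::field, 'v \<Rightarrow> 'f, 'e \<Rightarrow> 'f) bimod" where
  "arrow_bimod Q =
    \<lparr>carrier = {x. \<forall>a. a \<notin> arcs Q \<longrightarrow> x a = 0}, mult = undefined, one = undefined,
     zero = (\<lambda>a. 0),
     add = (\<lambda>x y a. x a + y a),
     smult = (\<lambda>c x a. c * x a),
     lact = (\<lambda>s x a. s (tail Q a) * x a),
     ract = (\<lambda>x s a. x a * s (head Q a))\<rparr>"

text \<open>
  The bimodule dual of an \<open>S\<close>-bimodule \<open>X\<close>: the maps from \<open>X\<close> to the enveloping algebra that are linear for its
  multiplication from the left (the outer action of \<open>S\<close>), with the actions of \<open>S\<close> coming from its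
  multiplication from the right (the inner action).
\<close>

definition env_dual ::
    "('v, 'e) pre_digraph \<Rightarrow> ('f::field, 'v \<Rightarrow> 'f, 'm) bimod \<Rightarrow>
     ('f, 'v \<Rightarrow> 'f, 'm \<Rightarrow> 'v \<times> 'v \<Rightarrow> 'f) bimod" where
  "env_dual Q X = (let S = vertex_algebra Q; E = vertex_env Q in
    \<lparr>carrier = {h \<in> linear_maps X E.
       \<forall>s\<in>carrier S. \<forall>t\<in>carrier S. \<forall>x\<in>carrier X.
         h (lact X s (ract X x t)) = pure_tensor s t \<otimes>\<^bsub>E\<^esub> h x},
     mult = undefined, one = undefined,
     zero = (\<lambda>x\<in>carrier X. \<zero>\<^bsub>E\<^esub>),
     add = (\<lambda>h k. \<lambda>x\<in>carrier X. h x \<oplus>\<^bsub>E\<^esub> k x),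
     smult = (\<lambda>c h. \<lambda>x\<in>carrier X. c \<odot>\<^bsub>E\<^esub> h x),
     lact = (\<lambda>s h. \<lambda>x\<in>carrier X. h x \<otimes>\<^bsub>E\<^esub> pure_tensor \<one>\<^bsub>S\<^esub> s),
     ract = (\<lambda>h s. \<lambda>x\<in>carrier X. h x \<otimes>\<^bsub>E\<^esub> pure_tensor s \<one>\<^bsub>S\<^esub>)\<rparr>)"


section \<open>The preprojective algebra\<close>

type_synonym ('f, 'v, 'e) pathalg = "'v \<times> 'e list \<Rightarrow> 'f"
type_synonym ('f, 'v, 'e) extclass =
  "(('f, 'v, 'e) pathalg \<times> (('f, 'v, 'e) pathalg \<Rightarrow> 'f) \<Rightarrow> ('f, 'v, 'e) pathalg) set"
type_synonym ('f, 'v, 'e) preproj =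
  "((('f, 'v, 'e) pathalg + ('f, 'v, 'e) extclass) list \<Rightarrow> 'f) set"
type_synonym ('f, 'v, 'e) dbl = "('e \<Rightarrow> 'f) \<times> (('e \<Rightarrow> 'f) \<Rightarrow> 'v \<times> 'v \<Rightarrow> 'f)"

definition ext_bimod ::
    "('v, 'e) pre_digraph \<Rightarrow> ('f::field, ('f, 'v, 'e) pathalg, ('f, 'v, 'e) extclass) bimod" where
  "ext_bimod Q =
    ext1 (path_algebra Q) (dual_bimod (path_algebra Q)) (regular_bimod (path_algebra Q))"

definition preprojective ::
    "('v, 'e) pre_digraph \<Rightarrow> ('f::field, ('f, 'v, 'e) preproj) graded_algebra" where
  "preprojective Q = tensor_algebra (path_algebra Q) (ext_bimod Q)"

definition double_bimod ::
    "('v, 'e) pre_digraph \<Rightarrow> ('f::field, 'v \<Rightarrow> 'f, ('f, 'v, 'e) dbl) bimod" where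
  "double_bimod Q = direct_sum (arrow_bimod Q) (env_dual Q (arrow_bimod Q))"

definition vertex_incl :: "('v \<Rightarrow> 'f::field) \<Rightarrow> ('f, 'v, 'e) pathalg" where
  "vertex_incl s = (\<lambda>(u, p). if p = [] then s u else 0)"

definition arrow_incl :: "('v, 'e) pre_digraph \<Rightarrow> ('e \<Rightarrow> 'f::field) \<Rightarrow> ('f, 'v, 'e) pathalg" where
  "arrow_incl Q x = (\<lambda>(u, p). case p of [a] \<Rightarrow> if u = tail Q a then x a else 0 | _ \<Rightarrow> 0)"

text \<open>
  The extension class of an element \<open>\<theta>\<close> of the bimodule dual of the arrow bimodule \<open>V\<close>.
  The cocycles vanishing on \<open>S\<close> are determined by their restriction to \<open>V\<close>; the one of \<open>\<theta>\<close> sends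
  \<open>x \<in> V\<close> and a functional \<open>f\<close> to the image of \<open>\<theta> x\<close> under applying \<open>f\<close> to the second
  tensor factor.
\<close>

definition ext_cocycle ::
    "('v, 'e) pre_digraph \<Rightarrow> (('e \<Rightarrow> 'f::field) \<Rightarrow> 'v \<times> 'v \<Rightarrow> 'f) \<Rightarrow>
     ('f, 'v, 'e) pathalg \<times> (('f, 'v, 'e) pathalg \<Rightarrow> 'f) \<Rightarrow> ('f, 'v, 'e) pathalg" where
  "ext_cocycle Q \<theta> = (let A = path_algebra Q; D = dual_bimod A in
    THE c. c \<in> carrier (bar_cocycles A D (regular_bimod A)) \<and>
      (\<forall>s\<in>carrier (vertex_algebra Q). \<forall>f\<in>carrier D. c (vertex_incl s, f) = \<zero>\<^bsub>A\<^esub>) \<and>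
      (\<forall>x\<in>carrier (arrow_bimod Q). \<forall>f\<in>carrier D. c (arrow_incl Q x, f) =
         vertex_incl (\<lambda>i. \<Sum>j\<in>verts Q. \<theta> x (i, j) * f (vertex_incl (\<lambda>k. if k = j then 1 else 0)))))"

definition ext_class ::
    "('v, 'e) pre_digraph \<Rightarrow> (('e \<Rightarrow> 'f::field) \<Rightarrow> 'v \<times> 'v \<Rightarrow> 'f) \<Rightarrow> ('f, 'v, 'e) extclass" where
  "ext_class Q \<theta> = (let A = path_algebra Q; D = dual_bimod A; N = regular_bimod A in
    bar_coboundaries A D N +>\<^bsub>bar_cocycles A D N\<^esub> ext_cocycle Q \<theta>)"

text \<open>
  The presentation of the preprojective algebra as a quotient of the tensor algebra of
  \<^const>\<open>double_bimod\<close> over \<open>S\<close>.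
\<close>

definition preproj_gen ::
    "('v, 'e) pre_digraph \<Rightarrow> ('v \<Rightarrow> 'f::field) + ('f, 'v, 'e) dbl \<Rightarrow> ('f, 'v, 'e) preproj" where
  "preproj_gen Q l = (let t = tensor_letter (path_algebra Q) (ext_bimod Q) in
    case l of
      Inl s \<Rightarrow> t (Inl (vertex_incl s))
    | Inr (x, \<theta>) \<Rightarrow> t (Inl (arrow_incl Q x)) \<oplus>\<^bsub>preprojective Q\<^esub> t (Inr (ext_class Q \<theta>)))"

definition preproj_relations ::
    "('v, 'e) pre_digraph \<Rightarrow> ((('v \<Rightarrow> 'f::field) + ('f, 'v, 'e) dbl) list \<Rightarrow> 'f) set set" where
  "preproj_relations Q =
    quadratic_relations (vertex_algebra Q) (double_bimod Q) (preprojective Q) (preproj_gen Q)"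


section \<open>The natural morphism\<close>

type_synonym ('f, 'v, 'e) preproj_dual =
  "((('v \<Rightarrow> 'f) + (('f, 'v, 'e) dbl \<Rightarrow> 'v \<Rightarrow> 'f)) list \<Rightarrow> 'f) set set"
type_synonym ('f, 'v, 'e) pathalg_dual =
  "((('v \<Rightarrow> 'f) + (('e \<Rightarrow> 'f) \<Rightarrow> 'v \<Rightarrow> 'f)) list \<Rightarrow> 'f) set set"
type_synonym ('f, 'v, 'e) triv_pathalg_dual =
  "('f, 'v, 'e) pathalg_dual \<times> (('f, 'v, 'e) pathalg_dual \<Rightarrow> 'f)"

definition preprojective_dual ::
    "('v, 'e) pre_digraph \<Rightarrow> ('f::field, ('f, 'v, 'e) preproj_dual) graded_algebra" where
  "preprojective_dual Q =
    quadratic_dual (vertex_algebra Q) (double_bimod Q) (preproj_relations Q)"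

text \<open>The path algebra is the tensor algebra of the arrow bimodule, without further relations.\<close>

definition path_relations ::
    "('v, 'e) pre_digraph \<Rightarrow> ((('v \<Rightarrow> 'f::field) + ('e \<Rightarrow> 'f)) list \<Rightarrow> 'f) set set" where
  "path_relations Q = {\<zero>\<^bsub>tensor_algebra (vertex_algebra Q) (arrow_bimod Q)\<^esub>}"

definition path_algebra_dual ::
    "('v, 'e) pre_digraph \<Rightarrow> ('f::field, ('f, 'v, 'e) pathalg_dual) graded_algebra" where
  "path_algebra_dual Q = quadratic_dual (vertex_algebra Q) (arrow_bimod Q) (path_relations Q)"

definition path_dual_letter ::
    "('v, 'e) pre_digraph \<Rightarrow> ('v \<Rightarrow> 'f::field) + (('e \<Rightarrow> 'f) \<Rightarrow> 'v \<Rightarrow> 'f) \<Rightarrow>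
     ('f, 'v, 'e) pathalg_dual" where
  "path_dual_letter Q = dual_letter (vertex_algebra Q) (arrow_bimod Q) (path_relations Q)"

text \<open>The standard symmetrizing form, on \<open>S\<close> and on its enveloping algebra.\<close>

definition symm_form :: "'x set \<Rightarrow> ('x \<Rightarrow> 'f::field) \<Rightarrow> 'f" where
  "symm_form X s = (\<Sum>x\<in>X. s x)"

text \<open>
  The element of \<open>V\<close> corresponding to an element \<open>g\<close> of the left dual of the bimodule dual of \<open>V\<close>.
\<close>

definition bidual_elem ::
    "('v, 'e) pre_digraph \<Rightarrow> ((('e \<Rightarrow> 'f::field) \<Rightarrow> 'v \<times> 'v \<Rightarrow> 'f) \<Rightarrow> 'v \<Rightarrow> 'f) \<Rightarrow> 'e \<Rightarrow> 'f" where
  "bidual_elem Q g = (THE x. x \<in> carrier (arrow_bimod Q) \<and>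
     (\<forall>\<theta>\<in>carrier (env_dual Q (arrow_bimod Q)).
        symm_form (verts Q) (g \<theta>) = symm_form (verts Q \<times> verts Q) (\<theta> x)))"

text \<open>
  The functional on the part of degree 1 of the quadratic dual of the path algebra, that is on the left
  dual of \<open>V\<close>, that corresponds to \<open>x \<in> V\<close>; it is extended by zero to the other degrees.
\<close>

definition eval_functional ::
    "('v, 'e) pre_digraph \<Rightarrow> ('e \<Rightarrow> 'f::field) \<Rightarrow> ('f, 'v, 'e) pathalg_dual \<Rightarrow> 'f" where
  "eval_functional Q x = (let \<Gamma> = path_algebra_dual Q in
    THE f. f \<in> carrier (dual_bimod \<Gamma>) \<and>
      (\<forall>i. i \<noteq> 1 \<longrightarrow> (\<forall>y\<in>degs \<Gamma> i. f y = 0)) \<and>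
      (\<forall>\<alpha>\<in>carrier (left_dual (vertex_algebra Q) (arrow_bimod Q)).
         f (path_dual_letter Q (Inr \<alpha>)) = symm_form (verts Q) (\<alpha> x)))"

text \<open>
  Restriction to the two summands of \<^const>\<open>double_bimod\<close> identifies its left dual with the direct
  sum of their left duals.
\<close>

definition restrict_fst ::
    "('v, 'e) pre_digraph \<Rightarrow> (('f::field, 'v, 'e) dbl \<Rightarrow> 'v \<Rightarrow> 'f) \<Rightarrow> ('e \<Rightarrow> 'f) \<Rightarrow> 'v \<Rightarrow> 'f" where
  "restrict_fst Q h = (\<lambda>x\<in>carrier (arrow_bimod Q). h (x, \<zero>\<^bsub>env_dual Q (arrow_bimod Q)\<^esub>))"

definition restrict_snd ::
    "('v, 'e) pre_digraph \<Rightarrow> (('f::field, 'v, 'e) dbl \<Rightarrow> 'v \<Rightarrow> 'f) \<Rightarrow>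
     (('e \<Rightarrow> 'f) \<Rightarrow> 'v \<times> 'v \<Rightarrow> 'f) \<Rightarrow> 'v \<Rightarrow> 'f" where
  "restrict_snd Q h = (\<lambda>\<theta>\<in>carrier (env_dual Q (arrow_bimod Q)). h (\<zero>\<^bsub>arrow_bimod Q\<^esub>, \<theta>))"

definition natural_morphism ::
    "('v, 'e) pre_digraph \<Rightarrow>
     (('f::field, 'v, 'e) preproj_dual \<Rightarrow> ('f, 'v, 'e) triv_pathalg_dual) \<Rightarrow> bool" where
  "natural_morphism Q \<phi> \<longleftrightarrow>
    (let S = vertex_algebra Q; U = double_bimod Q;
         l = dual_letter S U (preproj_relations Q) in
     \<phi> \<in> extensional (carrier (preprojective_dual Q)) \<and>
     \<phi> \<in> graded_hom (preprojective_dual Q) (triv2 (path_algebra_dual Q)) \<and>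
     (\<forall>s\<in>carrier S.
        \<phi> (l (Inl s)) = (path_dual_letter Q (Inl s), \<zero>\<^bsub>dual_bimod (path_algebra_dual Q)\<^esub>)) \<and>
     (\<forall>h\<in>carrier (left_dual S U).
        \<phi> (l (Inr h)) = (path_dual_letter Q (Inr (restrict_fst Q h)),
                         eval_functional Q (bidual_elem Q (restrict_snd Q h)))))"

end

theory Submission
  imports Defs
begin


text \<open>
  Two presentations are compared in coordinates. Let \<open>H\<close> be the algebra with the vertices as basis in
  degree 0, the arrows \<open>a\<close> and the dual arrows \<open>a*\<close> as basis in degree 1, and the vertices again as
  basis in degree 2. Its products in degree 2 are \<open>a a* = e\<close> for the basis element \<open>e\<close> of
  degree 2 at the head of \<open>a\<close>, \<open>a* a = - e\<close> for the one at the tail of \<open>a\<close>, and zero for all other pairs; products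
  of three elements of degree 1 vanish. The natural morphism factors through \<open>H\<close>.
  
  \<^item> The degree two part of \<open>H\<close> is that of the quadratic dual of the preprojective algebra
    (\<open>preprojective_presentation\<close>). This needs the relations of the preprojective algebra from two sides. At
    each vertex, the difference of the sum of the products \<open>a* a\<close> over the arrows ending there and the sum of
    the products \<open>a a*\<close> over the arrows starting there is a relation, because the corresponding cocycle is
    the coboundary of an explicit map (\<open>rho_relation\<close>). Conversely, a tensor orthogonal to all of these is
    orthogonal to every relation, because it is the degree two part of a representation of the
    preprojective algebra on an algebra that stops in degree 2 (\<open>preproj_relations_orthogonal\<close>).
  
  \<^item> The quadratic dual of the path algebra has radical square zero, since there are no relations.
    So its trivial extension has the same three sets of coordinates as \<open>H\<close>, and comparing products
    gives an isomorphism (\<open>triv2_elem_iso\<close>). The sign in the product of a trivial extension is what gives the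
    sign in \<open>H\<close>. Composing the map to \<open>H\<close> with this isomorphism gives the natural morphism
    (\<open>natural_morphism_coord\<close>).
  
  \<^item> Therefore the natural morphism is an isomorphism as soon as products of three generators
    vanish and every vertex meets an arrow (\<open>cube_iso\<close>). The second condition only fails for the quiver
    with one vertex and no arrows. For the first, the only products of three generators to consider are
    \<open>b b* b\<close>. If another generator \<open>c\<close> has the same target as \<open>b\<close>, then \<open>b b*\<close> is a multiple of
    \<open>c c*\<close> and \<open>c* b = 0\<close>; the argument at the other end is the same. If there is no such generator at
    either end, the arrow of \<open>b\<close> is a whole component, hence the whole quiver, which has type \<open>A\<close> with
    two vertices (\<open>triple_products_vanish\<close>). In that case there are no relations at all
    between the two generators, except that their squares are zero, and \<open>b b* b\<close> is not zero: it acts as a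
    matrix unit (\<open>A2_triple_product\<close>). As it is zero in \<open>H\<close>, the natural morphism is not injective.
\<close>

no_notation vwalk_join (infixr "\<oplus>" 65)

section \<open>Algebras over a field and their quotients\<close>

locale falgebra = ring A for A :: "('f::field, 'a, 'z) module_scheme" (structure) +
  assumes smult_closed [simp, intro]: "x \<in> carrier A \<Longrightarrow> c \<odot> x \<in> carrier A"
    and smult_l_distr: "x \<in> carrier A \<Longrightarrow> (c + d) \<odot> x = c \<odot> x \<oplus> d \<odot> x"
    and smult_r_distr: "x \<in> carrier A \<Longrightarrow> y \<in> carrier A \<Longrightarrow> c \<odot> (x \<oplus> y) = c \<odot> x \<oplus> c \<odot> y"
    and smult_smult: "x \<in> carrier A \<Longrightarrow> (c * d) \<odot> x = c \<odot> (d \<odot> x)"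
    and smult_one [simp]: "x \<in> carrier A \<Longrightarrow> 1 \<odot> x = x"
    and smult_mult_l: "x \<in> carrier A \<Longrightarrow> y \<in> carrier A \<Longrightarrow> (c \<odot> x) \<otimes> y = c \<odot> (x \<otimes> y)"
    and smult_mult_r: "x \<in> carrier A \<Longrightarrow> y \<in> carrier A \<Longrightarrow> x \<otimes> (c \<odot> y) = c \<odot> (x \<otimes> y)"
begin

lemma smult_zero_l [simp]:
  assumes "x \<in> carrier A" shows "0 \<odot> x = \<zero>"
proof -
  have "0 \<odot> x \<oplus> 0 \<odot> x = 0 \<odot> x \<oplus> \<zero>"
    using smult_l_distr[OF assms, of 0 0] assms by simp
  then show ?thesis using add.l_cancel_one[of "0 \<odot> x" "0 \<odot> x"] assms by simp
qed

lemma smult_zero_r [simp]: "c \<odot> \<zero> = \<zero>"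
proof -
  have "c \<odot> \<zero> \<oplus> c \<odot> \<zero> = c \<odot> \<zero> \<oplus> \<zero>"
    using smult_r_distr[of \<zero> \<zero> c] by simp
  then show ?thesis using add.l_cancel_one[of "c \<odot> \<zero>" "c \<odot> \<zero>"] by simp
qed

lemma smult_minus_one:
  assumes "x \<in> carrier A" shows "(- 1) \<odot> x = \<ominus> x"
proof -
  have "(- 1) \<odot> x \<oplus> x = \<zero>"
    using smult_l_distr[OF assms, of "- 1" 1] assms by simp
  then show ?thesis using assms by (metis minus_equality smult_closed)
qed

lemma minus_eq_smult: "x \<in> carrier A \<Longrightarrow> y \<in> carrier A \<Longrightarrow> x \<ominus> y = x \<oplus> (- 1) \<odot> y"
  by (simp add: smult_minus_one minus_eq)

lemma ideal_smult:
  assumes "ideal I A" "x \<in> I" shows "c \<odot> x \<in> I"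
proof -
  interpret I: ideal I A by fact
  have "c \<odot> x = (c \<odot> \<one>) \<otimes> x" using assms(2) by (simp add: smult_mult_l I.a_Hcarr)
  then show ?thesis using assms(2) by (simp add: I.I_l_closed)
qed

end

text \<open>Quotients inherit the axioms of an algebra through the projection.\<close>

lemma falgebra_surj_image:
  fixes A :: "('f::field, 'a, 'y) module_scheme" and B :: "('f, 'b, 'z) module_scheme"
  assumes "falgebra A"
    and surj: "carrier B = h ` carrier A"
    and add: "\<And>x y. x \<in> carrier A \<Longrightarrow> y \<in> carrier A \<Longrightarrow> h (x \<oplus>\<^bsub>A\<^esub> y) = h x \<oplus>\<^bsub>B\<^esub> h y"
    and mult: "\<And>x y. x \<in> carrier A \<Longrightarrow> y \<in> carrier A \<Longrightarrow> h (x \<otimes>\<^bsub>A\<^esub> y) = h x \<otimes>\<^bsub>B\<^esub> h y"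
    and one: "h \<one>\<^bsub>A\<^esub> = \<one>\<^bsub>B\<^esub>" and zero: "h \<zero>\<^bsub>A\<^esub> = \<zero>\<^bsub>B\<^esub>"
    and smult: "\<And>c x. x \<in> carrier A \<Longrightarrow> h (c \<odot>\<^bsub>A\<^esub> x) = c \<odot>\<^bsub>B\<^esub> h x"
  shows "falgebra B"
proof -
  interpret A: falgebra A by fact
  note ops = add[symmetric] mult[symmetric] one[symmetric] zero[symmetric] smult[symmetric]
  have inv: "\<exists>y\<in>carrier A. h (x \<oplus>\<^bsub>A\<^esub> y) = h \<zero>\<^bsub>A\<^esub>" if "x \<in> carrier A" for x
    using that by (intro bexI[of _ "\<ominus>\<^bsub>A\<^esub> x"]) (simp_all add: A.r_neg)
  have ab: "abelian_group B"
    by (rule abelian_groupI) (auto simp: surj ops A.a_ac inv)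
  have mon: "monoid B"
    by (rule monoidI) (auto simp: surj ops A.m_assoc)
  have "ring B"
    by (rule ringI[OF ab mon]) (auto simp: surj ops A.l_distr A.r_distr)
  then show ?thesis
    by (intro falgebra.intro falgebra_axioms.intro)
      (auto simp: surj ops A.smult_l_distr A.smult_r_distr A.smult_smult A.smult_mult_l A.smult_mult_r)
qed

definition alg_hom ::
    "('f, 'a, 'y) module_scheme \<Rightarrow> ('f, 'b, 'z) module_scheme \<Rightarrow> ('a \<Rightarrow> 'b) set" where
  "alg_hom A B = {h \<in> ring_hom A B. \<forall>c. \<forall>x\<in>carrier A. h (c \<odot>\<^bsub>A\<^esub> x) = c \<odot>\<^bsub>B\<^esub> h x}"

lemma alg_homI:
  assumes "\<And>x. x \<in> carrier A \<Longrightarrow> h x \<in> carrier B"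
    and "\<And>x y. x \<in> carrier A \<Longrightarrow> y \<in> carrier A \<Longrightarrow> h (x \<oplus>\<^bsub>A\<^esub> y) = h x \<oplus>\<^bsub>B\<^esub> h y"
    and "\<And>x y. x \<in> carrier A \<Longrightarrow> y \<in> carrier A \<Longrightarrow> h (x \<otimes>\<^bsub>A\<^esub> y) = h x \<otimes>\<^bsub>B\<^esub> h y"
    and "h \<one>\<^bsub>A\<^esub> = \<one>\<^bsub>B\<^esub>"
    and "\<And>c x. x \<in> carrier A \<Longrightarrow> h (c \<odot>\<^bsub>A\<^esub> x) = c \<odot>\<^bsub>B\<^esub> h x"
  shows "h \<in> alg_hom A B"
  using assms by (auto simp: alg_hom_def ring_hom_def)

lemma alg_homD:
  assumes "h \<in> alg_hom A B"
  shows "x \<in> carrier A \<Longrightarrow> h x \<in> carrier B"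
    and "x \<in> carrier A \<Longrightarrow> y \<in> carrier A \<Longrightarrow> h (x \<oplus>\<^bsub>A\<^esub> y) = h x \<oplus>\<^bsub>B\<^esub> h y"
    and "x \<in> carrier A \<Longrightarrow> y \<in> carrier A \<Longrightarrow> h (x \<otimes>\<^bsub>A\<^esub> y) = h x \<otimes>\<^bsub>B\<^esub> h y"
    and "h \<one>\<^bsub>A\<^esub> = \<one>\<^bsub>B\<^esub>"
    and "x \<in> carrier A \<Longrightarrow> h (c \<odot>\<^bsub>A\<^esub> x) = c \<odot>\<^bsub>B\<^esub> h x"
  using assms by (auto simp: alg_hom_def ring_hom_def)

lemma graded_hom_iff:
  "h \<in> graded_hom A B \<longleftrightarrow> h \<in> alg_hom A B \<and> (\<forall>n. h ` degs A n \<subseteq> degs B n)"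
  by (auto simp: graded_hom_def alg_hom_def)

lemma alg_hom_comp: "h \<in> alg_hom A B \<Longrightarrow> k \<in> alg_hom B C \<Longrightarrow> (\<lambda>x. k (h x)) \<in> alg_hom A C"
  by (rule alg_homI) (simp_all add: alg_homD)

lemma alg_hom_ring_hom_ring:
  assumes "falgebra A" "falgebra B" "h \<in> alg_hom A B"
  shows "ring_hom_ring A B h"
proof -
  interpret A: falgebra A by fact
  interpret B: falgebra B by fact
  show ?thesis
    using assms(3) by (intro ring_hom_ringI) (auto simp: alg_hom_def ring_hom_def A.ring_axioms B.ring_axioms)
qed

lemma alg_hom_zero:
  assumes "falgebra A" "falgebra B" "h \<in> alg_hom A B" shows "h \<zero>\<^bsub>A\<^esub> = \<zero>\<^bsub>B\<^esub>"
  using ring_hom_ring.homh[OF alg_hom_ring_hom_ring[OF assms]]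
    alg_hom_ring_hom_ring[OF assms] ring_hom_ring.axioms ring_hom_zero
  by (metis (no_types, lifting))

lemma additive_finsum:
  assumes "abelian_group A"
    and "h \<zero>\<^bsub>A\<^esub> = (0 :: 'c::comm_monoid_add)"
    and "\<And>x y. x \<in> carrier A \<Longrightarrow> y \<in> carrier A \<Longrightarrow> h (x \<oplus>\<^bsub>A\<^esub> y) = h x + h y"
    and "f \<in> S \<rightarrow> carrier A"
  shows "h (finsum A f S) = (\<Sum>x\<in>S. h (f x))"
proof -
  interpret abelian_group A by fact
  show ?thesis using assms(4)
  proof (induction S rule: infinite_finite_induct)
    case (insert x S)
    then have "f x \<in> carrier A" "f \<in> S \<rightarrow> carrier A" by auto
    then show ?case using insert assms(3) by simp
  qed (simp_all add: assms(2) finsum_infinite)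
qed

lemma hom_finsum:
  assumes "falgebra A" "falgebra B" "h \<in> alg_hom A B" "f \<in> S \<rightarrow> carrier A"
  shows "h (finsum A f S) = finsum B (\<lambda>x. h (f x)) S"
proof -
  interpret A: falgebra A by fact
  interpret B: falgebra B by fact
  show ?thesis using assms(4)
  proof (induction S rule: infinite_finite_induct)
    case (insert x S)
    then have f: "f x \<in> carrier A" "f \<in> S \<rightarrow> carrier A" by auto
    moreover have "(\<lambda>x. h (f x)) \<in> S \<rightarrow> carrier B" using f alg_homD(1)[OF assms(3)] by blast
    ultimately show ?case using insert assms(3) by (simp add: alg_homD)
  qed (simp_all add: alg_hom_zero[OF assms(1-3)] A.finsum_infinite B.finsum_infinite)
qed

text \<open>
  An operation on cosets is induced by any additive map that preserves the subgroup.
\<close>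

lemma coset_map:
  assumes "abelian_subgroup N M" "x \<in> carrier M"
    and "\<And>x. x \<in> carrier M \<Longrightarrow> f x \<in> carrier M"
    and "\<And>x y. x \<in> carrier M \<Longrightarrow> y \<in> carrier M \<Longrightarrow> f (x \<oplus>\<^bsub>M\<^esub> y) = f x \<oplus>\<^bsub>M\<^esub> f y"
    and "\<And>x. x \<in> N \<Longrightarrow> f x \<in> N"
  shows "(\<Union>y\<in>N +>\<^bsub>M\<^esub> x. N +>\<^bsub>M\<^esub> f y) = N +>\<^bsub>M\<^esub> f x"
proof -
  interpret N: abelian_subgroup N M by fact
  have "N +>\<^bsub>M\<^esub> f y = N +>\<^bsub>M\<^esub> f x" if y: "y \<in> N +>\<^bsub>M\<^esub> x" for y
  proof -
    obtain n where n: "n \<in> N" "y = n \<oplus>\<^bsub>M\<^esub> x"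
      using y by (auto simp: a_r_coset_def')
    then have "f y = f n \<oplus>\<^bsub>M\<^esub> f x" using assms N.a_Hcarr by auto
    then have "f y \<in> N +>\<^bsub>M\<^esub> f x" using n assms(5) by (auto simp: a_r_coset_def')
    then show ?thesis using N.a_repr_independence' assms(2,3) by metis
  qed
  then have "(\<Union>y\<in>N +>\<^bsub>M\<^esub> x. N +>\<^bsub>M\<^esub> f y) = (\<Union>y\<in>N +>\<^bsub>M\<^esub> x. N +>\<^bsub>M\<^esub> f x)"
    by (intro SUP_cong refl)
  moreover have "N +>\<^bsub>M\<^esub> x \<noteq> {}" using N.a_rcos_self assms(2) by blast
  ultimately show ?thesis by simp
qed

lemma (in falgebra) ideal_coset_eq:
  assumes "ideal I A" "x \<in> carrier A" "y \<in> carrier A"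
  shows "I +> x = I +> y \<longleftrightarrow> x \<ominus> y \<in> I"
proof -
  interpret I: ideal I A by fact
  show ?thesis
    by (metis I.a_rcos_module_minus I.a_rcos_self I.a_repr_independence' assms(2) assms(3) ring_axioms)
qed

lemma quot_smult:
  assumes "falgebra A" "ideal I A" "x \<in> carrier A"
  shows "c \<odot>\<^bsub>quot_algebra A I\<^esub> (I +>\<^bsub>A\<^esub> x) = I +>\<^bsub>A\<^esub> (c \<odot>\<^bsub>A\<^esub> x)"
proof -
  interpret A: falgebra A by fact
  interpret I: ideal I A by fact
  show ?thesis
    unfolding quot_algebra_def
    by (simp, rule coset_map)
      (auto simp: assms A.smult_r_distr A.ideal_smult I.abelian_subgroup_axioms intro: abelian_subgroupI3 I.is_additive_subgroup A.is_abelian_group)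
qed

lemma quot_simps:
  assumes "falgebra A" "ideal I A"
  shows "carrier (quot_algebra A I) = (\<lambda>x. I +>\<^bsub>A\<^esub> x) ` carrier A"
    and "x \<in> carrier A \<Longrightarrow> y \<in> carrier A \<Longrightarrow>
      (I +>\<^bsub>A\<^esub> x) \<oplus>\<^bsub>quot_algebra A I\<^esub> (I +>\<^bsub>A\<^esub> y) = I +>\<^bsub>A\<^esub> (x \<oplus>\<^bsub>A\<^esub> y)"
    and "x \<in> carrier A \<Longrightarrow> y \<in> carrier A \<Longrightarrow>
      (I +>\<^bsub>A\<^esub> x) \<otimes>\<^bsub>quot_algebra A I\<^esub> (I +>\<^bsub>A\<^esub> y) = I +>\<^bsub>A\<^esub> (x \<otimes>\<^bsub>A\<^esub> y)"
    and "\<one>\<^bsub>quot_algebra A I\<^esub> = I +>\<^bsub>A\<^esub> \<one>\<^bsub>A\<^esub>"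
    and "\<zero>\<^bsub>quot_algebra A I\<^esub> = I +>\<^bsub>A\<^esub> \<zero>\<^bsub>A\<^esub>"
    and "degs (quot_algebra A I) n = (\<lambda>x. I +>\<^bsub>A\<^esub> x) ` degs A n"
proof -
  interpret A: falgebra A by fact
  interpret I: ideal I A by fact
  show "carrier (quot_algebra A I) = (\<lambda>x. I +>\<^bsub>A\<^esub> x) ` carrier A"
    by (auto simp: quot_algebra_def A_RCOSETS_def')
  show "x \<in> carrier A \<Longrightarrow> y \<in> carrier A \<Longrightarrow>
      (I +>\<^bsub>A\<^esub> x) \<oplus>\<^bsub>quot_algebra A I\<^esub> (I +>\<^bsub>A\<^esub> y) = I +>\<^bsub>A\<^esub> (x \<oplus>\<^bsub>A\<^esub> y)"
    by (simp add: quot_algebra_def I.a_rcos_sum)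
  show "x \<in> carrier A \<Longrightarrow> y \<in> carrier A \<Longrightarrow>
      (I +>\<^bsub>A\<^esub> x) \<otimes>\<^bsub>quot_algebra A I\<^esub> (I +>\<^bsub>A\<^esub> y) = I +>\<^bsub>A\<^esub> (x \<otimes>\<^bsub>A\<^esub> y)"
    by (simp add: quot_algebra_def I.rcoset_mult_add)
  show "\<one>\<^bsub>quot_algebra A I\<^esub> = I +>\<^bsub>A\<^esub> \<one>\<^bsub>A\<^esub>" by (simp add: quot_algebra_def)
  show "\<zero>\<^bsub>quot_algebra A I\<^esub> = I +>\<^bsub>A\<^esub> \<zero>\<^bsub>A\<^esub>"
    by (simp add: quot_algebra_def A.a_coset_add_zero I.a_subset)
  show "degs (quot_algebra A I) n = (\<lambda>x. I +>\<^bsub>A\<^esub> x) ` degs A n" by (simp add: quot_algebra_def)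
qed

lemma quot_proj_hom:
  assumes "falgebra A" "ideal I A"
  shows "(\<lambda>x. I +>\<^bsub>A\<^esub> x) \<in> alg_hom A (quot_algebra A I)"
  by (rule alg_homI) (auto simp: quot_simps[OF assms] quot_smult[OF assms])

lemma quot_falgebra:
  assumes "falgebra A" "ideal I A"
  shows "falgebra (quot_algebra A I)"
  by (rule falgebra_surj_image[OF assms(1), where h = "\<lambda>x. I +>\<^bsub>A\<^esub> x"])
    (auto simp: quot_simps[OF assms] quot_smult[OF assms])

lemma quot_lift:
  assumes "falgebra A" "ideal I A" "falgebra B" "h \<in> alg_hom A B"
    and kills: "\<And>x. x \<in> I \<Longrightarrow> h x = \<zero>\<^bsub>B\<^esub>"
  obtains h' where "h' \<in> alg_hom (quot_algebra A I) B"
    and "\<And>x. x \<in> carrier A \<Longrightarrow> h' (I +>\<^bsub>A\<^esub> x) = h x"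
proof -
  interpret A: falgebra A by fact
  interpret B: falgebra B by fact
  interpret I: ideal I A by fact
  note hD = alg_homD[OF assms(4)]
  define h' where "h' X = the_elem (h ` X)" for X
  have val: "h' (I +>\<^bsub>A\<^esub> x) = h x" if x: "x \<in> carrier A" for x
  proof -
    have "h y = h x" if y: "y \<in> I +>\<^bsub>A\<^esub> x" for y
    proof -
      obtain n where "n \<in> I" "y = n \<oplus>\<^bsub>A\<^esub> x" using y by (auto simp: a_r_coset_def')
      then show ?thesis using kills hD x I.a_Hcarr by simp
    qed
    then have "h ` (I +>\<^bsub>A\<^esub> x) = (\<lambda>_. h x) ` (I +>\<^bsub>A\<^esub> x)" by (rule image_cong[OF refl])
    also have "\<dots> = {h x}" by (rule image_constant[OF I.a_rcos_self[OF x]])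
    finally have "h ` (I +>\<^bsub>A\<^esub> x) = {h x}" .
    then show ?thesis by (simp add: h'_def)
  qed
  have "h' \<in> alg_hom (quot_algebra A I) B"
    by (rule alg_homI)
      (auto simp: quot_simps[OF assms(1,2)] quot_smult[OF assms(1,2)] val hD)
  with val show thesis using that by blast
qed

lemma kernel_ideal:
  assumes "falgebra A" "falgebra B" "h \<in> alg_hom A B"
  shows "ideal {x \<in> carrier A. h x = \<zero>\<^bsub>B\<^esub>} A"
  using ring_hom_ring.kernel_is_ideal[OF alg_hom_ring_hom_ring[OF assms]]
  by (simp add: a_kernel_def')


section \<open>Free algebras and tensor algebras\<close>

lemma mem_Plus_iff [simp]: "Inl a \<in> A <+> B \<longleftrightarrow> a \<in> A" "Inr b \<in> A <+> B \<longleftrightarrow> b \<in> B"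
  by auto

lemma free_algebra_simps:
  "x \<in> carrier (free_algebra A M) \<longleftrightarrow>
     finite {w. x w \<noteq> 0} \<and> (\<forall>w. x w \<noteq> 0 \<longrightarrow> set w \<subseteq> carrier A <+> carrier M)"
  "x \<oplus>\<^bsub>free_algebra A M\<^esub> y = (\<lambda>w. x w + y w)"
  "x \<otimes>\<^bsub>free_algebra A M\<^esub> y = (\<lambda>w. \<Sum>k\<le>length w. x (take k w) * y (drop k w))"
  "\<one>\<^bsub>free_algebra A M\<^esub> = word []"
  "\<zero>\<^bsub>free_algebra A M\<^esub> = (\<lambda>w. 0)"
  "c \<odot>\<^bsub>free_algebra A M\<^esub> x = (\<lambda>w. c * x w)"
  "x \<in> degs (free_algebra A M) n \<longleftrightarrow> x \<in> carrier (free_algebra A M) \<and>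
     (\<forall>w. x w \<noteq> 0 \<longrightarrow> int (length (filter (\<lambda>l. \<not> isl l) w)) = n)"
  by (auto simp: free_algebra_def Let_def word_def fun_eq_iff)

text \<open>The two ways of cutting a sequence of length \<open>n\<close> into three.\<close>

lemma sum_triple_split:
  fixes g :: "nat \<Rightarrow> nat \<Rightarrow> 'a::comm_monoid_add"
  shows "(\<Sum>k\<le>n. \<Sum>j\<le>k. g j k) = (\<Sum>j\<le>n. \<Sum>i\<le>n - j. g j (j + i))"
  by (simp add: sum.Sigma)
    (rule sum.reindex_bij_witness[where i = "\<lambda>(j, i). (j + i, j)" and j = "\<lambda>(k, j). (j, k - j)"], auto)

lemma free_mult_support:
  assumes nz: "(x \<otimes>\<^bsub>free_algebra A M\<^esub> y) w \<noteq> 0"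
  shows "\<exists>u v. w = u @ v \<and> x u \<noteq> 0 \<and> y v \<noteq> 0"
proof -
  obtain k where "x (take k w) * y (drop k w) \<noteq> 0"
    using nz unfolding free_algebra_simps by (meson sum.not_neutral_contains_not_neutral)
  then show ?thesis by (intro exI[of _ "take k w"] exI[of _ "drop k w"]) auto
qed

lemma free_mult_closed:
  assumes "x \<in> carrier (free_algebra A M)" "y \<in> carrier (free_algebra A M)"
  shows "x \<otimes>\<^bsub>free_algebra A M\<^esub> y \<in> carrier (free_algebra A M)"
proof -
  note * = free_mult_support[where x = x and y = y and A = A and M = M]
  have "{w. (x \<otimes>\<^bsub>free_algebra A M\<^esub> y) w \<noteq> 0} \<subseteq> (\<lambda>(u, v). u @ v) ` ({u. x u \<noteq> 0} \<times> {v. y v \<noteq> 0})"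
    using * by fastforce
  then have "finite {w. (x \<otimes>\<^bsub>free_algebra A M\<^esub> y) w \<noteq> 0}"
    using assms by (auto simp: free_algebra_simps(1) intro: finite_subset)
  moreover have "set w \<subseteq> carrier A <+> carrier M" if nz: "(x \<otimes>\<^bsub>free_algebra A M\<^esub> y) w \<noteq> 0" for w
  proof -
    obtain u v where "w = u @ v" "x u \<noteq> 0" "y v \<noteq> 0" using *[OF nz] by blast
    then show ?thesis using assms by (simp add: free_algebra_simps(1))
  qed
  ultimately show ?thesis by (simp add: free_algebra_simps(1))
qed

lemma free_mult_assoc:
  "(x \<otimes>\<^bsub>free_algebra A M\<^esub> y) \<otimes>\<^bsub>free_algebra A M\<^esub> z = x \<otimes>\<^bsub>free_algebra A M\<^esub> (y \<otimes>\<^bsub>free_algebra A M\<^esub> z)"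
proof
  fix w :: "('a + 'b) list"
  let ?n = "length w"
  have "((x \<otimes>\<^bsub>free_algebra A M\<^esub> y) \<otimes>\<^bsub>free_algebra A M\<^esub> z) w =
      (\<Sum>k\<le>?n. \<Sum>j\<le>k. x (take j w) * y (drop j (take k w)) * z (drop k w))"
    unfolding free_algebra_simps by (intro sum.cong refl) (simp add: sum_distrib_right min_def)
  also have "\<dots> = (\<Sum>j\<le>?n. \<Sum>i\<le>?n - j. x (take j w) * y (drop j (take (j + i) w)) * z (drop (j + i) w))"
    by (rule sum_triple_split)
  also have "\<dots> = (x \<otimes>\<^bsub>free_algebra A M\<^esub> (y \<otimes>\<^bsub>free_algebra A M\<^esub> z)) w"
    unfolding free_algebra_simps
    by (intro sum.cong refl) (simp add: sum_distrib_left mult.assoc drop_take add.commute)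
  finally show "((x \<otimes>\<^bsub>free_algebra A M\<^esub> y) \<otimes>\<^bsub>free_algebra A M\<^esub> z) w =
      (x \<otimes>\<^bsub>free_algebra A M\<^esub> (y \<otimes>\<^bsub>free_algebra A M\<^esub> z)) w" .
qed

lemma free_mult_word:
  "(word u \<otimes>\<^bsub>free_algebra A M\<^esub> word v) = word (u @ v)"
proof
  fix w
  have "(word u \<otimes>\<^bsub>free_algebra A M\<^esub> word v) w =
      (\<Sum>k\<le>length w. if k = length u then if take k w = u \<and> drop k w = v then 1 else 0 else 0)"
    unfolding free_algebra_simps by (intro sum.cong refl) (auto simp: word_def)
  also have "\<dots> = word (u @ v) w"
    by (auto simp: word_def sum.delta) (metis append_take_drop_id)
  finally show "(word u \<otimes>\<^bsub>free_algebra A M\<^esub> word v) w = word (u @ v) w" .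
qed

lemma word_in_free [simp]:
  "word w \<in> carrier (free_algebra A M) \<longleftrightarrow> set w \<subseteq> carrier A <+> carrier M"
  by (auto simp: free_algebra_simps(1) word_def)

lemma free_one_mult:
  "word [] \<otimes>\<^bsub>free_algebra A M\<^esub> x = x" "x \<otimes>\<^bsub>free_algebra A M\<^esub> word [] = x"
proof -
  have "(word [] \<otimes>\<^bsub>free_algebra A M\<^esub> x) w = (\<Sum>k\<le>length w. if k = 0 then x w else 0)" for w
    unfolding free_algebra_simps by (intro sum.cong refl) (auto simp: word_def)
  then show "word [] \<otimes>\<^bsub>free_algebra A M\<^esub> x = x" by auto
  have "(x \<otimes>\<^bsub>free_algebra A M\<^esub> word []) w = (\<Sum>k\<le>length w. if k = length w then x w else 0)" for w
    unfolding free_algebra_simps by (intro sum.cong refl) (auto simp: word_def)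
  then show "x \<otimes>\<^bsub>free_algebra A M\<^esub> word [] = x" by auto
qed

lemma free_add_closed:
  assumes "x \<in> carrier (free_algebra A M)" "y \<in> carrier (free_algebra A M)"
  shows "x \<oplus>\<^bsub>free_algebra A M\<^esub> y \<in> carrier (free_algebra A M)"
proof -
  have "{w. x w + y w \<noteq> 0} \<subseteq> {w. x w \<noteq> 0} \<union> {w. y w \<noteq> 0}" by auto
  then have "finite {w. x w + y w \<noteq> 0}"
    using assms unfolding free_algebra_simps(1) by (meson finite_Un finite_subset)
  moreover have "set w \<subseteq> carrier A <+> carrier M" if "x w + y w \<noteq> 0" for w
    using assms that unfolding free_algebra_simps(1) by (metis add_0)
  ultimately show ?thesis unfolding free_algebra_simps by blast
qed

lemma free_smult_closed:
  "x \<in> carrier (free_algebra A M) \<Longrightarrow> c \<odot>\<^bsub>free_algebra A M\<^esub> x \<in> carrier (free_algebra A M)"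
  unfolding free_algebra_simps by (auto elim: rev_finite_subset)

lemma free_falgebra: "falgebra (free_algebra A M)"
proof -
  let ?F = "free_algebra A M"
  have ab: "abelian_group ?F"
  proof (rule abelian_groupI)
    fix x assume x: "x \<in> carrier ?F"
    show "\<exists>y\<in>carrier ?F. y \<oplus>\<^bsub>?F\<^esub> x = \<zero>\<^bsub>?F\<^esub>"
      by (rule bexI[OF _ free_smult_closed[OF x, of "- 1"]]) (simp add: free_algebra_simps)
  qed (auto simp: free_add_closed, auto simp: free_algebra_simps algebra_simps)
  have mon: "monoid ?F"
    by (rule monoidI)
      (simp_all only: free_mult_closed free_mult_assoc free_one_mult free_algebra_simps(4), simp)
  have "ring ?F"
    by (rule ringI[OF ab mon]) (simp_all add: free_algebra_simps distrib_left distrib_right sum.distrib)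
  then show ?thesis
    by (intro falgebra.intro falgebra_axioms.intro)
      (simp_all only: free_smult_closed,
       simp_all add: free_algebra_simps distrib_left distrib_right sum_distrib_left mult_ac)
qed

lemma free_induct [consumes 1, case_names word add]:
  assumes "x \<in> carrier (free_algebra A M)"
    and word: "\<And>c w. set w \<subseteq> carrier A <+> carrier M \<Longrightarrow> (x w \<noteq> 0 \<or> c = 0) \<Longrightarrow>
      P (c \<odot>\<^bsub>free_algebra A M\<^esub> word w)"
    and add: "\<And>y z. y \<in> carrier (free_algebra A M) \<Longrightarrow> z \<in> carrier (free_algebra A M) \<Longrightarrow>
      P y \<Longrightarrow> P z \<Longrightarrow> P (y \<oplus>\<^bsub>free_algebra A M\<^esub> z)"
  shows "P x"
proof -
  let ?F = "free_algebra A M"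
  have x: "finite {w. x w \<noteq> 0}" "\<And>w. x w \<noteq> 0 \<Longrightarrow> set w \<subseteq> carrier A <+> carrier M"
    using assms(1) by (simp_all add: free_algebra_simps(1))
  have "P (\<lambda>w. if w \<in> S then x w else 0) \<and> (\<lambda>w. if w \<in> S then x w else 0) \<in> carrier ?F"
    if "finite S" "S \<subseteq> {w. x w \<noteq> 0}" for S
    using that
  proof (induction S)
    case empty
    then show ?case using word[of "[]" 0] by (simp add: free_algebra_simps)
  next
    case (insert w S)
    have eq: "(\<lambda>v. if v \<in> insert w S then x v else 0) =
        (x w \<odot>\<^bsub>?F\<^esub> word w) \<oplus>\<^bsub>?F\<^esub> (\<lambda>v. if v \<in> S then x v else 0)"
      using insert(2) by (auto simp: free_algebra_simps word_def)
    have w: "x w \<noteq> 0" using insert by auto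
    have "x w \<odot>\<^bsub>?F\<^esub> word w \<in> carrier ?F" using x(2)[OF w] by (intro free_smult_closed) simp
    then show ?case
      unfolding eq using insert w x(2) by (intro conjI add word free_add_closed) auto
  qed
  from this[of "{w. x w \<noteq> 0}"] have "P (\<lambda>w. if w \<in> {w. x w \<noteq> 0} then x w else 0)"
    using x(1) by blast
  moreover have "(\<lambda>w. if w \<in> {w. x w \<noteq> 0} then x w else 0) = x" by auto
  ultimately show ?thesis by simp
qed

abbreviation word_prod :: "('f, 'b, 'z) module_scheme \<Rightarrow> ('l \<Rightarrow> 'b) \<Rightarrow> 'l list \<Rightarrow> 'b" where
  "word_prod B g w \<equiv> foldr (mult B) (map g w) \<one>\<^bsub>B\<^esub>"

lemma word_prod_closed:
  assumes "monoid B" "\<And>l. l \<in> set w \<Longrightarrow> g l \<in> carrier B"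
  shows "word_prod B g w \<in> carrier B"
proof -
  interpret monoid B by fact
  show ?thesis using assms(2) by (induction w) auto
qed

lemma word_prod_append:
  assumes "monoid B" "\<And>l. l \<in> set (v @ w) \<Longrightarrow> g l \<in> carrier B"
  shows "word_prod B g (v @ w) = word_prod B g v \<otimes>\<^bsub>B\<^esub> word_prod B g w"
proof -
  interpret monoid B by fact
  show ?thesis using assms(2)
  proof (induction v)
    case Nil
    then show ?case using word_prod_closed[OF assms(1), of w g] by simp
  next
    case (Cons l v)
    then show ?case
      using word_prod_closed[OF assms(1), of v g] word_prod_closed[OF assms(1), of w g]
      by (simp add: m_assoc del: foldr_append map_append)
  qed
qed

locale letter_map = B: falgebra B for B :: "('f::field, 'b, 'z) module_scheme" +
  fixes A :: "('f, 'a, 'y) module_scheme" and M :: "('f, 'a, 'm) bimod"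
    and g :: "'a + 'm \<Rightarrow> 'b"
  assumes letter_closed: "l \<in> carrier A <+> carrier M \<Longrightarrow> g l \<in> carrier B"
begin

lemma prod_closed: "set w \<subseteq> carrier A <+> carrier M \<Longrightarrow> word_prod B g w \<in> carrier B"
  by (rule word_prod_closed) (auto intro: letter_closed B.monoid_axioms)

lemma subst_smult_word:
  assumes "set w \<subseteq> carrier A <+> carrier M"
  shows "subst B g (c \<odot>\<^bsub>free_algebra A M\<^esub> word w) = c \<odot>\<^bsub>B\<^esub> word_prod B g w"
proof (cases "c = 0")
  case True
  then show ?thesis using prod_closed[OF assms] by (simp add: subst_def free_algebra_simps)
next
  case False
  then have "{v. c * (if v = w then 1 else 0) \<noteq> 0} = {w}" by auto
  then show ?thesis using prod_closed[OF assms]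
    by (simp add: subst_def free_algebra_simps word_def)
qed

lemma subst_superset:
  assumes "x \<in> carrier (free_algebra A M)" "finite T" "{w. x w \<noteq> 0} \<subseteq> T"
    "\<And>w. w \<in> T \<Longrightarrow> set w \<subseteq> carrier A <+> carrier M"
  shows "subst B g x = (\<Oplus>\<^bsub>B\<^esub>w\<in>T. x w \<odot>\<^bsub>B\<^esub> word_prod B g w)"
  unfolding subst_def
  by (rule B.add.finprod_mono_neutral_cong_left) (use assms prod_closed in auto)

lemma subst_add:
  assumes "x \<in> carrier (free_algebra A M)" "y \<in> carrier (free_algebra A M)"
  shows "subst B g (x \<oplus>\<^bsub>free_algebra A M\<^esub> y) = subst B g x \<oplus>\<^bsub>B\<^esub> subst B g y"
proof -
  let ?T = "{w. x w \<noteq> 0} \<union> {w. y w \<noteq> 0}"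
  have T: "finite ?T" "\<And>w. w \<in> ?T \<Longrightarrow> set w \<subseteq> carrier A <+> carrier M"
    using assms by (auto simp: free_algebra_simps(1))
  have cl: "(\<lambda>w. z w \<odot>\<^bsub>B\<^esub> word_prod B g w) \<in> ?T \<rightarrow> carrier B" for z
    using T(2) prod_closed by auto
  have "subst B g (x \<oplus>\<^bsub>free_algebra A M\<^esub> y) =
      (\<Oplus>\<^bsub>B\<^esub>w\<in>?T. (x \<oplus>\<^bsub>free_algebra A M\<^esub> y) w \<odot>\<^bsub>B\<^esub> word_prod B g w)"
    by (rule subst_superset[OF free_add_closed[OF assms] T(1) _ T(2)]) (auto simp: free_algebra_simps)
  also have "\<dots> = (\<Oplus>\<^bsub>B\<^esub>w\<in>?T. x w \<odot>\<^bsub>B\<^esub> word_prod B g w \<oplus>\<^bsub>B\<^esub> y w \<odot>\<^bsub>B\<^esub> word_prod B g w)"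
    using T(2) prod_closed
    by (intro B.finsum_cong') (auto simp: free_algebra_simps(2) B.smult_l_distr)
  also have "\<dots> = (\<Oplus>\<^bsub>B\<^esub>w\<in>?T. x w \<odot>\<^bsub>B\<^esub> word_prod B g w) \<oplus>\<^bsub>B\<^esub> (\<Oplus>\<^bsub>B\<^esub>w\<in>?T. y w \<odot>\<^bsub>B\<^esub> word_prod B g w)"
    by (rule B.finsum_addf[OF cl cl])
  also have "(\<Oplus>\<^bsub>B\<^esub>w\<in>?T. x w \<odot>\<^bsub>B\<^esub> word_prod B g w) = subst B g x"
    by (rule subst_superset[OF assms(1) T(1) _ T(2), symmetric]) auto
  also have "(\<Oplus>\<^bsub>B\<^esub>w\<in>?T. y w \<odot>\<^bsub>B\<^esub> word_prod B g w) = subst B g y"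
    by (rule subst_superset[OF assms(2) T(1) _ T(2), symmetric]) auto
  finally show ?thesis .
qed

lemma subst_closed: "x \<in> carrier (free_algebra A M) \<Longrightarrow> subst B g x \<in> carrier B"
  unfolding subst_def by (rule B.finsum_closed) (auto simp: free_algebra_simps(1) prod_closed)

lemma subst_hom: "subst B g \<in> alg_hom (free_algebra A M) B"
proof -
  let ?F = "free_algebra A M"
  interpret F: falgebra ?F by (rule free_falgebra)
  have smult: "subst B g (c \<odot>\<^bsub>?F\<^esub> x) = c \<odot>\<^bsub>B\<^esub> subst B g x" if "x \<in> carrier ?F" for c x
    using that
  proof (induction x rule: free_induct)
    case (word d w)
    then have "c \<odot>\<^bsub>?F\<^esub> (d \<odot>\<^bsub>?F\<^esub> word w) = (c * d) \<odot>\<^bsub>?F\<^esub> word w" by (simp add: F.smult_smult)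
    then show ?case using word
      by (simp only: subst_smult_word B.smult_smult[OF prod_closed])
  next
    case (add y z)
    then show ?case by (simp add: F.smult_r_distr subst_add B.smult_r_distr subst_closed)
  qed
  have mult_word: "subst B g ((c \<odot>\<^bsub>?F\<^esub> word v) \<otimes>\<^bsub>?F\<^esub> (d \<odot>\<^bsub>?F\<^esub> word w)) =
      subst B g (c \<odot>\<^bsub>?F\<^esub> word v) \<otimes>\<^bsub>B\<^esub> subst B g (d \<odot>\<^bsub>?F\<^esub> word w)"
    if "set v \<subseteq> carrier A <+> carrier M" "set w \<subseteq> carrier A <+> carrier M" for c d v w
  proof -
    have "(c \<odot>\<^bsub>?F\<^esub> word v) \<otimes>\<^bsub>?F\<^esub> (d \<odot>\<^bsub>?F\<^esub> word w) = (c * d) \<odot>\<^bsub>?F\<^esub> word (v @ w)"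
      using that by (simp add: F.smult_mult_l F.smult_mult_r F.smult_smult[symmetric] free_mult_word mult.commute)
    moreover have "word_prod B g (v @ w) = word_prod B g v \<otimes>\<^bsub>B\<^esub> word_prod B g w"
      using that by (intro word_prod_append B.monoid_axioms letter_closed) auto
    moreover have "set (v @ w) \<subseteq> carrier A <+> carrier M" using that by auto
    ultimately show ?thesis using that prod_closed
      by (simp only: subst_smult_word)
        (simp add: prod_closed B.smult_mult_l B.smult_mult_r B.smult_smult[symmetric] mult.commute)
  qed
  have mult_l: "subst B g (x \<otimes>\<^bsub>?F\<^esub> (d \<odot>\<^bsub>?F\<^esub> word w)) = subst B g x \<otimes>\<^bsub>B\<^esub> subst B g (d \<odot>\<^bsub>?F\<^esub> word w)"
    if "x \<in> carrier ?F" "set w \<subseteq> carrier A <+> carrier M" for x d w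
    using that(1)
  proof (induction x rule: free_induct)
    case (word c v)
    then show ?case using that(2) by (simp add: mult_word)
  next
    case (add y z)
    then show ?case using that(2) by (simp add: F.l_distr B.l_distr subst_add subst_closed)
  qed
  have mult: "subst B g (x \<otimes>\<^bsub>?F\<^esub> y) = subst B g x \<otimes>\<^bsub>B\<^esub> subst B g y"
    if "x \<in> carrier ?F" "y \<in> carrier ?F" for x y
    using that(2)
  proof (induction y rule: free_induct)
    case (word c v)
    then show ?case using that(1) by (simp add: mult_l)
  next
    case (add y z)
    then show ?case using that(1) by (simp add: F.r_distr B.r_distr subst_add subst_closed)
  qed
  have "subst B g (word []) = \<one>\<^bsub>B\<^esub>"
    using subst_smult_word[of "[]" 1] by (simp add: free_algebra_simps(6))
  then have "subst B g \<one>\<^bsub>?F\<^esub> = \<one>\<^bsub>B\<^esub>" by (simp add: free_algebra_simps(4))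
  then show ?thesis
    by (intro alg_homI subst_closed subst_add mult smult)
qed

lemma subst_word: "set w \<subseteq> carrier A <+> carrier M \<Longrightarrow> subst B g (word w) = word_prod B g w"
  using subst_smult_word[of w 1] falgebra.smult_one[OF free_falgebra, of "word w" A M] prod_closed
  by simp

end


locale graded_falgebra = falgebra A for A :: "('f::field, 'a) graded_algebra" (structure) +
  assumes degs_carrier: "x \<in> degs A n \<Longrightarrow> x \<in> carrier A"
    and degs_zero: "\<zero> \<in> degs A n"
    and degs_add: "x \<in> degs A n \<Longrightarrow> y \<in> degs A n \<Longrightarrow> x \<oplus> y \<in> degs A n"
    and degs_smult: "x \<in> degs A n \<Longrightarrow> c \<odot> x \<in> degs A n"
    and degs_one: "\<one> \<in> degs A 0"
    and degs_mult: "x \<in> degs A m \<Longrightarrow> y \<in> degs A n \<Longrightarrow> x \<otimes> y \<in> degs A (m + n)"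

lemma free_graded: "graded_falgebra (free_algebra A M)"
proof -
  let ?F = "free_algebra A M"
  interpret F: falgebra ?F by (rule free_falgebra)
  show ?thesis
  proof (intro graded_falgebra.intro graded_falgebra_axioms.intro F.falgebra_axioms)
    fix x y m n assume "x \<in> degs ?F m" "y \<in> degs ?F n"
    then show "x \<otimes>\<^bsub>?F\<^esub> y \<in> degs ?F (m + n)"
      using free_mult_support[where x = x and y = y and A = A and M = M] unfolding free_algebra_simps(7)
      by (fastforce simp: free_mult_closed)
  next
    fix x y n assume xy: "x \<in> degs ?F n" "y \<in> degs ?F n"
    have "int (length (filter (\<lambda>l. \<not> isl l) w)) = n" if "x w + y w \<noteq> 0" for w
      using xy that unfolding free_algebra_simps(7) by (metis add_0)
    then show "x \<oplus>\<^bsub>?F\<^esub> y \<in> degs ?F n"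
      using xy F.a_closed[of x y] unfolding free_algebra_simps(2,7) by blast
  next
    fix x n c assume x: "x \<in> degs ?F n"
    then show "c \<odot>\<^bsub>?F\<^esub> x \<in> degs ?F n"
      using F.smult_closed[of x c] unfolding free_algebra_simps(6,7) by (metis mult_zero_right)
  next
    show "\<zero>\<^bsub>?F\<^esub> \<in> degs ?F n" for n using F.zero_closed unfolding free_algebra_simps(5,7) by simp
    show "\<one>\<^bsub>?F\<^esub> \<in> degs ?F 0" unfolding free_algebra_simps(4,7) by (intro conjI) (simp, simp add: word_def)
  qed (simp add: free_algebra_simps(7))
qed

lemma quot_graded:
  assumes "graded_falgebra A" "ideal I A"
  shows "graded_falgebra (quot_algebra A I)"
proof -
  interpret A: graded_falgebra A by fact
  note q = quot_simps[OF A.falgebra_axioms assms(2)] quot_smult[OF A.falgebra_axioms assms(2)]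
  show ?thesis
    by (intro graded_falgebra.intro graded_falgebra_axioms.intro quot_falgebra A.falgebra_axioms assms(2))
      (auto simp: q A.degs_carrier intro!: imageI A.degs_zero A.degs_add A.degs_smult A.degs_one A.degs_mult)
qed

locale tensor_data =
  fixes A :: "('f::field, 'a, 'y) module_scheme" and M :: "('f, 'a, 'm) bimod"
  assumes A_add: "a \<in> carrier A \<Longrightarrow> b \<in> carrier A \<Longrightarrow> a \<oplus>\<^bsub>A\<^esub> b \<in> carrier A"
    and A_smult: "a \<in> carrier A \<Longrightarrow> c \<odot>\<^bsub>A\<^esub> a \<in> carrier A"
    and A_mult: "a \<in> carrier A \<Longrightarrow> b \<in> carrier A \<Longrightarrow> a \<otimes>\<^bsub>A\<^esub> b \<in> carrier A"
    and A_one: "\<one>\<^bsub>A\<^esub> \<in> carrier A"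
    and M_add: "m \<in> carrier M \<Longrightarrow> n \<in> carrier M \<Longrightarrow> m \<oplus>\<^bsub>M\<^esub> n \<in> carrier M"
    and M_smult: "m \<in> carrier M \<Longrightarrow> c \<odot>\<^bsub>M\<^esub> m \<in> carrier M"
    and M_lact: "a \<in> carrier A \<Longrightarrow> m \<in> carrier M \<Longrightarrow> lact M a m \<in> carrier M"
    and M_ract: "a \<in> carrier A \<Longrightarrow> m \<in> carrier M \<Longrightarrow> ract M m a \<in> carrier M"
begin

lemma tensor_rels_carrier: "tensor_rels A M \<subseteq> carrier (free_algebra A M)"
proof -
  interpret F: falgebra "free_algebra A M" by (rule free_falgebra)
  show ?thesis
    unfolding tensor_rels_def Let_def
    by (auto intro!: F.minus_closed F.a_closed F.smult_closed
        simp: A_add A_smult A_mult A_one M_add M_smult M_lact M_ract)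
qed

lemma tensor_ideal_ideal: "ideal (tensor_ideal A M) (free_algebra A M)"
  unfolding tensor_ideal_def
  by (rule ring.genideal_ideal[OF _ tensor_rels_carrier])
    (rule falgebra.axioms(1)[OF free_falgebra])

lemma tensor_graded: "graded_falgebra (tensor_algebra A M)"
  unfolding tensor_algebra_def by (rule quot_graded[OF free_graded tensor_ideal_ideal])

lemmas tensor_simps =
  quot_simps[OF free_falgebra tensor_ideal_ideal, folded tensor_algebra_def]
  quot_smult[OF free_falgebra tensor_ideal_ideal, folded tensor_algebra_def]

end

text \<open>
  The data that determine an algebra homomorphism from the tensor algebra of a bimodule: an
  algebra homomorphism on its degree zero part and a compatible map of bimodules.
\<close>

locale tensor_map = tensor_data A M + letter_map B A M g
  for A :: "('f::field, 'a, 'y) module_scheme" and M :: "('f, 'a, 'm) bimod"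
    and B :: "('f, 'b, 'z) module_scheme" and g :: "'a + 'm \<Rightarrow> 'b" +
  assumes g_add: "a \<in> carrier A \<Longrightarrow> b \<in> carrier A \<Longrightarrow> g (Inl (a \<oplus>\<^bsub>A\<^esub> b)) = g (Inl a) \<oplus>\<^bsub>B\<^esub> g (Inl b)"
    and g_smult: "a \<in> carrier A \<Longrightarrow> g (Inl (c \<odot>\<^bsub>A\<^esub> a)) = c \<odot>\<^bsub>B\<^esub> g (Inl a)"
    and g_mult: "a \<in> carrier A \<Longrightarrow> b \<in> carrier A \<Longrightarrow> g (Inl (a \<otimes>\<^bsub>A\<^esub> b)) = g (Inl a) \<otimes>\<^bsub>B\<^esub> g (Inl b)"
    and g_one: "g (Inl \<one>\<^bsub>A\<^esub>) = \<one>\<^bsub>B\<^esub>"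
    and g_Madd: "m \<in> carrier M \<Longrightarrow> n \<in> carrier M \<Longrightarrow> g (Inr (m \<oplus>\<^bsub>M\<^esub> n)) = g (Inr m) \<oplus>\<^bsub>B\<^esub> g (Inr n)"
    and g_Msmult: "m \<in> carrier M \<Longrightarrow> g (Inr (c \<odot>\<^bsub>M\<^esub> m)) = c \<odot>\<^bsub>B\<^esub> g (Inr m)"
    and g_lact: "a \<in> carrier A \<Longrightarrow> m \<in> carrier M \<Longrightarrow> g (Inr (lact M a m)) = g (Inl a) \<otimes>\<^bsub>B\<^esub> g (Inr m)"
    and g_ract: "a \<in> carrier A \<Longrightarrow> m \<in> carrier M \<Longrightarrow> g (Inr (ract M m a)) = g (Inr m) \<otimes>\<^bsub>B\<^esub> g (Inl a)"
begin

lemma g_closed [simp]: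
  "a \<in> carrier A \<Longrightarrow> g (Inl a) \<in> carrier B" "m \<in> carrier M \<Longrightarrow> g (Inr m) \<in> carrier B"
  by (auto intro: letter_closed)

lemma subst_rels:
  assumes "x \<in> tensor_rels A M" shows "subst B g x = \<zero>\<^bsub>B\<^esub>"
proof -
  let ?F = "free_algebra A M"
  interpret F: falgebra ?F by (rule free_falgebra)
  note hD = alg_homD[OF subst_hom]
  have minus: "subst B g (x \<ominus>\<^bsub>?F\<^esub> y) = subst B g x \<ominus>\<^bsub>B\<^esub> subst B g y"
    if "x \<in> carrier ?F" "y \<in> carrier ?F" for x y
    using that by (simp add: F.minus_eq_smult B.minus_eq_smult hD)
  have kill: "subst B g (y \<ominus>\<^bsub>?F\<^esub> z) = \<zero>\<^bsub>B\<^esub>"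
    if "y \<in> carrier ?F" "z \<in> carrier ?F" "subst B g y = subst B g z" for y z
    using that by (simp add: minus hD B.r_neg B.minus_eq)
  note cl = A_add A_smult A_mult A_one M_add M_smult M_lact M_ract F.a_closed F.smult_closed
  have "tensor_rels A M \<subseteq> {x. subst B g x = \<zero>\<^bsub>B\<^esub>}"
    unfolding tensor_rels_def Let_def
    by (intro Un_least subsetI; clarify; intro CollectI kill)
      (simp_all add: cl hD(2,5) subst_word free_algebra_simps(4)
        g_add g_smult g_mult g_one g_Madd g_Msmult g_lact g_ract)
  then show ?thesis using assms by blast
qed

lemma subst_tensor_ideal:
  assumes "x \<in> tensor_ideal A M" shows "subst B g x = \<zero>\<^bsub>B\<^esub>"
proof -
  interpret F: falgebra "free_algebra A M" by (rule free_falgebra)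
  have "tensor_ideal A M \<subseteq> {x \<in> carrier (free_algebra A M). subst B g x = \<zero>\<^bsub>B\<^esub>}"
    unfolding tensor_ideal_def
    by (rule F.genideal_minimal[OF kernel_ideal[OF free_falgebra B.falgebra_axioms subst_hom]])
      (use tensor_rels_carrier subst_rels in auto)
  then show ?thesis using assms by auto
qed

text \<open>
  The universal property of the tensor algebra: the defining relations go to zero.
\<close>

lemma tensor_hom:
  obtains h where "h \<in> alg_hom (tensor_algebra A M) B"
    and "\<And>x. x \<in> carrier (free_algebra A M) \<Longrightarrow> h (tensor_ideal A M +>\<^bsub>free_algebra A M\<^esub> x) = subst B g x"
    and "\<And>l. l \<in> carrier A <+> carrier M \<Longrightarrow> h (tensor_letter A M l) = g l"
proof -
  obtain h where h: "h \<in> alg_hom (quot_algebra (free_algebra A M) (tensor_ideal A M)) B"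
    "\<And>x. x \<in> carrier (free_algebra A M) \<Longrightarrow> h (tensor_ideal A M +>\<^bsub>free_algebra A M\<^esub> x) = subst B g x"
    using quot_lift[OF free_falgebra tensor_ideal_ideal B.falgebra_axioms subst_hom subst_tensor_ideal]
    by blast
  have "h (tensor_letter A M l) = g l" if l: "l \<in> carrier A <+> carrier M" for l
  proof -
    have "h (tensor_letter A M l) = subst B g (word [l])"
      unfolding tensor_letter_def using l by (intro h(2)) simp
    also have "\<dots> = g l" using l letter_closed[OF l] by (subst subst_word) auto
    finally show ?thesis .
  qed
  with h show thesis using that unfolding tensor_algebra_def by blast
qed

text \<open>
  Coefficients from \<^term>\<open>A\<close> are absorbed into neighbouring letters from \<^term>\<open>M\<close>, so a
  product only depends on at most as many factors as there are letters from \<^term>\<open>M\<close>.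
\<close>

lemma word_prod_absorb:
  assumes "set w \<subseteq> carrier A <+> carrier M"
  shows "length (filter (\<lambda>l. \<not> isl l) w) = 0 \<Longrightarrow> \<exists>a\<in>carrier A. word_prod B g w = g (Inl a)"
    and "length (filter (\<lambda>l. \<not> isl l) w) = 1 \<Longrightarrow> \<exists>m\<in>carrier M. word_prod B g w = g (Inr m)"
    and "length (filter (\<lambda>l. \<not> isl l) w) = 2 \<Longrightarrow>
      \<exists>m\<in>carrier M. \<exists>n\<in>carrier M. word_prod B g w = g (Inr m) \<otimes>\<^bsub>B\<^esub> g (Inr n)"
    and "3 \<le> length (filter (\<lambda>l. \<not> isl l) w) \<Longrightarrow>
      (\<And>l m n. l \<in> carrier M \<Longrightarrow> m \<in> carrier M \<Longrightarrow> n \<in> carrier M \<Longrightarrow>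
        g (Inr l) \<otimes>\<^bsub>B\<^esub> (g (Inr m) \<otimes>\<^bsub>B\<^esub> g (Inr n)) = \<zero>\<^bsub>B\<^esub>) \<Longrightarrow> word_prod B g w = \<zero>\<^bsub>B\<^esub>"
  using assms
proof (induction w)
  case Nil
  {
    case 1 then show ?case using A_one g_one by force
  next
    case 2 then show ?case by simp
  next
    case 3 then show ?case by simp
  next
    case 4 then show ?case by simp
  }
next
  case (Cons l w)
  {
    case 1
    then obtain a where a: "l = Inl a" "a \<in> carrier A" by (auto simp: isl_def split: if_splits)
    then obtain b where "b \<in> carrier A" "word_prod B g w = g (Inl b)" using Cons(1) 1 by auto
    then show ?case using a A_mult by (intro bexI[of _ "a \<otimes>\<^bsub>A\<^esub> b"]) (simp_all add: g_mult)
  next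
    case 2
    show ?case
    proof (cases l)
      case (Inl a)
      then obtain m where "m \<in> carrier M" "word_prod B g w = g (Inr m)" using Cons(2) 2 by auto
      then show ?thesis using Inl 2 M_lact by (intro bexI[of _ "lact M a m"]) (auto simp: g_lact)
    next
      case (Inr m)
      then obtain b where "b \<in> carrier A" "word_prod B g w = g (Inl b)" using Cons(1) 2 by auto
      then show ?thesis using Inr 2 M_ract by (intro bexI[of _ "ract M m b"]) (auto simp: g_ract)
    qed
  next
    case 3
    show ?case
    proof (cases l)
      case (Inl a)
      then obtain m n where mn: "m \<in> carrier M" "n \<in> carrier M"
        "word_prod B g w = g (Inr m) \<otimes>\<^bsub>B\<^esub> g (Inr n)" using Cons(3) 3 by auto
      then show ?thesis using Inl 3 M_lact
        by (intro bexI[of _ "lact M a m"] bexI[of _ n]) (auto simp: g_lact B.m_assoc)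
    next
      case (Inr m)
      then obtain n where "n \<in> carrier M" "word_prod B g w = g (Inr n)" using Cons(2) 3 by auto
      then show ?thesis using Inr 3 by (intro bexI[of _ m] bexI[of _ n]) auto
    qed
  next
    case 4
    show ?case
    proof (cases l)
      case (Inl a)
      then have "word_prod B g w = \<zero>\<^bsub>B\<^esub>" using Cons(4) 4 by auto
      then show ?thesis using Inl 4(3) by auto
    next
      case (Inr m)
      show ?thesis
      proof (cases "length (filter (\<lambda>l. \<not> isl l) w) = 2")
        case True
        then obtain n k where "n \<in> carrier M" "k \<in> carrier M"
          "word_prod B g w = g (Inr n) \<otimes>\<^bsub>B\<^esub> g (Inr k)" using Cons(3) 4 by auto
        then show ?thesis using Inr 4 by auto
      next
        case False
        then have "word_prod B g w = \<zero>\<^bsub>B\<^esub>" using Inr Cons(4) 4 by auto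
        then show ?thesis using Inr 4(3) by auto
      qed
    qed
  }
qed

end

lemma (in tensor_data) tensor_letter_map:
  "tensor_map A M (tensor_algebra A M) (tensor_letter A M)"
proof -
  let ?F = "free_algebra A M"
  let ?I = "tensor_ideal A M"
  interpret F: falgebra ?F by (rule free_falgebra)
  interpret I: ideal ?I ?F by (rule tensor_ideal_ideal)
  interpret T: graded_falgebra "tensor_algebra A M" by (rule tensor_graded)
  have rel: "?I +>\<^bsub>?F\<^esub> x = ?I +>\<^bsub>?F\<^esub> y"
    if "x \<ominus>\<^bsub>?F\<^esub> y \<in> tensor_rels A M" "x \<in> carrier ?F" "y \<in> carrier ?F" for x y
    using that F.ideal_coset_eq[OF tensor_ideal_ideal] F.genideal_self[OF tensor_rels_carrier]
    unfolding tensor_ideal_def by blast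
  have w2: "word [k, l] = word [k] \<otimes>\<^bsub>?F\<^esub> (word [l] :: ('a + 'm) list \<Rightarrow> 'f)" for k l
    by (simp add: free_mult_word)
  note cl = A_add A_smult A_mult A_one M_add M_smult M_lact M_ract
  show ?thesis
  proof (unfold_locales, goal_cases)
    case (1 l) then show ?case by (auto simp: tensor_letter_def tensor_simps)
  next
    case (2 a b)
    have "?I +>\<^bsub>?F\<^esub> word [Inl (a \<oplus>\<^bsub>A\<^esub> b)] = ?I +>\<^bsub>?F\<^esub> (word [Inl a] \<oplus>\<^bsub>?F\<^esub> word [Inl b])"
      by (rule rel) (use 2 in \<open>unfold tensor_rels_def Let_def, blast\<close>, use 2 in \<open>simp_all add: cl\<close>)
    then show ?case using 2 by (simp add: tensor_letter_def tensor_simps)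
  next
    case (3 a c)
    have "?I +>\<^bsub>?F\<^esub> word [Inl (c \<odot>\<^bsub>A\<^esub> a)] = ?I +>\<^bsub>?F\<^esub> (c \<odot>\<^bsub>?F\<^esub> word [Inl a])"
      by (rule rel) (use 3 in \<open>unfold tensor_rels_def Let_def, blast\<close>, use 3 in \<open>simp_all add: cl\<close>)
    then show ?case using 3 by (simp add: tensor_letter_def tensor_simps)
  next
    case (4 a b)
    have "?I +>\<^bsub>?F\<^esub> word [Inl (a \<otimes>\<^bsub>A\<^esub> b)] = ?I +>\<^bsub>?F\<^esub> word [Inl a, Inl b]"
      by (rule rel) (use 4 in \<open>unfold tensor_rels_def Let_def, blast\<close>, use 4 in \<open>simp_all add: cl\<close>)
    then show ?case using 4 by (simp add: tensor_letter_def tensor_simps w2)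
  next
    case 5
    have "?I +>\<^bsub>?F\<^esub> word [Inl \<one>\<^bsub>A\<^esub>] = ?I +>\<^bsub>?F\<^esub> \<one>\<^bsub>?F\<^esub>"
      by (rule rel) (use A_one in \<open>unfold tensor_rels_def Let_def, blast\<close>, use A_one in \<open>simp_all add: cl\<close>)
    then show ?case by (simp add: tensor_letter_def tensor_simps)
  next
    case (6 a b)
    have "?I +>\<^bsub>?F\<^esub> word [Inr (a \<oplus>\<^bsub>M\<^esub> b)] = ?I +>\<^bsub>?F\<^esub> (word [Inr a] \<oplus>\<^bsub>?F\<^esub> word [Inr b])"
      by (rule rel) (use 6 in \<open>unfold tensor_rels_def Let_def, blast\<close>, use 6 in \<open>simp_all add: cl\<close>)
    then show ?case using 6 by (simp add: tensor_letter_def tensor_simps)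
  next
    case (7 a c)
    have "?I +>\<^bsub>?F\<^esub> word [Inr (c \<odot>\<^bsub>M\<^esub> a)] = ?I +>\<^bsub>?F\<^esub> (c \<odot>\<^bsub>?F\<^esub> word [Inr a])"
      by (rule rel) (use 7 in \<open>unfold tensor_rels_def Let_def, blast\<close>, use 7 in \<open>simp_all add: cl\<close>)
    then show ?case using 7 by (simp add: tensor_letter_def tensor_simps)
  next
    case (8 a m)
    have "?I +>\<^bsub>?F\<^esub> word [Inr (lact M a m)] = ?I +>\<^bsub>?F\<^esub> word [Inl a, Inr m]"
      by (rule rel) (use 8 in \<open>unfold tensor_rels_def Let_def, blast\<close>, use 8 in \<open>simp_all add: cl\<close>)
    then show ?case using 8 by (simp add: tensor_letter_def tensor_simps w2)
  next
    case (9 a m)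
    have "?I +>\<^bsub>?F\<^esub> word [Inr (ract M m a)] = ?I +>\<^bsub>?F\<^esub> word [Inr m, Inl a]"
      by (rule rel) (use 9 in \<open>unfold tensor_rels_def Let_def, blast\<close>, use 9 in \<open>simp_all add: cl\<close>)
    then show ?case using 9 by (simp add: tensor_letter_def tensor_simps w2)
  qed
qed

lemma tensor_map_comp:
  assumes "tensor_map A M B g" "falgebra C" "k \<in> alg_hom B C"
  shows "tensor_map A M C (\<lambda>l. k (g l))"
proof -
  interpret tensor_map A M B g by fact
  interpret C: falgebra C by fact
  note kD = alg_homD[OF assms(3)]
  show ?thesis
    by unfold_locales
      (simp_all add: kD letter_closed g_add g_smult g_mult g_one g_Madd g_Msmult g_lact g_ract)
qed

lemma (in tensor_data) tensor_coset_subst: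
  assumes "x \<in> carrier (free_algebra A M)"
  shows "subst (tensor_algebra A M) (tensor_letter A M) x =
    tensor_ideal A M +>\<^bsub>free_algebra A M\<^esub> x"
proof -
  interpret T: tensor_map A M "tensor_algebra A M" "tensor_letter A M"
    by (rule tensor_letter_map)
  note hD = alg_homD[OF T.subst_hom]
  interpret F: falgebra "free_algebra A M" by (rule free_falgebra)
  have w: "word_prod (tensor_algebra A M) (tensor_letter A M) w =
      tensor_ideal A M +>\<^bsub>free_algebra A M\<^esub> word w" if "set w \<subseteq> carrier A <+> carrier M" for w
    using that
  proof (induction w)
    case Nil
    then show ?case by (simp add: tensor_simps free_algebra_simps(4))
  next
    case (Cons l w)
    have "word (l # w) = word [l] \<otimes>\<^bsub>free_algebra A M\<^esub> word w" by (simp add: free_mult_word)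
    then show ?case using Cons by (simp add: tensor_simps tensor_letter_def)
  qed
  show ?thesis using assms
  proof (induction x rule: free_induct)
    case (word c w)
    then show ?case by (simp add: hD(5) T.subst_word w tensor_simps(7))
  next
    case (add y z)
    then show ?case by (simp add: hD(2) tensor_simps(2))
  qed
qed

lemma two_letter_closed:
  shows two_letter_zero: "\<zero>\<^bsub>free_algebra A M\<^esub> \<in> two_letter_sums A M"
    and two_letter_add: "x \<in> two_letter_sums A M \<Longrightarrow> y \<in> two_letter_sums A M \<Longrightarrow>
      x \<oplus>\<^bsub>free_algebra A M\<^esub> y \<in> two_letter_sums A M"
    and two_letter_smult: "x \<in> two_letter_sums A M \<Longrightarrow> c \<odot>\<^bsub>free_algebra A M\<^esub> x \<in> two_letter_sums A M"
    and two_letter_word: "m \<in> carrier M \<Longrightarrow> n \<in> carrier M \<Longrightarrow> word [Inr m, Inr n] \<in> two_letter_sums A M"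
    and two_letter_degs: "x \<in> two_letter_sums A M \<Longrightarrow> x \<in> degs (free_algebra A M) 2"
proof -
  interpret F: falgebra "free_algebra A M" by (rule free_falgebra)
  show "\<zero>\<^bsub>free_algebra A M\<^esub> \<in> two_letter_sums A M"
    using F.zero_closed unfolding two_letter_sums_def by (simp add: free_algebra_simps(5))
  show "x \<oplus>\<^bsub>free_algebra A M\<^esub> y \<in> two_letter_sums A M"
    if xy: "x \<in> two_letter_sums A M" "y \<in> two_letter_sums A M"
  proof -
    have "\<exists>u v. w = [Inr u, Inr v]" if "x w + y w \<noteq> 0" for w
      using xy that unfolding two_letter_sums_def mem_Collect_eq by (metis add_0)
    then show ?thesis using F.a_closed[of x y] xy
      unfolding two_letter_sums_def by (simp add: free_algebra_simps(2))
  qed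
  show "c \<odot>\<^bsub>free_algebra A M\<^esub> x \<in> two_letter_sums A M" if x: "x \<in> two_letter_sums A M"
    using F.smult_closed[of x c] x unfolding two_letter_sums_def by (simp add: free_algebra_simps(6))
  show "word [Inr m, Inr n] \<in> two_letter_sums A M" if "m \<in> carrier M" "n \<in> carrier M"
    using that by (auto simp: two_letter_sums_def) (auto simp: word_def split: if_splits)
  show "x \<in> degs (free_algebra A M) 2" if "x \<in> two_letter_sums A M"
    using that unfolding two_letter_sums_def free_algebra_simps(7) by fastforce
qed

text \<open>
  A word of degree two has coefficients before, between and after its two letters from the
  bimodule; all of them can be absorbed.
\<close>

lemma (in tensor_data) two_letter_representative:
  assumes "x \<in> degs (free_algebra A M) 2"
  shows "\<exists>\<xi>\<in>two_letter_sums A M. tensor_ideal A M +>\<^bsub>free_algebra A M\<^esub> x =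
    tensor_ideal A M +>\<^bsub>free_algebra A M\<^esub> \<xi>"
proof -
  let ?F = "free_algebra A M"
  interpret F: falgebra ?F by (rule free_falgebra)
  interpret T: tensor_map A M "tensor_algebra A M" "tensor_letter A M"
    by (rule tensor_letter_map)
  have x: "x \<in> carrier ?F" and d: "\<And>w. x w \<noteq> 0 \<Longrightarrow> int (length (filter (\<lambda>l. \<not> isl l) w)) = 2"
    using assms by (auto simp: free_algebra_simps(7))
  have carr: "two_letter_sums A M \<subseteq> carrier ?F" by (auto simp: two_letter_sums_def)
  show ?thesis using x
  proof (induction x rule: free_induct)
    case (word c w)
    show ?case
    proof (cases "c = 0")
      case True
      then show ?thesis using two_letter_zero word(1) by (intro bexI[of _ "\<zero>\<^bsub>?F\<^esub>"]) simp_all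
    next
      case False
      then have "length (filter (\<lambda>l. \<not> isl l) w) = 2" using d word(2) by fastforce
      then obtain m n where mn: "m \<in> carrier M" "n \<in> carrier M"
        "word_prod (tensor_algebra A M) (tensor_letter A M) w =
          tensor_letter A M (Inr m) \<otimes>\<^bsub>tensor_algebra A M\<^esub> tensor_letter A M (Inr n)"
        using T.word_prod_absorb(3)[OF word(1)] by blast
      have "tensor_ideal A M +>\<^bsub>?F\<^esub> word w =
          word_prod (tensor_algebra A M) (tensor_letter A M) w"
        using word(1) by (simp add: tensor_coset_subst[symmetric] T.subst_word)
      also have "\<dots> = tensor_ideal A M +>\<^bsub>?F\<^esub> word [Inr m, Inr n]"
        using mn by (simp add: tensor_letter_def tensor_simps(3) free_mult_word)
      finally have "tensor_ideal A M +>\<^bsub>?F\<^esub> (c \<odot>\<^bsub>?F\<^esub> word w) =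
          tensor_ideal A M +>\<^bsub>?F\<^esub> (c \<odot>\<^bsub>?F\<^esub> word [Inr m, Inr n])"
        using word(1) mn by (simp add: tensor_simps(7)[symmetric])
      then show ?thesis using two_letter_smult[OF two_letter_word[OF mn(1,2)]] by blast
    qed
  next
    case (add y z)
    then obtain \<xi> \<eta> where "\<xi> \<in> two_letter_sums A M" "\<eta> \<in> two_letter_sums A M"
      "tensor_ideal A M +>\<^bsub>?F\<^esub> y = tensor_ideal A M +>\<^bsub>?F\<^esub> \<xi>"
      "tensor_ideal A M +>\<^bsub>?F\<^esub> z = tensor_ideal A M +>\<^bsub>?F\<^esub> \<eta>" by blast
    then show ?case using add(1,2) carr two_letter_add[of \<xi> A M \<eta>]
      by (intro bexI[of _ "\<xi> \<oplus>\<^bsub>?F\<^esub> \<eta>"]) (simp_all add: tensor_simps(2)[symmetric] subsetD[OF carr])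
  qed
qed

text \<open>The degree of a word is the sum of the degrees of its letters.\<close>

lemma subst_degs:
  fixes C :: "('f::field, 'b) graded_algebra" and M :: "('f, 'a, 'm) bimod"
  assumes "graded_falgebra C"
    and g: "\<And>a. a \<in> carrier A \<Longrightarrow> g (Inl a) \<in> degs C 0" "\<And>m. m \<in> carrier M \<Longrightarrow> g (Inr m) \<in> degs C 1"
    and "x \<in> degs (free_algebra A M) n"
  shows "subst C g x \<in> degs C n"
proof -
  interpret C: graded_falgebra C by fact
  interpret letter_map C A M g
    by unfold_locales (auto dest: g C.degs_carrier)
  interpret F: falgebra "free_algebra A M" by (rule free_falgebra)
  have w: "word_prod C g w \<in> degs C (int (length (filter (\<lambda>l. \<not> isl l) w)))"
    if "set w \<subseteq> carrier A <+> carrier M" for w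
    using that
  proof (induction w)
    case (Cons l w)
    then show ?case
      using C.degs_mult[OF g(1), of _ "word_prod C g w"] C.degs_mult[OF g(2), of _ "word_prod C g w"]
      by auto
  qed (simp add: C.degs_one)
  have x: "x \<in> carrier (free_algebra A M)"
    and d: "\<And>w. x w \<noteq> 0 \<Longrightarrow> int (length (filter (\<lambda>l. \<not> isl l) w)) = n"
    using assms(4) by (auto simp: free_algebra_simps(7))
  show ?thesis using x
  proof (induction x rule: free_induct)
    case (word c w)
    then show ?case
    proof (cases "c = 0")
      case True
      then show ?thesis
        using subst_smult_word[OF word(1), of 0] prod_closed[OF word(1)] word(1)
        by (simp add: C.degs_zero)
    next
      case False
      then show ?thesis using word w[OF word(1)] d by (auto simp: subst_smult_word intro: C.degs_smult)
    qed
  next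
    case (add y z)
    then show ?case by (simp add: subst_add C.degs_add)
  qed
qed


section \<open>Graded algebras concentrated in degrees zero to two\<close>

text \<open>
  The vertices \<open>X\<close> are orthogonal idempotents, the arrows \<open>D\<close> span degree one and the arrows \<open>P\<close> span degree two;
  \<open>\<kappa> p b c\<close> is the coefficient of \<open>p\<close> in the product of \<open>b\<close> and \<open>c\<close>. All quadratic data are
  compared inside algebras of this form, where equality can be checked on coordinates.
\<close>

definition cube_zero_algebra ::
    "'v set \<Rightarrow> 'd set \<Rightarrow> 'p set \<Rightarrow> ('d \<Rightarrow> 'v) \<Rightarrow> ('d \<Rightarrow> 'v) \<Rightarrow> ('p \<Rightarrow> 'v) \<Rightarrow> ('p \<Rightarrow> 'v) \<Rightarrow>
     ('p \<Rightarrow> 'd \<Rightarrow> 'd \<Rightarrow> 'f::field) \<Rightarrow> ('f, ('v \<Rightarrow> 'f) \<times> ('d \<Rightarrow> 'f) \<times> ('p \<Rightarrow> 'f)) graded_algebra" where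
  "cube_zero_algebra X D P src tgt lp rp \<kappa> =
    (let C = {(s, u, w). (\<forall>i. i \<notin> X \<longrightarrow> s i = 0) \<and> (\<forall>b. b \<notin> D \<longrightarrow> u b = 0) \<and> (\<forall>p. p \<notin> P \<longrightarrow> w p = 0)} in
    \<lparr>carrier = C,
     mult = (\<lambda>(s, u, w) (s', u', w').
       (\<lambda>i. s i * s' i, \<lambda>b. s (src b) * u' b + u b * s' (tgt b),
        \<lambda>p. s (lp p) * w' p + w p * s' (rp p) + (\<Sum>b\<in>D. \<Sum>c\<in>D. \<kappa> p b c * u b * u' c))),
     one = (\<lambda>i. if i \<in> X then 1 else 0, \<lambda>b. 0, \<lambda>p. 0),
     zero = (\<lambda>i. 0, \<lambda>b. 0, \<lambda>p. 0),
     add = (\<lambda>(s, u, w) (s', u', w'). (\<lambda>i. s i + s' i, \<lambda>b. u b + u' b, \<lambda>p. w p + w' p)),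
     smult = (\<lambda>c (s, u, w). (\<lambda>i. c * s i, \<lambda>b. c * u b, \<lambda>p. c * w p)),
     degs = (\<lambda>n. {(s, u, w) \<in> C. (n \<noteq> 0 \<longrightarrow> s = (\<lambda>i. 0)) \<and> (n \<noteq> 1 \<longrightarrow> u = (\<lambda>b. 0)) \<and>
       (n \<noteq> 2 \<longrightarrow> w = (\<lambda>p. 0))})\<rparr>)"

locale cube_zero =
  fixes X :: "'v set" and D :: "'d set" and P :: "'p set"
    and src tgt :: "'d \<Rightarrow> 'v" and lp rp :: "'p \<Rightarrow> 'v" and \<kappa> :: "'p \<Rightarrow> 'd \<Rightarrow> 'd \<Rightarrow> 'f::field"
  assumes finite_D: "finite D"
    and src_in: "b \<in> D \<Longrightarrow> src b \<in> X" and tgt_in: "b \<in> D \<Longrightarrow> tgt b \<in> X"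
    and lp_in: "p \<in> P \<Longrightarrow> lp p \<in> X" and rp_in: "p \<in> P \<Longrightarrow> rp p \<in> X"
    and kappa_support: "\<kappa> p b c \<noteq> 0 \<Longrightarrow> p \<in> P \<and> b \<in> D \<and> c \<in> D \<and> src b = lp p \<and> tgt b = src c \<and> tgt c = rp p"
begin

abbreviation "B \<equiv> cube_zero_algebra X D P src tgt lp rp \<kappa>"

definition K :: "'p \<Rightarrow> ('d \<Rightarrow> 'f) \<Rightarrow> ('d \<Rightarrow> 'f) \<Rightarrow> 'f" where
  "K p u u' = (\<Sum>b\<in>D. \<Sum>c\<in>D. \<kappa> p b c * u b * u' c)"

lemma cube_zero_simps:
  "(s, u, w) \<in> carrier B \<longleftrightarrow>
     (\<forall>i. i \<notin> X \<longrightarrow> s i = 0) \<and> (\<forall>b. b \<notin> D \<longrightarrow> u b = 0) \<and> (\<forall>p. p \<notin> P \<longrightarrow> w p = 0)"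
  "(s, u, w) \<oplus>\<^bsub>B\<^esub> (s', u', w') = (\<lambda>i. s i + s' i, \<lambda>b. u b + u' b, \<lambda>p. w p + w' p)"
  "(s, u, w) \<otimes>\<^bsub>B\<^esub> (s', u', w') =
     (\<lambda>i. s i * s' i, \<lambda>b. s (src b) * u' b + u b * s' (tgt b),
      \<lambda>p. s (lp p) * w' p + w p * s' (rp p) + K p u u')"
  "\<one>\<^bsub>B\<^esub> = (\<lambda>i. if i \<in> X then 1 else 0, \<lambda>b. 0, \<lambda>p. 0)"
  "\<zero>\<^bsub>B\<^esub> = (\<lambda>i. 0, \<lambda>b. 0, \<lambda>p. 0)"
  "c \<odot>\<^bsub>B\<^esub> (s, u, w) = (\<lambda>i. c * s i, \<lambda>b. c * u b, \<lambda>p. c * w p)"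
  "(s, u, w) \<in> degs B n \<longleftrightarrow> (s, u, w) \<in> carrier B \<and>
     (n \<noteq> 0 \<longrightarrow> s = (\<lambda>i. 0)) \<and> (n \<noteq> 1 \<longrightarrow> u = (\<lambda>b. 0)) \<and> (n \<noteq> 2 \<longrightarrow> w = (\<lambda>p. 0))"
  by (auto simp: cube_zero_algebra_def Let_def K_def)

lemma K_simps:
  "K p (\<lambda>b. u b + u' b) v = K p u v + K p u' v"
  "K p v (\<lambda>b. u b + u' b) = K p v u + K p v u'"
  "K p (\<lambda>b. c * u b) v = c * K p u v"
  "K p v (\<lambda>b. c * u b) = c * K p v u"
  "K p (\<lambda>b. 0) v = 0" "K p v (\<lambda>b. 0) = 0"
  "p \<notin> P \<Longrightarrow> K p u v = 0"
proof -
  show "p \<notin> P \<Longrightarrow> K p u v = 0"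
    using kappa_support unfolding K_def by (intro sum.neutral ballI) (metis mult_zero_left)
qed (simp_all add: K_def algebra_simps sum.distrib sum_distrib_left)

text \<open>
  The support condition on \<open>\<kappa>\<close> makes the product bilinear over the vertices, which is associativity.
\<close>

lemma K_balanced:
  "K p (\<lambda>b. s (src b) * u b) v = s (lp p) * K p u v"
  "K p (\<lambda>b. u b * s (tgt b)) v = K p u (\<lambda>b. s (src b) * v b)"
  "K p u (\<lambda>b. v b * s (tgt b)) = K p u v * s (rp p)"
  unfolding K_def sum_distrib_left sum_distrib_right
  by (intro sum.cong refl; use kappa_support in \<open>fastforce simp: mult_ac\<close>)+

lemma cube_zero_graded: "graded_falgebra B"
proof -
  have ab: "abelian_group B"
  proof (rule abelian_groupI)
    fix x assume x: "x \<in> carrier B"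
    obtain s u w where suw: "x = (s, u, w)" by (cases x) auto
    show "\<exists>y\<in>carrier B. y \<oplus>\<^bsub>B\<^esub> x = \<zero>\<^bsub>B\<^esub>"
      using x by (intro bexI[of _ "(\<lambda>i. - s i, \<lambda>b. - u b, \<lambda>p. - w p)"]) (auto simp: suw cube_zero_simps)
  qed (auto simp: cube_zero_simps add_ac)
  have closed: "x \<otimes>\<^bsub>B\<^esub> y \<in> carrier B" if "x \<in> carrier B" "y \<in> carrier B" for x y
    using that by (cases x; cases y) (auto simp: cube_zero_simps K_simps)
  have mon: "monoid B"
  proof (rule monoidI)
    fix x y z assume "x \<in> carrier B" "y \<in> carrier B" "z \<in> carrier B"
    obtain s u w s' u' w' s'' u'' w'' where xyz: "x = (s, u, w)" "y = (s', u', w')" "z = (s'', u'', w'')"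
      by (cases x; cases y; cases z) auto
    show "(x \<otimes>\<^bsub>B\<^esub> y) \<otimes>\<^bsub>B\<^esub> z = x \<otimes>\<^bsub>B\<^esub> (y \<otimes>\<^bsub>B\<^esub> z)"
      by (simp add: xyz cube_zero_simps K_simps K_balanced)
        (simp add: fun_eq_iff algebra_simps)
  next
    fix x assume "x \<in> carrier B"
    then obtain s u w where x: "x = (s, u, w)" "(s, u, w) \<in> carrier B" by (cases x) auto
    show "\<one>\<^bsub>B\<^esub> \<otimes>\<^bsub>B\<^esub> x = x" "x \<otimes>\<^bsub>B\<^esub> \<one>\<^bsub>B\<^esub> = x"
      using x(2) src_in tgt_in lp_in rp_in
      by (auto simp: x(1) cube_zero_simps K_simps fun_eq_iff) blast+
  qed (auto simp: closed, simp add: cube_zero_simps)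
  have "ring B"
    by (rule ringI[OF ab mon]) (auto simp: cube_zero_simps K_simps fun_eq_iff algebra_simps)
  then have "falgebra B"
    by (intro falgebra.intro falgebra_axioms.intro)
      (auto simp: cube_zero_simps K_simps fun_eq_iff algebra_simps)
  moreover have "x \<otimes>\<^bsub>B\<^esub> y \<in> degs B (m + n)" if "x \<in> degs B m" "y \<in> degs B n" for x y m n
  proof -
    obtain s u w s' u' w' where xy: "x = (s, u, w)" "y = (s', u', w')"
      by (cases x; cases y) auto
    have c: "x \<otimes>\<^bsub>B\<^esub> y \<in> carrier B"
      by (rule closed) (use that in \<open>simp_all add: xy cube_zero_simps(7)\<close>)
    have z: "m \<noteq> 0 \<Longrightarrow> s = (\<lambda>i. 0)" "m \<noteq> 1 \<Longrightarrow> u = (\<lambda>b. 0)" "m \<noteq> 2 \<Longrightarrow> w = (\<lambda>p. 0)"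
      "n \<noteq> 0 \<Longrightarrow> s' = (\<lambda>i. 0)" "n \<noteq> 1 \<Longrightarrow> u' = (\<lambda>b. 0)" "n \<noteq> 2 \<Longrightarrow> w' = (\<lambda>p. 0)"
      using that by (simp_all add: xy cube_zero_simps(7))
    have 0: "s = (\<lambda>i. 0) \<or> s' = (\<lambda>i. 0)" if "m + n \<noteq> 0"
    proof -
      have "m \<noteq> 0 \<or> n \<noteq> 0" using that by auto
      then show ?thesis using z by blast
    qed
    have 1: "(s = (\<lambda>i. 0) \<or> u' = (\<lambda>b. 0)) \<and> (u = (\<lambda>b. 0) \<or> s' = (\<lambda>i. 0))" if "m + n \<noteq> 1"
    proof -
      have "m \<noteq> 0 \<or> n \<noteq> 1" "m \<noteq> 1 \<or> n \<noteq> 0" using that by auto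
      then show ?thesis using z by blast
    qed
    have 2: "(s = (\<lambda>i. 0) \<or> w' = (\<lambda>p. 0)) \<and> (w = (\<lambda>p. 0) \<or> s' = (\<lambda>i. 0)) \<and> (u = (\<lambda>b. 0) \<or> u' = (\<lambda>b. 0))"
      if "m + n \<noteq> 2"
    proof -
      have "m \<noteq> 0 \<or> n \<noteq> 2" "m \<noteq> 2 \<or> n \<noteq> 0" "m \<noteq> 1 \<or> n \<noteq> 1" using that by auto
      then show ?thesis using z by blast
    qed
    show ?thesis
      using c unfolding xy cube_zero_simps(3,7)
    proof (intro conjI impI, goal_cases)
      case 2 then show ?case using 0 by auto
    next
      case 3 then show ?case using 1 by auto
    next
      case 4
      show ?case using 2[OF 4(2)] by (auto simp: K_simps)
    qed
  qed
  ultimately show ?thesis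
    by (intro graded_falgebra.intro graded_falgebra_axioms.intro)
      (auto simp: cube_zero_simps)
qed

lemma comp_finsum:
  assumes "f \<in> S \<rightarrow> carrier B"
  shows "fst (finsum B f S) i = (\<Sum>x\<in>S. fst (f x) i)"
    and "fst (snd (finsum B f S)) b = (\<Sum>x\<in>S. fst (snd (f x)) b)"
    and "snd (snd (finsum B f S)) p = (\<Sum>x\<in>S. snd (snd (f x)) p)"
proof -
  interpret B: graded_falgebra B by (rule cube_zero_graded)
  note af = additive_finsum[OF B.abelian_group_axioms _ _ assms]
  show "fst (finsum B f S) i = (\<Sum>x\<in>S. fst (f x) i)"
    by (rule af[of "\<lambda>x. fst x i"]) (auto simp: cube_zero_simps)
  show "fst (snd (finsum B f S)) b = (\<Sum>x\<in>S. fst (snd (f x)) b)"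
    by (rule af[of "\<lambda>x. fst (snd x) b"]) (auto simp: cube_zero_simps)
  show "snd (snd (finsum B f S)) p = (\<Sum>x\<in>S. snd (snd (f x)) p)"
    by (rule af[of "\<lambda>x. snd (snd x) p"]) (auto simp: cube_zero_simps)
qed

end

definition pair_support :: "(('a + 'm) list \<Rightarrow> 'f::field) \<Rightarrow> ('m \<times> 'm) set" where
  "pair_support x = {(u, v). x [Inr u, Inr v] \<noteq> 0}"

text \<open>
  The coordinates of a tensor of degree two, in terms of coordinates \<^term>\<open>co\<close> of the factors.
\<close>

definition coef2 :: "('m \<Rightarrow> 'd \<Rightarrow> 'f::field) \<Rightarrow> (('a + 'm) list \<Rightarrow> 'f) \<Rightarrow> 'd \<Rightarrow> 'd \<Rightarrow> 'f" where
  "coef2 co x b c = (\<Sum>(u, v)\<in>pair_support x. x [Inr u, Inr v] * co u b * co v c)"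

lemma two_letter_support:
  assumes "x \<in> two_letter_sums A M"
  shows "finite (pair_support x)"
    and "bij_betw (\<lambda>(u, v). [Inr u, Inr v]) (pair_support x) {w. x w \<noteq> 0}"
    and "(u, v) \<in> pair_support x \<Longrightarrow> u \<in> carrier M \<and> v \<in> carrier M"
proof -
  have x: "finite {w. x w \<noteq> 0}" "\<And>w. x w \<noteq> 0 \<Longrightarrow> set w \<subseteq> carrier A <+> carrier M"
    "\<And>w. x w \<noteq> 0 \<Longrightarrow> \<exists>u v. w = [Inr u, Inr v]"
    using assms by (auto simp: two_letter_sums_def free_algebra_simps(1))
  show b: "bij_betw (\<lambda>(u, v). [Inr u, Inr v]) (pair_support x) {w. x w \<noteq> 0}"
    using x(3) by (fastforce simp: bij_betw_def inj_on_def pair_support_def)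
  show "finite (pair_support x)" using bij_betw_finite[OF b] x(1) by simp
  show "(u, v) \<in> pair_support x \<Longrightarrow> u \<in> carrier M \<and> v \<in> carrier M"
    using x(2)[of "[Inr u, Inr v]"] by (auto simp: pair_support_def)
qed

lemma (in cube_zero) subst_two_letter:
  assumes "letter_map B A M g" "x \<in> two_letter_sums A M"
    and g: "\<And>m. m \<in> carrier M \<Longrightarrow> \<exists>w. g (Inr m) = (\<lambda>i. 0, co m, w)"
  shows "subst B g x = (\<lambda>i. 0, \<lambda>b. 0, \<lambda>p. \<Sum>b\<in>D. \<Sum>c\<in>D. \<kappa> p b c * coef2 co x b c)"
proof -
  interpret B: graded_falgebra B by (rule cube_zero_graded)
  interpret letter_map B A M g by fact
  note supp = two_letter_support[OF assms(2)]
  let ?f = "\<lambda>w. x w \<odot>\<^bsub>B\<^esub> word_prod B g w"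
  have x: "x \<in> carrier (free_algebra A M)" using assms(2) by (simp add: two_letter_sums_def)
  have cl: "?f \<in> {w. x w \<noteq> 0} \<rightarrow> carrier B"
    using x by (auto simp: free_algebra_simps(1) prod_closed)
  have val: "?f [Inr u, Inr v] = (\<lambda>i. 0, \<lambda>b. 0, \<lambda>p. x [Inr u, Inr v] * K p (co u) (co v))"
    if uv: "(u, v) \<in> pair_support x" for u v
  proof -
    obtain w w' where "g (Inr u) = (\<lambda>i. 0, co u, w)" "g (Inr v) = (\<lambda>i. 0, co v, w')"
      using g supp(3)[OF uv] by blast
    moreover have "word_prod B g [Inr u, Inr v] = g (Inr u) \<otimes>\<^bsub>B\<^esub> g (Inr v)"
      using supp(3)[OF uv] letter_closed by (simp add: B.r_one)
    ultimately show ?thesis by (simp add: cube_zero_simps del: foldr.simps list.map)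
  qed
  have re: "(\<Sum>w\<in>{w. x w \<noteq> 0}. h w) = (\<Sum>(u, v)\<in>pair_support x. h [Inr u, Inr v])" for h :: "_ \<Rightarrow> 'f"
    using sum.reindex_bij_betw[OF supp(2), of h] by (simp add: case_prod_unfold)
  have "fst (subst B g x) = (\<lambda>i. 0)" "fst (snd (subst B g x)) = (\<lambda>b. 0)"
    unfolding subst_def fun_eq_iff comp_finsum[OF cl] re
    by (auto intro!: sum.neutral simp: val simp del: foldr.simps list.map)
  moreover have "snd (snd (subst B g x)) p = (\<Sum>b\<in>D. \<Sum>c\<in>D. \<kappa> p b c * coef2 co x b c)" for p
  proof -
    have "snd (snd (subst B g x)) p = (\<Sum>(u, v)\<in>pair_support x. x [Inr u, Inr v] * K p (co u) (co v))"
      unfolding subst_def comp_finsum[OF cl] re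
      by (intro sum.cong refl) (auto simp: val simp del: foldr.simps list.map)
    also have "\<dots> = (\<Sum>q\<in>pair_support x. \<Sum>b\<in>D. \<Sum>c\<in>D.
        \<kappa> p b c * (x [Inr (fst q), Inr (snd q)] * co (fst q) b * co (snd q) c))"
      unfolding K_def by (intro sum.cong refl) (auto simp: sum_distrib_left mult_ac)
    also have "\<dots> = (\<Sum>b\<in>D. \<Sum>c\<in>D. \<Sum>q\<in>pair_support x.
        \<kappa> p b c * (x [Inr (fst q), Inr (snd q)] * co (fst q) b * co (snd q) c))"
      by (subst sum.swap, intro sum.cong refl, rule sum.swap)
    also have "\<dots> = (\<Sum>b\<in>D. \<Sum>c\<in>D. \<kappa> p b c * coef2 co x b c)"
      by (simp add: coef2_def sum_distrib_left case_prod_unfold)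
    finally show ?thesis .
  qed
  ultimately show ?thesis by (simp add: prod_eq_iff fun_eq_iff)
qed

section \<open>Bimodules with a basis of arrows\<close>

lemma fun_algebra_simps:
  "s \<in> carrier (fun_algebra X) \<longleftrightarrow> (\<forall>x. x \<notin> X \<longrightarrow> s x = 0)"
  "s \<oplus>\<^bsub>fun_algebra X\<^esub> t = (\<lambda>x. s x + t x)"
  "s \<otimes>\<^bsub>fun_algebra X\<^esub> t = (\<lambda>x. s x * t x)"
  "\<one>\<^bsub>fun_algebra X\<^esub> = (\<lambda>x. if x \<in> X then 1 else 0)"
  "\<zero>\<^bsub>fun_algebra X\<^esub> = (\<lambda>x. 0)"
  "c \<odot>\<^bsub>fun_algebra X\<^esub> s = (\<lambda>x. c * s x)"
  by (auto simp: fun_algebra_def)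

lemma fun_algebra_abelian: "abelian_group (fun_algebra X)"
proof (rule abelian_groupI)
  fix x :: "'a \<Rightarrow> 'b" assume "x \<in> carrier (fun_algebra X)"
  then show "\<exists>y\<in>carrier (fun_algebra X). y \<oplus>\<^bsub>fun_algebra X\<^esub> x = \<zero>\<^bsub>fun_algebra X\<^esub>"
    by (intro bexI[of _ "\<lambda>i. - x i"]) (auto simp: fun_algebra_simps)
qed (auto simp: fun_algebra_simps add_ac)

definition unit_fun :: "'d \<Rightarrow> 'd \<Rightarrow> 'f::field" where
  "unit_fun b = (\<lambda>c. if c = b then 1 else 0)"

lemma unit_fun_simps [simp]: "unit_fun b b = 1" "c \<noteq> b \<Longrightarrow> unit_fun b c = 0"
  by (simp_all add: unit_fun_def)

text \<open>
  A bimodule over the functions on a finite set of vertices with coordinates \<^term>\<open>co\<close> that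
  are indexed by a finite set of arrows, on which it acts through their ends.
\<close>

locale coord_bimod =
  fixes X :: "'v set" and D :: "'d set" and src tgt :: "'d \<Rightarrow> 'v"
    and M :: "('f::field, 'v \<Rightarrow> 'f, 'm) bimod" and co :: "'m \<Rightarrow> 'd \<Rightarrow> 'f"
  assumes finite_X: "finite X" and finite_D: "finite D"
    and src_in: "b \<in> D \<Longrightarrow> src b \<in> X" and tgt_in: "b \<in> D \<Longrightarrow> tgt b \<in> X"
    and co_bij: "bij_betw co (carrier M) {u. \<forall>b. b \<notin> D \<longrightarrow> u b = 0}"
    and zero_closed: "\<zero>\<^bsub>M\<^esub> \<in> carrier M"
    and add_closed: "m \<in> carrier M \<Longrightarrow> n \<in> carrier M \<Longrightarrow> m \<oplus>\<^bsub>M\<^esub> n \<in> carrier M"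
    and smult_closed: "m \<in> carrier M \<Longrightarrow> c \<odot>\<^bsub>M\<^esub> m \<in> carrier M"
    and lact_closed: "s \<in> carrier (fun_algebra X) \<Longrightarrow> m \<in> carrier M \<Longrightarrow> lact M s m \<in> carrier M"
    and ract_closed: "s \<in> carrier (fun_algebra X) \<Longrightarrow> m \<in> carrier M \<Longrightarrow> ract M m s \<in> carrier M"
    and co_zero: "co \<zero>\<^bsub>M\<^esub> b = 0"
    and co_add: "m \<in> carrier M \<Longrightarrow> n \<in> carrier M \<Longrightarrow> co (m \<oplus>\<^bsub>M\<^esub> n) b = co m b + co n b"
    and co_smult: "m \<in> carrier M \<Longrightarrow> co (c \<odot>\<^bsub>M\<^esub> m) b = c * co m b"
    and co_lact: "s \<in> carrier (fun_algebra X) \<Longrightarrow> m \<in> carrier M \<Longrightarrow> co (lact M s m) b = s (src b) * co m b"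
    and co_ract: "s \<in> carrier (fun_algebra X) \<Longrightarrow> m \<in> carrier M \<Longrightarrow> co (ract M m s) b = co m b * s (tgt b)"
begin

abbreviation "S \<equiv> fun_algebra X :: ('f, 'v \<Rightarrow> 'f) module"

sublocale tensor_data "fun_algebra X :: ('f, 'v \<Rightarrow> 'f) module" M
  by unfold_locales
    (auto simp: fun_algebra_simps add_closed smult_closed intro!: lact_closed ract_closed)

definition lift :: "('d \<Rightarrow> 'f) \<Rightarrow> 'm" where
  "lift u = inv_into (carrier M) co u"

abbreviation basis :: "'d \<Rightarrow> 'm" where "basis b \<equiv> lift (unit_fun b)"

lemma co_lift:
  assumes "\<And>b. b \<notin> D \<Longrightarrow> u b = 0" shows "lift u \<in> carrier M" "co (lift u) = u"
proof -
  have "u \<in> co ` carrier M" using assms co_bij by (auto simp: bij_betw_def)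
  then show "lift u \<in> carrier M" "co (lift u) = u"
    unfolding lift_def by (auto intro: inv_into_into f_inv_into_f)
qed

lemma basis:
  assumes "b \<in> D" shows "basis b \<in> carrier M" "co (basis b) = unit_fun b"
  using assms by (auto intro!: co_lift simp: unit_fun_def)

lemma co_inj: "m \<in> carrier M \<Longrightarrow> n \<in> carrier M \<Longrightarrow> (\<And>b. co m b = co n b) \<Longrightarrow> m = n"
  using inj_onD[OF bij_betw_imp_inj_on[OF co_bij], of m n] by (simp add: fun_eq_iff)

lemma co_outside: "m \<in> carrier M \<Longrightarrow> b \<notin> D \<Longrightarrow> co m b = 0"
  using co_bij by (auto simp: bij_betw_def)

lemma coord_induct [consumes 1, case_names zero add smult basis]:
  assumes "m \<in> carrier M"
    and "Q \<zero>\<^bsub>M\<^esub>" "\<And>m n. m \<in> carrier M \<Longrightarrow> n \<in> carrier M \<Longrightarrow> Q m \<Longrightarrow> Q n \<Longrightarrow> Q (m \<oplus>\<^bsub>M\<^esub> n)"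
    and "\<And>c m. m \<in> carrier M \<Longrightarrow> Q m \<Longrightarrow> Q (c \<odot>\<^bsub>M\<^esub> m)" "\<And>b. b \<in> D \<Longrightarrow> Q (basis b)"
  shows "Q m"
proof -
  have "Q m" if "finite T" "T \<subseteq> D" "m \<in> carrier M" "\<And>b. b \<notin> T \<Longrightarrow> co m b = 0" for T m
    using that
  proof (induction T arbitrary: m)
    case empty
    have "m = \<zero>\<^bsub>M\<^esub>" using empty by (intro co_inj zero_closed) (auto simp: co_zero)
    then show ?case using assms(2) by simp
  next
    case (insert b T)
    let ?u = "\<lambda>c. if c = b then 0 else co m c"
    have u: "lift ?u \<in> carrier M" "co (lift ?u) = ?u"
      by (intro co_lift; use insert in \<open>auto simp: co_outside\<close>)+
    have b: "basis b \<in> carrier M" "co (basis b) = unit_fun b" using basis insert by auto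
    have "m = (co m b \<odot>\<^bsub>M\<^esub> basis b) \<oplus>\<^bsub>M\<^esub> lift ?u"
      by (intro co_inj)
        (simp_all add: insert(5) b u add_closed smult_closed co_add co_smult, (simp add: unit_fun_def)?)
    moreover have "Q (lift ?u)" using insert by (intro insert(3)) (auto simp: u)
    moreover have "Q (co m b \<odot>\<^bsub>M\<^esub> basis b)" using insert assms(4,5) b by auto
    ultimately show ?case using assms(3) b(1) u(1) smult_closed by metis
  qed
  from this[OF finite_D subset_refl assms(1)] show ?thesis using co_outside assms(1) by blast
qed

lemma linear_expand:
  assumes "m \<in> carrier M"
    and add: "\<And>m n. m \<in> carrier M \<Longrightarrow> n \<in> carrier M \<Longrightarrow> h (m \<oplus>\<^bsub>M\<^esub> n) = h m + h n"
    and smult: "\<And>c m. m \<in> carrier M \<Longrightarrow> h (c \<odot>\<^bsub>M\<^esub> m) = c * (h m :: 'f)"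
  shows "h m = (\<Sum>b\<in>D. co m b * h (basis b))"
  using assms(1)
proof (induction m rule: coord_induct)
  case zero
  have "0 \<odot>\<^bsub>M\<^esub> \<zero>\<^bsub>M\<^esub> = \<zero>\<^bsub>M\<^esub>"
    by (rule co_inj) (simp_all add: smult_closed zero_closed co_smult co_zero)
  then have "h \<zero>\<^bsub>M\<^esub> = 0" using smult[OF zero_closed, of 0] by simp
  then show ?case by (simp add: co_zero)
next
  case (basis b)
  have "(\<Sum>c\<in>D. co (lift (unit_fun b)) c * h (lift (unit_fun c))) =
      (\<Sum>c\<in>D. if c = b then h (lift (unit_fun c)) else 0)"
    using basis
    by (intro sum.cong refl, case_tac "x = b") (simp_all add: coord_bimod.basis(2)[OF coord_bimod_axioms])
  then show ?case using basis finite_D by simp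
qed (simp_all add: add smult co_add co_smult distrib_right sum.distrib sum_distrib_left mult.assoc)

definition dco :: "('m \<Rightarrow> 'v \<Rightarrow> 'f) \<Rightarrow> 'd \<Rightarrow> 'f" where
  "dco f b = (if b \<in> D then f (basis b) (src b) else 0)"

lemma left_dual_iff:
  "f \<in> carrier (left_dual S M) \<longleftrightarrow> f \<in> carrier M \<rightarrow>\<^sub>E carrier S \<and>
     (\<forall>x\<in>carrier M. \<forall>y\<in>carrier M. f (x \<oplus>\<^bsub>M\<^esub> y) = (\<lambda>k. f x k + f y k)) \<and>
     (\<forall>c. \<forall>x\<in>carrier M. f (c \<odot>\<^bsub>M\<^esub> x) = (\<lambda>k. c * f x k)) \<and>
     (\<forall>s\<in>carrier S. \<forall>x\<in>carrier M. f (lact M s x) = (\<lambda>k. s k * f x k))"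
  by (auto simp: left_dual_def linear_maps_def fun_algebra_simps)

lemma left_dualD:
  assumes "f \<in> carrier (left_dual S M)"
  shows "m \<in> carrier M \<Longrightarrow> f m \<in> carrier S" "m \<notin> carrier M \<Longrightarrow> f m = undefined"
    and "m \<in> carrier M \<Longrightarrow> n \<in> carrier M \<Longrightarrow> f (m \<oplus>\<^bsub>M\<^esub> n) k = f m k + f n k"
    and "m \<in> carrier M \<Longrightarrow> f (c \<odot>\<^bsub>M\<^esub> m) k = c * f m k"
    and "s \<in> carrier S \<Longrightarrow> m \<in> carrier M \<Longrightarrow> f (lact M s m) k = s k * f m k"
proof -
  note f = assms[unfolded left_dual_iff]
  show "m \<in> carrier M \<Longrightarrow> f m \<in> carrier S" using f by (elim conjE) (rule PiE_mem)
  show "m \<notin> carrier M \<Longrightarrow> f m = undefined" using f by (elim conjE) (rule PiE_arb)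
  show "m \<in> carrier M \<Longrightarrow> n \<in> carrier M \<Longrightarrow> f (m \<oplus>\<^bsub>M\<^esub> n) k = f m k + f n k"
    "m \<in> carrier M \<Longrightarrow> f (c \<odot>\<^bsub>M\<^esub> m) k = c * f m k"
    "s \<in> carrier S \<Longrightarrow> m \<in> carrier M \<Longrightarrow> f (lact M s m) k = s k * f m k" using f by simp_all
qed

lemma left_dualI:
  assumes "\<And>m. m \<in> carrier M \<Longrightarrow> f m \<in> carrier S"
    and "\<And>m n k. m \<in> carrier M \<Longrightarrow> n \<in> carrier M \<Longrightarrow> f (m \<oplus>\<^bsub>M\<^esub> n) k = f m k + f n k"
    and "\<And>c m k. m \<in> carrier M \<Longrightarrow> f (c \<odot>\<^bsub>M\<^esub> m) k = c * f m k"
    and "\<And>s m k. s \<in> carrier S \<Longrightarrow> m \<in> carrier M \<Longrightarrow> f (lact M s m) k = s k * f m k"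
  shows "(\<lambda>m\<in>carrier M. f m) \<in> carrier (left_dual S M)"
  unfolding left_dual_iff
  using assms(1) by (simp add: fun_eq_iff assms(2-4) add_closed smult_closed lact_closed)

lemma left_dual_expand:
  assumes "f \<in> carrier (left_dual S M)" "m \<in> carrier M"
  shows "f m k = (\<Sum>b\<in>D. if src b = k then co m b * dco f b else 0)"
proof -
  note f = left_dualD[OF assms(1)]
  have b: "f (basis b) k = (if src b = k then dco f b else 0)" if bD: "b \<in> D" for b
  proof -
    have s: "unit_fun (src b) \<in> carrier S" using src_in[OF bD] by (auto simp: fun_algebra_simps unit_fun_def)
    have "lact M (unit_fun (src b)) (basis b) = basis b"
      using bD s basis[OF bD]
      by (intro co_inj lact_closed) (auto simp: co_lact unit_fun_def)
    then have "f (basis b) k = unit_fun (src b) k * f (basis b) k"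
      using f(5)[OF s basis(1)[OF bD], of k] by simp
    then show ?thesis using bD by (auto simp: unit_fun_def dco_def split: if_splits)
  qed
  have "f m k = (\<Sum>b\<in>D. co m b * f (basis b) k)"
    by (rule linear_expand[where h = "\<lambda>m. f m k", OF assms(2)]) (simp_all add: f)
  also have "\<dots> = (\<Sum>b\<in>D. if src b = k then co m b * dco f b else 0)"
    by (intro sum.cong refl) (simp add: b)
  finally show ?thesis .
qed

text \<open>
  The dual of an arrow runs backwards: acting on the argument of a functional from the right is
  acting on the functional from the left.
\<close>

lemma left_dual_coord: "coord_bimod X D tgt src (left_dual S M) dco"
proof -
  let ?W = "left_dual S M"
  have mk: "(\<lambda>m\<in>carrier M. \<lambda>k. \<Sum>b\<in>D. if src b = k then co m b * z b else 0) \<in> carrier ?W" for z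
    by (rule left_dualI)
      (auto simp: fun_algebra_simps src_in add_closed smult_closed lact_closed co_add co_smult co_lact
        sum.distrib[symmetric] sum_distrib_left distrib_right mult.assoc
        intro!: sum.cong sum.neutral)
  have dco_inj: "f = g" if "f \<in> carrier ?W" "g \<in> carrier ?W" "dco f = dco g" for f g
  proof
    fix m
    show "f m = g m"
    proof (cases "m \<in> carrier M")
      case True
      then show ?thesis using left_dual_expand[OF that(1) True] left_dual_expand[OF that(2) True] that(3)
        by (intro ext) (simp cong: if_cong)
    next
      case False
      then show ?thesis using left_dualD(2)[OF that(1)] left_dualD(2)[OF that(2)] by simp
    qed
  qed
  have val: "dco (\<lambda>m\<in>carrier M. \<lambda>k. \<Sum>b\<in>D. if src b = k then co m b * z b else 0) = z"
    if "\<And>b. b \<notin> D \<Longrightarrow> z b = 0" for z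
  proof
    fix b
    have "(\<Sum>c\<in>D. if src c = src b then co (basis b) c * z c else 0) = (\<Sum>c\<in>D. if c = b then z c else 0)"
      if "b \<in> D" using that by (intro sum.cong refl, case_tac "x = b") (simp_all add: basis)
    then show "dco (\<lambda>m\<in>carrier M. \<lambda>k. \<Sum>b\<in>D. if src b = k then co m b * z b else 0) b = z b"
      using that basis finite_D by (auto simp: dco_def)
  qed
  have bij: "bij_betw dco (carrier ?W) {u. \<forall>b. b \<notin> D \<longrightarrow> u b = 0}"
    unfolding bij_betw_def
  proof
    show "inj_on dco (carrier ?W)" using dco_inj by (auto intro: inj_onI)
    show "dco ` carrier ?W = {u. \<forall>b. b \<notin> D \<longrightarrow> u b = 0}"
    proof (intro equalityI subsetI)
      fix z :: "'d \<Rightarrow> 'f" assume "z \<in> {u. \<forall>b. b \<notin> D \<longrightarrow> u b = 0}"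
      then have z: "\<And>b. b \<notin> D \<Longrightarrow> z b = 0" by simp
      define f where "f = (\<lambda>m\<in>carrier M. \<lambda>k. \<Sum>b\<in>D. if src b = k then co m b * z b else 0)"
      have "dco f = z" unfolding f_def by (rule val) (rule z)
      moreover have "f \<in> carrier ?W" unfolding f_def by (rule mk)
      ultimately show "z \<in> dco ` carrier ?W" by (intro image_eqI[of z dco f]) simp_all
    next
      fix z assume "z \<in> dco ` carrier ?W"
      then obtain f where "z = dco f" by blast
      then show "z \<in> {u. \<forall>b. b \<notin> D \<longrightarrow> u b = 0}" by (simp add: dco_def)
    qed
  qed
  have W: "\<zero>\<^bsub>?W\<^esub> = (\<lambda>m\<in>carrier M. \<lambda>k. 0)"
    "\<And>f g. f \<oplus>\<^bsub>?W\<^esub> g = (\<lambda>m\<in>carrier M. \<lambda>k. f m k + g m k)"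
    "\<And>c f. c \<odot>\<^bsub>?W\<^esub> f = (\<lambda>m\<in>carrier M. \<lambda>k. c * f m k)"
    "\<And>s f. lact ?W s f = (\<lambda>m\<in>carrier M. f (ract M m s))"
    "\<And>s f. ract ?W f s = (\<lambda>m\<in>carrier M. \<lambda>k. f m k * s k)"
    by (simp_all add: left_dual_def fun_algebra_simps)
  have lr: "ract M (lact M t m) s = lact M t (ract M m s)"
    if "s \<in> carrier S" "t \<in> carrier S" "m \<in> carrier M" for s t m
    by (rule co_inj) (simp_all add: that ract_closed lact_closed co_ract co_lact mult.assoc)
  have radd: "ract M (m \<oplus>\<^bsub>M\<^esub> n) s = ract M m s \<oplus>\<^bsub>M\<^esub> ract M n s"
    if "s \<in> carrier S" "m \<in> carrier M" "n \<in> carrier M" for s m n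
    by (rule co_inj) (simp_all add: that ract_closed add_closed co_ract co_add distrib_right)
  have rsm: "ract M (c \<odot>\<^bsub>M\<^esub> m) s = c \<odot>\<^bsub>M\<^esub> ract M m s" if "s \<in> carrier S" "m \<in> carrier M" for s m c
    by (rule co_inj) (simp_all add: that ract_closed smult_closed co_ract co_smult)
  have rb: "ract M (basis b) s = s (tgt b) \<odot>\<^bsub>M\<^esub> basis b" if "s \<in> carrier S" "b \<in> D" for s b
    by (rule co_inj; (case_tac "ba = b")?)
      (use that in \<open>auto simp: basis ract_closed smult_closed co_ract co_smult\<close>)
  note fa = fun_algebra_simps
  show ?thesis
  proof (unfold_locales, goal_cases)
    case 6
    show ?case unfolding W by (rule left_dualI) (simp_all add: fa)
  next
    case (7 f g)
    show ?case unfolding W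
      by (rule left_dualI)
        (use left_dualD(1)[OF 7(1)] left_dualD(1)[OF 7(2)] in
          \<open>simp_all add: fa left_dualD(3-5)[OF 7(1)] left_dualD(3-5)[OF 7(2)] algebra_simps\<close>)
  next
    case (8 f c)
    show ?case unfolding W
      by (rule left_dualI)
        (use left_dualD(1)[OF 8] in \<open>simp_all add: fa left_dualD(3-5)[OF 8] algebra_simps\<close>)
  next
    case (9 s f)
    show ?case unfolding W
      by (rule left_dualI)
        (simp_all add: left_dualD[OF 9(2)] ract_closed 9(1) add_closed smult_closed lact_closed radd rsm lr)
  next
    case (10 s f)
    show ?case unfolding W
      by (rule left_dualI)
        (use left_dualD(1)[OF 10(2)] in \<open>simp_all add: fa left_dualD(3-5)[OF 10(2)] algebra_simps\<close>)
  next
    case (13 f c b)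
    then show ?case unfolding W by (simp add: dco_def basis)
  next
    case (14 s f b)
    then show ?case unfolding W
      by (simp add: dco_def basis rb left_dualD(4))
  next
    case (15 s f b)
    then show ?case unfolding W by (simp add: dco_def basis)
  qed (simp_all add: finite_X finite_D src_in tgt_in bij W dco_def basis)
qed

text \<open>
  Because of \<open>g (u f(v))\<close> the factors pair crosswise: the first factor on the dual side with the second
  factor on the other.
\<close>

lemma quadratic_pairing_coord:
  assumes \<xi>: "\<xi> \<in> two_letter_sums S (left_dual S M)" and x: "x \<in> two_letter_sums S M"
  shows "quadratic_pairing S M \<xi> x k =
    (\<Sum>b\<in>D. \<Sum>c\<in>D. if src b = k \<and> tgt b = src c then coef2 co x b c * coef2 dco \<xi> c b else 0)"
proof -
  note sx = two_letter_support[OF x]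
  note s\<xi> = two_letter_support[OF \<xi>]
  let ?W = "left_dual S M"
  let ?G = "\<lambda>(f, g, u, v). (\<xi> [Inr f, Inr g] * x [Inr u, Inr v]) \<odot>\<^bsub>S\<^esub> g (ract M u (f v))"
  let ?h = "\<lambda>((f, g), (u, v)). (f, g, u, v)"
  have set: "{(f, g, u, v). \<xi> [Inr f, Inr g] \<noteq> 0 \<and> x [Inr u, Inr v] \<noteq> 0} =
      ?h ` (pair_support \<xi> \<times> pair_support x)"
    by (force simp: pair_support_def)
  have inj: "inj_on ?h (pair_support \<xi> \<times> pair_support x)" by (auto simp: inj_on_def)
  have fS: "f v \<in> carrier S" if "f \<in> carrier ?W" "v \<in> carrier M" for f v
    using that by (rule left_dualD(1))
  have cl: "?G \<in> ?h ` (pair_support \<xi> \<times> pair_support x) \<rightarrow> carrier S"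
    using sx(3) s\<xi>(3) fS by (fastforce simp: A_smult ract_closed)
  have val: "g (ract M u (f v)) k =
      (\<Sum>b\<in>D. \<Sum>c\<in>D. if src b = k \<and> tgt b = src c then co u b * co v c * dco f c * dco g b else 0)"
    if "f \<in> carrier ?W" "g \<in> carrier ?W" "u \<in> carrier M" "v \<in> carrier M" for f g u v
  proof -
    have "g (ract M u (f v)) k = (\<Sum>b\<in>D. if src b = k then co (ract M u (f v)) b * dco g b else 0)"
      using that by (intro left_dual_expand ract_closed fS)
    also have "\<dots> = (\<Sum>b\<in>D. \<Sum>c\<in>D. if src b = k \<and> tgt b = src c then co u b * co v c * dco f c * dco g b else 0)"
      using that fS
      by (intro sum.cong refl)
        (auto simp: co_ract left_dual_expand[OF that(1,4)] sum_distrib_left sum_distrib_right mult_ac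
          intro!: sum.cong)
    finally show ?thesis .
  qed
  have "quadratic_pairing S M \<xi> x k = (\<Sum>q\<in>?h ` (pair_support \<xi> \<times> pair_support x). ?G q k)"
    unfolding quadratic_pairing_def set
    by (rule additive_finsum[OF fun_algebra_abelian _ _ cl]) (auto simp: fun_algebra_simps)
  also have "\<dots> = (\<Sum>q\<in>pair_support \<xi> \<times> pair_support x. ?G (?h q) k)"
    by (simp add: sum.reindex[OF inj])
  also have "\<dots> = (\<Sum>p\<in>pair_support \<xi>. \<Sum>q\<in>pair_support x. ?G (?h (p, q)) k)"
    by (rule sum.cartesian_product')
  also have "\<dots> = (\<Sum>p\<in>pair_support \<xi>. \<Sum>q\<in>pair_support x. \<Sum>b\<in>D. \<Sum>c\<in>D.
      if src b = k \<and> tgt b = src c then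
        (x [Inr (fst q), Inr (snd q)] * co (fst q) b * co (snd q) c) *
        (\<xi> [Inr (fst p), Inr (snd p)] * dco (fst p) c * dco (snd p) b) else 0)"
  proof (intro sum.cong refl)
    fix p q assume pq: "p \<in> pair_support \<xi>" "q \<in> pair_support x"
    obtain f g u v where [simp]: "p = (f, g)" "q = (u, v)" by (cases p; cases q) auto
    show "?G (?h (p, q)) k = (\<Sum>b\<in>D. \<Sum>c\<in>D. if src b = k \<and> tgt b = src c then
        (x [Inr (fst q), Inr (snd q)] * co (fst q) b * co (snd q) c) *
        (\<xi> [Inr (fst p), Inr (snd p)] * dco (fst p) c * dco (snd p) b) else 0)"
      using pq sx(3)[of u v] s\<xi>(3)[of f g]
      by (simp add: fun_algebra_simps val sum_distrib_left if_distrib[of "\<lambda>y. _ * y"] mult_ac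
          cong: if_cong)
  qed
  also have "\<dots> = (\<Sum>b\<in>D. \<Sum>c\<in>D. \<Sum>p\<in>pair_support \<xi>. \<Sum>q\<in>pair_support x.
      if src b = k \<and> tgt b = src c then
        (x [Inr (fst q), Inr (snd q)] * co (fst q) b * co (snd q) c) *
        (\<xi> [Inr (fst p), Inr (snd p)] * dco (fst p) c * dco (snd p) b) else 0)"
    by (simp only: sum.swap[of _ D "pair_support x"] sum.swap[of _ D "pair_support \<xi>"])
  also have "\<dots> = (\<Sum>b\<in>D. \<Sum>c\<in>D. if src b = k \<and> tgt b = src c then coef2 co x b c * coef2 dco \<xi> c b else 0)"
    by (intro sum.cong refl)
      (auto simp: coef2_def case_prod_unfold sum_distrib_left sum_distrib_right intro: sum.swap)
  finally show ?thesis .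
qed

end

lemma direct_sum_coord:
  fixes D :: "'d set" and D' :: "'e set"
    and M :: "('f::field, 'v \<Rightarrow> 'f, 'm) bimod" and M' :: "('f, 'v \<Rightarrow> 'f, 'n) bimod"
  assumes "coord_bimod X D src tgt M co" "coord_bimod X D' src' tgt' M' co'"
  shows "coord_bimod X (D <+> D') (case_sum src src') (case_sum tgt tgt') (direct_sum M M')
    (\<lambda>(m, n). case_sum (co m) (co' n))"
proof -
  interpret M: coord_bimod X D src tgt M co by fact
  interpret M': coord_bimod X D' src' tgt' M' co' by fact
  let ?co = "\<lambda>(m, n). case_sum (co m) (co' n)"
  have bij: "bij_betw ?co (carrier M \<times> carrier M') {u. \<forall>b. b \<notin> D <+> D' \<longrightarrow> u b = 0}"
    unfolding bij_betw_def
  proof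
    show "inj_on ?co (carrier M \<times> carrier M')"
    proof (rule inj_onI, clarify)
      fix m n m' n'
      assume mn: "m \<in> carrier M" "n \<in> carrier M'" "m' \<in> carrier M" "n' \<in> carrier M'"
        and eq: "case_sum (co m) (co' n) = case_sum (co m') (co' n')"
      from fun_cong[OF eq, of "Inl _"] fun_cong[OF eq, of "Inr _"]
      show "m = m' \<and> n = n'" using mn by (auto intro!: M.co_inj M'.co_inj)
    qed
    show "?co ` (carrier M \<times> carrier M') = {u. \<forall>b. b \<notin> D <+> D' \<longrightarrow> u b = 0}"
    proof (intro equalityI subsetI)
      fix u :: "'d + 'e \<Rightarrow> 'f" assume u: "u \<in> {u. \<forall>b. b \<notin> D <+> D' \<longrightarrow> u b = 0}"
      have 1: "M.lift (u \<circ> Inl) \<in> carrier M" "co (M.lift (u \<circ> Inl)) = u \<circ> Inl"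
        by (intro M.co_lift; use u in auto)+
      have 2: "M'.lift (u \<circ> Inr) \<in> carrier M'" "co' (M'.lift (u \<circ> Inr)) = u \<circ> Inr"
        by (intro M'.co_lift; use u in auto)+
      show "u \<in> ?co ` (carrier M \<times> carrier M')"
        by (rule image_eqI[of _ _ "(M.lift (u \<circ> Inl), M'.lift (u \<circ> Inr))"])
          (auto simp: 1 2 fun_eq_iff split: sum.splits)
    next
      fix u :: "'d + 'e \<Rightarrow> 'f" assume "u \<in> ?co ` (carrier M \<times> carrier M')"
      then show "u \<in> {u. \<forall>b. b \<notin> D <+> D' \<longrightarrow> u b = 0}"
        by (auto split: sum.splits) (metis M.co_outside, metis M'.co_outside)
    qed
  qed
  have S: "carrier (direct_sum M M') = carrier M \<times> carrier M'"
    "\<And>m n m' n'. (m, n) \<oplus>\<^bsub>direct_sum M M'\<^esub> (m', n') = (m \<oplus>\<^bsub>M\<^esub> m', n \<oplus>\<^bsub>M'\<^esub> n')"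
    "\<And>c m n. c \<odot>\<^bsub>direct_sum M M'\<^esub> (m, n) = (c \<odot>\<^bsub>M\<^esub> m, c \<odot>\<^bsub>M'\<^esub> n)"
    "\<And>a m n. lact (direct_sum M M') a (m, n) = (lact M a m, lact M' a n)"
    "\<And>a m n. ract (direct_sum M M') (m, n) a = (ract M m a, ract M' n a)"
    "\<zero>\<^bsub>direct_sum M M'\<^esub> = (\<zero>\<^bsub>M\<^esub>, \<zero>\<^bsub>M'\<^esub>)"
    by (simp_all add: direct_sum_def)
  show ?thesis
    by unfold_locales
      (auto simp: S bij M.finite_X M.finite_D M'.finite_D M.src_in M'.src_in M.tgt_in M'.tgt_in
        M.zero_closed M'.zero_closed M.add_closed M'.add_closed M.smult_closed M'.smult_closed
        M.lact_closed M'.lact_closed M.ract_closed M'.ract_closed M.co_zero M'.co_zero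
        M.co_add M'.co_add M.co_smult M'.co_smult M.co_lact M'.co_lact M.co_ract M'.co_ract
        split: sum.splits)
qed

text \<open>The homomorphism from a tensor algebra given by coordinates in degrees zero and one.\<close>

definition coord_letter :: "('m \<Rightarrow> 'd \<Rightarrow> 'f::field) \<Rightarrow> ('v \<Rightarrow> 'f) + 'm \<Rightarrow> ('v \<Rightarrow> 'f) \<times> ('d \<Rightarrow> 'f) \<times> ('p \<Rightarrow> 'f)" where
  "coord_letter co = case_sum (\<lambda>s. (s, \<lambda>b. 0, \<lambda>p. 0)) (\<lambda>m. (\<lambda>i. 0, co m, \<lambda>p. 0))"

locale coord_cube_zero =
  coord_bimod X D src tgt M co + cube_zero X D P src tgt lp rp \<kappa>
  for X :: "'v set" and D :: "'d set" and src tgt :: "'d \<Rightarrow> 'v"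
    and M :: "('f::field, 'v \<Rightarrow> 'f, 'm) bimod" and co :: "'m \<Rightarrow> 'd \<Rightarrow> 'f"
    and P :: "'p set" and lp rp :: "'p \<Rightarrow> 'v" and \<kappa> :: "'p \<Rightarrow> 'd \<Rightarrow> 'd \<Rightarrow> 'f"
begin

lemma coord_letter_map: "tensor_map S M B (coord_letter co)"
proof -
  interpret B: graded_falgebra B by (rule cube_zero_graded)
  show ?thesis
    by unfold_locales
      (auto simp: coord_letter_def cube_zero_simps K_simps fun_algebra_simps co_outside fun_eq_iff
        co_add co_smult co_lact co_ract)
qed

lemma subst_coord_letter:
  assumes "x \<in> two_letter_sums S M"
  shows "subst B (coord_letter co) x = (\<lambda>i. 0, \<lambda>b. 0, \<lambda>p. \<Sum>b\<in>D. \<Sum>c\<in>D. \<kappa> p b c * coef2 co x b c)"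
proof (rule subst_two_letter[OF _ assms])
  show "letter_map B S M (coord_letter co)"
    using coord_letter_map unfolding tensor_map_def by blast
qed (simp add: coord_letter_def)

end

lemma (in coord_bimod) coef2_subst:
  assumes "b \<in> D" "c \<in> D" "tgt b = src c"
  obtains g and E :: "('f, ('v \<Rightarrow> 'f) \<times> ('d \<Rightarrow> 'f) \<times> (unit \<Rightarrow> 'f)) graded_algebra"
  where "tensor_map S M E g" "\<And>x. x \<in> two_letter_sums S M \<Longrightarrow> snd (snd (subst E g x)) () = coef2 co x b c"
    and "abelian_group E" "\<And>y z. y \<in> carrier E \<Longrightarrow> z \<in> carrier E \<Longrightarrow> snd (snd (y \<oplus>\<^bsub>E\<^esub> z)) () = snd (snd y) () + snd (snd z) ()"
    and "snd (snd \<zero>\<^bsub>E\<^esub>) () = 0"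
proof -
  define \<kappa>' where "\<kappa>' = (\<lambda>_::unit. \<lambda>b' c'. if b' = b \<and> c' = c then 1 else 0 :: 'f)"
  interpret coord_cube_zero X D src tgt M co UNIV "\<lambda>_. src b" "\<lambda>_. tgt c" \<kappa>'
    by unfold_locales (use assms in \<open>auto simp: \<kappa>'_def finite_D src_in tgt_in split: if_splits\<close>)
  have "(\<Sum>b'\<in>D. \<Sum>c'\<in>D. \<kappa>' p b' c' * coef2 co x b' c') = coef2 co x b c" for x :: "(('v \<Rightarrow> 'f) + 'm) list \<Rightarrow> 'f" and p
  proof -
    have "(\<Sum>c'\<in>D. \<kappa>' p b' c' * coef2 co x b' c') = (if b' = b then coef2 co x b c else 0)" for b'
      using assms(2) finite_D by (simp add: \<kappa>'_def if_distrib[of "\<lambda>y. y * _"] sum.delta cong: if_cong)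
    then show ?thesis using assms(1) finite_D by simp
  qed
  then show thesis
    using that[OF coord_letter_map] subst_coord_letter cube_zero_graded
    by (auto simp: cube_zero_simps graded_falgebra_def falgebra_def ring_def)
qed

text \<open>
  Coordinates of composable pairs are well defined on tensors: mapping the tensor algebra to the
  algebra whose degree two part has a basis element for the given pair reads them off.
\<close>

lemma (in coord_bimod) coef2_tensor_ideal:
  assumes "b \<in> D" "c \<in> D" "tgt b = src c" "x \<in> two_letter_sums S M" "x \<in> tensor_ideal S M"
  shows "coef2 co x b c = 0"
  using coef2_subst[OF assms(1-3)] tensor_map.subst_tensor_ideal assms(4,5) by metis


section \<open>Quadratic duals\<close>

lemma hom_subst:
  assumes "letter_map B A M g" "falgebra C" "k \<in> alg_hom B C" "x \<in> carrier (free_algebra A M)"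
  shows "k (subst B g x) = subst C (\<lambda>l. k (g l)) x"
proof -
  interpret B: letter_map B A M g by fact
  interpret C: falgebra C by fact
  note kD = alg_homD[OF assms(3)]
  interpret C: letter_map C A M "\<lambda>l. k (g l)"
    by unfold_locales (simp add: kD B.letter_closed)
  note hB = alg_homD[OF B.subst_hom] and hC = alg_homD[OF C.subst_hom]
  have w: "k (word_prod B g w) = word_prod C (\<lambda>l. k (g l)) w"
    if "set w \<subseteq> carrier A <+> carrier M" for w
    using that by (induction w) (simp_all add: kD B.letter_closed B.prod_closed)
  show ?thesis using assms(4)
  proof (induction x rule: free_induct)
    case (word c w)
    then show ?case
      by (simp only: B.subst_smult_word C.subst_smult_word kD(5)[OF B.prod_closed] w)
  next
    case (add y z)
    then show ?case by (simp add: hB(1,2) hC(2) kD(2))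
  qed
qed

lemma trivial_kernel_inj:
  assumes "falgebra A" "falgebra B" "h \<in> alg_hom A B"
    and "\<And>x. x \<in> carrier A \<Longrightarrow> h x = \<zero>\<^bsub>B\<^esub> \<Longrightarrow> x = \<zero>\<^bsub>A\<^esub>"
  shows "inj_on h (carrier A)"
proof (rule inj_onI)
  interpret A: falgebra A by fact
  interpret B: falgebra B by fact
  note hD = alg_homD[OF assms(3)]
  fix x y assume xy: "x \<in> carrier A" "y \<in> carrier A" "h x = h y"
  have "h (x \<ominus>\<^bsub>A\<^esub> y) = h y \<oplus>\<^bsub>B\<^esub> (- 1) \<odot>\<^bsub>B\<^esub> h y"
    using xy by (simp add: A.minus_eq_smult hD)
  also have "\<dots> = \<zero>\<^bsub>B\<^esub>" using xy hD(1) by (simp add: B.smult_minus_one B.r_neg)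
  finally have "x \<ominus>\<^bsub>A\<^esub> y = \<zero>\<^bsub>A\<^esub>" using xy by (intro assms(4)) auto
  then show "x = y" using xy A.add.inv_solve_right[of "\<zero>\<^bsub>A\<^esub>" x y] by (simp add: A.minus_eq)
qed

lemma (in cube_zero) K_unit: "b \<in> D \<Longrightarrow> c \<in> D \<Longrightarrow> K p (unit_fun b) (unit_fun c) = \<kappa> p b c"
proof -
  assume bc: "b \<in> D" "c \<in> D"
  have "(\<Sum>c'\<in>D. \<kappa> p b' c' * unit_fun b b' * unit_fun c c') =
      (\<Sum>c'\<in>D. if c' = c then \<kappa> p b' c * unit_fun b b' else 0)" for b'
    by (intro sum.cong refl) (auto simp: unit_fun_def)
  then have "K p (unit_fun b) (unit_fun c) = (\<Sum>b'\<in>D. \<kappa> p b' c * unit_fun b b')"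
    unfolding K_def using bc(2) finite_D by simp
  also have "\<dots> = (\<Sum>b'\<in>D. if b' = b then \<kappa> p b c else 0)"
    by (intro sum.cong refl) (auto simp: unit_fun_def)
  also have "\<dots> = \<kappa> p b c" using bc(1) finite_D by simp
  finally show ?thesis .
qed

context coord_bimod
begin

abbreviation "W \<equiv> left_dual S M"
abbreviation "F \<equiv> free_algebra S W"
abbreviation "I \<equiv> tensor_ideal S W"
abbreviation "T \<equiv> tensor_algebra S W"

interpretation W: coord_bimod X D tgt src W dco by (rule left_dual_coord)

lemma quadratic_perp_carrier: "quadratic_perp S M R \<subseteq> carrier T"
  using graded_falgebra.degs_carrier[OF W.tensor_graded] by (auto simp: quadratic_perp_def)

lemma quadratic_ideal_ideal: "ideal (quadratic_ideal S M R) T"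
  unfolding quadratic_ideal_def
  by (rule ring.genideal_ideal[OF _ quadratic_perp_carrier])
    (rule falgebra.axioms(1)[OF graded_falgebra.axioms(1)[OF W.tensor_graded]])

lemma quadratic_perp_ideal: "quadratic_perp S M R \<subseteq> quadratic_ideal S M R"
  unfolding quadratic_ideal_def
  by (rule ring.genideal_self[OF _ quadratic_perp_carrier])
    (rule falgebra.axioms(1)[OF graded_falgebra.axioms(1)[OF W.tensor_graded]])

lemma quadratic_dual_graded: "graded_falgebra (quadratic_dual S M R)"
  unfolding quadratic_dual_def by (rule quot_graded[OF W.tensor_graded quadratic_ideal_ideal])

lemmas quadratic_dual_simps =
  quot_simps[OF graded_falgebra.axioms(1)[OF W.tensor_graded] quadratic_ideal_ideal, folded quadratic_dual_def]
  quot_smult[OF graded_falgebra.axioms(1)[OF W.tensor_graded] quadratic_ideal_ideal, folded quadratic_dual_def]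

lemma quadratic_proj:
  "(\<lambda>Y. quadratic_ideal S M R +>\<^bsub>T\<^esub> Y) \<in> alg_hom T (quadratic_dual S M R)"
  unfolding quadratic_dual_def
  by (rule quot_proj_hom[OF graded_falgebra.axioms(1)[OF W.tensor_graded] quadratic_ideal_ideal])

lemma dual_letter_map: "tensor_map S W (quadratic_dual S M R) (dual_letter S M R)"
proof -
  have "dual_letter S M R = (\<lambda>l. quadratic_ideal S M R +>\<^bsub>T\<^esub> tensor_letter S W l)"
    by (simp add: dual_letter_def fun_eq_iff)
  then show ?thesis
    using tensor_map_comp[OF W.tensor_letter_map graded_falgebra.axioms(1)[OF quadratic_dual_graded]
        quadratic_proj] by simp
qed

lemma dual_coset_subst:
  assumes "x \<in> carrier F"
  shows "subst (quadratic_dual S M R) (dual_letter S M R) x =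
    quadratic_ideal S M R +>\<^bsub>T\<^esub> (I +>\<^bsub>F\<^esub> x)"
proof -
  have "letter_map T S W (tensor_letter S W)"
    using W.tensor_letter_map unfolding tensor_map_def by blast
  from hom_subst[OF this graded_falgebra.axioms(1)[OF quadratic_dual_graded] quadratic_proj assms]
  show ?thesis
    unfolding W.tensor_coset_subst[OF assms] by (simp add: dual_letter_def[abs_def])
qed

lemma quadratic_dual_cases:
  assumes "z \<in> carrier (quadratic_dual S M R)"
  obtains x where "x \<in> carrier F" "z = subst (quadratic_dual S M R) (dual_letter S M R) x"
  using assms dual_coset_subst
  by (auto simp: quadratic_dual_simps W.tensor_simps)

text \<open>The classes of letters generate. Nothing is assumed of the target.\<close>

lemma quadratic_dual_unique:
  assumes "h \<in> alg_hom (quadratic_dual S M R) C" "k \<in> alg_hom (quadratic_dual S M R) C"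
    and eq: "\<And>l. l \<in> carrier S <+> carrier W \<Longrightarrow> h (dual_letter S M R l) = k (dual_letter S M R l)"
    and "z \<in> carrier (quadratic_dual S M R)"
  shows "h z = k z"
proof -
  interpret L: tensor_map S W "quadratic_dual S M R" "dual_letter S M R"
    by (rule dual_letter_map)
  note hD = alg_homD[OF assms(1)] and kD = alg_homD[OF assms(2)]
  have w: "h (word_prod (quadratic_dual S M R) (dual_letter S M R) w) =
      k (word_prod (quadratic_dual S M R) (dual_letter S M R) w)"
    if "set w \<subseteq> carrier S <+> carrier W" for w
    using that by (induction w) (simp_all add: hD kD L.letter_closed L.prod_closed eq)
  obtain x where x: "x \<in> carrier F" "z = subst (quadratic_dual S M R) (dual_letter S M R) x"
    by (rule quadratic_dual_cases[OF assms(4)])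
  note s = alg_homD[OF L.subst_hom]
  show ?thesis unfolding x(2) using x(1)
  proof (induction x rule: free_induct)
    case (word c w)
    then show ?case
      by (simp only: L.subst_smult_word hD(5)[OF L.prod_closed] kD(5)[OF L.prod_closed] w)
  next
    case (add y z)
    then show ?case by (simp add: s(1,2) hD(2) kD(2))
  qed
qed

lemma degree_two_representative:
  assumes "Y \<in> degs T 2"
  obtains \<xi> where "\<xi> \<in> two_letter_sums S W" "Y = I +>\<^bsub>F\<^esub> \<xi>" "\<xi> \<in> Y"
proof -
  obtain x where x: "x \<in> degs F 2" "Y = I +>\<^bsub>F\<^esub> x" using assms by (auto simp: W.tensor_simps)
  obtain \<xi> where \<xi>: "\<xi> \<in> two_letter_sums S W" "Y = I +>\<^bsub>F\<^esub> \<xi>"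
    using W.two_letter_representative[OF x(1)] x(2) by auto
  interpret I: ideal I F by (rule W.tensor_ideal_ideal)
  have "\<xi> \<in> Y" using \<xi> I.a_rcos_self by (simp add: two_letter_sums_def)
  with \<xi> show thesis using that by blast
qed

text \<open>
  Killing the sums of two letters whose classes are orthogonal to the relations is enough, since every class of
  degree two contains such a sum.
\<close>

lemma quadratic_dual_hom:
  assumes "tensor_map S W E g"
    and kills: "\<And>\<xi>. \<xi> \<in> two_letter_sums S W \<Longrightarrow> I +>\<^bsub>F\<^esub> \<xi> \<in> quadratic_perp S M R \<Longrightarrow> subst E g \<xi> = \<zero>\<^bsub>E\<^esub>"
  obtains h where "h \<in> alg_hom (quadratic_dual S M R) E"
    and "\<And>x. x \<in> carrier F \<Longrightarrow> h (quadratic_ideal S M R +>\<^bsub>T\<^esub> (I +>\<^bsub>F\<^esub> x)) = subst E g x"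
    and "\<And>l. l \<in> carrier S <+> carrier W \<Longrightarrow> h (dual_letter S M R l) = g l"
proof -
  interpret E: tensor_map S W E g by fact
  interpret T: graded_falgebra T by (rule W.tensor_graded)
  obtain h where h: "h \<in> alg_hom T E" "\<And>x. x \<in> carrier F \<Longrightarrow> h (I +>\<^bsub>F\<^esub> x) = subst E g x"
    "\<And>l. l \<in> carrier S <+> carrier W \<Longrightarrow> h (tensor_letter S W l) = g l"
    by (rule E.tensor_hom) blast
  have perp: "h Y = \<zero>\<^bsub>E\<^esub>" if Y: "Y \<in> quadratic_perp S M R" for Y
  proof -
    have "Y \<in> degs T 2" using Y by (simp add: quadratic_perp_def)
    then obtain \<xi> where \<xi>: "\<xi> \<in> two_letter_sums S W" "Y = I +>\<^bsub>F\<^esub> \<xi>" by (rule degree_two_representative)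
    then show ?thesis using Y kills h(2) by (simp add: two_letter_sums_def)
  qed
  have "quadratic_ideal S M R \<subseteq> {Y \<in> carrier T. h Y = \<zero>\<^bsub>E\<^esub>}"
    unfolding quadratic_ideal_def
    by (rule T.genideal_minimal[OF kernel_ideal[OF T.falgebra_axioms E.B.falgebra_axioms h(1)]])
      (use perp quadratic_perp_carrier in auto)
  then have "h Y = \<zero>\<^bsub>E\<^esub>" if "Y \<in> quadratic_ideal S M R" for Y using that by auto
  then obtain h' where h': "h' \<in> alg_hom (quadratic_dual S M R) E"
    "\<And>Y. Y \<in> carrier T \<Longrightarrow> h' (quadratic_ideal S M R +>\<^bsub>T\<^esub> Y) = h Y"
    using quot_lift[OF T.falgebra_axioms quadratic_ideal_ideal E.B.falgebra_axioms h(1)]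
    unfolding quadratic_dual_def by blast
  interpret L: tensor_map S W T "tensor_letter S W" by (rule W.tensor_letter_map)
  have "h' (dual_letter S M R l) = g l" if "l \<in> carrier S <+> carrier W" for l
    using that h(3) h'(2) L.letter_closed by (simp add: dual_letter_def)
  moreover have "h' (quadratic_ideal S M R +>\<^bsub>T\<^esub> (I +>\<^bsub>F\<^esub> x)) = subst E g x" if "x \<in> carrier F" for x
    using that h(2) h'(2) by (simp add: W.tensor_simps)
  ultimately show thesis using that h'(1) by blast
qed

end

text \<open>
  A quadratic dual whose relations are exactly the quadratic relations of an algebra
  concentrated in degrees zero to two.
\<close>

locale quadratic_presentation =
  U: coord_bimod X D src tgt M co + cube_zero X D P tgt src lp rp \<kappa>
  for X :: "'v set" and D :: "'d set" and src tgt :: "'d \<Rightarrow> 'v"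
    and M :: "('f::field, 'v \<Rightarrow> 'f, 'm) bimod" and co :: "'m \<Rightarrow> 'd \<Rightarrow> 'f"
    and P :: "'p set" and lp rp :: "'p \<Rightarrow> 'v" and \<kappa> :: "'p \<Rightarrow> 'd \<Rightarrow> 'd \<Rightarrow> 'f" +
  fixes R :: "((('v \<Rightarrow> 'f) + 'm) list \<Rightarrow> 'f) set set"
  assumes perp_iff: "Y \<in> degs U.T 2 \<Longrightarrow> Y \<in> quadratic_perp U.S M R \<longleftrightarrow>
    (\<forall>\<xi> \<in> Y \<inter> two_letter_sums U.S U.W. subst B (coord_letter U.dco) \<xi> = \<zero>\<^bsub>B\<^esub>)"
begin

sublocale W: coord_cube_zero X D tgt src U.W U.dco P lp rp \<kappa>
  using U.left_dual_coord cube_zero_axioms by (rule coord_cube_zero.intro)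

abbreviation "QD \<equiv> quadratic_dual U.S M R"
abbreviation "dl \<equiv> dual_letter U.S M R"
abbreviation "J \<equiv> quadratic_ideal U.S M R"

sublocale L: tensor_map U.S U.W QD dl by (rule U.dual_letter_map)

lemma cube_hom:
  obtains h where "h \<in> graded_hom QD B"
    and "\<And>x. x \<in> carrier U.F \<Longrightarrow> h (J +>\<^bsub>U.T\<^esub> (U.I +>\<^bsub>U.F\<^esub> x)) = subst B (coord_letter U.dco) x"
    and "\<And>l. l \<in> carrier U.S <+> carrier U.W \<Longrightarrow> h (dl l) = coord_letter U.dco l"
proof -
  interpret F: graded_falgebra U.F by (rule free_graded)
  interpret I: ideal U.I U.F by (rule W.tensor_ideal_ideal)
  have "subst B (coord_letter U.dco) \<xi> = \<zero>\<^bsub>B\<^esub>"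
    if \<xi>: "\<xi> \<in> two_letter_sums U.S U.W" "U.I +>\<^bsub>U.F\<^esub> \<xi> \<in> quadratic_perp U.S M R" for \<xi>
  proof -
    have d: "U.I +>\<^bsub>U.F\<^esub> \<xi> \<in> degs U.T 2" using \<xi>(1) two_letter_degs by (auto simp: W.tensor_simps)
    have "\<xi> \<in> U.I +>\<^bsub>U.F\<^esub> \<xi>" using \<xi>(1) I.a_rcos_self by (simp add: two_letter_sums_def)
    then show ?thesis using perp_iff[OF d] \<xi> by blast
  qed
  from U.quadratic_dual_hom[OF W.coord_letter_map this]
  obtain h where h: "h \<in> alg_hom QD B"
    "\<And>x. x \<in> carrier U.F \<Longrightarrow> h (J +>\<^bsub>U.T\<^esub> (U.I +>\<^bsub>U.F\<^esub> x)) = subst B (coord_letter U.dco) x"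
    "\<And>l. l \<in> carrier U.S <+> carrier U.W \<Longrightarrow> h (dl l) = coord_letter U.dco l"
    by blast
  have deg: "coord_letter U.dco (Inl a) \<in> degs B 0" if "a \<in> carrier U.S" for a
    using that by (simp add: coord_letter_def cube_zero_simps fun_algebra_simps)
  have deg': "coord_letter U.dco (Inr m) \<in> degs B 1" if "m \<in> carrier U.W" for m
    using that by (simp add: coord_letter_def cube_zero_simps W.co_outside)
  have "h ` degs QD n \<subseteq> degs B n" for n
  proof (rule image_subsetI)
    fix z assume "z \<in> degs QD n"
    then obtain x where x: "x \<in> degs U.F n" "z = J +>\<^bsub>U.T\<^esub> (U.I +>\<^bsub>U.F\<^esub> x)"
      by (auto simp: U.quadratic_dual_simps W.tensor_simps)
    then show "h z \<in> degs B n"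
      using subst_degs[OF cube_zero_graded deg deg' x(1)] h(2) F.degs_carrier by simp
  qed
  with h(1) have "h \<in> graded_hom QD B" by (simp add: graded_hom_iff)
  then show thesis using h(2,3) by (rule that)
qed

lemma letter_zero: "dl (Inl \<zero>\<^bsub>U.S\<^esub>) = \<zero>\<^bsub>QD\<^esub>" "dl (Inr \<zero>\<^bsub>U.W\<^esub>) = \<zero>\<^bsub>QD\<^esub>"
proof -
  have "\<zero>\<^bsub>U.S\<^esub> \<in> carrier U.S" "\<zero>\<^bsub>U.S\<^esub> = 0 \<odot>\<^bsub>U.S\<^esub> \<zero>\<^bsub>U.S\<^esub>" by (simp_all add: fun_algebra_simps)
  then show "dl (Inl \<zero>\<^bsub>U.S\<^esub>) = \<zero>\<^bsub>QD\<^esub>"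
    using L.g_smult[of "\<zero>\<^bsub>U.S\<^esub>" 0] by (simp add: L.g_closed)
  have "\<zero>\<^bsub>U.W\<^esub> = 0 \<odot>\<^bsub>U.W\<^esub> \<zero>\<^bsub>U.W\<^esub>"
    by (rule W.co_inj) (simp_all add: W.zero_closed W.M_smult W.co_zero W.co_smult)
  then show "dl (Inr \<zero>\<^bsub>U.W\<^esub>) = \<zero>\<^bsub>QD\<^esub>"
    using L.g_Msmult[OF W.zero_closed, of 0] L.g_closed(2)[OF W.zero_closed] by simp
qed

text \<open>When products of three letters vanish, degrees above two are zero.\<close>

lemma decomposition:
  assumes triple: "\<And>f g h. f \<in> carrier U.W \<Longrightarrow> g \<in> carrier U.W \<Longrightarrow> h \<in> carrier U.W \<Longrightarrow>
      dl (Inr f) \<otimes>\<^bsub>QD\<^esub> (dl (Inr g) \<otimes>\<^bsub>QD\<^esub> dl (Inr h)) = \<zero>\<^bsub>QD\<^esub>"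
    and "z \<in> carrier QD"
  shows "\<exists>s\<in>carrier U.S. \<exists>f\<in>carrier U.W. \<exists>Y\<in>degs U.T 2.
    z = dl (Inl s) \<oplus>\<^bsub>QD\<^esub> (dl (Inr f) \<oplus>\<^bsub>QD\<^esub> (J +>\<^bsub>U.T\<^esub> Y))"
proof -
  interpret QD: graded_falgebra QD by (rule U.quadratic_dual_graded)
  interpret T: graded_falgebra U.T by (rule W.tensor_graded)
  note hD = alg_homD[OF L.subst_hom]
  note pD = alg_homD[OF U.quadratic_proj]
  have S0: "\<zero>\<^bsub>U.S\<^esub> \<in> carrier U.S" by (simp add: fun_algebra_simps)
  have p0: "J +>\<^bsub>U.T\<^esub> \<zero>\<^bsub>U.T\<^esub> = \<zero>\<^bsub>QD\<^esub>" by (simp add: U.quadratic_dual_simps(5))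
  obtain x where x: "x \<in> carrier U.F" "z = subst QD dl x"
    by (rule U.quadratic_dual_cases[OF assms(2)])
  show ?thesis unfolding x(2) using x(1)
  proof (induction x rule: free_induct)
    case (word c w)
    let ?n = "length (filter (\<lambda>l. \<not> isl l) w)"
    have sw: "subst QD dl (c \<odot>\<^bsub>U.F\<^esub> word w) = c \<odot>\<^bsub>QD\<^esub> word_prod QD dl w"
      by (rule L.subst_smult_word[OF word(1)])
    consider "?n = 0" | "?n = 1" | "?n = 2" | "3 \<le> ?n" by linarith
    then show ?case
    proof cases
      case 1
      then obtain a where a: "a \<in> carrier U.S" "word_prod QD dl w = dl (Inl a)"
        using L.word_prod_absorb(1)[OF word(1)] by blast
      show ?thesis
        by (intro bexI[of _ "c \<odot>\<^bsub>U.S\<^esub> a"] bexI[of _ "\<zero>\<^bsub>U.W\<^esub>"] bexI[of _ "\<zero>\<^bsub>U.T\<^esub>"])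
          (simp_all add: sw a letter_zero p0 L.g_smult W.A_smult W.zero_closed T.degs_zero)
    next
      case 2
      then obtain a where a: "a \<in> carrier U.W" "word_prod QD dl w = dl (Inr a)"
        using L.word_prod_absorb(2)[OF word(1)] by blast
      show ?thesis
        by (intro bexI[of _ "\<zero>\<^bsub>U.S\<^esub>"] bexI[of _ "c \<odot>\<^bsub>U.W\<^esub> a"] bexI[of _ "\<zero>\<^bsub>U.T\<^esub>"])
          (simp_all add: sw a letter_zero p0 L.g_Msmult W.M_smult S0 T.degs_zero)
    next
      case 3
      have Fc: "word w \<in> carrier U.F" using word(1) by simp
      have "word w \<in> degs U.F 2" unfolding free_algebra_simps(7) using 3 Fc
        by (intro conjI) (simp, simp add: word_def)
      then have Y: "U.I +>\<^bsub>U.F\<^esub> word w \<in> degs U.T 2" by (simp add: W.tensor_simps)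
      have "subst QD dl (c \<odot>\<^bsub>U.F\<^esub> word w) = c \<odot>\<^bsub>QD\<^esub> (J +>\<^bsub>U.T\<^esub> (U.I +>\<^bsub>U.F\<^esub> word w))"
        using hD(5)[OF Fc] U.dual_coset_subst[OF Fc] by simp
      also have "\<dots> = J +>\<^bsub>U.T\<^esub> (c \<odot>\<^bsub>U.T\<^esub> (U.I +>\<^bsub>U.F\<^esub> word w))"
        using pD(5)[OF T.degs_carrier[OF Y]] by simp
      finally show ?thesis
        using pD(1)[OF T.smult_closed[OF T.degs_carrier[OF Y]]]
        by (intro bexI[of _ "\<zero>\<^bsub>U.S\<^esub>"] bexI[of _ "\<zero>\<^bsub>U.W\<^esub>"] bexI[of _ "c \<odot>\<^bsub>U.T\<^esub> (U.I +>\<^bsub>U.F\<^esub> word w)"])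
          (simp_all add: letter_zero W.zero_closed S0 T.degs_smult Y)
    next
      case 4
      have "word_prod QD dl w = \<zero>\<^bsub>QD\<^esub>"
        by (rule L.word_prod_absorb(4)[OF word(1) 4]) (rule triple)
      then show ?thesis
        by (intro bexI[of _ "\<zero>\<^bsub>U.S\<^esub>"] bexI[of _ "\<zero>\<^bsub>U.W\<^esub>"] bexI[of _ "\<zero>\<^bsub>U.T\<^esub>"])
          (simp_all add: sw letter_zero p0 W.zero_closed S0 T.degs_zero)
    qed
  next
    case (add y z)
    then obtain s f Y s' f' Y' where *: "s \<in> carrier U.S" "f \<in> carrier U.W" "Y \<in> degs U.T 2"
      "subst QD dl y = dl (Inl s) \<oplus>\<^bsub>QD\<^esub> (dl (Inr f) \<oplus>\<^bsub>QD\<^esub> (J +>\<^bsub>U.T\<^esub> Y))"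
      "s' \<in> carrier U.S" "f' \<in> carrier U.W" "Y' \<in> degs U.T 2"
      "subst QD dl z = dl (Inl s') \<oplus>\<^bsub>QD\<^esub> (dl (Inr f') \<oplus>\<^bsub>QD\<^esub> (J +>\<^bsub>U.T\<^esub> Y'))"
      by blast
    have YY: "Y \<in> carrier U.T" "Y' \<in> carrier U.T" using *(3,7) T.degs_carrier by blast+
    have "subst QD dl (y \<oplus>\<^bsub>U.F\<^esub> z) =
        dl (Inl (s \<oplus>\<^bsub>U.S\<^esub> s')) \<oplus>\<^bsub>QD\<^esub> (dl (Inr (f \<oplus>\<^bsub>U.W\<^esub> f')) \<oplus>\<^bsub>QD\<^esub> (J +>\<^bsub>U.T\<^esub> (Y \<oplus>\<^bsub>U.T\<^esub> Y')))"
      using add(1,2) * YY pD(1)[OF YY(1)] pD(1)[OF YY(2)]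
      by (simp add: hD(2) L.g_add L.g_Madd pD(2) L.B.a_ac)
    then show ?case
      using * by (intro bexI[of _ "s \<oplus>\<^bsub>U.S\<^esub> s'"] bexI[of _ "f \<oplus>\<^bsub>U.W\<^esub> f'"] bexI[of _ "Y \<oplus>\<^bsub>U.T\<^esub> Y'"])
        (simp_all add: W.A_add W.M_add T.degs_add)
  qed
qed

text \<open>
  By \<open>decomposition\<close> an element is a sum of parts of degrees zero, one and two, which are
  detected separately: the first two by coordinates, the last one because a class of degree two that goes to zero
  is orthogonal to the relations. The condition on \<open>P\<close> says that each basis element of degree two
  is a multiple of a product, and gives surjectivity.
\<close>

lemma cube_iso:
  assumes triple: "\<And>f g h. f \<in> carrier U.W \<Longrightarrow> g \<in> carrier U.W \<Longrightarrow> h \<in> carrier U.W \<Longrightarrow>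
      dl (Inr f) \<otimes>\<^bsub>QD\<^esub> (dl (Inr g) \<otimes>\<^bsub>QD\<^esub> dl (Inr h)) = \<zero>\<^bsub>QD\<^esub>"
    and P: "finite P" "\<And>p. p \<in> P \<Longrightarrow> \<exists>b\<in>D. \<exists>c\<in>D. \<exists>r. r \<noteq> 0 \<and> (\<forall>q. \<kappa> q b c = (if q = p then r else 0))"
    and h: "h \<in> graded_hom QD B"
      "\<And>x. x \<in> carrier U.F \<Longrightarrow> h (J +>\<^bsub>U.T\<^esub> (U.I +>\<^bsub>U.F\<^esub> x)) = subst B (coord_letter U.dco) x"
      "\<And>l. l \<in> carrier U.S <+> carrier U.W \<Longrightarrow> h (dl l) = coord_letter U.dco l"
  shows "h \<in> graded_iso QD B"
proof -
  interpret QD: graded_falgebra QD by (rule U.quadratic_dual_graded)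
  interpret T: graded_falgebra U.T by (rule W.tensor_graded)
  interpret B: graded_falgebra B by (rule cube_zero_graded)
  have hom: "h \<in> alg_hom QD B" and deg: "\<And>z n. z \<in> degs QD n \<Longrightarrow> h z \<in> degs B n"
    using h(1) by (auto simp: graded_hom_iff)
  note hD = alg_homD[OF hom]
  note pD = alg_homD[OF U.quadratic_proj]
  have hl: "s \<in> carrier U.S \<Longrightarrow> h (dl (Inl s)) = (s, \<lambda>b. 0, \<lambda>p. 0)"
    "f \<in> carrier U.W \<Longrightarrow> h (dl (Inr f)) = (\<lambda>i. 0, U.dco f, \<lambda>p. 0)" for s f
    using h(3) by (simp_all add: coord_letter_def)
  have dldeg: "s \<in> carrier U.S \<Longrightarrow> dl (Inl s) \<in> degs QD 0"
    "f \<in> carrier U.W \<Longrightarrow> dl (Inr f) \<in> degs QD 1" for s f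
    unfolding dual_letter_def tensor_letter_def U.quadratic_dual_simps(6) W.tensor_simps(6)
    by (auto intro!: imageI simp: free_algebra_simps(7)) (auto simp: word_def split: if_splits)
  have ker: "z = \<zero>\<^bsub>QD\<^esub>" if z: "z \<in> carrier QD" "h z = \<zero>\<^bsub>B\<^esub>" for z
  proof -
    obtain s f Y where *: "s \<in> carrier U.S" "f \<in> carrier U.W" "Y \<in> degs U.T 2"
      "z = dl (Inl s) \<oplus>\<^bsub>QD\<^esub> (dl (Inr f) \<oplus>\<^bsub>QD\<^esub> (J +>\<^bsub>U.T\<^esub> Y))"
      using decomposition[OF triple z(1)] by blast
    have Yc: "Y \<in> carrier U.T" using *(3) T.degs_carrier by blast
    obtain \<xi> where \<xi>: "\<xi> \<in> two_letter_sums U.S U.W" "Y = U.I +>\<^bsub>U.F\<^esub> \<xi>" "\<xi> \<in> Y"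
      by (rule U.degree_two_representative[OF *(3)])
    have pi: "J +>\<^bsub>U.T\<^esub> Y \<in> carrier QD" using pD(1)[OF Yc] .
    have hY: "h (J +>\<^bsub>U.T\<^esub> Y) = subst B (coord_letter U.dco) \<xi>"
      using \<xi> h(2) by (simp add: two_letter_sums_def)
    obtain w where w: "h (J +>\<^bsub>U.T\<^esub> Y) = (\<lambda>i. 0, \<lambda>b. 0, w)"
      unfolding hY W.subst_coord_letter[OF \<xi>(1)] by blast
    have "h z = (s, U.dco f, w)"
      using * pi by (simp add: hD hl w cube_zero_simps)
    with z(2) have eqs: "s = (\<lambda>i. 0)" "U.dco f = (\<lambda>b. 0)" "w = (\<lambda>p. 0)"
      by (simp_all add: cube_zero_simps(5))
    have "s = \<zero>\<^bsub>U.S\<^esub>" using eqs by (simp add: fun_algebra_simps)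
    moreover have "f = \<zero>\<^bsub>U.W\<^esub>"
      using eqs(2) *(2) by (intro W.co_inj W.zero_closed) (simp_all add: W.co_zero)
    moreover have "J +>\<^bsub>U.T\<^esub> Y = \<zero>\<^bsub>QD\<^esub>"
    proof -
      interpret I: ideal U.I U.F by (rule W.tensor_ideal_ideal)
      interpret J: ideal J U.T by (rule U.quadratic_ideal_ideal)
      have "subst B (coord_letter U.dco) \<xi>' = \<zero>\<^bsub>B\<^esub>" if \<xi>': "\<xi>' \<in> Y" "\<xi>' \<in> two_letter_sums U.S U.W" for \<xi>'
      proof -
        have "\<xi> \<in> carrier U.F" using \<xi>(1) by (simp add: two_letter_sums_def)
        then have "Y = U.I +>\<^bsub>U.F\<^esub> \<xi>'"
          using \<xi>'(1) I.a_repr_independence'[of \<xi>' \<xi>] unfolding \<xi>(2) by simp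
        then show ?thesis using h(2)[of \<xi>'] \<xi>'(2) w eqs(3)
          by (simp add: two_letter_sums_def cube_zero_simps(5))
      qed
      then have "Y \<in> quadratic_perp U.S M R" using perp_iff[OF *(3)] by blast
      then have "Y \<in> J" using U.quadratic_perp_ideal by blast
      then have "J +>\<^bsub>U.T\<^esub> Y = J" by (rule J.a_rcos_const)
      then show ?thesis using U.quadratic_dual_simps(5) T.a_coset_add_zero[OF J.a_subset] by simp
    qed
    ultimately show ?thesis using *(4) letter_zero by simp
  qed
  have inj: "inj_on h (carrier QD)"
    by (rule trivial_kernel_inj[OF L.B.falgebra_axioms B.falgebra_axioms hom ker])
  have two: "(\<lambda>i. 0, \<lambda>b. 0, w) \<in> h ` degs QD 2" if w: "\<And>p. p \<notin> P \<Longrightarrow> w p = 0" for w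
  proof -
    have "(\<lambda>i. 0, \<lambda>b. 0, w) \<in> h ` degs QD 2" if "finite V" "V \<subseteq> P" "\<And>p. p \<notin> V \<Longrightarrow> w p = 0" for V w
      using that
    proof (induction V arbitrary: w)
      case empty
      then have "w = (\<lambda>p. 0)" by auto
      then show ?case
        using alg_hom_zero[OF L.B.falgebra_axioms B.falgebra_axioms hom]
        by (intro image_eqI[of _ _ "\<zero>\<^bsub>QD\<^esub>"]) (simp_all add: cube_zero_simps QD.degs_zero)
    next
      case (insert p V)
      obtain b c r where bc: "b \<in> D" "c \<in> D" "r \<noteq> 0" "\<And>q. \<kappa> q b c = (if q = p then r else 0)"
        using P(2)[of p] insert(4) by blast
      have "(\<lambda>i. 0, \<lambda>b. 0, \<lambda>q. if q = p then 0 else w q) \<in> h ` degs QD 2"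
        using insert by (intro insert(3)) auto
      then obtain z where z: "z \<in> degs QD 2" "h z = (\<lambda>i. 0, \<lambda>b. 0, \<lambda>q. if q = p then 0 else w q)"
        by force
      let ?y = "dl (Inr (W.basis b)) \<otimes>\<^bsub>QD\<^esub> dl (Inr (W.basis c))"
      have y: "?y \<in> degs QD 2"
        using QD.degs_mult[OF dldeg(2) dldeg(2)] W.basis bc by force
      have hy: "h ?y = (\<lambda>i. 0, \<lambda>b. 0, \<lambda>q. if q = p then r else 0)"
        using bc by (simp add: hD hl W.basis cube_zero_simps K_unit fun_eq_iff)
      let ?x = "(w p / r) \<odot>\<^bsub>QD\<^esub> ?y \<oplus>\<^bsub>QD\<^esub> z"
      have "h ?x = (\<lambda>i. 0, \<lambda>b. 0, w)"
        using QD.degs_carrier[OF y] QD.degs_carrier[OF z(1)] bc(3)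
        by (simp add: hD hy z(2) cube_zero_simps fun_eq_iff)
      moreover have "?x \<in> degs QD 2" by (intro QD.degs_add QD.degs_smult y z(1))
      ultimately show ?case by (intro image_eqI[of _ h ?x]) simp_all
    qed
    from this[OF P(1) subset_refl w] show ?thesis .
  qed
  have zero: "(\<lambda>i. s i, \<lambda>b. 0, \<lambda>p. 0) \<in> h ` degs QD 0" if "s \<in> carrier U.S" for s
    by (rule image_eqI[of _ h "dl (Inl s)"]) (use that in \<open>simp_all add: hl dldeg\<close>)
  have one: "(\<lambda>i. 0, u, \<lambda>p. 0) \<in> h ` degs QD 1" if "\<And>b. b \<notin> D \<Longrightarrow> u b = 0" for u
    by (rule image_eqI[of _ h "dl (Inr (W.lift u))"]) (use W.co_lift[OF that] in \<open>simp_all add: hl dldeg\<close>)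
  have degs: "h ` degs QD n = degs B n" for n
  proof
    show "h ` degs QD n \<subseteq> degs B n" using deg by blast
    show "degs B n \<subseteq> h ` degs QD n"
    proof
      fix x assume "x \<in> degs B n"
      moreover obtain s u w where x: "x = (s, u, w)" by (cases x) auto
      ultimately have c: "(s, u, w) \<in> carrier B" and
        d: "n \<noteq> 0 \<Longrightarrow> s = (\<lambda>i. 0)" "n \<noteq> 1 \<Longrightarrow> u = (\<lambda>b. 0)" "n \<noteq> 2 \<Longrightarrow> w = (\<lambda>p. 0)"
        by (simp_all add: cube_zero_simps(7))
      consider "n = 0" | "n = 1" | "n = 2" | "n \<noteq> 0" "n \<noteq> 1" "n \<noteq> 2" by blast
      then show "x \<in> h ` degs QD n"
      proof cases
        case 4
        then have "x = \<zero>\<^bsub>B\<^esub>" using x d by (simp add: cube_zero_simps)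
        then show ?thesis
          using alg_hom_zero[OF L.B.falgebra_axioms B.falgebra_axioms hom] QD.degs_zero
          by (intro image_eqI[of _ h "\<zero>\<^bsub>QD\<^esub>"]) simp_all
      qed (use c d zero[of s] one[of u] two[of w] x in
          \<open>simp_all add: cube_zero_simps(1) fun_algebra_simps(1)\<close>)
    qed
  qed
  have "h ` carrier QD = carrier B"
  proof
    show "h ` carrier QD \<subseteq> carrier B" using hD(1) by blast
    show "carrier B \<subseteq> h ` carrier QD"
    proof
      fix x assume x: "x \<in> carrier B"
      obtain s u w where suw: "x = (s, u, w)" by (cases x) auto
      have "(s, \<lambda>b. 0, \<lambda>p. 0) \<in> degs B 0" "(\<lambda>i. 0, u, \<lambda>p. 0) \<in> degs B 1" "(\<lambda>i. 0, \<lambda>b. 0, w) \<in> degs B 2"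
        using x by (simp_all add: suw cube_zero_simps)
      then obtain a b c where abc: "a \<in> degs QD 0" "b \<in> degs QD 1" "c \<in> degs QD 2"
        "h a = (s, \<lambda>b. 0, \<lambda>p. 0)" "h b = (\<lambda>i. 0, u, \<lambda>p. 0)" "h c = (\<lambda>i. 0, \<lambda>b. 0, w)"
        unfolding degs[symmetric] image_iff by metis
      note cl = QD.degs_carrier[OF abc(1)] QD.degs_carrier[OF abc(2)] QD.degs_carrier[OF abc(3)]
      have "h (a \<oplus>\<^bsub>QD\<^esub> (b \<oplus>\<^bsub>QD\<^esub> c)) = x" using cl by (simp add: hD abc suw cube_zero_simps)
      then show "x \<in> h ` carrier QD"
        using cl by (intro image_eqI[of _ h "a \<oplus>\<^bsub>QD\<^esub> (b \<oplus>\<^bsub>QD\<^esub> c)"]) simp_all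
    qed
  qed
  with inj have "bij_betw h (carrier QD) (carrier B)" by (simp add: bij_betw_def)
  then show ?thesis using h(1) degs by (simp add: graded_iso_def)
qed

end


section \<open>First extensions of the dual of an algebra by the algebra\<close>

lemma dual_bimod_simps:
  "f \<oplus>\<^bsub>dual_bimod A\<^esub> g = (\<lambda>x\<in>carrier A. f x + g x)"
  "\<zero>\<^bsub>dual_bimod A\<^esub> = (\<lambda>x\<in>carrier A. 0)"
  "c \<odot>\<^bsub>dual_bimod A\<^esub> f = (\<lambda>x\<in>carrier A. c * f x)"
  "lact (dual_bimod A) a f = (\<lambda>x\<in>carrier A. f (x \<otimes>\<^bsub>A\<^esub> a))"
  "ract (dual_bimod A) f a = (\<lambda>x\<in>carrier A. f (a \<otimes>\<^bsub>A\<^esub> x))"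
  by (simp_all add: dual_bimod_def)

lemma dual_bimodD:
  assumes "f \<in> carrier (dual_bimod A)"
  shows "x \<in> carrier A \<Longrightarrow> y \<in> carrier A \<Longrightarrow> f (x \<oplus>\<^bsub>A\<^esub> y) = f x + f y"
    and "x \<in> carrier A \<Longrightarrow> f (c \<odot>\<^bsub>A\<^esub> x) = c * f x"
    and "x \<notin> carrier A \<Longrightarrow> f x = undefined"
proof -
  have f: "f \<in> carrier A \<rightarrow>\<^sub>E UNIV" "\<forall>x\<in>carrier A. \<forall>y\<in>carrier A. f (x \<oplus>\<^bsub>A\<^esub> y) = f x + f y"
    "\<forall>c. \<forall>x\<in>carrier A. f (c \<odot>\<^bsub>A\<^esub> x) = c * f x"
    using assms by (simp_all add: dual_bimod_def linear_maps_def ground_algebra_def)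
  show "x \<in> carrier A \<Longrightarrow> y \<in> carrier A \<Longrightarrow> f (x \<oplus>\<^bsub>A\<^esub> y) = f x + f y" using f(2) by simp
  show "x \<in> carrier A \<Longrightarrow> f (c \<odot>\<^bsub>A\<^esub> x) = c * f x" using f(3) by simp
  show "x \<notin> carrier A \<Longrightarrow> f x = undefined" by (rule PiE_arb[OF f(1)])
qed

lemma (in falgebra) dual_bimodI:
  assumes "\<And>x y. x \<in> carrier A \<Longrightarrow> y \<in> carrier A \<Longrightarrow> f (x \<oplus>\<^bsub>A\<^esub> y) = f x + f y"
    and "\<And>c x. x \<in> carrier A \<Longrightarrow> f (c \<odot>\<^bsub>A\<^esub> x) = c * f x"
  shows "(\<lambda>x\<in>carrier A. f x) \<in> carrier (dual_bimod A)"
  using assms by (simp add: dual_bimod_def linear_maps_def ground_algebra_def)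

context falgebra
begin

abbreviation "D \<equiv> dual_bimod A"
abbreviation "N \<equiv> regular_bimod A"
abbreviation "Z \<equiv> bar_cocycles A D N"
abbreviation "Bd \<equiv> bar_coboundaries A D N"
abbreviation "E \<equiv> ext1 A D N"

lemma D_eqI:
  "f \<in> carrier D \<Longrightarrow> g \<in> carrier D \<Longrightarrow> (\<And>x. x \<in> carrier A \<Longrightarrow> f x = g x) \<Longrightarrow> f = g"
  using dual_bimodD(3)[of f A] dual_bimodD(3)[of g A] by (metis ext)

lemma D_closed [simp]:
  "f \<in> carrier D \<Longrightarrow> g \<in> carrier D \<Longrightarrow> f \<oplus>\<^bsub>D\<^esub> g \<in> carrier D"
  "f \<in> carrier D \<Longrightarrow> c \<odot>\<^bsub>D\<^esub> f \<in> carrier D"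
  "\<zero>\<^bsub>D\<^esub> \<in> carrier D"
  "a \<in> carrier A \<Longrightarrow> f \<in> carrier D \<Longrightarrow> lact D a f \<in> carrier D"
  "a \<in> carrier A \<Longrightarrow> f \<in> carrier D \<Longrightarrow> ract D f a \<in> carrier D"
  unfolding dual_bimod_simps
  by (rule dual_bimodI; simp add: dual_bimodD(1,2) l_distr r_distr smult_mult_l smult_mult_r algebra_simps)+

lemma D_actions:
  assumes "f \<in> carrier D"
  shows "a \<in> carrier A \<Longrightarrow> b \<in> carrier A \<Longrightarrow> lact D b (ract D f a) = ract D (lact D b f) a"
    and "a \<in> carrier A \<Longrightarrow> g \<in> carrier D \<Longrightarrow> ract D (f \<oplus>\<^bsub>D\<^esub> g) a = ract D f a \<oplus>\<^bsub>D\<^esub> ract D g a"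
    and "a \<in> carrier A \<Longrightarrow> ract D (c \<odot>\<^bsub>D\<^esub> f) a = c \<odot>\<^bsub>D\<^esub> ract D f a"
    and "b \<in> carrier A \<Longrightarrow> g \<in> carrier D \<Longrightarrow> lact D b (f \<oplus>\<^bsub>D\<^esub> g) = lact D b f \<oplus>\<^bsub>D\<^esub> lact D b g"
    and "b \<in> carrier A \<Longrightarrow> lact D b (c \<odot>\<^bsub>D\<^esub> f) = c \<odot>\<^bsub>D\<^esub> lact D b f"
    and "a \<in> carrier A \<Longrightarrow> b \<in> carrier A \<Longrightarrow> lact D (a \<otimes> b) f = lact D a (lact D b f)"
    and "a \<in> carrier A \<Longrightarrow> b \<in> carrier A \<Longrightarrow> lact D (a \<oplus> b) f = lact D a f \<oplus>\<^bsub>D\<^esub> lact D b f"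
    and "a \<in> carrier A \<Longrightarrow> lact D (c \<odot> a) f = c \<odot>\<^bsub>D\<^esub> lact D a f"
  unfolding dual_bimod_simps
  using assms by (auto simp: fun_eq_iff m_assoc dual_bimodD(1,2) r_distr smult_mult_r)

lemma regular_simps:
  "carrier N = carrier A" "x \<oplus>\<^bsub>N\<^esub> y = x \<oplus> y" "\<zero>\<^bsub>N\<^esub> = \<zero>" "c \<odot>\<^bsub>N\<^esub> x = c \<odot> x" "lact N = (\<otimes>)" "ract N = (\<otimes>)"
  by (simp_all add: regular_bimod_def)

lemma regular_minus: "x \<ominus>\<^bsub>N\<^esub> y = x \<ominus> y"
  by (simp add: a_minus_def a_inv_def m_inv_def regular_bimod_def)

lemma cocycleD:
  assumes "c \<in> carrier Z" "a \<in> carrier A" "f \<in> carrier D"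
  shows "c (a, f) \<in> carrier A"
    and "g \<in> carrier D \<Longrightarrow> c (a, f \<oplus>\<^bsub>D\<^esub> g) = c (a, f) \<oplus> c (a, g)"
    and "c (a, k \<odot>\<^bsub>D\<^esub> f) = k \<odot> c (a, f)"
    and "b \<in> carrier A \<Longrightarrow> c (a \<oplus> b, f) = c (a, f) \<oplus> c (b, f)"
    and "c (k \<odot> a, f) = k \<odot> c (a, f)"
    and "b \<in> carrier A \<Longrightarrow> c (a \<otimes> b, f) = a \<otimes> c (b, f) \<oplus> c (a, lact D b f)"
proof -
  have c: "c \<in> carrier A \<times> carrier D \<rightarrow>\<^sub>E carrier A"
    "\<forall>a\<in>carrier A. (\<lambda>m\<in>carrier D. c (a, m)) \<in> linear_maps D N"
    "\<forall>m\<in>carrier D. (\<lambda>a\<in>carrier A. c (a, m)) \<in> linear_maps A N"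
    "\<forall>a\<in>carrier A. \<forall>b\<in>carrier A. \<forall>m\<in>carrier D. c (a \<otimes> b, m) = a \<otimes> c (b, m) \<oplus> c (a, lact D b m)"
    using assms(1) by (simp_all add: bar_cocycles_def regular_simps)
  show "c (a, f) \<in> carrier A" using PiE_mem[OF c(1), of "(a, f)"] assms(2,3) by simp
  have l: "\<forall>x\<in>carrier D. \<forall>y\<in>carrier D. (\<lambda>m\<in>carrier D. c (a, m)) (x \<oplus>\<^bsub>D\<^esub> y) =
      (\<lambda>m\<in>carrier D. c (a, m)) x \<oplus> (\<lambda>m\<in>carrier D. c (a, m)) y"
    "\<forall>k. \<forall>x\<in>carrier D. (\<lambda>m\<in>carrier D. c (a, m)) (k \<odot>\<^bsub>D\<^esub> x) = k \<odot> (\<lambda>m\<in>carrier D. c (a, m)) x"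
    using bspec[OF c(2) assms(2)] unfolding linear_maps_def mem_Collect_eq regular_simps by blast+
  show "g \<in> carrier D \<Longrightarrow> c (a, f \<oplus>\<^bsub>D\<^esub> g) = c (a, f) \<oplus> c (a, g)" using l(1) assms(3) by simp
  show "c (a, k \<odot>\<^bsub>D\<^esub> f) = k \<odot> c (a, f)" using l(2) assms(3) by simp
  have r: "\<forall>x\<in>carrier A. \<forall>y\<in>carrier A. (\<lambda>a\<in>carrier A. c (a, f)) (x \<oplus> y) =
      (\<lambda>a\<in>carrier A. c (a, f)) x \<oplus> (\<lambda>a\<in>carrier A. c (a, f)) y"
    "\<forall>k. \<forall>x\<in>carrier A. (\<lambda>a\<in>carrier A. c (a, f)) (k \<odot> x) = k \<odot> (\<lambda>a\<in>carrier A. c (a, f)) x"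
    using bspec[OF c(3) assms(3)] unfolding linear_maps_def mem_Collect_eq regular_simps by blast+
  show "b \<in> carrier A \<Longrightarrow> c (a \<oplus> b, f) = c (a, f) \<oplus> c (b, f)" using r(1) assms(2) by simp
  show "c (k \<odot> a, f) = k \<odot> c (a, f)" using r(2) assms(2) by simp
  show "b \<in> carrier A \<Longrightarrow> c (a \<otimes> b, f) = a \<otimes> c (b, f) \<oplus> c (a, lact D b f)"
    using c(4) assms(2,3) by simp
qed

lemma cocycleI:
  assumes "\<And>a f. a \<in> carrier A \<Longrightarrow> f \<in> carrier D \<Longrightarrow> c (a, f) \<in> carrier A"
    and "\<And>a f g. a \<in> carrier A \<Longrightarrow> f \<in> carrier D \<Longrightarrow> g \<in> carrier D \<Longrightarrow> c (a, f \<oplus>\<^bsub>D\<^esub> g) = c (a, f) \<oplus> c (a, g)"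
    and "\<And>a f k. a \<in> carrier A \<Longrightarrow> f \<in> carrier D \<Longrightarrow> c (a, k \<odot>\<^bsub>D\<^esub> f) = k \<odot> c (a, f)"
    and "\<And>a b f. a \<in> carrier A \<Longrightarrow> b \<in> carrier A \<Longrightarrow> f \<in> carrier D \<Longrightarrow> c (a \<oplus> b, f) = c (a, f) \<oplus> c (b, f)"
    and "\<And>a f k. a \<in> carrier A \<Longrightarrow> f \<in> carrier D \<Longrightarrow> c (k \<odot> a, f) = k \<odot> c (a, f)"
    and "\<And>a b f. a \<in> carrier A \<Longrightarrow> b \<in> carrier A \<Longrightarrow> f \<in> carrier D \<Longrightarrow>
      c (a \<otimes> b, f) = a \<otimes> c (b, f) \<oplus> c (a, lact D b f)"
  shows "(\<lambda>z\<in>carrier A \<times> carrier D. c z) \<in> carrier Z"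
  using assms(1) by (simp add: bar_cocycles_def linear_maps_def regular_simps assms(2-6) Pi_iff)

lemma cocycle_eqI:
  assumes "c \<in> carrier Z" "d \<in> carrier Z"
    and "\<And>a f. a \<in> carrier A \<Longrightarrow> f \<in> carrier D \<Longrightarrow> c (a, f) = d (a, f)"
  shows "c = d"
proof
  fix z
  have e: "c \<in> extensional (carrier A \<times> carrier D)" "d \<in> extensional (carrier A \<times> carrier D)"
    using assms(1,2) by (simp_all add: bar_cocycles_def PiE_def)
  show "c z = d z"
    by (cases "z \<in> carrier A \<times> carrier D")
      (use assms(3) extensional_arb[OF e(1)] extensional_arb[OF e(2)] in auto)
qed

lemma cocycle_ops:
  "c \<oplus>\<^bsub>Z\<^esub> d = (\<lambda>z\<in>carrier A \<times> carrier D. c z \<oplus> d z)"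
  "\<zero>\<^bsub>Z\<^esub> = (\<lambda>z\<in>carrier A \<times> carrier D. \<zero>)"
  "k \<odot>\<^bsub>Z\<^esub> c = (\<lambda>z\<in>carrier A \<times> carrier D. k \<odot> c z)"
  "lact Z a c = (\<lambda>(x, m)\<in>carrier A \<times> carrier D. c (x, ract D m a))"
  "ract Z c a = (\<lambda>z\<in>carrier A \<times> carrier D. c z \<otimes> a)"
  by (simp_all add: bar_cocycles_def regular_simps)

lemma Z_closed [simp]:
  "c \<in> carrier Z \<Longrightarrow> d \<in> carrier Z \<Longrightarrow> c \<oplus>\<^bsub>Z\<^esub> d \<in> carrier Z"
  "c \<in> carrier Z \<Longrightarrow> k \<odot>\<^bsub>Z\<^esub> c \<in> carrier Z"
  "\<zero>\<^bsub>Z\<^esub> \<in> carrier Z"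
  "a \<in> carrier A \<Longrightarrow> c \<in> carrier Z \<Longrightarrow> lact Z a c \<in> carrier Z"
  "a \<in> carrier A \<Longrightarrow> c \<in> carrier Z \<Longrightarrow> ract Z c a \<in> carrier Z"
  unfolding cocycle_ops
  by (rule cocycleI;
      simp add: cocycleD D_actions l_distr r_distr smult_r_distr smult_l_distr smult_mult_l smult_mult_r
        m_assoc a_ac smult_smult[symmetric] mult.commute)+

lemma Z_abelian: "abelian_group Z"
proof (rule abelian_groupI)
  fix c assume c: "c \<in> carrier Z"
  show "\<exists>d\<in>carrier Z. d \<oplus>\<^bsub>Z\<^esub> c = \<zero>\<^bsub>Z\<^esub>"
  proof (rule bexI)
    show "(- 1) \<odot>\<^bsub>Z\<^esub> c \<in> carrier Z" using c by simp
    show "((- 1) \<odot>\<^bsub>Z\<^esub> c) \<oplus>\<^bsub>Z\<^esub> c = \<zero>\<^bsub>Z\<^esub>"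
      unfolding cocycle_ops
      by (rule restrict_ext) (use c in \<open>auto simp: cocycleD(1) smult_minus_one l_neg\<close>)
  qed
  show "\<zero>\<^bsub>Z\<^esub> \<oplus>\<^bsub>Z\<^esub> c = c"
    by (rule cocycle_eqI) (use c in \<open>simp_all add: cocycleD(1)\<close>, simp add: cocycle_ops cocycleD(1))
next
  fix c d e assume cde: "c \<in> carrier Z" "d \<in> carrier Z" "e \<in> carrier Z"
  show "(c \<oplus>\<^bsub>Z\<^esub> d) \<oplus>\<^bsub>Z\<^esub> e = c \<oplus>\<^bsub>Z\<^esub> (d \<oplus>\<^bsub>Z\<^esub> e)"
    unfolding cocycle_ops by (rule restrict_ext) (use cde in \<open>auto simp: cocycleD(1) a_assoc\<close>)
next
  fix c d assume cd: "c \<in> carrier Z" "d \<in> carrier Z"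
  show "c \<oplus>\<^bsub>Z\<^esub> d = d \<oplus>\<^bsub>Z\<^esub> c"
    unfolding cocycle_ops by (rule restrict_ext) (use cd in \<open>auto simp: cocycleD(1) a_comm\<close>)
qed simp_all

definition cobd :: "(('a \<Rightarrow> 'f) \<Rightarrow> 'a) \<Rightarrow> 'a \<times> ('a \<Rightarrow> 'f) \<Rightarrow> 'a" where
  "cobd h = (\<lambda>(a, m)\<in>carrier A \<times> carrier D. a \<otimes> h m \<ominus> h (lact D a m))"

definition D_linear :: "(('a \<Rightarrow> 'f) \<Rightarrow> 'a) \<Rightarrow> bool" where
  "D_linear h \<longleftrightarrow> (\<forall>f\<in>carrier D. h f \<in> carrier A) \<and>
     (\<forall>f\<in>carrier D. \<forall>g\<in>carrier D. h (f \<oplus>\<^bsub>D\<^esub> g) = h f \<oplus> h g) \<and>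
     (\<forall>k. \<forall>f\<in>carrier D. h (k \<odot>\<^bsub>D\<^esub> f) = k \<odot> h f)"

lemma D_linearD:
  assumes "D_linear h" "f \<in> carrier D"
  shows "h f \<in> carrier A" "g \<in> carrier D \<Longrightarrow> h (f \<oplus>\<^bsub>D\<^esub> g) = h f \<oplus> h g" "h (k \<odot>\<^bsub>D\<^esub> f) = k \<odot> h f"
  using assms by (simp_all add: D_linear_def)

lemma coboundaries_eq: "Bd = cobd ` {h. D_linear h}"
proof -
  have 1: "D_linear h" if "h \<in> linear_maps D N" for h
  proof -
    have "h \<in> carrier D \<rightarrow>\<^sub>E carrier A" using that by (simp add: linear_maps_def regular_simps)
    then have "\<forall>f\<in>carrier D. h f \<in> carrier A" by (blast intro: PiE_mem)
    with that show ?thesis by (simp add: D_linear_def linear_maps_def regular_simps)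
  qed
  have 2: "restrict h (carrier D) \<in> linear_maps D N" "cobd h = cobd (restrict h (carrier D))" if "D_linear h" for h
  proof -
    show "restrict h (carrier D) \<in> linear_maps D N"
      unfolding linear_maps_def using D_linearD[OF that] by (simp add: regular_simps Pi_iff)
    show "cobd h = cobd (restrict h (carrier D))"
      unfolding cobd_def by (rule restrict_ext) auto
  qed
  have "Bd = cobd ` linear_maps D N"
    unfolding bar_coboundaries_def cobd_def[abs_def] regular_simps regular_minus ..
  also have "\<dots> = cobd ` {h. D_linear h}"
  proof
    show "cobd ` linear_maps D N \<subseteq> cobd ` {h. D_linear h}" using 1 by blast
    show "cobd ` {h. D_linear h} \<subseteq> cobd ` linear_maps D N"
    proof (rule image_subsetI)
      fix h assume "h \<in> {h. D_linear h}"
      then show "cobd h \<in> cobd ` linear_maps D N" using 2[of h] by simp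
    qed
  qed
  finally show ?thesis .
qed

text \<open>
  For a map that is linear on functionals, the bar differential is the defect of compatibility with
  the left actions.
\<close>

lemma cobd_val:
  "D_linear h \<Longrightarrow> a \<in> carrier A \<Longrightarrow> m \<in> carrier D \<Longrightarrow> cobd h (a, m) = a \<otimes> h m \<oplus> (- 1) \<odot> h (lact D a m)"
  by (simp add: cobd_def minus_eq_smult D_linearD)

lemma telescope:
  "p \<in> carrier A \<Longrightarrow> q \<in> carrier A \<Longrightarrow> r \<in> carrier A \<Longrightarrow> (p \<oplus> (- 1) \<odot> q) \<oplus> (q \<oplus> r) = p \<oplus> r"
  by (simp add: smult_minus_one a_assoc r_neg1)

lemma cobd_closed: "D_linear h \<Longrightarrow> cobd h \<in> carrier Z"
proof -
  assume h: "D_linear h"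
  note hD = D_linearD[OF h]
  have "(\<lambda>z\<in>carrier A \<times> carrier D. cobd h z) \<in> carrier Z"
  proof (rule cocycleI, goal_cases)
    case (6 a b f)
    then show ?case
      using telescope[of "a \<otimes> (b \<otimes> h f)" "a \<otimes> h (lact D b f)" "(- 1) \<odot> h (lact D a (lact D b f))"]
      by (simp add: cobd_val h hD D_actions r_distr smult_mult_r m_assoc)
  qed (simp_all add: cobd_val h hD D_actions l_distr r_distr smult_r_distr smult_l_distr
        smult_mult_l smult_mult_r m_assoc a_ac smult_smult[symmetric] mult.commute)
  moreover have "(\<lambda>z\<in>carrier A \<times> carrier D. cobd h z) = cobd h"
    unfolding cobd_def by (rule ext) auto
  ultimately show ?thesis by simp
qed

lemma cobd_ops:
  assumes "D_linear h"
  shows "D_linear g \<Longrightarrow> cobd h \<oplus>\<^bsub>Z\<^esub> cobd g \<in> Bd" "k \<odot>\<^bsub>Z\<^esub> cobd h \<in> Bd"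
    "a \<in> carrier A \<Longrightarrow> lact Z a (cobd h) \<in> Bd" "a \<in> carrier A \<Longrightarrow> ract Z (cobd h) a \<in> Bd"
proof -
  note hD = D_linearD[OF assms]
  note arith = assms l_distr r_distr smult_r_distr smult_l_distr
        smult_mult_l smult_mult_r m_assoc a_ac smult_smult[symmetric] mult.commute
  show "cobd h \<oplus>\<^bsub>Z\<^esub> cobd g \<in> Bd" if g: "D_linear g"
  proof -
    note gD = D_linearD[OF g]
    have l: "D_linear (\<lambda>m. h m \<oplus> g m)" by (simp add: D_linear_def hD gD smult_r_distr a_ac)
    have "cobd h \<oplus>\<^bsub>Z\<^esub> cobd g = cobd (\<lambda>m. h m \<oplus> g m)"
      by (rule cocycle_eqI) (simp_all add: cobd_closed assms g l, simp add: cocycle_ops cobd_val l g hD gD arith)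
    then show ?thesis unfolding coboundaries_eq using l by blast
  qed
  show "k \<odot>\<^bsub>Z\<^esub> cobd h \<in> Bd"
  proof -
    have l: "D_linear (\<lambda>m. k \<odot> h m)"
      by (simp add: D_linear_def hD smult_r_distr smult_smult[symmetric] mult.commute)
    have "k \<odot>\<^bsub>Z\<^esub> cobd h = cobd (\<lambda>m. k \<odot> h m)"
      by (rule cocycle_eqI) (simp_all add: cobd_closed assms l, simp add: cocycle_ops cobd_val l hD arith)
    then show ?thesis unfolding coboundaries_eq using l by blast
  qed
  show "lact Z a (cobd h) \<in> Bd" if a: "a \<in> carrier A"
  proof -
    have l: "D_linear (\<lambda>m. h (ract D m a))" by (simp add: D_linear_def hD a D_actions)
    have "lact Z a (cobd h) = cobd (\<lambda>m. h (ract D m a))"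
      by (rule cocycle_eqI)
        (simp_all add: cobd_closed assms l a, simp add: cocycle_ops cobd_val assms l hD a D_actions)
    then show ?thesis unfolding coboundaries_eq using l by blast
  qed
  show "ract Z (cobd h) a \<in> Bd" if a: "a \<in> carrier A"
  proof -
    have l: "D_linear (\<lambda>m. h m \<otimes> a)" by (simp add: D_linear_def hD a l_distr smult_mult_l)
    have "ract Z (cobd h) a = cobd (\<lambda>m. h m \<otimes> a)"
      by (rule cocycle_eqI)
        (simp_all add: cobd_closed assms l a, simp add: cocycle_ops cobd_val l hD a arith)
    then show ?thesis unfolding coboundaries_eq using l by blast
  qed
qed

lemma Bd_subgroup: "abelian_subgroup Bd Z"
proof -
  interpret Z: abelian_group Z by (rule Z_abelian)
  have z: "D_linear (\<lambda>m. \<zero>)" by (simp add: D_linear_def)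
  have inv: "\<ominus>\<^bsub>Z\<^esub> c = (- 1) \<odot>\<^bsub>Z\<^esub> c" if c: "c \<in> carrier Z" for c
  proof -
    have "((- 1) \<odot>\<^bsub>Z\<^esub> c) \<oplus>\<^bsub>Z\<^esub> c = \<zero>\<^bsub>Z\<^esub>"
      unfolding cocycle_ops
      by (rule restrict_ext) (use c in \<open>auto simp: cocycleD(1) smult_minus_one l_neg\<close>)
    then show ?thesis using c by (intro Z.minus_equality) simp_all
  qed
  have "additive_subgroup Bd Z"
  proof (intro additive_subgroupI group.subgroupI[OF Z.a_group])
    show "Bd \<subseteq> carrier (add_monoid Z)" unfolding coboundaries_eq using cobd_closed by auto
    show "Bd \<noteq> {}" unfolding coboundaries_eq using z by blast
    fix c assume "c \<in> Bd"
    then obtain h where h: "D_linear h" "c = cobd h" unfolding coboundaries_eq by blast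
    show "inv\<^bsub>add_monoid Z\<^esub> c \<in> Bd"
      using inv[OF cobd_closed[OF h(1)]] cobd_ops(2)[OF h(1), of "- 1"] h(2)
      by (simp add: a_inv_def)
    fix d assume "d \<in> Bd"
    then obtain g where g: "D_linear g" "d = cobd g" unfolding coboundaries_eq by blast
    show "c \<otimes>\<^bsub>add_monoid Z\<^esub> d \<in> Bd" using cobd_ops(1)[OF h(1) g(1)] h(2) g(2) by simp
  qed
  then show ?thesis by (rule abelian_subgroupI3[OF _ Z_abelian])
qed

lemma ext_simps:
  assumes "c \<in> carrier Z" "d \<in> carrier Z"
  shows "(Bd +>\<^bsub>Z\<^esub> c) \<oplus>\<^bsub>E\<^esub> (Bd +>\<^bsub>Z\<^esub> d) = Bd +>\<^bsub>Z\<^esub> (c \<oplus>\<^bsub>Z\<^esub> d)"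
    and "k \<odot>\<^bsub>E\<^esub> (Bd +>\<^bsub>Z\<^esub> c) = Bd +>\<^bsub>Z\<^esub> (k \<odot>\<^bsub>Z\<^esub> c)"
    and "a \<in> carrier A \<Longrightarrow> lact E a (Bd +>\<^bsub>Z\<^esub> c) = Bd +>\<^bsub>Z\<^esub> lact Z a c"
    and "a \<in> carrier A \<Longrightarrow> ract E (Bd +>\<^bsub>Z\<^esub> c) a = Bd +>\<^bsub>Z\<^esub> ract Z c a"
proof -
  interpret Bd: abelian_subgroup Bd Z by (rule Bd_subgroup)
  have mem: "f c \<in> Bd" if "c \<in> Bd" "\<And>h. D_linear h \<Longrightarrow> f (cobd h) \<in> Bd" for f c
    using that by (auto simp: coboundaries_eq)
  note map = coset_map[OF Bd_subgroup assms(1)]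
  show "(Bd +>\<^bsub>Z\<^esub> c) \<oplus>\<^bsub>E\<^esub> (Bd +>\<^bsub>Z\<^esub> d) = Bd +>\<^bsub>Z\<^esub> (c \<oplus>\<^bsub>Z\<^esub> d)"
    using assms by (simp add: ext1_def quot_bimod_def Bd.a_rcos_sum)
  have s: "smult E = (\<lambda>k X. \<Union>x\<in>X. Bd +>\<^bsub>Z\<^esub> (k \<odot>\<^bsub>Z\<^esub> x))"
    "lact E = (\<lambda>a X. \<Union>x\<in>X. Bd +>\<^bsub>Z\<^esub> lact Z a x)" "ract E = (\<lambda>X a. \<Union>x\<in>X. Bd +>\<^bsub>Z\<^esub> ract Z x a)"
    by (simp_all add: ext1_def quot_bimod_def)
  note arith = cocycle_ops cocycleD(1) smult_r_distr l_distr
  show "k \<odot>\<^bsub>E\<^esub> (Bd +>\<^bsub>Z\<^esub> c) = Bd +>\<^bsub>Z\<^esub> (k \<odot>\<^bsub>Z\<^esub> c)"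
    unfolding s
  proof (rule map)
    show "k \<odot>\<^bsub>Z\<^esub> (x \<oplus>\<^bsub>Z\<^esub> y) = k \<odot>\<^bsub>Z\<^esub> x \<oplus>\<^bsub>Z\<^esub> k \<odot>\<^bsub>Z\<^esub> y" if "x \<in> carrier Z" "y \<in> carrier Z" for x y
      by (rule cocycle_eqI) (use that in \<open>simp_all\<close>, use that in \<open>simp add: arith\<close>)
    show "k \<odot>\<^bsub>Z\<^esub> x \<in> Bd" if "x \<in> Bd" for x by (rule mem[OF that]) (rule cobd_ops(2))
  qed simp
  show "lact E a (Bd +>\<^bsub>Z\<^esub> c) = Bd +>\<^bsub>Z\<^esub> lact Z a c" if a: "a \<in> carrier A"
    unfolding s
  proof (rule map)
    show "lact Z a (x \<oplus>\<^bsub>Z\<^esub> y) = lact Z a x \<oplus>\<^bsub>Z\<^esub> lact Z a y" if "x \<in> carrier Z" "y \<in> carrier Z" for x y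
      by (rule cocycle_eqI) (use that a in \<open>simp_all\<close>, use that a in \<open>simp add: arith\<close>)
    show "lact Z a x \<in> Bd" if "x \<in> Bd" for x by (rule mem[OF that]) (rule cobd_ops(3)[OF _ a])
  qed (simp add: a)
  show "ract E (Bd +>\<^bsub>Z\<^esub> c) a = Bd +>\<^bsub>Z\<^esub> ract Z c a" if a: "a \<in> carrier A"
    unfolding s
  proof (rule map)
    show "ract Z (x \<oplus>\<^bsub>Z\<^esub> y) a = ract Z x a \<oplus>\<^bsub>Z\<^esub> ract Z y a" if "x \<in> carrier Z" "y \<in> carrier Z" for x y
      by (rule cocycle_eqI) (use that a in \<open>simp_all\<close>, use that a in \<open>simp add: arith\<close>)
    show "ract Z x a \<in> Bd" if "x \<in> Bd" for x by (rule mem[OF that]) (rule cobd_ops(4)[OF _ a])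
  qed (simp add: a)
qed

lemma ext_carrier: "carrier E = (\<lambda>c. Bd +>\<^bsub>Z\<^esub> c) ` carrier Z"
  by (auto simp: ext1_def quot_bimod_def A_RCOSETS_def')

lemma ext_tensor_data: "tensor_data A E"
  by unfold_locales (auto simp: ext_carrier ext_simps)

text \<open>Values on classes can be computed with any representative, also with the chosen one.\<close>

lemma ext_functional:
  assumes "c \<in> carrier Z"
    and "\<And>c d. c \<in> carrier Z \<Longrightarrow> d \<in> carrier Z \<Longrightarrow> L (c \<oplus>\<^bsub>Z\<^esub> d) = L c + (L d :: 'b::ab_group_add)"
    and "\<And>h. D_linear h \<Longrightarrow> L (cobd h) = 0"
  shows "L (SOME d. d \<in> Bd +>\<^bsub>Z\<^esub> c) = L c"
proof -
  interpret Bd: abelian_subgroup Bd Z by (rule Bd_subgroup)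
  have "L d = L c" if d: "d \<in> Bd +>\<^bsub>Z\<^esub> c" for d
  proof -
    obtain h where h: "D_linear h" "d = cobd h \<oplus>\<^bsub>Z\<^esub> c"
      using d by (auto simp: a_r_coset_def' coboundaries_eq)
    then show ?thesis using assms cobd_closed by simp
  qed
  then show ?thesis using someI[of "\<lambda>d. d \<in> Bd +>\<^bsub>Z\<^esub> c"] Bd.a_rcos_self[OF assms(1)] by blast
qed

end


section \<open>Path algebras and their extension classes\<close>

locale finite_quiver = fin_digraph Q for Q :: "('v, 'e) pre_digraph"
begin

abbreviation "walk_end u p \<equiv> last (pre_digraph.awalk_verts Q u p)"

lemma walk_end_simps [simp]:
  "walk_end u [] = u" "walk_end u (a # p) = walk_end (head Q a) p"
  by simp_all

lemma walk_end_append [simp]: "walk_end u (p @ q) = walk_end (walk_end u p) q"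
  by (induction p arbitrary: u) simp_all

lemma quiver_paths_simps [simp]:
  "(u, []) \<in> quiver_paths Q \<longleftrightarrow> u \<in> verts Q"
  "(u, a # p) \<in> quiver_paths Q \<longleftrightarrow> a \<in> arcs Q \<and> u = tail Q a \<and> (head Q a, p) \<in> quiver_paths Q"
  by (auto simp: quiver_paths_def awalk_Nil_iff awalk_Cons_iff)

lemma quiver_paths_append [simp]:
  "(u, p @ q) \<in> quiver_paths Q \<longleftrightarrow> (u, p) \<in> quiver_paths Q \<and> (walk_end u p, q) \<in> quiver_paths Q"
proof (induction p arbitrary: u)
  case Nil
  show ?case by (cases q) auto
qed auto

lemma walk_end_in_verts: "(u, p) \<in> quiver_paths Q \<Longrightarrow> walk_end u p \<in> verts Q"
  by (induction p arbitrary: u) auto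

abbreviation "PA \<equiv> path_algebra Q"

lemma path_algebra_simps:
  "x \<in> carrier PA \<longleftrightarrow> finite {p. x p \<noteq> 0} \<and> (\<forall>p. x p \<noteq> 0 \<longrightarrow> p \<in> quiver_paths Q)"
  "x \<oplus>\<^bsub>PA\<^esub> y = (\<lambda>p. x p + y p)"
  "(x \<otimes>\<^bsub>PA\<^esub> y) (u, p) = (\<Sum>k\<le>length p. x (u, take k p) * y (walk_end u (take k p), drop k p))"
  "\<one>\<^bsub>PA\<^esub> (u, p) = (if u \<in> verts Q \<and> p = [] then 1 else 0)"
  "\<zero>\<^bsub>PA\<^esub> = (\<lambda>p. 0)"
  "c \<odot>\<^bsub>PA\<^esub> x = (\<lambda>p. c * x p)"
  by (simp_all add: path_algebra_def)

lemma path_mult_support: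
  assumes nz: "(x \<otimes>\<^bsub>PA\<^esub> y) (u, w) \<noteq> (0 :: 'f::field)"
  shows "\<exists>p q. w = p @ q \<and> x (u, p) \<noteq> 0 \<and> y (walk_end u p, q) \<noteq> 0"
proof -
  obtain k where "x (u, take k w) * y (walk_end u (take k w), drop k w) \<noteq> 0"
    using nz unfolding path_algebra_simps by (meson sum.not_neutral_contains_not_neutral)
  then show ?thesis by (intro exI[of _ "take k w"] exI[of _ "drop k w"]) auto
qed

lemma path_mult_closed:
  assumes "x \<in> carrier PA" "y \<in> carrier (PA :: ('f::field, _) module)"
  shows "x \<otimes>\<^bsub>PA\<^esub> y \<in> carrier PA"
proof -
  have "{w. (x \<otimes>\<^bsub>PA\<^esub> y) w \<noteq> 0} \<subseteq>
      (\<lambda>((u, p), (v, q)). (u, p @ q)) ` ({p. x p \<noteq> 0} \<times> {q. y q \<noteq> 0})"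
  proof (rule subsetI)
    fix uw assume "uw \<in> {w. (x \<otimes>\<^bsub>PA\<^esub> y) w \<noteq> 0}"
    moreover obtain u w where uw: "uw = (u, w)" by (cases uw)
    ultimately have nz: "(x \<otimes>\<^bsub>PA\<^esub> y) (u, w) \<noteq> 0" by simp
    obtain p q where "w = p @ q" "x (u, p) \<noteq> 0" "y (walk_end u p, q) \<noteq> 0"
      using path_mult_support[OF nz] by blast
    then show "uw \<in> (\<lambda>((u, p), (v, q)). (u, p @ q)) ` ({p. x p \<noteq> 0} \<times> {q. y q \<noteq> 0})"
      unfolding uw by (intro image_eqI[of _ _ "((u, p), (walk_end u p, q))"]) simp_all
  qed
  then have "finite {w. (x \<otimes>\<^bsub>PA\<^esub> y) w \<noteq> 0}"
    using assms by (auto simp: path_algebra_simps(1) intro: finite_subset)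
  moreover have "(u, w) \<in> quiver_paths Q" if nz: "(x \<otimes>\<^bsub>PA\<^esub> y) (u, w) \<noteq> 0" for u w
    using path_mult_support[OF nz] assms by (auto simp: path_algebra_simps(1))
  ultimately show ?thesis by (simp add: path_algebra_simps(1) split_paired_all)
qed

lemma path_mult_assoc:
  "(x \<otimes>\<^bsub>PA\<^esub> y) \<otimes>\<^bsub>PA\<^esub> z = x \<otimes>\<^bsub>PA\<^esub> (y \<otimes>\<^bsub>PA\<^esub> (z :: 'v \<times> 'e list \<Rightarrow> 'f::field))"
proof
  fix up :: "'v \<times> 'e list"
  obtain u p where [simp]: "up = (u, p)" by (cases up)
  let ?n = "length p"
  have e: "walk_end (walk_end u (take j p)) (take i (drop j p)) = walk_end u (take (j + i) p)" for i j
    by (simp add: take_add)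
  have "((x \<otimes>\<^bsub>PA\<^esub> y) \<otimes>\<^bsub>PA\<^esub> z) (u, p) =
      (\<Sum>k\<le>?n. \<Sum>j\<le>k. x (u, take j p) * y (walk_end u (take j p), drop j (take k p)) *
        z (walk_end u (take k p), drop k p))"
    unfolding path_algebra_simps by (intro sum.cong refl) (simp add: sum_distrib_right min_def)
  also have "\<dots> = (\<Sum>j\<le>?n. \<Sum>i\<le>?n - j. x (u, take j p) *
      y (walk_end u (take j p), drop j (take (j + i) p)) * z (walk_end u (take (j + i) p), drop (j + i) p))"
    by (rule sum_triple_split)
  also have "\<dots> = (x \<otimes>\<^bsub>PA\<^esub> (y \<otimes>\<^bsub>PA\<^esub> z)) (u, p)"
    unfolding path_algebra_simps
    by (intro sum.cong refl) (simp add: sum_distrib_left mult.assoc drop_take e add.commute)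
  finally show "((x \<otimes>\<^bsub>PA\<^esub> y) \<otimes>\<^bsub>PA\<^esub> z) up = (x \<otimes>\<^bsub>PA\<^esub> (y \<otimes>\<^bsub>PA\<^esub> z)) up" by simp
qed

lemma path_one_closed: "\<one>\<^bsub>PA\<^esub> \<in> carrier (PA :: ('f::field, _) module)"
proof -
  have "{p. \<one>\<^bsub>PA\<^esub> p \<noteq> (0 :: 'f)} \<subseteq> verts Q \<times> {[]}"
    by (auto simp: path_algebra_simps split: if_splits)
  then have "finite {p. \<one>\<^bsub>PA\<^esub> p \<noteq> (0 :: 'f)}" by (rule finite_subset) simp
  then show ?thesis by (auto simp: path_algebra_simps split: if_splits)
qed

lemma path_add_closed:
  assumes "x \<in> carrier PA" "y \<in> carrier (PA :: ('f::field, _) module)"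
  shows "x \<oplus>\<^bsub>PA\<^esub> y \<in> carrier PA"
proof -
  have "{w. x w + y w \<noteq> 0} \<subseteq> {w. x w \<noteq> 0} \<union> {w. y w \<noteq> 0}" by auto
  then have "finite {w. x w + y w \<noteq> 0}"
    using assms unfolding path_algebra_simps(1) by (meson finite_Un finite_subset)
  moreover have "w \<in> quiver_paths Q" if "x w + y w \<noteq> 0" for w
    using assms that unfolding path_algebra_simps(1) by (metis add_0)
  ultimately show ?thesis unfolding path_algebra_simps by blast
qed

lemma path_smult_closed: "x \<in> carrier PA \<Longrightarrow> c \<odot>\<^bsub>PA\<^esub> x \<in> carrier (PA :: ('f::field, _) module)"
  unfolding path_algebra_simps by (auto elim: rev_finite_subset)

lemma path_falgebra: "falgebra (PA :: ('f::field, _) module)"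
proof -
  let ?A = "PA :: ('f, _) module"
  have ab: "abelian_group ?A"
  proof (rule abelian_groupI)
    fix x assume x: "x \<in> carrier ?A"
    show "\<exists>y\<in>carrier ?A. y \<oplus>\<^bsub>?A\<^esub> x = \<zero>\<^bsub>?A\<^esub>"
      by (rule bexI[OF _ path_smult_closed[OF x, of "- 1"]]) (simp add: path_algebra_simps)
  qed (auto simp: path_add_closed, auto simp: path_algebra_simps algebra_simps)
  have mon: "monoid ?A"
  proof (rule monoidI)
    fix x assume x: "x \<in> carrier ?A"
    show "\<one>\<^bsub>?A\<^esub> \<otimes>\<^bsub>?A\<^esub> x = x"
    proof
      fix up :: "'v \<times> 'e list"
      obtain u p where [simp]: "up = (u, p)" by (cases up)
      have "(\<one>\<^bsub>?A\<^esub> \<otimes>\<^bsub>?A\<^esub> x) (u, p) = (\<Sum>k\<le>length p. if k = 0 then x (u, p) else 0)"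
        unfolding path_algebra_simps(3)
      proof (intro sum.cong refl)
        fix k assume "k \<in> {..length p}"
        have "x (u, p) = 0" if "u \<notin> verts Q"
        proof -
          have "(u, p) \<notin> quiver_paths Q" using that by (cases p) auto
          then show ?thesis using x by (auto simp: path_algebra_simps(1))
        qed
        then show "\<one>\<^bsub>?A\<^esub> (u, take k p) * x (walk_end u (take k p), drop k p) =
            (if k = 0 then x (u, p) else 0)"
          using \<open>k \<in> {..length p}\<close> by (auto simp: path_algebra_simps(4))
      qed
      then show "(\<one>\<^bsub>?A\<^esub> \<otimes>\<^bsub>?A\<^esub> x) up = x up" by simp
    qed
    show "x \<otimes>\<^bsub>?A\<^esub> \<one>\<^bsub>?A\<^esub> = x"
    proof
      fix up :: "'v \<times> 'e list"
      obtain u p where [simp]: "up = (u, p)" by (cases up)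
      have "(x \<otimes>\<^bsub>?A\<^esub> \<one>\<^bsub>?A\<^esub>) (u, p) = (\<Sum>k\<le>length p. if k = length p then x (u, p) else 0)"
        unfolding path_algebra_simps(3)
      proof (intro sum.cong refl)
        fix k assume k: "k \<in> {..length p}"
        have "x (u, p) = 0" if "walk_end u p \<notin> verts Q"
          using that walk_end_in_verts[of u p] x by (auto simp: path_algebra_simps(1))
        then show "x (u, take k p) * \<one>\<^bsub>?A\<^esub> (walk_end u (take k p), drop k p) =
            (if k = length p then x (u, p) else 0)"
          using k by (auto simp: path_algebra_simps(4))
      qed
      then show "(x \<otimes>\<^bsub>?A\<^esub> \<one>\<^bsub>?A\<^esub>) up = x up" by simp
    qed
  qed (simp_all only: path_mult_closed path_one_closed path_mult_assoc)
  have "ring ?A"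
    by (rule ringI[OF ab mon])
      (simp_all add: fun_eq_iff path_algebra_simps distrib_left distrib_right sum.distrib)
  then show ?thesis
    by (intro falgebra.intro falgebra_axioms.intro)
      (simp_all only: path_smult_closed,
       simp_all add: fun_eq_iff path_algebra_simps distrib_left distrib_right sum_distrib_left mult_ac)
qed

lemma unit_path_closed: "p \<in> quiver_paths Q \<Longrightarrow> unit_fun p \<in> carrier (PA :: ('f::field, _) module)"
  by (auto simp: path_algebra_simps unit_fun_def)

lemma path_induct [consumes 1, case_names zero unit add]:
  assumes "x \<in> carrier (PA :: ('f::field, _) module)"
    and zero: "R (\<lambda>p. 0)" and unit: "\<And>c p. p \<in> quiver_paths Q \<Longrightarrow> R (c \<odot>\<^bsub>PA\<^esub> unit_fun p)"
    and add: "\<And>y z. y \<in> carrier PA \<Longrightarrow> z \<in> carrier PA \<Longrightarrow> R y \<Longrightarrow> R z \<Longrightarrow> R (y \<oplus>\<^bsub>PA\<^esub> z)"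
  shows "R x"
proof -
  let ?r = "\<lambda>S p. if p \<in> S then x p else 0"
  have "R (?r S) \<and> ?r S \<in> carrier PA" if "finite S" "S \<subseteq> {p. x p \<noteq> 0}" for S
    using that
  proof (induction S)
    case empty
    then show ?case using zero by (simp add: path_algebra_simps)
  next
    case (insert p S)
    have eq: "?r (insert p S) = (x p \<odot>\<^bsub>PA\<^esub> unit_fun p) \<oplus>\<^bsub>PA\<^esub> ?r S"
      using insert(2) by (auto simp: path_algebra_simps unit_fun_def)
    have "p \<in> quiver_paths Q" using insert(4) assms(1) unfolding path_algebra_simps(1) by blast
    then show ?case
      unfolding eq using insert
      by (intro conjI add unit path_add_closed path_smult_closed unit_path_closed) auto
  qed
  from this[of "{p. x p \<noteq> 0}"] have "R (?r {p. x p \<noteq> 0})"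
    using assms(1) by (auto simp: path_algebra_simps(1))
  moreover have "?r {p. x p \<noteq> 0} = x" by auto
  ultimately show ?thesis by simp
qed

lemma unit_path_Cons:
  assumes "a \<in> arcs Q"
  shows "(unit_fun (tail Q a, [a]) \<otimes>\<^bsub>PA\<^esub> unit_fun (head Q a, p)) =
    (unit_fun (tail Q a, a # p) :: 'v \<times> 'e list \<Rightarrow> 'f::field)"
proof
  fix vq :: "'v \<times> 'e list"
  obtain v q where [simp]: "vq = (v, q)" by (cases vq)
  have "(unit_fun (tail Q a, [a]) \<otimes>\<^bsub>PA\<^esub> unit_fun (head Q a, p)) (v, q) =
      (\<Sum>k\<le>length q. if k = 1 then unit_fun (tail Q a, a # p) (v, q) else (0 :: 'f))"
    unfolding path_algebra_simps
  proof (intro sum.cong refl)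
    fix k assume k: "k \<in> {..length q}"
    have *: "take k q = [a] \<longleftrightarrow> k = 1 \<and> (\<exists>q'. q = a # q')" using k by (cases q; cases k) auto
    show "unit_fun (tail Q a, [a]) (v, take k q) * unit_fun (head Q a, p) (walk_end v (take k q), drop k q) =
        (if k = 1 then unit_fun (tail Q a, a # p) (v, q) else (0 :: 'f))"
      using * by (auto simp: unit_fun_def Suc_le_eq)
  qed
  also have "\<dots> = unit_fun (tail Q a, a # p) (v, q)"
    by (cases q) (auto simp: unit_fun_def Suc_le_eq)
  finally show "(unit_fun (tail Q a, [a]) \<otimes>\<^bsub>PA\<^esub> unit_fun (head Q a, p)) vq =
    (unit_fun (tail Q a, a # p) vq :: 'f)" by simp
qed

lemma vertex_incl_closed:
  "s \<in> carrier (vertex_algebra Q) \<Longrightarrow> vertex_incl s \<in> carrier (PA :: ('f::field, _) module)"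
proof -
  assume s: "s \<in> carrier (vertex_algebra Q :: ('f, _) module)"
  have "{p. vertex_incl s p \<noteq> 0} \<subseteq> verts Q \<times> {[]}"
    using s by (auto simp: vertex_incl_def fun_algebra_simps split: if_splits)
  then have "finite {p. vertex_incl s p \<noteq> 0}" by (rule finite_subset) simp
  then show ?thesis using s
    by (auto simp: path_algebra_simps vertex_incl_def fun_algebra_simps split: if_splits)
qed

lemma arrow_incl_nonzero:
  "arrow_incl Q x (u, p) \<noteq> (0 :: 'f::field) \<longleftrightarrow> (\<exists>a. p = [a] \<and> u = tail Q a \<and> x a \<noteq> 0)"
  by (auto simp: arrow_incl_def split: list.splits if_splits)

lemma arrow_incl_closed:
  "x \<in> carrier (arrow_bimod Q) \<Longrightarrow> arrow_incl Q x \<in> carrier (PA :: ('f::field, _) module)"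
proof -
  assume x: "x \<in> carrier (arrow_bimod Q :: ('f, _, _) bimod)"
  then have x0: "x a \<noteq> 0 \<Longrightarrow> a \<in> arcs Q" for a by (auto simp: arrow_bimod_def)
  have "{p. arrow_incl Q x p \<noteq> 0} \<subseteq> (\<lambda>a. (tail Q a, [a])) ` arcs Q"
    using x0 by (auto simp: arrow_incl_nonzero)
  then have "finite {p. arrow_incl Q x p \<noteq> 0}" by (rule finite_subset) simp
  then show ?thesis using x0 by (auto simp: path_algebra_simps(1) arrow_incl_nonzero)
qed

lemma incl_unit:
  "vertex_incl (unit_fun i) = unit_fun (i, [])"
  "arrow_incl Q (unit_fun a) = unit_fun (tail Q a, [a])"
  by (auto simp: fun_eq_iff vertex_incl_def arrow_incl_def unit_fun_def split: list.splits)

text \<open>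
  A cocycle is determined by its values on vertices and arrows, since these generate the path algebra.
\<close>

lemma cocycle_determined:
  fixes c d :: "('v \<times> 'e list \<Rightarrow> 'f::field) \<times> (('v \<times> 'e list \<Rightarrow> 'f) \<Rightarrow> 'f) \<Rightarrow> 'v \<times> 'e list \<Rightarrow> 'f"
  assumes c: "c \<in> carrier (bar_cocycles PA (dual_bimod PA) (regular_bimod PA))"
    and d: "d \<in> carrier (bar_cocycles PA (dual_bimod PA) (regular_bimod PA))"
    and v: "\<And>i f. i \<in> verts Q \<Longrightarrow> f \<in> carrier (dual_bimod PA) \<Longrightarrow>
      c (vertex_incl (unit_fun i), f) = d (vertex_incl (unit_fun i), f)"
    and a: "\<And>a f. a \<in> arcs Q \<Longrightarrow> f \<in> carrier (dual_bimod PA) \<Longrightarrow>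
      c (arrow_incl Q (unit_fun a), f) = d (arrow_incl Q (unit_fun a), f)"
  shows "c = d"
proof -
  interpret A: falgebra "PA :: ('f, _) module" by (rule path_falgebra)
  have p: "c (unit_fun (u, p), f) = d (unit_fun (u, p), f)"
    if "(u, p) \<in> quiver_paths Q" "f \<in> carrier A.D" for u p f
    using that
  proof (induction p arbitrary: u f)
    case Nil
    then show ?case using v[of u f] by (simp add: incl_unit)
  next
    case (Cons b p)
    then have b: "b \<in> arcs Q" "u = tail Q b" "(head Q b, p) \<in> quiver_paths Q" by auto
    have cl: "unit_fun (tail Q b, [b]) \<in> carrier PA" "unit_fun (head Q b, p) \<in> carrier (PA :: ('f, _) module)"
      using b by (auto intro!: unit_path_closed)
    have fb: "lact A.D (unit_fun (head Q b, p)) f \<in> carrier A.D" using cl Cons by simp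
    show ?case
      unfolding b(2) unit_path_Cons[OF b(1), of p, symmetric]
      unfolding A.cocycleD(6)[OF c cl(1) Cons.prems(2) cl(2)] A.cocycleD(6)[OF d cl(1) Cons.prems(2) cl(2)]
      using a[OF b(1) fb] Cons.IH[OF b(3) Cons.prems(2)] by (simp add: incl_unit)
  qed
  show ?thesis
  proof (rule A.cocycle_eqI[OF c d])
    fix x f assume x: "x \<in> carrier (PA :: ('f, _) module)" and f: "f \<in> carrier A.D"
    show "c (x, f) = d (x, f)" using x
    proof (induction x rule: path_induct)
      case zero
      show ?case
        using A.cocycleD(5)[OF c A.zero_closed f, of 0] A.cocycleD(5)[OF d A.zero_closed f, of 0]
          A.cocycleD(1)[OF c A.zero_closed f] A.cocycleD(1)[OF d A.zero_closed f]
        by (simp add: path_algebra_simps(5)[symmetric])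
    next
      case (unit k p)
      obtain u q where [simp]: "p = (u, q)" by (cases p)
      have "unit_fun p \<in> carrier (PA :: ('f, _) module)" by (rule unit_path_closed[OF unit])
      then show ?case
        using A.cocycleD(5)[OF c _ f] A.cocycleD(5)[OF d _ f] p[of u q f] unit f by simp
    next
      case (add y z)
      then show ?case using A.cocycleD(4)[OF c _ f] A.cocycleD(4)[OF d _ f] by simp
    qed
  qed
qed

lemma dual_sum:
  assumes f: "f \<in> carrier (dual_bimod (PA :: ('f::field, _) module))"
    and "finite K" "\<And>k. k \<in> K \<Longrightarrow> z k \<in> carrier PA"
  shows "(\<lambda>p. \<Sum>k\<in>K. r k * z k p) \<in> carrier PA \<and> f (\<lambda>p. \<Sum>k\<in>K. r k * z k p) = (\<Sum>k\<in>K. r k * f (z k))"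
  using assms(2,3)
proof (induction K)
  case empty
  interpret A: falgebra "PA :: ('f, _) module" by (rule path_falgebra)
  have "f \<zero>\<^bsub>PA\<^esub> = 0" using dual_bimodD(2)[OF f A.zero_closed, of 0] by simp
  then show ?case using A.zero_closed by (simp add: path_algebra_simps(5))
next
  case (insert k K)
  let ?s = "\<lambda>p. \<Sum>k\<in>K. r k * z k p"
  have eq: "(\<lambda>p. \<Sum>k\<in>insert k K. r k * z k p) = (r k \<odot>\<^bsub>PA\<^esub> z k) \<oplus>\<^bsub>PA\<^esub> ?s"
    using insert(1,2) by (simp add: path_algebra_simps)
  have "?s \<in> carrier PA" "f ?s = (\<Sum>k\<in>K. r k * f (z k))" using insert by auto
  moreover have zk: "z k \<in> carrier PA" "r k \<odot>\<^bsub>PA\<^esub> z k \<in> carrier PA"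
    using insert by (auto intro: path_smult_closed)
  ultimately show ?case
    unfolding eq using insert(1,2)
    by (simp add: path_add_closed dual_bimodD(1)[OF f zk(2)] dual_bimodD(2)[OF f zk(1)])
qed

text \<open>
  Cutting every path of \<^term>\<open>y\<close> that starts with \<^term>\<open>q\<close> at the arrow after
  \<^term>\<open>q\<close>, which is weighted by \<^term>\<open>t\<close>, and keeping the rest.
\<close>

definition cut :: "('e \<Rightarrow> 'f::field) \<Rightarrow> ('v \<times> 'e list \<Rightarrow> 'f) \<Rightarrow> 'v \<times> 'e list \<Rightarrow> 'v \<times> 'e list \<Rightarrow> 'f" where
  "cut t y = (\<lambda>(u, q) (v, p). \<Sum>a\<in>arcs Q. if head Q a = v then t a * y (u, q @ a # p) else 0)"

lemma cut_nonzero: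
  assumes "cut t y (u, q) (v, p) \<noteq> 0"
  shows "\<exists>a\<in>arcs Q. head Q a = v \<and> y (u, q @ a # p) \<noteq> 0"
proof -
  obtain a where "a \<in> arcs Q" "(if head Q a = v then t a * y (u, q @ a # p) else 0) \<noteq> 0"
    using assms unfolding cut_def by (auto elim: sum.not_neutral_contains_not_neutral)
  then show ?thesis by (auto split: if_splits)
qed

lemma cut_closed:
  assumes "y \<in> carrier PA" shows "cut t y uq \<in> carrier (PA :: ('f::field, _) module)"
proof -
  obtain u q where [simp]: "uq = (u, q)" by (cases uq)
  have "{vp. cut t y uq vp \<noteq> 0} \<subseteq>
      (\<lambda>(a, (u, w)). (head Q a, drop (Suc (length q)) w)) ` (arcs Q \<times> {p. y p \<noteq> 0})"
  proof clarify
    fix v p assume "cut t y uq (v, p) \<noteq> 0"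
    then obtain a where "a \<in> arcs Q" "head Q a = v" "y (u, q @ a # p) \<noteq> 0"
      using cut_nonzero[of t y u q v p] by auto
    then show "(v, p) \<in> (\<lambda>(a, (u, w)). (head Q a, drop (Suc (length q)) w)) ` (arcs Q \<times> {p. y p \<noteq> 0})"
      by (intro image_eqI[of _ _ "(a, (u, q @ a # p))"]) auto
  qed
  then have "finite {vp. cut t y uq vp \<noteq> 0}"
    using assms by (auto simp: path_algebra_simps(1) intro: finite_subset)
  moreover have "(v, p) \<in> quiver_paths Q" if nz: "cut t y uq (v, p) \<noteq> 0" for v p
  proof -
    obtain a where "a \<in> arcs Q" "head Q a = v" "y (u, q @ a # p) \<noteq> 0"
      using cut_nonzero[of t y u q v p] nz by auto
    then have "(u, q @ a # p) \<in> quiver_paths Q" using assms unfolding path_algebra_simps(1) by blast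
    then show ?thesis using \<open>head Q a = v\<close> by simp
  qed
  ultimately show ?thesis by (simp add: path_algebra_simps(1) split_paired_all)
qed

lemma sum_split_at:
  fixes g :: "nat \<Rightarrow> 'a::comm_monoid_add"
  shows "(\<Sum>k\<le>n + Suc m. g k) = (\<Sum>k\<le>n. g k) + (\<Sum>j\<le>m. g (Suc n + j))"
  by (induction m) (simp_all add: add.assoc)

lemma cut_mult:
  "cut t (y \<otimes>\<^bsub>PA\<^esub> z) (u, q) = (\<lambda>p. \<Sum>k\<le>length q. y (u, take k q) *
     cut t z (walk_end u (take k q), drop k q) p) \<oplus>\<^bsub>PA\<^esub> (cut t y (u, q) \<otimes>\<^bsub>PA\<^esub> (z :: 'v \<times> 'e list \<Rightarrow> 'f::field))"
proof
  fix vp :: "'v \<times> 'e list"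
  obtain v p where [simp]: "vp = (v, p)" by (cases vp)
  have m: "(y \<otimes>\<^bsub>PA\<^esub> z) (u, q @ a # p) =
      (\<Sum>k\<le>length q. y (u, take k q) * z (walk_end u (take k q), drop k q @ a # p)) +
      (\<Sum>j\<le>length p. y (u, q @ a # take j p) * z (walk_end (head Q a) (take j p), drop j p))" for a
  proof -
    have "(y \<otimes>\<^bsub>PA\<^esub> z) (u, q @ a # p) = (\<Sum>k\<le>length q + Suc (length p).
        y (u, take k (q @ a # p)) * z (walk_end u (take k (q @ a # p)), drop k (q @ a # p)))"
      by (simp add: path_algebra_simps(3))
    also have "\<dots> = (\<Sum>k\<le>length q. y (u, take k (q @ a # p)) * z (walk_end u (take k (q @ a # p)), drop k (q @ a # p))) +
      (\<Sum>j\<le>length p. y (u, take (Suc (length q) + j) (q @ a # p)) *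
        z (walk_end u (take (Suc (length q) + j) (q @ a # p)), drop (Suc (length q) + j) (q @ a # p)))"
      by (rule sum_split_at)
    finally show ?thesis by simp
  qed
  have "cut t (y \<otimes>\<^bsub>PA\<^esub> z) (u, q) (v, p) =
      (\<Sum>a\<in>arcs Q. (\<Sum>k\<le>length q. if head Q a = v then
          t a * (y (u, take k q) * z (walk_end u (take k q), drop k q @ a # p)) else 0) +
        (\<Sum>j\<le>length p. if head Q a = v then
          t a * (y (u, q @ a # take j p) * z (walk_end v (take j p), drop j p)) else 0))"
    unfolding cut_def prod.case m
    by (intro sum.cong refl) (auto simp: distrib_left sum_distrib_left)
  also have "\<dots> = (\<Sum>k\<le>length q. \<Sum>a\<in>arcs Q. if head Q a = v then
          t a * (y (u, take k q) * z (walk_end u (take k q), drop k q @ a # p)) else 0) +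
      (\<Sum>j\<le>length p. \<Sum>a\<in>arcs Q. if head Q a = v then
          t a * (y (u, q @ a # take j p) * z (walk_end v (take j p), drop j p)) else 0)"
    by (simp add: sum.distrib sum.swap[of _ _ "arcs Q"])
  also have "(\<Sum>k\<le>length q. \<Sum>a\<in>arcs Q. if head Q a = v then
          t a * (y (u, take k q) * z (walk_end u (take k q), drop k q @ a # p)) else 0) =
      (\<Sum>k\<le>length q. y (u, take k q) * cut t z (walk_end u (take k q), drop k q) (v, p))"
    unfolding cut_def by (intro sum.cong refl) (auto simp: sum_distrib_left mult_ac intro!: sum.cong)
  also have "(\<Sum>j\<le>length p. \<Sum>a\<in>arcs Q. if head Q a = v then
          t a * (y (u, q @ a # take j p) * z (walk_end v (take j p), drop j p)) else 0) =
      (cut t y (u, q) \<otimes>\<^bsub>PA\<^esub> z) (v, p)"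
    unfolding path_algebra_simps(3) cut_def
    by (intro sum.cong refl) (auto simp: sum_distrib_right sum_distrib_left mult_ac intro!: sum.cong)
  finally show "cut t (y \<otimes>\<^bsub>PA\<^esub> z) (u, q) vp = ((\<lambda>p. \<Sum>k\<le>length q. y (u, take k q) *
     cut t z (walk_end u (take k q), drop k q) p) \<oplus>\<^bsub>PA\<^esub> (cut t y (u, q) \<otimes>\<^bsub>PA\<^esub> z)) vp"
    by (simp add: path_algebra_simps(2))
qed

text \<open>
  The cocycle that is zero on vertices and sends an arrow \<^term>\<open>a\<close> and a functional \<^term>\<open>f\<close> to the
  multiple of the start of \<^term>\<open>a\<close> by \<^term>\<open>t a\<close> times the value of \<^term>\<open>f\<close> at the end of \<^term>\<open>a\<close>.
  The Leibniz rule forces its values on longer paths.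
\<close>

definition arc_cocycle ::
    "('e \<Rightarrow> 'f::field) \<Rightarrow> ('v \<times> 'e list \<Rightarrow> 'f) \<times> (('v \<times> 'e list \<Rightarrow> 'f) \<Rightarrow> 'f) \<Rightarrow> 'v \<times> 'e list \<Rightarrow> 'f" where
  "arc_cocycle t = (\<lambda>z\<in>carrier PA \<times> carrier (dual_bimod PA). (\<lambda>uq. snd z (cut t (fst z) uq)))"

text \<open>
  The Leibniz rule holds because a cut in a product of two paths lies either in the first or in the second
  (\<open>cut_mult\<close>).
\<close>

lemma arc_cocycle_closed:
  "arc_cocycle t \<in> carrier (bar_cocycles PA (dual_bimod PA) (regular_bimod (PA :: ('f::field, _) module)))"
proof -
  interpret A: falgebra "PA :: ('f, _) module" by (rule path_falgebra)
  have add: "cut t (x \<oplus>\<^bsub>PA\<^esub> y) uq = cut t x uq \<oplus>\<^bsub>PA\<^esub> cut t y uq" for x y uq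
    by (auto simp: cut_def path_algebra_simps fun_eq_iff sum.distrib[symmetric] distrib_left
        intro!: sum.cong split: prod.splits)
  have sm: "cut t (k \<odot>\<^bsub>PA\<^esub> x) uq = k \<odot>\<^bsub>PA\<^esub> cut t x uq" for x k uq
    by (auto simp: cut_def path_algebra_simps fun_eq_iff sum_distrib_left mult_ac
        intro!: sum.cong split: prod.splits)
  have f0: "f (\<lambda>p. 0) = 0" if "f \<in> carrier A.D" for f
    using dual_bimodD(2)[OF that A.zero_closed, of 0] A.smult_zero_l[OF A.zero_closed]
    by (simp add: path_algebra_simps(5))
  show ?thesis
    unfolding arc_cocycle_def
  proof (rule A.cocycleI, goal_cases)
    case (1 y f)
    have nz: "\<exists>p a. a \<in> arcs Q \<and> y (u, q @ a # p) \<noteq> 0" if "f (cut t y (u, q)) \<noteq> 0" for u q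
    proof -
      have "cut t y (u, q) \<noteq> (\<lambda>p. 0)" using that f0[OF 1(2)] by auto
      then show ?thesis using cut_nonzero[of t y u q] by (fastforce simp: fun_eq_iff)
    qed
    have "{uq. f (cut t y uq) \<noteq> 0} \<subseteq> (\<Union>(u, w)\<in>{p. y p \<noteq> 0}. (\<lambda>k. (u, take k w)) ` {..length w})"
    proof (rule subsetI)
      fix uq assume "uq \<in> {uq. f (cut t y uq) \<noteq> 0}"
      moreover obtain u q where uq: "uq = (u, q)" by (cases uq)
      ultimately have "f (cut t y (u, q)) \<noteq> 0" by simp
      from nz[OF this] obtain a p where "y (u, q @ a # p) \<noteq> 0" by blast
      moreover have "uq \<in> (\<lambda>k. (u, take k (q @ a # p))) ` {..length (q @ a # p)}"
        unfolding uq by (rule image_eqI[of _ _ "length q"]) simp_all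
      ultimately show "uq \<in> (\<Union>(u, w)\<in>{p. y p \<noteq> 0}. (\<lambda>k. (u, take k w)) ` {..length w})"
        by (intro UN_I[of "(u, q @ a # p)"]) simp_all
    qed
    moreover have "finite (\<Union>(u, w)\<in>{p. y p \<noteq> 0}. (\<lambda>k. (u, take k w)) ` {..length w})"
      using 1(1) by (auto simp: path_algebra_simps(1))
    ultimately have "finite {uq. f (cut t y uq) \<noteq> 0}" by (rule finite_subset)
    moreover have "(u, q) \<in> quiver_paths Q" if "f (cut t y (u, q)) \<noteq> 0" for u q
    proof -
      from nz[OF that] obtain a p where "y (u, q @ a # p) \<noteq> 0" by blast
      then have "(u, q @ a # p) \<in> quiver_paths Q" using 1(1) unfolding path_algebra_simps(1) by blast
      then show ?thesis by simp
    qed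
    ultimately show ?case by (simp add: path_algebra_simps(1) split_paired_all)
  next
    case (2 y f g)
    then show ?case by (simp add: dual_bimod_simps cut_closed path_algebra_simps(2))
  next
    case (3 y f k)
    then show ?case by (simp add: dual_bimod_simps cut_closed path_algebra_simps(6))
  next
    case (4 x y f)
    then show ?case
      by (simp add: add dual_bimodD(1)[OF 4(3)] cut_closed) (simp add: path_algebra_simps(2))
  next
    case (5 y f k)
    then show ?case
      by (simp add: sm dual_bimodD(2)[OF 5(2)] cut_closed) (simp add: path_algebra_simps(6))
  next
    case (6 y z f)
    show ?case
    proof
      fix uq :: "'v \<times> 'e list"
      obtain u q where [simp]: "uq = (u, q)" by (cases uq)
      let ?s = "\<lambda>p. \<Sum>k\<le>length q. y (u, take k q) * cut t z (walk_end u (take k q), drop k q) p"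
      have s: "?s \<in> carrier PA"
        "f ?s = (\<Sum>k\<le>length q. y (u, take k q) * f (cut t z (walk_end u (take k q), drop k q)))"
        using dual_sum[OF 6(3), of "{..length q}" "\<lambda>k. cut t z (walk_end u (take k q), drop k q)"]
          cut_closed[OF 6(2)] by auto
      have "f (cut t (y \<otimes>\<^bsub>PA\<^esub> z) (u, q)) = f ?s + f (cut t y (u, q) \<otimes>\<^bsub>PA\<^esub> z)"
        unfolding cut_mult
        by (rule dual_bimodD(1)[OF 6(3) s(1)]) (use 6 cut_closed path_mult_closed in blast)
      then show "snd (y \<otimes>\<^bsub>PA\<^esub> z, f) (cut t (fst (y \<otimes>\<^bsub>PA\<^esub> z, f)) uq) =
          (y \<otimes>\<^bsub>PA\<^esub> (\<lambda>uq. snd (z, f) (cut t (fst (z, f)) uq)) \<oplus>\<^bsub>PA\<^esub>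
            (\<lambda>uq. snd (y, lact A.D z f) (cut t (fst (y, lact A.D z f)) uq))) uq"
        using 6 by (simp add: s(2) path_algebra_simps(2,3) dual_bimod_simps cut_closed)
    qed
  qed
qed

lemma arc_cocycle_vertex:
  assumes "s \<in> carrier (vertex_algebra Q)" "f \<in> carrier (dual_bimod PA)"
  shows "arc_cocycle t (vertex_incl s, f) = (\<lambda>p. 0 :: 'f::field)"
proof -
  interpret A: falgebra "PA :: ('f, _) module" by (rule path_falgebra)
  have "cut t (vertex_incl s) uq = \<zero>\<^bsub>PA\<^esub>" for uq
    by (auto simp: cut_def vertex_incl_def path_algebra_simps(5) fun_eq_iff intro!: sum.neutral
        split: prod.splits)
  moreover have "f \<zero>\<^bsub>PA\<^esub> = 0" using dual_bimodD(2)[OF assms(2) A.zero_closed, of 0] by simp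
  ultimately show ?thesis using assms by (simp add: arc_cocycle_def vertex_incl_closed)
qed

lemma arc_cocycle_arrow:
  assumes x: "x \<in> carrier (arrow_bimod Q)" and f: "f \<in> carrier (dual_bimod PA)"
  shows "arc_cocycle t (arrow_incl Q x, f) = vertex_incl (\<lambda>i. \<Sum>j\<in>verts Q.
    (\<Sum>a\<in>arcs Q. if tail Q a = i \<and> head Q a = j then x a * t a else (0 :: 'f::field)) * f (vertex_incl (unit_fun j)))"
proof
  fix uq :: "'v \<times> 'e list"
  obtain u q where [simp]: "uq = (u, q)" by (cases uq)
  interpret A: falgebra "PA :: ('f, _) module" by (rule path_falgebra)
  have "f \<zero>\<^bsub>PA\<^esub> = 0" using dual_bimodD(2)[OF f A.zero_closed, of 0] by simp
  then have f0: "f (\<lambda>p. 0) = 0" by (simp add: path_algebra_simps(5))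
  let ?r = "\<lambda>j. \<Sum>a\<in>arcs Q. if tail Q a = u \<and> head Q a = j then x a * t a else 0"
  have val: "arc_cocycle t (arrow_incl Q x, f) (u, q) = f (cut t (arrow_incl Q x) (u, q))"
    using assms by (simp add: arc_cocycle_def arrow_incl_closed)
  show "arc_cocycle t (arrow_incl Q x, f) uq = vertex_incl (\<lambda>i. \<Sum>j\<in>verts Q.
    (\<Sum>a\<in>arcs Q. if tail Q a = i \<and> head Q a = j then x a * t a else 0) * f (vertex_incl (unit_fun j))) uq"
  proof (cases "q = []")
    case False
    have "arrow_incl Q x (u, q @ a # p) = 0" for a p
      using False arrow_incl_nonzero[of x u "q @ a # p"] by (auto simp: append_eq_Cons_conv)
    then have "cut t (arrow_incl Q x) (u, q) = (\<lambda>p. 0)" by (auto simp: cut_def fun_eq_iff intro!: sum.neutral)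
    then show ?thesis using False f0 by (simp add: val vertex_incl_def)
  next
    case True
    have "cut t (arrow_incl Q x) (u, []) (v, p) = (\<Sum>j\<in>verts Q. ?r j * vertex_incl (unit_fun j) (v, p))" for v p
    proof -
      have l: "cut t (arrow_incl Q x) (u, []) (v, p) = (if p = [] then ?r v else 0)"
      proof -
        have "arrow_incl Q x (u, [] @ a # p) = (if p = [] \<and> u = tail Q a then x a else 0)" for a
          by (auto simp: arrow_incl_def split: list.splits)
        then show ?thesis
          by (cases "p = []") (auto simp: cut_def intro!: sum.cong sum.neutral)
      qed
      have "(\<Sum>j\<in>verts Q. ?r j * vertex_incl (unit_fun j) (v, p)) =
          (\<Sum>j\<in>verts Q. if j = v then (if p = [] then ?r v else 0) else 0)"
        by (intro sum.cong refl) (auto simp: vertex_incl_def unit_fun_def)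
      also have "\<dots> = (if v \<in> verts Q then (if p = [] then ?r v else 0) else 0)" by simp
      also have "\<dots> = (if p = [] then ?r v else 0)"
        by (cases "v \<in> verts Q") (auto intro!: sum.neutral)
      finally show ?thesis using l by simp
    qed
    then have eq: "cut t (arrow_incl Q x) (u, []) = (\<lambda>p. \<Sum>j\<in>verts Q. ?r j * vertex_incl (unit_fun j) p)"
      by (simp add: fun_eq_iff)
    have cl: "vertex_incl (unit_fun j) \<in> carrier (PA :: ('f, _) module)" if "j \<in> verts Q" for j
      using that by (intro vertex_incl_closed) (auto simp: fun_algebra_simps unit_fun_def)
    have "f (cut t (arrow_incl Q x) (u, [])) = (\<Sum>j\<in>verts Q. ?r j * f (vertex_incl (unit_fun j)))"
      unfolding eq by (rule dual_sum[OF f finite_verts cl, THEN conjunct2])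
    then show ?thesis using True val by (simp add: vertex_incl_def)
  qed
qed

end


section \<open>The double quiver and the preprojective relations\<close>

context finite_quiver
begin

abbreviation "SA \<equiv> vertex_algebra Q"
abbreviation "V \<equiv> arrow_bimod Q"
abbreviation "Vd \<equiv> env_dual Q (arrow_bimod Q)"

lemma arrow_simps:
  "x \<in> carrier V \<longleftrightarrow> (\<forall>a. a \<notin> arcs Q \<longrightarrow> x a = 0)" "\<zero>\<^bsub>V\<^esub> = (\<lambda>a. 0)"
  "x \<oplus>\<^bsub>V\<^esub> y = (\<lambda>a. x a + y a)" "c \<odot>\<^bsub>V\<^esub> x = (\<lambda>a. c * x a)"
  "lact V s x = (\<lambda>a. s (tail Q a) * x a)" "ract V x s = (\<lambda>a. x a * s (head Q a))"
  by (simp_all add: arrow_bimod_def)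

lemma arrow_coord:
  "coord_bimod (verts Q) (arcs Q) (tail Q) (head Q) (V :: ('f::field, _, _) bimod) (\<lambda>x. x)"
  by unfold_locales (auto simp: arrow_simps bij_betw_def)

lemma arrow_lift:
  assumes "x \<in> carrier (V :: ('f::field, _, _) bimod)"
  shows "coord_bimod.lift V (\<lambda>x. x) x = x"
proof -
  interpret V: coord_bimod "verts Q" "arcs Q" "tail Q" "head Q" "V :: ('f, _, _) bimod" "\<lambda>x. x"
    by (rule arrow_coord)
  show ?thesis using V.co_lift[of x] assms by (simp add: arrow_simps)
qed

lemma unit_arrow_closed: "a \<in> arcs Q \<Longrightarrow> unit_fun a \<in> carrier (V :: ('f::field, _, _) bimod)"
  by (auto simp: arrow_simps unit_fun_def)

lemma env_simps:
  "\<zero>\<^bsub>Vd\<^esub> = (\<lambda>x\<in>carrier V. \<lambda>ij. 0)"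
  "h \<oplus>\<^bsub>Vd\<^esub> k = (\<lambda>x\<in>carrier V. \<lambda>ij. h x ij + k x ij)"
  "c \<odot>\<^bsub>Vd\<^esub> h = (\<lambda>x\<in>carrier V. \<lambda>ij. c * h x ij)"
  "lact Vd s h = (\<lambda>x\<in>carrier V. \<lambda>ij. h x ij * ((if fst ij \<in> verts Q then 1 else 0) * s (snd ij)))"
  "ract Vd h s = (\<lambda>x\<in>carrier V. \<lambda>ij. h x ij * (s (fst ij) * (if snd ij \<in> verts Q then 1 else 0)))"
  by (simp_all add: env_dual_def Let_def fun_algebra_simps pure_tensor_def split_def)

lemma envD:
  assumes "h \<in> carrier (Vd :: ('f::field, _, _) bimod)"
  shows "x \<in> carrier V \<Longrightarrow> ij \<notin> verts Q \<times> verts Q \<Longrightarrow> h x ij = 0"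
    and "x \<notin> carrier V \<Longrightarrow> h x = undefined"
    and "x \<in> carrier V \<Longrightarrow> y \<in> carrier V \<Longrightarrow> h (\<lambda>a. x a + y a) ij = h x ij + h y ij"
    and "x \<in> carrier V \<Longrightarrow> h (\<lambda>a. c * x a) ij = c * h x ij"
    and "s \<in> carrier SA \<Longrightarrow> t \<in> carrier SA \<Longrightarrow> x \<in> carrier V \<Longrightarrow>
      h (\<lambda>a. s (tail Q a) * (x a * t (head Q a))) (i, j) = s i * t j * h x (i, j)"
proof -
  have h: "h \<in> carrier V \<rightarrow>\<^sub>E carrier (vertex_env Q)"
    "\<forall>x\<in>carrier V. \<forall>y\<in>carrier V. h (x \<oplus>\<^bsub>V\<^esub> y) = h x \<oplus>\<^bsub>vertex_env Q\<^esub> h y"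
    "\<forall>c. \<forall>x\<in>carrier V. h (c \<odot>\<^bsub>V\<^esub> x) = c \<odot>\<^bsub>vertex_env Q\<^esub> h x"
    "\<forall>s\<in>carrier SA. \<forall>t\<in>carrier SA. \<forall>x\<in>carrier V. h (lact V s (ract V x t)) = pure_tensor s t \<otimes>\<^bsub>vertex_env Q\<^esub> h x"
    using assms by (simp_all add: env_dual_def Let_def linear_maps_def)
  show "x \<in> carrier V \<Longrightarrow> ij \<notin> verts Q \<times> verts Q \<Longrightarrow> h x ij = 0"
    using PiE_mem[OF h(1), of x] unfolding fun_algebra_simps(1) by blast
  show "x \<notin> carrier V \<Longrightarrow> h x = undefined" by (rule PiE_arb[OF h(1)])
  show "x \<in> carrier V \<Longrightarrow> y \<in> carrier V \<Longrightarrow> h (\<lambda>a. x a + y a) ij = h x ij + h y ij"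
    using h(2) by (simp add: arrow_simps(3) fun_algebra_simps(2))
  show "x \<in> carrier V \<Longrightarrow> h (\<lambda>a. c * x a) ij = c * h x ij"
    using h(3) by (simp add: arrow_simps(4) fun_algebra_simps(6))
  show "s \<in> carrier SA \<Longrightarrow> t \<in> carrier SA \<Longrightarrow> x \<in> carrier V \<Longrightarrow>
      h (\<lambda>a. s (tail Q a) * (x a * t (head Q a))) (i, j) = s i * t j * h x (i, j)"
    using h(4) by (simp add: arrow_simps(5,6) fun_algebra_simps(3) pure_tensor_def)
qed

lemma envI:
  fixes h :: "('e \<Rightarrow> 'f::field) \<Rightarrow> 'v \<times> 'v \<Rightarrow> 'f"
  assumes "\<And>x ij. x \<in> carrier V \<Longrightarrow> ij \<notin> verts Q \<times> verts Q \<Longrightarrow> h x ij = 0"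
    and "\<And>x y ij. x \<in> carrier V \<Longrightarrow> y \<in> carrier V \<Longrightarrow> h (\<lambda>a. x a + y a) ij = h x ij + h y ij"
    and "\<And>x c ij. x \<in> carrier V \<Longrightarrow> h (\<lambda>a. c * x a) ij = c * h x ij"
    and "\<And>s t x i j. s \<in> carrier SA \<Longrightarrow> t \<in> carrier SA \<Longrightarrow> x \<in> carrier V \<Longrightarrow>
      h (\<lambda>a. s (tail Q a) * (x a * t (head Q a))) (i, j) = s i * t j * h x (i, j)"
  shows "(\<lambda>x\<in>carrier V. h x) \<in> carrier Vd"
proof -
  interpret V: coord_bimod "verts Q" "arcs Q" "tail Q" "head Q" "V :: ('f, _, _) bimod" "\<lambda>x. x"
    by (rule arrow_coord)
  have "(\<lambda>x\<in>carrier V. h x) \<in> linear_maps V (vertex_env Q)"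
    unfolding linear_maps_def mem_Collect_eq
  proof (intro conjI ballI allI)
    show "(\<lambda>x\<in>carrier V. h x) \<in> carrier V \<rightarrow>\<^sub>E carrier (vertex_env Q)"
      using assms(1) by (auto simp: fun_algebra_simps(1))
    fix x assume x: "x \<in> carrier (V :: ('f, _, _) bimod)"
    show "(\<lambda>x\<in>carrier V. h x) (c \<odot>\<^bsub>V\<^esub> x) = c \<odot>\<^bsub>vertex_env Q\<^esub> (\<lambda>x\<in>carrier V. h x) x" for c
      using V.smult_closed[OF x, of c] x assms(3)
      by (simp add: fun_eq_iff arrow_simps(4) fun_algebra_simps(6))
    fix y assume y: "y \<in> carrier (V :: ('f, _, _) bimod)"
    show "(\<lambda>x\<in>carrier V. h x) (x \<oplus>\<^bsub>V\<^esub> y) = (\<lambda>x\<in>carrier V. h x) x \<oplus>\<^bsub>vertex_env Q\<^esub> (\<lambda>x\<in>carrier V. h x) y"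
      using V.add_closed[OF x y] x y assms(2)
      by (simp add: fun_eq_iff arrow_simps(3) fun_algebra_simps(2))
  qed
  moreover have "(\<lambda>x\<in>carrier V. h x) (lact V s (ract V x t)) =
      pure_tensor s t \<otimes>\<^bsub>vertex_env Q\<^esub> (\<lambda>x\<in>carrier V. h x) x"
    if st: "s \<in> carrier SA" "t \<in> carrier SA" "x \<in> carrier V" for s t x
  proof -
    have "lact V s (ract V x t) \<in> carrier V" using st by (intro V.lact_closed V.ract_closed)
    then show ?thesis using st assms(4)[OF st]
      by (simp add: fun_eq_iff arrow_simps(5,6) fun_algebra_simps(3) pure_tensor_def split_paired_all)
  qed
  ultimately show ?thesis by (simp add: env_dual_def Let_def)
qed

definition eco :: "(('e \<Rightarrow> 'f::field) \<Rightarrow> 'v \<times> 'v \<Rightarrow> 'f) \<Rightarrow> 'e \<Rightarrow> 'f" where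
  "eco \<theta> a = (if a \<in> arcs Q then \<theta> (unit_fun a) (tail Q a, head Q a) else 0)"

lemma env_expand:
  assumes \<theta>: "\<theta> \<in> carrier (Vd :: ('f::field, _, _) bimod)" and x: "x \<in> carrier V"
  shows "\<theta> x (i, j) = (\<Sum>a\<in>arcs Q. if tail Q a = i \<and> head Q a = j then x a * eco \<theta> a else 0)"
proof -
  interpret V: coord_bimod "verts Q" "arcs Q" "tail Q" "head Q" "V :: ('f, _, _) bimod" "\<lambda>x. x"
    by (rule arrow_coord)
  have b: "\<theta> (unit_fun a) (i, j) = (if tail Q a = i \<and> head Q a = j then eco \<theta> a else 0)" if a: "a \<in> arcs Q" for a
  proof -
    have s: "unit_fun (tail Q a) \<in> carrier (SA :: ('f, _) module)" "unit_fun (head Q a) \<in> carrier (SA :: ('f, _) module)"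
      using a by (auto simp: fun_algebra_simps unit_fun_def)
    have "(\<lambda>b. unit_fun (tail Q a) (tail Q b) * (unit_fun a b * unit_fun (head Q a) (head Q b))) =
        (unit_fun a :: 'e \<Rightarrow> 'f)"
      by (auto simp: unit_fun_def fun_eq_iff)
    then have "\<theta> (unit_fun a) (i, j) = unit_fun (tail Q a) i * unit_fun (head Q a) j * \<theta> (unit_fun a) (i, j)"
      using envD(5)[OF \<theta> s unit_arrow_closed[OF a], of i j] by simp
    then show ?thesis using a by (auto simp: eco_def unit_fun_def split: if_splits)
  qed
  have "\<theta> x (i, j) = (\<Sum>a\<in>arcs Q. x a * \<theta> (V.basis a) (i, j))"
    by (rule V.linear_expand[where h = "\<lambda>x. \<theta> x (i, j)", OF x])
      (simp_all add: arrow_simps(3,4) envD(3,4)[OF \<theta>])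
  also have "\<dots> = (\<Sum>a\<in>arcs Q. if tail Q a = i \<and> head Q a = j then x a * eco \<theta> a else 0)"
    by (intro sum.cong refl) (simp add: b arrow_lift unit_arrow_closed)
  finally show ?thesis .
qed

lemma env_mk:
  "(\<lambda>x\<in>carrier V. \<lambda>(i, j). \<Sum>a\<in>arcs Q. if tail Q a = i \<and> head Q a = j then x a * z a else 0)
    \<in> carrier (Vd :: ('f::field, _, _) bimod)"
proof (rule envI, goal_cases)
  case (1 x ij)
  obtain i j where [simp]: "ij = (i, j)" by (cases ij)
  show ?case using 1 by (auto intro!: sum.neutral)
next
  case (2 x y ij)
  obtain i j where [simp]: "ij = (i, j)" by (cases ij)
  show ?case by (auto simp: sum.distrib[symmetric] distrib_right intro!: sum.cong)
next
  case (3 x c ij)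
  obtain i j where [simp]: "ij = (i, j)" by (cases ij)
  show ?case by (auto simp: sum_distrib_left mult.assoc intro!: sum.cong)
next
  case (4 s t x i j)
  show ?case by (auto simp: sum_distrib_left mult_ac intro!: sum.cong)
qed

text \<open>
  A bimodule map out of the arrows is determined by one coefficient for each arrow. The inner action exchanges
  the two ends, so these coordinates belong to the reversed arrows.
\<close>

lemma env_coord:
  "coord_bimod (verts Q) (arcs Q) (head Q) (tail Q) (Vd :: ('f::field, _, _) bimod) eco"
proof -
  interpret V: coord_bimod "verts Q" "arcs Q" "tail Q" "head Q" "V :: ('f, _, _) bimod" "\<lambda>x. x"
    by (rule arrow_coord)
  have inj: "h = k" if "h \<in> carrier Vd" "k \<in> carrier Vd" "eco h = eco k"
    for h k :: "('e \<Rightarrow> 'f) \<Rightarrow> 'v \<times> 'v \<Rightarrow> 'f"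
  proof
    fix x
    show "h x = k x"
    proof (cases "x \<in> carrier (V :: ('f, _, _) bimod)")
      case True
      show ?thesis
      proof
        fix ij :: "'v \<times> 'v"
        show "h x ij = k x ij"
          using env_expand[OF that(1) True] env_expand[OF that(2) True] that(3)
          by (cases ij) (simp cong: if_cong)
      qed
    next
      case False
      then show ?thesis using envD(2)[OF that(1)] envD(2)[OF that(2)] by simp
    qed
  qed
  have val: "eco (\<lambda>x\<in>carrier V. \<lambda>(i, j). \<Sum>a\<in>arcs Q. if tail Q a = i \<and> head Q a = j then x a * z a else 0) = z"
    if "\<And>a. a \<notin> arcs Q \<Longrightarrow> z a = 0" for z :: "'e \<Rightarrow> 'f"
  proof
    fix a
    have "(\<Sum>c\<in>arcs Q. if tail Q c = tail Q a \<and> head Q c = head Q a then unit_fun a c * z c else 0) =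
        (\<Sum>c\<in>arcs Q. if c = a then z c else 0)"
      by (intro sum.cong refl) (auto simp: unit_fun_def)
    then show "eco (\<lambda>x\<in>carrier V. \<lambda>(i, j). \<Sum>a\<in>arcs Q. if tail Q a = i \<and> head Q a = j then x a * z a else 0) a = z a"
      using that by (auto simp: eco_def unit_arrow_closed)
  qed
  have bij: "bij_betw eco (carrier Vd) {u :: 'e \<Rightarrow> 'f. \<forall>b. b \<notin> arcs Q \<longrightarrow> u b = 0}"
    unfolding bij_betw_def
  proof
    show "inj_on eco (carrier (Vd :: ('f, _, _) bimod))" using inj by (blast intro: inj_onI)
    show "eco ` carrier Vd = {u :: 'e \<Rightarrow> 'f. \<forall>b. b \<notin> arcs Q \<longrightarrow> u b = 0}"
    proof (intro equalityI subsetI)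
      fix z :: "'e \<Rightarrow> 'f" assume "z \<in> {u. \<forall>b. b \<notin> arcs Q \<longrightarrow> u b = 0}"
      then have z: "\<And>b. b \<notin> arcs Q \<Longrightarrow> z b = 0" by simp
      define h where "h = (\<lambda>x\<in>carrier V. \<lambda>(i, j). \<Sum>a\<in>arcs Q. if tail Q a = i \<and> head Q a = j then x a * z a else 0)"
      have "eco h = z" unfolding h_def by (rule val) (rule z)
      moreover have "h \<in> carrier Vd" unfolding h_def by (rule env_mk)
      ultimately show "z \<in> eco ` carrier Vd" by (intro image_eqI[of z eco h]) simp_all
    next
      fix z assume "z \<in> eco ` carrier (Vd :: ('f, _, _) bimod)"
      then obtain h where "z = eco h" by blast
      then show "z \<in> {u. \<forall>b. b \<notin> arcs Q \<longrightarrow> u b = 0}" by (simp add: eco_def)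
    qed
  qed
  note fa = fun_algebra_simps
  show ?thesis
  proof (unfold_locales, goal_cases)
    case 6
    show ?case unfolding env_simps by (rule envI) simp_all
  next
    case (7 h k)
    show ?case unfolding env_simps
      by (rule envI)
        (simp_all add: envD(1,3-5)[OF 7(1)] envD(1,3-5)[OF 7(2)], (simp_all add: algebra_simps)?)
  next
    case (8 h c)
    show ?case unfolding env_simps
      by (rule envI) (simp_all add: envD(1,3-5)[OF 8], (simp_all add: algebra_simps)?)
  next
    case (9 s h)
    show ?case unfolding env_simps
      by (rule envI) (simp_all add: envD(1,3-5)[OF 9(2)], (simp_all add: algebra_simps)?)
  next
    case (10 s h)
    show ?case unfolding env_simps
      by (rule envI) (simp_all add: envD(1,3-5)[OF 10(2)], (simp_all add: algebra_simps)?)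
  qed (simp_all add: bij env_simps eco_def unit_arrow_closed)
qed

abbreviation "arcs2 \<equiv> arcs Q <+> arcs Q"
abbreviation "src2 \<equiv> case_sum (tail Q) (head Q)"
abbreviation "tgt2 \<equiv> case_sum (head Q) (tail Q)"
abbreviation "U2 \<equiv> double_bimod Q"

definition dbl_co :: "('f::field, 'v, 'e) dbl \<Rightarrow> 'e + 'e \<Rightarrow> 'f" where
  "dbl_co = (\<lambda>(x, \<theta>). case_sum x (eco \<theta>))"

lemma double_coord:
  "coord_bimod (verts Q) arcs2 src2 tgt2 (U2 :: ('f::field, _, ('f, 'v, 'e) dbl) bimod) dbl_co"
  using direct_sum_coord[OF arrow_coord env_coord]
  unfolding double_bimod_def dbl_co_def by simp

lemma vertex_incl_mult:
  "(vertex_incl s \<otimes>\<^bsub>PA\<^esub> y) (u, p) = s u * (y (u, p) :: 'f::field)"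
  "(y \<otimes>\<^bsub>PA\<^esub> vertex_incl s) (u, p) = y (u, p) * s (walk_end u p)"
proof -
  have "(vertex_incl s \<otimes>\<^bsub>PA\<^esub> y) (u, p) = (\<Sum>k\<le>length p. if k = 0 then s u * y (u, p) else 0)"
    unfolding path_algebra_simps by (intro sum.cong refl) (auto simp: vertex_incl_def)
  then show "(vertex_incl s \<otimes>\<^bsub>PA\<^esub> y) (u, p) = s u * y (u, p)" by simp
  have "(y \<otimes>\<^bsub>PA\<^esub> vertex_incl s) (u, p) = (\<Sum>k\<le>length p. if k = length p then y (u, p) * s (walk_end u p) else 0)"
    unfolding path_algebra_simps by (intro sum.cong refl) (auto simp: vertex_incl_def)
  then show "(y \<otimes>\<^bsub>PA\<^esub> vertex_incl s) (u, p) = y (u, p) * s (walk_end u p)" by simp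
qed

lemma unit_vertex_closed: "i \<in> verts Q \<Longrightarrow> unit_fun i \<in> carrier (SA :: ('f::field, _) module)"
  by (auto simp: fun_algebra_simps unit_fun_def)

abbreviation "DA \<equiv> dual_bimod (path_algebra Q)"
abbreviation "ZA \<equiv> bar_cocycles (path_algebra Q) (dual_bimod (path_algebra Q)) (regular_bimod (path_algebra Q))"
abbreviation "BA \<equiv> bar_coboundaries (path_algebra Q) (dual_bimod (path_algebra Q)) (regular_bimod (path_algebra Q))"

lemma arc_cocycle_unit:
  assumes "a \<in> arcs Q" "f \<in> carrier (DA :: ('f::field, _, _) bimod)"
  shows "arc_cocycle t (arrow_incl Q (unit_fun a), f) =
    vertex_incl (\<lambda>i. if i = tail Q a then t a * f (vertex_incl (unit_fun (head Q a))) else 0)"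
proof -
  have "(\<Sum>j\<in>verts Q. (\<Sum>b\<in>arcs Q. if tail Q b = i \<and> head Q b = j then unit_fun a b * t b else 0) *
        f (vertex_incl (unit_fun j))) =
      (if i = tail Q a then t a * f (vertex_incl (unit_fun (head Q a))) else 0)" for i
  proof -
    have 1: "(\<Sum>b\<in>arcs Q. if tail Q b = i \<and> head Q b = j then unit_fun a b * t b else 0) =
        (if tail Q a = i \<and> head Q a = j then t a else 0)" for j
    proof -
      have "(\<Sum>b\<in>arcs Q. if tail Q b = i \<and> head Q b = j then unit_fun a b * t b else 0) =
          (\<Sum>b\<in>arcs Q. if b = a then (if tail Q a = i \<and> head Q a = j then t a else 0) else 0)"
        by (intro sum.cong refl) (auto simp: unit_fun_def)
      then show ?thesis using assms(1) by simp
    qed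
    have "(\<Sum>j\<in>verts Q. (if tail Q a = i \<and> head Q a = j then t a else 0) * f (vertex_incl (unit_fun j))) =
        (\<Sum>j\<in>verts Q. if j = head Q a then
          (if i = tail Q a then t a * f (vertex_incl (unit_fun (head Q a))) else 0) else 0)"
      by (intro sum.cong refl) auto
    then show ?thesis unfolding 1 using assms(1) by simp
  qed
  then show ?thesis
    using arc_cocycle_arrow[OF unit_arrow_closed[OF assms(1)] assms(2)] by simp
qed

text \<open>
  The definite description in \<open>ext_cocycle\<close> is met by the cocycle cutting paths with the weights
  \<open>eco \<theta>\<close>, and only by it, since cocycles are determined on vertices and arrows.
\<close>

lemma ext_cocycle_eq:
  assumes \<theta>: "\<theta> \<in> carrier (Vd :: ('f::field, _, _) bimod)"
  shows "ext_cocycle Q \<theta> = arc_cocycle (eco \<theta>)"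
proof -
  interpret A: falgebra "PA :: ('f, _) module" by (rule path_falgebra)
  let ?P = "\<lambda>c. c \<in> carrier ZA \<and>
      (\<forall>s\<in>carrier (vertex_algebra Q). \<forall>f\<in>carrier DA. c (vertex_incl s, f) = \<zero>\<^bsub>PA\<^esub>) \<and>
      (\<forall>x\<in>carrier (arrow_bimod Q). \<forall>f\<in>carrier DA. c (arrow_incl Q x, f) =
         vertex_incl (\<lambda>i. \<Sum>j\<in>verts Q. \<theta> x (i, j) * f (vertex_incl (\<lambda>k. if k = j then 1 else 0))))"
  have P: "?P (arc_cocycle (eco \<theta>))"
    by (auto simp: arc_cocycle_closed arc_cocycle_vertex arc_cocycle_arrow path_algebra_simps(5)
        env_expand[OF \<theta>] unit_fun_def)
  have "c = arc_cocycle (eco \<theta>)" if c: "?P c" for c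
  proof (rule cocycle_determined)
    show "c \<in> carrier ZA" using c by blast
    show "arc_cocycle (eco \<theta>) \<in> carrier ZA" by (rule arc_cocycle_closed)
    show "c (vertex_incl (unit_fun i), f) = arc_cocycle (eco \<theta>) (vertex_incl (unit_fun i), f)"
      if "i \<in> verts Q" "f \<in> carrier DA" for i f
    proof -
      have "unit_fun i \<in> carrier (SA :: ('f, _) module)" by (rule unit_vertex_closed[OF that(1)])
      then show ?thesis using c P that by simp
    qed
    show "c (arrow_incl Q (unit_fun a), f) = arc_cocycle (eco \<theta>) (arrow_incl Q (unit_fun a), f)"
      if "a \<in> arcs Q" "f \<in> carrier DA" for a f
    proof -
      have "unit_fun a \<in> carrier (V :: ('f, _, _) bimod)" by (rule unit_arrow_closed[OF that(1)])
      then show ?thesis using c P that by simp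
    qed
  qed
  then have "(THE c. ?P c) = arc_cocycle (eco \<theta>)" using P by (intro the_equality) blast+
  then show ?thesis unfolding ext_cocycle_def Let_def .
qed

lemma arc_cocycle_ops:
  fixes t t' :: "'e \<Rightarrow> 'f::field"
  shows "arc_cocycle t \<oplus>\<^bsub>ZA\<^esub> arc_cocycle t' = arc_cocycle (\<lambda>a. t a + t' a)"
    and "k \<odot>\<^bsub>ZA\<^esub> arc_cocycle t = arc_cocycle (\<lambda>a. k * t a)"
    and "s \<in> carrier SA \<Longrightarrow> lact ZA (vertex_incl s) (arc_cocycle t) = arc_cocycle (\<lambda>a. s (head Q a) * t a)"
    and "s \<in> carrier SA \<Longrightarrow> ract ZA (arc_cocycle t) (vertex_incl s) = arc_cocycle (\<lambda>a. t a * s (tail Q a))"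
proof -
  interpret A: falgebra "PA :: ('f, _) module" by (rule path_falgebra)
  note cl = arc_cocycle_closed vertex_incl_closed unit_vertex_closed arrow_incl_closed unit_arrow_closed
  note vals = A.cocycle_ops arc_cocycle_vertex arc_cocycle_unit cl path_algebra_simps(2,6)
  have vi: "vertex_incl (\<lambda>i. if i = j then x else 0) = (\<lambda>(u, p). if u = j \<and> p = [] then x else (0 :: 'f))" for j x
    by (auto simp: vertex_incl_def fun_eq_iff)
  show "arc_cocycle t \<oplus>\<^bsub>ZA\<^esub> arc_cocycle t' = arc_cocycle (\<lambda>a. t a + t' a)"
    by (rule cocycle_determined)
      (simp_all add: cl, simp_all add: vals, simp_all add: vi fun_eq_iff distrib_right)
  show "k \<odot>\<^bsub>ZA\<^esub> arc_cocycle t = arc_cocycle (\<lambda>a. k * t a)"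
    by (rule cocycle_determined)
      (simp_all add: cl, simp_all add: vals, simp_all add: vi fun_eq_iff mult.assoc)
  show "lact ZA (vertex_incl s) (arc_cocycle t) = arc_cocycle (\<lambda>a. s (head Q a) * t a)"
    if s: "s \<in> carrier SA"
  proof -
    have "ract DA f (vertex_incl s) (vertex_incl (unit_fun j)) = s j * f (vertex_incl (unit_fun j))"
      if "f \<in> carrier DA" "j \<in> verts Q" for f j
    proof -
      have "vertex_incl s \<otimes>\<^bsub>PA\<^esub> vertex_incl (unit_fun j) = s j \<odot>\<^bsub>PA\<^esub> vertex_incl (unit_fun j)"
        by (simp add: fun_eq_iff split_paired_all vertex_incl_mult path_algebra_simps(6))
          (auto simp: vertex_incl_def unit_fun_def)
      moreover have "vertex_incl (unit_fun j) \<in> carrier (PA :: ('f, _) module)"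
        by (intro vertex_incl_closed unit_vertex_closed that(2))
      ultimately show ?thesis using that by (simp add: dual_bimod_simps dual_bimodD(2)[OF that(1)])
    qed
    note r = this
    show ?thesis
    proof (rule cocycle_determined)
      show "lact ZA (vertex_incl s) (arc_cocycle t) \<in> carrier ZA" by (simp add: cl s)
      show "arc_cocycle (\<lambda>a. s (head Q a) * t a) \<in> carrier ZA" by (rule arc_cocycle_closed)
      show "lact ZA (vertex_incl s) (arc_cocycle t) (vertex_incl (unit_fun i), f) =
          arc_cocycle (\<lambda>a. s (head Q a) * t a) (vertex_incl (unit_fun i), f)"
        if "i \<in> verts Q" "f \<in> carrier DA" for i f
        using that s by (simp add: vals)
      show "lact ZA (vertex_incl s) (arc_cocycle t) (arrow_incl Q (unit_fun a), f) =
          arc_cocycle (\<lambda>a. s (head Q a) * t a) (arrow_incl Q (unit_fun a), f)"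
        if "a \<in> arcs Q" "f \<in> carrier DA" for a f
        using that s
        by (simp add: vals) (rule arg_cong[where f = vertex_incl], auto simp: fun_eq_iff mult_ac r)
    qed
  qed
  show "ract ZA (arc_cocycle t) (vertex_incl s) = arc_cocycle (\<lambda>a. t a * s (tail Q a))"
    if s: "s \<in> carrier SA"
  proof (rule cocycle_determined)
    have z: "(\<lambda>p. 0) \<otimes>\<^bsub>PA\<^esub> vertex_incl s = (\<lambda>p. 0)"
      by (simp add: fun_eq_iff split_paired_all vertex_incl_mult)
    show "ract ZA (arc_cocycle t) (vertex_incl s) \<in> carrier ZA" by (simp add: cl s)
    show "arc_cocycle (\<lambda>a. t a * s (tail Q a)) \<in> carrier ZA" by (rule arc_cocycle_closed)
    show "ract ZA (arc_cocycle t) (vertex_incl s) (vertex_incl (unit_fun i), f) =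
        arc_cocycle (\<lambda>a. t a * s (tail Q a)) (vertex_incl (unit_fun i), f)"
      if "i \<in> verts Q" "f \<in> carrier DA" for i f
      using that s by (simp add: vals z)
    show "ract ZA (arc_cocycle t) (vertex_incl s) (arrow_incl Q (unit_fun a), f) =
        arc_cocycle (\<lambda>a. t a * s (tail Q a)) (arrow_incl Q (unit_fun a), f)"
      if "a \<in> arcs Q" "f \<in> carrier DA" for a f
      using that s
      by (simp add: vals fun_eq_iff split_paired_all vertex_incl_mult) (auto simp: vertex_incl_def)
  qed
qed

end


lemma coef2_superset:
  assumes "finite K" "pair_support x \<subseteq> K"
  shows "coef2 co x b c = (\<Sum>(u, v)\<in>K. x [Inr u, Inr v] * co u b * co v c)"
  unfolding coef2_def
  by (rule sum.mono_neutral_left) (use assms in \<open>auto simp: pair_support_def\<close>)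

lemma coef2_add:
  assumes "x \<in> two_letter_sums A M" "y \<in> two_letter_sums A M"
  shows "coef2 co (x \<oplus>\<^bsub>free_algebra A M\<^esub> y) b c = coef2 co x b c + coef2 co y b c"
proof -
  let ?K = "pair_support x \<union> pair_support y"
  have K: "finite ?K" using two_letter_support(1)[OF assms(1)] two_letter_support(1)[OF assms(2)] by simp
  have "pair_support (x \<oplus>\<^bsub>free_algebra A M\<^esub> y) \<subseteq> ?K"
    by (auto simp: pair_support_def free_algebra_simps)
  from coef2_superset[OF K this, where co = co and b = b and c = c]
  show ?thesis
    by (simp add: coef2_superset[OF K, of x] coef2_superset[OF K, of y] free_algebra_simps(2) sum.distrib[symmetric] case_prod_unfold distrib_right)
qed

lemma coef2_smult:
  "coef2 co (k \<odot>\<^bsub>free_algebra A M\<^esub> x) b c = (k :: 'f::field) * coef2 co x b c"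
proof (cases "k = 0")
  case False
  then have "pair_support (k \<odot>\<^bsub>free_algebra A M\<^esub> x) = pair_support x"
    by (auto simp: pair_support_def free_algebra_simps)
  then show ?thesis
    by (simp add: coef2_def free_algebra_simps(6) sum_distrib_left case_prod_unfold mult.assoc)
qed (simp add: coef2_def free_algebra_simps(6))

lemma coef2_word:
  fixes u v :: 'm and co :: "'m \<Rightarrow> 'd \<Rightarrow> 'f::field"
  shows "coef2 co (word [Inr u, Inr v] :: ('s + 'm) list \<Rightarrow> 'f) b c = co u b * co v c"
proof -
  have "pair_support (word [Inr u, Inr v] :: ('s + 'm) list \<Rightarrow> 'f) = {(u, v)}"
    by (auto simp: pair_support_def word_def)
  then show ?thesis by (simp add: coef2_def word_def)
qed

lemma two_letter_finsum:
  assumes "finite K" "\<And>k. k \<in> K \<Longrightarrow> f k \<in> two_letter_sums A M"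
  shows "finsum (free_algebra A M) f K \<in> two_letter_sums A M \<and>
    coef2 co (finsum (free_algebra A M) f K) b c = (\<Sum>k\<in>K. coef2 co (f k) b c)"
  using assms
proof (induction K)
  case empty
  interpret F: falgebra "free_algebra A M" by (rule free_falgebra)
  show ?case using two_letter_zero
    by (simp add: coef2_def free_algebra_simps(5))
next
  case (insert k K)
  interpret F: falgebra "free_algebra A M" by (rule free_falgebra)
  have f: "f k \<in> carrier (free_algebra A M)" "f \<in> K \<rightarrow> carrier (free_algebra A M)"
    using insert by (auto simp: two_letter_sums_def)
  show ?case using insert f by (simp add: two_letter_add coef2_add)
qed

lemma finsum_additive:
  assumes "abelian_group G" "abelian_group H"
    and "\<And>x. x \<in> carrier G \<Longrightarrow> T x \<in> carrier H" "T \<zero>\<^bsub>G\<^esub> = \<zero>\<^bsub>H\<^esub>"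
    and "\<And>x y. x \<in> carrier G \<Longrightarrow> y \<in> carrier G \<Longrightarrow> T (x \<oplus>\<^bsub>G\<^esub> y) = T x \<oplus>\<^bsub>H\<^esub> T y"
    and "f \<in> S \<rightarrow> carrier G"
  shows "T (finsum G f S) = finsum H (\<lambda>x. T (f x)) S"
proof -
  interpret G: abelian_group G by fact
  interpret H: abelian_group H by fact
  show ?thesis using assms(6)
  proof (induction S rule: infinite_finite_induct)
    case (insert x S)
    then have f: "f x \<in> carrier G" "f \<in> S \<rightarrow> carrier G" by auto
    moreover have "(\<lambda>x. T (f x)) \<in> S \<rightarrow> carrier H" using f assms(3) by blast
    ultimately show ?case using insert assms(3,5) by simp
  qed (simp_all add: assms(4))
qed

context finite_quiver
begin

lemma ext_data: "tensor_data (PA :: ('f::field, _) module) (ext_bimod Q)"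
  unfolding ext_bimod_def by (rule falgebra.ext_tensor_data[OF path_falgebra])

lemma preprojective_falgebra:
  "falgebra (preprojective Q :: ('f::field, ('f, 'v, 'e) preproj) graded_algebra)"
  unfolding preprojective_def
  by (rule graded_falgebra.axioms(1)[OF tensor_data.tensor_graded[OF ext_data]])

abbreviation "cls c \<equiv> BA +>\<^bsub>ZA\<^esub> c"

lemma letter_map_Pi:
  "tensor_map (PA :: ('f::field, _) module) (ext_bimod Q) (preprojective Q)
    (tensor_letter (path_algebra Q) (ext_bimod Q))"
  unfolding preprojective_def by (rule tensor_data.tensor_letter_map[OF ext_data])

lemma preproj_gen_simps:
  "preproj_gen Q (Inl s) = tensor_letter PA (ext_bimod Q) (Inl (vertex_incl s))"
  "\<theta> \<in> carrier Vd \<Longrightarrow> preproj_gen Q (Inr (x, \<theta>)) =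
    tensor_letter PA (ext_bimod Q) (Inl (arrow_incl Q x)) \<oplus>\<^bsub>preprojective Q\<^esub>
    tensor_letter PA (ext_bimod Q) (Inr (cls (arc_cocycle (eco (\<theta> :: ('e \<Rightarrow> 'f::field) \<Rightarrow> 'v \<times> 'v \<Rightarrow> 'f)))))"
  by (simp_all add: preproj_gen_def Let_def ext_class_def ext_cocycle_eq)

lemma cls_ops:
  fixes c d :: "('v \<times> 'e list \<Rightarrow> 'f::field) \<times> (('v \<times> 'e list \<Rightarrow> 'f) \<Rightarrow> 'f) \<Rightarrow> 'v \<times> 'e list \<Rightarrow> 'f"
  assumes "c \<in> carrier ZA" "d \<in> carrier ZA"
  shows "cls c \<in> carrier (ext_bimod Q)"
    and "cls c \<oplus>\<^bsub>ext_bimod Q\<^esub> cls d = cls (c \<oplus>\<^bsub>ZA\<^esub> d)"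
    and "k \<odot>\<^bsub>ext_bimod Q\<^esub> cls c = cls (k \<odot>\<^bsub>ZA\<^esub> c)"
    and "a \<in> carrier PA \<Longrightarrow> lact (ext_bimod Q) a (cls c) = cls (lact ZA a c)"
    and "a \<in> carrier PA \<Longrightarrow> ract (ext_bimod Q) (cls c) a = cls (ract ZA c a)"
proof -
  interpret A: falgebra "PA :: ('f, _) module" by (rule path_falgebra)
  show "cls c \<in> carrier (ext_bimod Q)" unfolding ext_bimod_def A.ext_carrier using assms by blast
  show "cls c \<oplus>\<^bsub>ext_bimod Q\<^esub> cls d = cls (c \<oplus>\<^bsub>ZA\<^esub> d)" "k \<odot>\<^bsub>ext_bimod Q\<^esub> cls c = cls (k \<odot>\<^bsub>ZA\<^esub> c)"
    "a \<in> carrier PA \<Longrightarrow> lact (ext_bimod Q) a (cls c) = cls (lact ZA a c)"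
    "a \<in> carrier PA \<Longrightarrow> ract (ext_bimod Q) (cls c) a = cls (ract ZA c a)"
    unfolding ext_bimod_def using A.ext_simps[OF assms] by simp_all
qed

lemma preproj_gen_map:
  "tensor_map (SA :: ('f::field, _) module) U2 (preprojective Q) (preproj_gen Q)"
proof -
  interpret A: falgebra "PA :: ('f, _) module" by (rule path_falgebra)
  interpret P: falgebra "preprojective Q :: ('f, ('f, 'v, 'e) preproj) graded_algebra"
    by (rule preprojective_falgebra)
  interpret t: tensor_map "PA :: ('f, _) module" "ext_bimod Q" "preprojective Q"
    "tensor_letter (path_algebra Q) (ext_bimod Q)" by (rule letter_map_Pi)
  interpret U: coord_bimod "verts Q" arcs2 src2 tgt2 "U2 :: ('f, _, ('f, 'v, 'e) dbl) bimod" dbl_co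
    by (rule double_coord)
  interpret V: coord_bimod "verts Q" "arcs Q" "tail Q" "head Q" "V :: ('f, _, _) bimod" "\<lambda>x. x"
    by (rule arrow_coord)
  interpret E: coord_bimod "verts Q" "arcs Q" "head Q" "tail Q" "Vd :: ('f, _, _) bimod" eco
    by (rule env_coord)
  have U: "carrier U2 = carrier V \<times> carrier (Vd :: ('f, _, _) bimod)"
    "\<And>m n m' n'. (m, n) \<oplus>\<^bsub>U2\<^esub> (m', n') = (m \<oplus>\<^bsub>V\<^esub> m', n \<oplus>\<^bsub>(Vd :: ('f, _, _) bimod)\<^esub> n')"
    "\<And>c m n. c \<odot>\<^bsub>U2\<^esub> (m, n) = (c \<odot>\<^bsub>V\<^esub> m, c \<odot>\<^bsub>(Vd :: ('f, _, _) bimod)\<^esub> n)"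
    "\<And>a m n. lact U2 a (m, n) = (lact V a m, lact (Vd :: ('f, _, _) bimod) a n)"
    "\<And>a m n. ract U2 (m, n) a = (ract V m a, ract (Vd :: ('f, _, _) bimod) n a)"
    by (simp_all add: double_bimod_def direct_sum_def)
  have vi: "vertex_incl (s \<oplus>\<^bsub>SA\<^esub> s') = vertex_incl s \<oplus>\<^bsub>PA\<^esub> vertex_incl s'"
    "vertex_incl (c \<odot>\<^bsub>SA\<^esub> s) = c \<odot>\<^bsub>PA\<^esub> vertex_incl s"
    "vertex_incl (s \<otimes>\<^bsub>SA\<^esub> s') = vertex_incl s \<otimes>\<^bsub>PA\<^esub> vertex_incl s'"
    "vertex_incl \<one>\<^bsub>SA\<^esub> = \<one>\<^bsub>PA\<^esub>" for s s' :: "'v \<Rightarrow> 'f" and c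
    by (simp_all add: fun_eq_iff split_paired_all vertex_incl_mult path_algebra_simps(2,4,6) fun_algebra_simps)
      (simp_all add: vertex_incl_def)
  have ai: "arrow_incl Q (x \<oplus>\<^bsub>V\<^esub> x') = arrow_incl Q x \<oplus>\<^bsub>PA\<^esub> arrow_incl Q x'"
    "arrow_incl Q (c \<odot>\<^bsub>V\<^esub> x) = c \<odot>\<^bsub>PA\<^esub> arrow_incl Q x"
    "arrow_incl Q (lact V s x) = vertex_incl s \<otimes>\<^bsub>PA\<^esub> arrow_incl Q x"
    "arrow_incl Q (ract V x s) = arrow_incl Q x \<otimes>\<^bsub>PA\<^esub> vertex_incl s"
    for x x' :: "'e \<Rightarrow> 'f" and s c
    by (simp_all add: fun_eq_iff split_paired_all vertex_incl_mult path_algebra_simps(2,6) arrow_simps)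
      (auto simp: arrow_incl_def split: list.splits)
  have ec1: "eco (h \<oplus>\<^bsub>Vd\<^esub> k) = (\<lambda>a. eco h a + eco k a)"
    if "h \<in> carrier Vd" "k \<in> carrier Vd" for h k :: "('e \<Rightarrow> 'f) \<Rightarrow> 'v \<times> 'v \<Rightarrow> 'f"
    using that by (simp add: fun_eq_iff E.co_add)
  have ec2: "eco (c \<odot>\<^bsub>Vd\<^esub> h) = (\<lambda>a. c * eco h a)"
    "s \<in> carrier SA \<Longrightarrow> eco (lact Vd s h) = (\<lambda>a. s (head Q a) * eco h a)"
    "s \<in> carrier SA \<Longrightarrow> eco (ract Vd h s) = (\<lambda>a. eco h a * s (tail Q a))"
    if "h \<in> carrier Vd" for h :: "('e \<Rightarrow> 'f) \<Rightarrow> 'v \<times> 'v \<Rightarrow> 'f" and c s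
    using that by (simp_all add: fun_eq_iff E.co_smult E.co_lact E.co_ract)
  note cl = vertex_incl_closed arrow_incl_closed arc_cocycle_closed cls_ops(1)[OF arc_cocycle_closed arc_cocycle_closed]
  note co = cls_ops(2-5)[OF arc_cocycle_closed arc_cocycle_closed, symmetric]
  show ?thesis
  proof (unfold_locales, goal_cases)
    case (1 l)
    then show ?case
      by (cases l) (auto simp: U preproj_gen_simps cl)
  next
    case (2 a b) then show ?case by (simp add: preproj_gen_simps vi t.g_add cl)
  next
    case (3 a c) then show ?case by (simp add: preproj_gen_simps vi t.g_smult cl)
  next
    case (4 a b) then show ?case by (simp add: preproj_gen_simps vi t.g_mult cl)
  next
    case 5 then show ?case by (simp add: preproj_gen_simps vi t.g_one)
  next
    case (6 m n)
    then obtain x h x' h' where [simp]: "m = (x, h)" "n = (x', h')"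
      and m: "x \<in> carrier V" "h \<in> carrier Vd" "x' \<in> carrier V" "h' \<in> carrier Vd" by (auto simp: U)
    show ?case
      by (simp add: U preproj_gen_simps m E.add_closed ec1 ec2 ai arc_cocycle_ops(1)[symmetric] co
          t.g_add t.g_Madd cl P.a_ac)
  next
    case (7 m c)
    then obtain x h where [simp]: "m = (x, h)" and m: "x \<in> carrier V" "h \<in> carrier Vd" by (auto simp: U)
    show ?case
      by (simp add: U preproj_gen_simps m E.smult_closed ec1 ec2 ai arc_cocycle_ops(2)[symmetric] co
          t.g_smult t.g_Msmult cl P.smult_r_distr)
  next
    case (8 s m)
    then obtain x h where [simp]: "m = (x, h)" and m: "x \<in> carrier V" "h \<in> carrier Vd" by (auto simp: U)
    show ?case
      by (simp add: U preproj_gen_simps m 8(1) E.lact_closed ec1 ec2 ai arc_cocycle_ops(3)[symmetric] co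
          t.g_mult t.g_lact cl P.r_distr)
  next
    case (9 s m)
    then obtain x h where [simp]: "m = (x, h)" and m: "x \<in> carrier V" "h \<in> carrier Vd" by (auto simp: U)
    show ?case
      by (simp add: U preproj_gen_simps m 9(1) E.ract_closed ec1 ec2 ai arc_cocycle_ops(4)[symmetric] co
          t.g_mult t.g_ract cl P.l_distr)
  qed
qed

lemma unit_products:
  "unit_fun (i, []) \<otimes>\<^bsub>PA\<^esub> unit_fun (j, []) = (if i = j then unit_fun (i, []) else \<zero>\<^bsub>PA\<^esub> :: 'v \<times> 'e list \<Rightarrow> 'f::field)"
  "unit_fun (i, []) \<otimes>\<^bsub>PA\<^esub> unit_fun (tail Q b, [b]) =
    (if i = tail Q b then unit_fun (tail Q b, [b]) else \<zero>\<^bsub>PA\<^esub> :: 'v \<times> 'e list \<Rightarrow> 'f)"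
  "unit_fun (tail Q b, [b]) \<otimes>\<^bsub>PA\<^esub> unit_fun (i, []) =
    (if i = head Q b then unit_fun (tail Q b, [b]) else \<zero>\<^bsub>PA\<^esub> :: 'v \<times> 'e list \<Rightarrow> 'f)"
  by (simp_all only: incl_unit(1)[symmetric] fun_eq_iff split_paired_All vertex_incl_mult)
    (auto simp: path_algebra_simps(5) unit_fun_def vertex_incl_def)

text \<open>
  At a vertex \<^term>\<open>i\<close>, the signed sum of the products of each arrow with its dual is the coboundary of the
  map that sends a functional to its value at \<^term>\<open>i\<close>, times the idempotent at \<^term>\<open>i\<close>.
\<close>

definition rho_cocycle ::
    "'v \<Rightarrow> 'e \<Rightarrow> ('v \<times> 'e list \<Rightarrow> 'f::field) \<times> (('v \<times> 'e list \<Rightarrow> 'f) \<Rightarrow> 'f) \<Rightarrow> 'v \<times> 'e list \<Rightarrow> 'f" where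
  "rho_cocycle i a =
    (if head Q a = i then 1 else 0) \<odot>\<^bsub>ZA\<^esub> ract ZA (arc_cocycle (unit_fun a)) (arrow_incl Q (unit_fun a))
    \<oplus>\<^bsub>ZA\<^esub> (if tail Q a = i then - 1 else 0) \<odot>\<^bsub>ZA\<^esub> lact ZA (arrow_incl Q (unit_fun a)) (arc_cocycle (unit_fun a))"

lemma rho_cocycle_closed: "a \<in> arcs Q \<Longrightarrow> rho_cocycle i a \<in> carrier (ZA :: ('f::field, _, _) bimod)"
proof -
  assume a: "a \<in> arcs Q"
  interpret A: falgebra "PA :: ('f, _) module" by (rule path_falgebra)
  show ?thesis unfolding rho_cocycle_def
    by (simp add: arc_cocycle_closed arrow_incl_closed unit_arrow_closed a)
qed

lemma rho_coboundary:
  assumes i: "i \<in> verts Q"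
  shows "finsum ZA (rho_cocycle i) (arcs Q) =
    falgebra.cobd PA (\<lambda>f. f (unit_fun (i, [])) \<odot>\<^bsub>PA\<^esub> (unit_fun (i, []) :: 'v \<times> 'e list \<Rightarrow> 'f::field))"
    and "falgebra.D_linear PA (\<lambda>f. f (unit_fun (i, [])) \<odot>\<^bsub>PA\<^esub> (unit_fun (i, []) :: 'v \<times> 'e list \<Rightarrow> 'f))"
proof -
  interpret A: falgebra "PA :: ('f, _) module" by (rule path_falgebra)
  interpret Z: abelian_group "ZA :: ('f, 'v \<times> 'e list \<Rightarrow> 'f, _) bimod" by (rule A.Z_abelian)
  let ?rc = "rho_cocycle i :: 'e \<Rightarrow> ('v \<times> 'e list \<Rightarrow> 'f) \<times> (('v \<times> 'e list \<Rightarrow> 'f) \<Rightarrow> 'f) \<Rightarrow> 'v \<times> 'e list \<Rightarrow> 'f"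
  let ?h = "\<lambda>f. f (unit_fun (i, [])) \<odot>\<^bsub>PA\<^esub> (unit_fun (i, []) :: 'v \<times> 'e list \<Rightarrow> 'f)"
  have e: "unit_fun (j, []) \<in> carrier (PA :: ('f, _) module)" if "j \<in> verts Q" for j
    using that by (intro unit_path_closed) simp
  have al: "unit_fun (tail Q a, [a]) \<in> carrier (PA :: ('f, _) module)" if "a \<in> arcs Q" for a
    using that by (intro unit_path_closed) simp
  show lin: "A.D_linear ?h"
    unfolding A.D_linear_def
    using e[OF i] by (simp add: dual_bimod_simps A.smult_l_distr A.smult_smult)
  have z: "?rc \<in> arcs Q \<rightarrow> carrier ZA" using rho_cocycle_closed by blast
  have ev: "finsum ZA ?rc (arcs Q) (y, f) p = (\<Sum>a\<in>arcs Q. ?rc a (y, f) p)"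
    if "y \<in> carrier PA" "f \<in> carrier DA" for y f p
    by (rule additive_finsum[where h = "\<lambda>c. c (y, f) p", OF A.Z_abelian _ _ z])
      (use that in \<open>simp_all add: A.cocycle_ops path_algebra_simps(2,5)\<close>)
  have f0: "f \<zero>\<^bsub>PA\<^esub> = 0" if "f \<in> carrier DA" for f :: "('v \<times> 'e list \<Rightarrow> 'f) \<Rightarrow> 'f"
    using dual_bimodD(2)[OF that A.zero_closed, of 0] by simp
  have val: "?rc a (y, f) p =
      (if head Q a = i then 1 else 0) * (arc_cocycle (unit_fun a) (y, f) \<otimes>\<^bsub>PA\<^esub> unit_fun (tail Q a, [a])) p +
      (if tail Q a = i then - 1 else 0) * arc_cocycle (unit_fun a) (y, ract DA f (unit_fun (tail Q a, [a]))) p"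
    if "a \<in> arcs Q" "y \<in> carrier PA" "f \<in> carrier DA" for a y p and f :: "('v \<times> 'e list \<Rightarrow> 'f) \<Rightarrow> 'f"
    using that al[OF that(1)]
    by (simp add: rho_cocycle_def A.cocycle_ops path_algebra_simps(2,6) incl_unit)
  show "finsum ZA ?rc (arcs Q) = A.cobd ?h"
  proof (rule cocycle_determined)
    show "finsum ZA ?rc (arcs Q) \<in> carrier ZA" by (rule Z.finsum_closed[OF z])
    show "A.cobd ?h \<in> carrier ZA" by (rule A.cobd_closed[OF lin])
  next
    fix j and f :: "('v \<times> 'e list \<Rightarrow> 'f) \<Rightarrow> 'f" assume j: "j \<in> verts Q" and f: "f \<in> carrier DA"
    show "finsum ZA ?rc (arcs Q) (vertex_incl (unit_fun j), f) =
        A.cobd ?h (vertex_incl (unit_fun j), f)"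
    proof
      fix p
      have vj: "unit_fun j \<in> carrier (SA :: ('f, _) module)" by (rule unit_vertex_closed[OF j])
      have "?rc a (unit_fun (j, []), f) p = 0" if a: "a \<in> arcs Q" for a
      proof -
        have "arc_cocycle (unit_fun a) (unit_fun (j, []), g) = \<zero>\<^bsub>PA\<^esub>"
          if "g \<in> carrier DA" for g :: "('v \<times> 'e list \<Rightarrow> 'f) \<Rightarrow> 'f"
          using arc_cocycle_vertex[OF vj that] by (simp add: incl_unit path_algebra_simps(5))
        then show ?thesis
          using f al[OF a] by (simp add: val a e[OF j]) (simp add: path_algebra_simps(5))
      qed
      moreover have "A.cobd ?h (unit_fun (j, []), f) = \<zero>\<^bsub>PA\<^esub>"
        using f f0[OF f] e[OF i] e[OF j]
        by (simp add: A.cobd_val[OF lin] dual_bimod_simps A.smult_mult_r unit_products A.smult_minus_one A.r_neg)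
      ultimately show "finsum ZA ?rc (arcs Q) (vertex_incl (unit_fun j), f) p =
          A.cobd ?h (vertex_incl (unit_fun j), f) p"
        by (simp add: incl_unit ev e[OF j] f) (simp add: path_algebra_simps(5))
    qed
  next
    fix b and f :: "('v \<times> 'e list \<Rightarrow> 'f) \<Rightarrow> 'f" assume b: "b \<in> arcs Q" and f: "f \<in> carrier DA"
    show "finsum ZA ?rc (arcs Q) (arrow_incl Q (unit_fun b), f) =
        A.cobd ?h (arrow_incl Q (unit_fun b), f)"
    proof
      fix up :: "'v \<times> 'e list"
      obtain u p where [simp]: "up = (u, p)" by (cases up)
      let ?b = "unit_fun (tail Q b, [b]) :: 'v \<times> 'e list \<Rightarrow> 'f"
      let ?eh = "unit_fun (head Q b, []) :: 'v \<times> 'e list \<Rightarrow> 'f"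
      let ?ei = "unit_fun (i, []) :: 'v \<times> 'e list \<Rightarrow> 'f"
      have ac: "arc_cocycle (unit_fun a) (?b, g) =
          vertex_incl (\<lambda>k. if k = tail Q b then unit_fun a b * g ?eh else 0)"
        if "g \<in> carrier DA" for a g
        using arc_cocycle_unit[OF b that, of "unit_fun a"] unfolding incl_unit .
      have "(\<Sum>a\<in>arcs Q. ?rc a (?b, f) (u, p)) =
          (\<Sum>a\<in>arcs Q. if a = b then
            (if head Q b = i then 1 else 0) * ((if u = tail Q b then f ?eh else 0) * ?b (u, p)) +
            (if tail Q b = i then - 1 else 0) * (if p = [] \<and> u = tail Q b then f ?b else 0) else 0)"
      proof (intro sum.cong refl)
        fix a assume a: "a \<in> arcs Q"
        have r: "ract DA f (unit_fun (tail Q a, [a])) ?eh =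
            f (unit_fun (tail Q a, [a]) \<otimes>\<^bsub>PA\<^esub> ?eh)" using b by (simp add: dual_bimod_simps e)
        show "?rc a (?b, f) (u, p) = (if a = b then
            (if head Q b = i then 1 else 0) * ((if u = tail Q b then f ?eh else 0) * ?b (u, p)) +
            (if tail Q b = i then - 1 else 0) * (if p = [] \<and> u = tail Q b then f ?b else 0) else 0)"
          unfolding val[OF a al[OF b] f] ac[OF f] ac[OF A.D_closed(5)[OF al[OF a] f], of a, unfolded r]
            unit_products(3) vertex_incl_mult
          by (cases "a = b") (auto simp: vertex_incl_def)
      qed
      also have "\<dots> = (if head Q b = i then 1 else 0) * ((if u = tail Q b then f ?eh else 0) * ?b (u, p)) +
            (if tail Q b = i then - 1 else 0) * (if p = [] \<and> u = tail Q b then f ?b else 0)"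
        using b by simp
      also have "\<dots> = A.cobd ?h (?b, f) (u, p)"
      proof -
        have "A.cobd ?h (?b, f) (u, p) = f ?ei * (?b \<otimes>\<^bsub>PA\<^esub> ?ei) (u, p) - f (?ei \<otimes>\<^bsub>PA\<^esub> ?b) * ?ei (u, p)"
          using al[OF b] f e[OF i]
          by (simp add: A.cobd_val[OF lin] dual_bimod_simps A.smult_mult_r)
            (simp add: path_algebra_simps(2,6))
        then show ?thesis unfolding unit_products
          using f0[OF f] by (auto simp: unit_fun_def path_algebra_simps(5))
      qed
      finally show "finsum ZA ?rc (arcs Q) (arrow_incl Q (unit_fun b), f) up =
        A.cobd ?h (arrow_incl Q (unit_fun b), f) up"
        by (simp add: incl_unit ev al[OF b] f)
    qed
  qed
qed

abbreviation "ubasis \<equiv> coord_bimod.basis (double_bimod Q) dbl_co"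

text \<open>
  The preprojective relation at a vertex: dual arrow times arrow over the arrows that end there, minus arrow times
  dual arrow over those that start there.
\<close>

definition rho :: "'v \<Rightarrow> (('v \<Rightarrow> 'f::field) + ('f, 'v, 'e) dbl) list \<Rightarrow> 'f" where
  "rho i = finsum (free_algebra SA U2) (\<lambda>a.
    (if head Q a = i then 1 else 0) \<odot>\<^bsub>free_algebra SA U2\<^esub> word [Inr (ubasis (Inr a)), Inr (ubasis (Inl a))]
    \<oplus>\<^bsub>free_algebra SA U2\<^esub>
    (if tail Q a = i then - 1 else 0) \<odot>\<^bsub>free_algebra SA U2\<^esub> word [Inr (ubasis (Inl a)), Inr (ubasis (Inr a))])
    (arcs Q)"

text \<open>
  The coefficients of \<open>rho\<close> with the two factors exchanged, as the pairing of a tensor square with its dual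
  demands. They are the structure constants of the dual algebra in degree two.
\<close>

definition vertex_kappa :: "'v \<Rightarrow> 'e + 'e \<Rightarrow> 'e + 'e \<Rightarrow> 'f::field" where
  "vertex_kappa i c b = (\<Sum>a\<in>arcs Q.
     (if head Q a = i then 1 else 0) * (unit_fun (Inl a) c * unit_fun (Inr a) b) -
     (if tail Q a = i then 1 else 0) * (unit_fun (Inr a) c * unit_fun (Inl a) b))"

lemma rho_two_letter:
  shows "rho i \<in> two_letter_sums SA (U2 :: ('f::field, _, ('f, 'v, 'e) dbl) bimod)"
    and "coef2 dbl_co (rho i :: _ \<Rightarrow> 'f) b c = vertex_kappa i c b"
proof -
  interpret U: coord_bimod "verts Q" arcs2 src2 tgt2 "U2 :: ('f, _, ('f, 'v, 'e) dbl) bimod" dbl_co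
    by (rule double_coord)
  show "rho i \<in> two_letter_sums SA (U2 :: ('f, _, ('f, 'v, 'e) dbl) bimod)"
    unfolding rho_def
    by (rule two_letter_finsum[THEN conjunct1])
      (auto intro!: two_letter_add two_letter_smult two_letter_word U.basis(1))
  have "coef2 dbl_co (rho i :: _ \<Rightarrow> 'f) b c = (\<Sum>a\<in>arcs Q. coef2 dbl_co
      ((if head Q a = i then 1 else 0) \<odot>\<^bsub>free_algebra SA U2\<^esub> word [Inr (ubasis (Inr a)), Inr (ubasis (Inl a))]
      \<oplus>\<^bsub>free_algebra SA U2\<^esub>
      (if tail Q a = i then - 1 else 0) \<odot>\<^bsub>free_algebra SA U2\<^esub> word [Inr (ubasis (Inl a)), Inr (ubasis (Inr a))]) b c)"
    unfolding rho_def
    by (rule two_letter_finsum[THEN conjunct2])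
      (auto intro!: two_letter_add two_letter_smult two_letter_word U.basis(1))
  also have "\<dots> = vertex_kappa i c b"
    unfolding vertex_kappa_def
  proof (intro sum.cong refl)
    fix a assume a: "a \<in> arcs Q"
    have t: "k \<odot>\<^bsub>free_algebra SA U2\<^esub> word [Inr (ubasis (Inr a)), Inr (ubasis (Inl a))] \<in> two_letter_sums SA U2"
      "k \<odot>\<^bsub>free_algebra SA U2\<^esub> word [Inr (ubasis (Inl a)), Inr (ubasis (Inr a))] \<in> two_letter_sums SA U2" for k :: 'f
      using a by (auto intro!: two_letter_smult two_letter_word U.basis(1))
    have bb: "dbl_co (ubasis (Inl a)) = (unit_fun (Inl a) :: _ \<Rightarrow> 'f)"
      "dbl_co (ubasis (Inr a)) = (unit_fun (Inr a) :: _ \<Rightarrow> 'f)"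
      using a U.basis(2)[of "Inl a"] U.basis(2)[of "Inr a"] by simp_all
    show "coef2 dbl_co
      ((if head Q a = i then 1 else 0) \<odot>\<^bsub>free_algebra SA U2\<^esub> word [Inr (ubasis (Inr a)), Inr (ubasis (Inl a))]
      \<oplus>\<^bsub>free_algebra SA U2\<^esub>
      (if tail Q a = i then - 1 else 0) \<odot>\<^bsub>free_algebra SA U2\<^esub> word [Inr (ubasis (Inl a)), Inr (ubasis (Inr a))]) b c =
      (if head Q a = i then 1 else 0) * (unit_fun (Inl a) c * unit_fun (Inr a) b) -
      (if tail Q a = i then 1 else 0) * (unit_fun (Inr a) c * (unit_fun (Inl a) b :: 'f))"
      unfolding coef2_add[OF t] coef2_smult coef2_word bb by simp
  qed
  finally show "coef2 dbl_co (rho i :: _ \<Rightarrow> 'f) b c = vertex_kappa i c b" .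
qed

lemma gen_basis:
  assumes a: "a \<in> arcs Q"
  shows "preproj_gen Q (Inr (ubasis (Inl a))) =
      tensor_letter PA (ext_bimod Q) (Inl (arrow_incl Q (unit_fun a :: 'e \<Rightarrow> 'f::field)))"
    and "preproj_gen Q (Inr (ubasis (Inr a))) =
      tensor_letter PA (ext_bimod Q) (Inr (cls (arc_cocycle (unit_fun a :: 'e \<Rightarrow> 'f))))"
proof -
  interpret A: falgebra "PA :: ('f, _) module" by (rule path_falgebra)
  interpret P: falgebra "preprojective Q :: ('f, ('f, 'v, 'e) preproj) graded_algebra"
    by (rule preprojective_falgebra)
  interpret t: tensor_map "PA :: ('f, _) module" "ext_bimod Q" "preprojective Q"
    "tensor_letter (path_algebra Q) (ext_bimod Q)" by (rule letter_map_Pi)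
  interpret U: coord_bimod "verts Q" arcs2 src2 tgt2 "U2 :: ('f, _, ('f, 'v, 'e) dbl) bimod" dbl_co
    by (rule double_coord)
  have pair: "fst (ubasis d) = (\<lambda>a. unit_fun d (Inl a) :: 'f) \<and> snd (ubasis d) \<in> carrier (Vd :: ('f, _, _) bimod) \<and>
      eco (snd (ubasis d)) = (\<lambda>a. unit_fun d (Inr a) :: 'f)" if "d \<in> arcs2" for d
  proof -
    obtain x h where xh: "ubasis d = (x, h :: ('e \<Rightarrow> 'f) \<Rightarrow> 'v \<times> 'v \<Rightarrow> 'f)" by (cases "ubasis d :: ('f, 'v, 'e) dbl") auto
    have "h \<in> carrier Vd" using U.basis(1)[OF that] xh by (simp add: double_bimod_def direct_sum_def)
    moreover have "case_sum x (eco h) = (unit_fun d :: _ \<Rightarrow> 'f)" using U.basis(2)[OF that] xh by (simp add: dbl_co_def)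
    then have "x = (\<lambda>a. unit_fun d (Inl a))" "eco h = (\<lambda>a. unit_fun d (Inr a))"
      by (metis sum.case(1), metis sum.case(2))
    ultimately show ?thesis using xh by simp
  qed
  have gen: "preproj_gen Q (Inr (ubasis d)) =
      tensor_letter PA (ext_bimod Q) (Inl (arrow_incl Q (\<lambda>a. unit_fun d (Inl a)))) \<oplus>\<^bsub>preprojective Q\<^esub>
      tensor_letter PA (ext_bimod Q) (Inr (cls (arc_cocycle (\<lambda>a. unit_fun d (Inr a) :: 'f))))" if "d \<in> arcs2" for d
    using preproj_gen_simps(2)[of "snd (U.basis d)" "fst (U.basis d)"] pair[OF that] by (metis prod.collapse)
  note z = arc_cocycle_closed cls_ops(1)[OF arc_cocycle_closed arc_cocycle_closed]
  have c0: "tensor_letter PA (ext_bimod Q) (Inr (cls (arc_cocycle (\<lambda>a. 0 :: 'f)))) = \<zero>\<^bsub>preprojective Q\<^esub>"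
  proof -
    have "cls (arc_cocycle (\<lambda>a. 0 :: 'f)) = 0 \<odot>\<^bsub>ext_bimod Q\<^esub> cls (arc_cocycle (\<lambda>a. 0))"
      using cls_ops(3)[OF arc_cocycle_closed arc_cocycle_closed, of 0 "\<lambda>a. 0 :: 'f"]
        arc_cocycle_ops(2)[of 0 "\<lambda>a. 0 :: 'f"] by simp
    then have "tensor_letter PA (ext_bimod Q) (Inr (cls (arc_cocycle (\<lambda>a. 0 :: 'f)))) =
        tensor_letter PA (ext_bimod Q) (Inr (0 \<odot>\<^bsub>ext_bimod Q\<^esub> cls (arc_cocycle (\<lambda>a. 0))))"
      by (rule arg_cong)
    also have "\<dots> = 0 \<odot>\<^bsub>preprojective Q\<^esub> tensor_letter PA (ext_bimod Q) (Inr (cls (arc_cocycle (\<lambda>a. 0 :: 'f))))"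
      by (rule t.g_Msmult[OF z(2)])
    also have "\<dots> = \<zero>\<^bsub>preprojective Q\<^esub>" by (rule P.smult_zero_l[OF t.g_closed(2)[OF z(2)]])
    finally show ?thesis .
  qed
  have a0: "tensor_letter PA (ext_bimod Q) (Inl (arrow_incl Q (\<lambda>a. 0 :: 'f))) = \<zero>\<^bsub>preprojective Q\<^esub>"
  proof -
    have "arrow_incl Q (\<lambda>a. 0 :: 'f) = 0 \<odot>\<^bsub>PA\<^esub> \<zero>\<^bsub>PA\<^esub>"
      by (auto simp: fun_eq_iff arrow_incl_def path_algebra_simps(5,6) split: list.splits)
    then show ?thesis using t.g_smult[OF A.zero_closed, of 0] t.g_closed(1)[OF A.zero_closed] by simp
  qed
  have u: "(\<lambda>b. unit_fun (Inl a) (Inl b)) = (unit_fun a :: 'e \<Rightarrow> 'f)" "(\<lambda>b. unit_fun (Inr a) (Inr b)) = (unit_fun a :: 'e \<Rightarrow> 'f)"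
    "(\<lambda>b. unit_fun (Inl a) (Inr b)) = (\<lambda>b. 0 :: 'f)" "(\<lambda>b. unit_fun (Inr a) (Inl b)) = (\<lambda>b. 0 :: 'f)"
    by (auto simp: unit_fun_def)
  show "preproj_gen Q (Inr (ubasis (Inl a))) =
      tensor_letter PA (ext_bimod Q) (Inl (arrow_incl Q (unit_fun a :: 'e \<Rightarrow> 'f)))"
    using gen[of "Inl a"] a by (simp add: u c0 arrow_incl_closed unit_arrow_closed)
  show "preproj_gen Q (Inr (ubasis (Inr a))) =
      tensor_letter PA (ext_bimod Q) (Inr (cls (arc_cocycle (unit_fun a :: 'e \<Rightarrow> 'f))))"
    using gen[of "Inr a"] a by (simp add: u a0 z)
qed

text \<open>
  Products with arrows correspond to the two actions on classes of cocycles, and by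
  \<open>rho_coboundary\<close> the signed sum of the resulting cocycles has class zero.
\<close>

lemma rho_relation:
  assumes i: "i \<in> verts Q"
  shows "subst (preprojective Q) (preproj_gen Q) (rho i :: _ \<Rightarrow> 'f::field) = \<zero>\<^bsub>preprojective Q\<^esub>"
proof -
  interpret A: falgebra "PA :: ('f, _) module" by (rule path_falgebra)
  interpret Z: abelian_group "ZA :: ('f, 'v \<times> 'e list \<Rightarrow> 'f, _) bimod" by (rule A.Z_abelian)
  interpret P: falgebra "preprojective Q :: ('f, ('f, 'v, 'e) preproj) graded_algebra"
    by (rule preprojective_falgebra)
  interpret t: tensor_map "PA :: ('f, _) module" "ext_bimod Q" "preprojective Q"
    "tensor_letter (path_algebra Q) (ext_bimod Q)" by (rule letter_map_Pi)
  interpret g: tensor_map "SA :: ('f, _) module" U2 "preprojective Q" "preproj_gen Q" by (rule preproj_gen_map)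
  interpret U: coord_bimod "verts Q" arcs2 src2 tgt2 "U2 :: ('f, _, ('f, 'v, 'e) dbl) bimod" dbl_co
    by (rule double_coord)
  interpret F: falgebra "free_algebra SA (U2 :: ('f, _, ('f, 'v, 'e) dbl) bimod)" by (rule free_falgebra)
  let ?T = "\<lambda>c. tensor_letter PA (ext_bimod Q) (Inr (cls c)) :: ('f, 'v, 'e) preproj"
  let ?k = "\<lambda>a. (if head Q a = i then 1 else 0) :: 'f" and ?l = "\<lambda>a. (if tail Q a = i then - 1 else 0) :: 'f"
  let ?r = "\<lambda>a. ?k a \<odot>\<^bsub>free_algebra SA U2\<^esub> word [Inr (ubasis (Inr a)), Inr (ubasis (Inl a))]
    \<oplus>\<^bsub>free_algebra SA U2\<^esub> ?l a \<odot>\<^bsub>free_algebra SA U2\<^esub> word [Inr (ubasis (Inl a)), Inr (ubasis (Inr a))]"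
  have Tc: "?T c \<in> carrier (preprojective Q)" if "c \<in> carrier ZA" for c
    using that cls_ops(1)[OF that that] by (rule_tac t.g_closed(2))
  have Tadd: "?T (c \<oplus>\<^bsub>ZA\<^esub> d) = ?T c \<oplus>\<^bsub>preprojective Q\<^esub> ?T d" if "c \<in> carrier ZA" "d \<in> carrier ZA" for c d
    using that by (simp add: cls_ops(2)[OF that, symmetric] t.g_Madd cls_ops(1)[OF that] cls_ops(1)[OF that(2,1)])
  have Tsm: "?T (k \<odot>\<^bsub>ZA\<^esub> c) = k \<odot>\<^bsub>preprojective Q\<^esub> ?T c" if "c \<in> carrier ZA" for c k
    using that by (simp add: cls_ops(3)[OF that that, symmetric] t.g_Msmult cls_ops(1)[OF that that])
  have T0: "?T \<zero>\<^bsub>ZA\<^esub> = \<zero>\<^bsub>preprojective Q\<^esub>"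
    using Tsm[OF Z.zero_closed, of 0] Tc[OF Z.zero_closed] by (simp add: A.cocycle_ops cong: restrict_cong)
  have ub: "ubasis d \<in> carrier (U2 :: ('f, _, ('f, 'v, 'e) dbl) bimod)" if "d \<in> arcs2" for d
    using U.basis(1)[OF that] .
  have rc: "?r \<in> arcs Q \<rightarrow> carrier (free_algebra SA U2)"
    by (auto intro!: F.a_closed F.smult_closed ub)
  have rterm: "subst (preprojective Q) (preproj_gen Q) (?r a) = ?T (rho_cocycle i a)" if a: "a \<in> arcs Q" for a
  proof -
    note gD = alg_homD[OF g.subst_hom]
    have al: "arrow_incl Q (unit_fun a) \<in> carrier (PA :: ('f, _) module)"
      by (intro arrow_incl_closed unit_arrow_closed a)
    have c: "arc_cocycle (unit_fun a) \<in> carrier (ZA :: ('f, _, _) bimod)" by (rule arc_cocycle_closed)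
    have w1: "subst (preprojective Q) (preproj_gen Q) (word [Inr (ubasis (Inr a)), Inr (ubasis (Inl a))]) =
        ?T (ract ZA (arc_cocycle (unit_fun a)) (arrow_incl Q (unit_fun a)))"
      using a ub al cls_ops(1)[OF c c]
      by (simp add: g.subst_word gen_basis t.g_ract[symmetric] cls_ops(5)[OF c c])
    have w2: "subst (preprojective Q) (preproj_gen Q) (word [Inr (ubasis (Inl a)), Inr (ubasis (Inr a))]) =
        ?T (lact ZA (arrow_incl Q (unit_fun a)) (arc_cocycle (unit_fun a)))"
      using a ub al cls_ops(1)[OF c c]
      by (simp add: g.subst_word gen_basis t.g_lact[symmetric] cls_ops(4)[OF c c])
    have "subst (preprojective Q) (preproj_gen Q) (?r a) =
        ?k a \<odot>\<^bsub>preprojective Q\<^esub> ?T (ract ZA (arc_cocycle (unit_fun a)) (arrow_incl Q (unit_fun a)))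
        \<oplus>\<^bsub>preprojective Q\<^esub> ?l a \<odot>\<^bsub>preprojective Q\<^esub> ?T (lact ZA (arrow_incl Q (unit_fun a)) (arc_cocycle (unit_fun a)))"
      using a by (simp add: gD(2,5) ub w1 w2 del: if_split)
    also have "\<dots> = ?T (rho_cocycle i a)"
      unfolding rho_cocycle_def using al c by (simp add: Tadd Tsm del: if_split)
    finally show ?thesis .
  qed
  have "subst (preprojective Q) (preproj_gen Q) (rho i :: _ \<Rightarrow> 'f) =
      finsum (preprojective Q) (\<lambda>a. subst (preprojective Q) (preproj_gen Q) (?r a)) (arcs Q)"
    unfolding rho_def by (rule hom_finsum[OF F.falgebra_axioms P.falgebra_axioms g.subst_hom rc])
  also have "\<dots> = finsum (preprojective Q) (\<lambda>a. ?T (rho_cocycle i a)) (arcs Q)"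
    by (rule P.finsum_cong') (auto simp: rterm Tc rho_cocycle_closed)
  also have "\<dots> = ?T (finsum ZA (rho_cocycle i) (arcs Q))"
    by (rule finsum_additive[where T = ?T, OF A.Z_abelian P.abelian_group_axioms Tc T0 Tadd, symmetric])
      (auto simp: rho_cocycle_closed)
  also have "\<dots> = \<zero>\<^bsub>preprojective Q\<^esub>"
  proof -
    interpret B: abelian_subgroup BA "ZA :: ('f, 'v \<times> 'e list \<Rightarrow> 'f, _) bimod" by (rule A.Bd_subgroup)
    have "finsum ZA (rho_cocycle i :: _ \<Rightarrow> _ \<times> _ \<Rightarrow> 'v \<times> 'e list \<Rightarrow> 'f) (arcs Q) \<in> BA"
      unfolding rho_coboundary(1)[OF i] A.coboundaries_eq using rho_coboundary(2)[OF i] by blast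
    then have "cls (finsum ZA (rho_cocycle i) (arcs Q)) =
        (BA :: (('v \<times> 'e list \<Rightarrow> 'f) \<times> (('v \<times> 'e list \<Rightarrow> 'f) \<Rightarrow> 'f) \<Rightarrow> 'v \<times> 'e list \<Rightarrow> 'f) set)"
      by (rule B.a_rcos_const)
    also have "\<dots> = cls \<zero>\<^bsub>ZA\<^esub>" using Z.a_coset_add_zero[OF B.a_subset] by simp
    finally show ?thesis using T0 by simp
  qed
  finally show ?thesis .
qed

end


section \<open>The quadratic relations of the preprojective algebra\<close>

lemma double_sum_Plus:
  assumes "finite D1" "finite D2"
  shows "(\<Sum>b\<in>D1 <+> D2. \<Sum>c\<in>D1 <+> D2. F b c) =
    (\<Sum>a\<in>D1. \<Sum>b\<in>D1. F (Inl a) (Inl b)) + (\<Sum>a\<in>D1. \<Sum>b\<in>D2. F (Inl a) (Inr b)) +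
    (\<Sum>a\<in>D2. \<Sum>b\<in>D1. F (Inr a) (Inl b)) + (\<Sum>a\<in>D2. \<Sum>b\<in>D2. F (Inr a) (Inr b))"
  by (simp add: sum.Plus assms comp_def sum.distrib add_ac)

context finite_quiver
begin

text \<open>
  Degree two is spanned by pairs of vertices; composable arrows \<open>b\<close>, \<open>c\<close> multiply to
  \<open>\<kappa>0 b c\<close> times the pair of their outer ends.
\<close>

definition end_kappa :: "('e + 'e \<Rightarrow> 'e + 'e \<Rightarrow> 'f::field) \<Rightarrow> 'v \<times> 'v \<Rightarrow> 'e + 'e \<Rightarrow> 'e + 'e \<Rightarrow> 'f" where
  "end_kappa \<kappa>0 = (\<lambda>(i, j) b c.
    if b \<in> arcs2 \<and> c \<in> arcs2 \<and> src2 b = i \<and> tgt2 b = src2 c \<and> tgt2 c = j then \<kappa>0 b c else 0)"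

lemma end_cube:
  "cube_zero (verts Q) arcs2 (verts Q \<times> verts Q) src2 tgt2 fst snd (end_kappa \<kappa>0)"
  by unfold_locales (auto simp: end_kappa_def split: if_splits prod.splits)

abbreviation "EB \<kappa>0 \<equiv> cube_zero_algebra (verts Q) arcs2 (verts Q \<times> verts Q) src2 tgt2 fst snd (end_kappa \<kappa>0)"

text \<open>
  The coefficient functionals detect the two ways in which a cocycle reaches degree two.
\<close>

definition pcoef :: "'v \<times> 'e list \<Rightarrow> ('v \<times> 'e list \<Rightarrow> 'f::field) \<Rightarrow> 'f" where
  "pcoef p = (\<lambda>x\<in>carrier PA. x p)"

lemma pcoef_closed: "pcoef p \<in> carrier (dual_bimod (PA :: ('f::field, _) module))"
  unfolding pcoef_def
  by (rule falgebra.dual_bimodI[OF path_falgebra]) (simp_all add: path_algebra_simps)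

lemma mult_short_path:
  "(y \<otimes>\<^bsub>PA\<^esub> z) (u, []) = y (u, []) * (z (u, []) :: 'f::field)"
  "(y \<otimes>\<^bsub>PA\<^esub> z) (u, [a]) = y (u, []) * z (u, [a]) + y (u, [a]) * z (head Q a, [])"
  "(y \<otimes>\<^bsub>PA\<^esub> z) (u, [a, b]) = y (u, []) * z (u, [a, b]) + y (u, [a]) * z (head Q a, [b]) +
     y (u, [a, b]) * z (head Q b, [])"
  by (simp_all add: path_algebra_simps(3) numeral_2_eq_2)

definition cut_end :: "(('v \<times> 'e list \<Rightarrow> 'f::field) \<times> (('v \<times> 'e list \<Rightarrow> 'f) \<Rightarrow> 'f) \<Rightarrow> 'v \<times> 'e list \<Rightarrow> 'f) \<Rightarrow> 'e \<Rightarrow> 'v \<times> 'e list \<Rightarrow> 'f" where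
  "cut_end c a = c (unit_fun (tail Q a, [a]), pcoef (head Q a, []))"

definition cut_arrow :: "(('v \<times> 'e list \<Rightarrow> 'f::field) \<times> (('v \<times> 'e list \<Rightarrow> 'f) \<Rightarrow> 'f) \<Rightarrow> 'v \<times> 'e list \<Rightarrow> 'f) \<Rightarrow> 'e \<Rightarrow> 'e \<Rightarrow> 'f" where
  "cut_arrow c a x = c (unit_fun (tail Q x, [x]), pcoef (tail Q a, [a])) (tail Q x, [])"

text \<open>
  The coordinates of a class in degrees one and two, read off from values of a cocycle on single arrows.
  A dual arrow appears in degree one; in degree two it is multiplied by an arrow on the left, which is
  visible at the coefficient functional of that arrow, or on the right, which is visible in
  the coefficient of that arrow in the value of the cocycle.
\<close>

definition class_coords ::
    "('e + 'e \<Rightarrow> 'e + 'e \<Rightarrow> 'f::field) \<Rightarrow>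
     (('v \<times> 'e list \<Rightarrow> 'f) \<times> (('v \<times> 'e list \<Rightarrow> 'f) \<Rightarrow> 'f) \<Rightarrow> 'v \<times> 'e list \<Rightarrow> 'f) \<Rightarrow>
     ('v \<Rightarrow> 'f) \<times> ('e + 'e \<Rightarrow> 'f) \<times> ('v \<times> 'v \<Rightarrow> 'f)" where
  "class_coords \<kappa>0 c = (\<lambda>i. 0, case_sum (\<lambda>a. 0) (\<lambda>a. if a \<in> arcs Q then cut_end c a (tail Q a, []) else 0),
     \<lambda>ij. (\<Sum>a\<in>arcs Q. \<Sum>x\<in>arcs Q. end_kappa \<kappa>0 ij (Inl a) (Inr x) * cut_arrow c a x) +
          (\<Sum>a\<in>arcs Q. \<Sum>b\<in>arcs Q. end_kappa \<kappa>0 ij (Inr a) (Inl b) * cut_end c a (tail Q b, [b])))"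

definition quad_rep ::
    "('e + 'e \<Rightarrow> 'e + 'e \<Rightarrow> 'f::field) \<Rightarrow> ('v \<times> 'e list \<Rightarrow> 'f) + ('f, 'v, 'e) extclass \<Rightarrow>
     ('v \<Rightarrow> 'f) \<times> ('e + 'e \<Rightarrow> 'f) \<times> ('v \<times> 'v \<Rightarrow> 'f)" where
  "quad_rep \<kappa>0 = case_sum
    (\<lambda>y. (\<lambda>i. y (i, []), case_sum (\<lambda>a. y (tail Q a, [a])) (\<lambda>a. 0),
      \<lambda>ij. \<Sum>a\<in>arcs Q. \<Sum>b\<in>arcs Q. end_kappa \<kappa>0 ij (Inl a) (Inl b) * y (tail Q a, [a, b])))
    (\<lambda>X. class_coords \<kappa>0 (SOME c. c \<in> X))"

text \<open>
  A coboundary has coordinates in degree two only along the products of an arrow with its own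
  dual; at each vertex, the sums of the coordinates of the two kinds are opposite.
\<close>

lemma class_coords_coboundary:
  fixes \<kappa>0 :: "'e + 'e \<Rightarrow> 'e + 'e \<Rightarrow> 'f::field"
  assumes trace: "\<And>i. i \<in> verts Q \<Longrightarrow>
      (\<Sum>a\<in>arcs Q. if head Q a = i then \<kappa>0 (Inr a) (Inl a) else 0) =
      (\<Sum>a\<in>arcs Q. if tail Q a = i then \<kappa>0 (Inl a) (Inr a) else 0)"
    and h: "falgebra.D_linear (PA :: ('f, _) module) h"
  shows "class_coords \<kappa>0 (falgebra.cobd PA h) = (\<lambda>i. 0, \<lambda>b. 0, \<lambda>ij. 0)"
proof -
  interpret A: falgebra "PA :: ('f, _) module" by (rule path_falgebra)
  note hD = A.D_linearD[OF h]
  let ?c = "A.cobd h"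
  let ?H = "\<lambda>i. h (pcoef (i, [])) (i, [])"
  have al: "unit_fun (tail Q a, [a]) \<in> carrier (PA :: ('f, _) module)" if "a \<in> arcs Q" for a
    using that by (intro unit_path_closed) simp
  have h0: "h \<zero>\<^bsub>DA\<^esub> = \<zero>\<^bsub>PA\<^esub>"
  proof -
    have "\<zero>\<^bsub>DA\<^esub> = 0 \<odot>\<^bsub>DA\<^esub> (\<zero>\<^bsub>DA\<^esub> :: ('v \<times> 'e list \<Rightarrow> 'f) \<Rightarrow> 'f)"
      by (simp add: dual_bimod_simps cong: restrict_cong)
    then show ?thesis using hD(3)[OF A.D_closed(3), of 0] hD(1)[OF A.D_closed(3)] by simp
  qed
  have l0: "lact DA (unit_fun (tail Q a, [a])) (pcoef (head Q a, [])) = (\<zero>\<^bsub>DA\<^esub> :: ('v \<times> 'e list \<Rightarrow> 'f) \<Rightarrow> 'f)"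
    if "a \<in> arcs Q" for a
    by (rule A.D_eqI)
      (use al[OF that] in \<open>simp_all add: pcoef_closed, simp add: dual_bimod_simps pcoef_def mult_short_path unit_fun_def\<close>)
  have l1: "lact DA (unit_fun (tail Q x, [x])) (pcoef (tail Q a, [a])) =
      (if a = x then pcoef (tail Q a, []) else \<zero>\<^bsub>DA\<^esub> :: ('v \<times> 'e list \<Rightarrow> 'f) \<Rightarrow> 'f)"
    if "x \<in> arcs Q" for a x
  proof (rule A.D_eqI)
    fix z assume z: "z \<in> carrier (PA :: ('f, _) module)"
    show "lact DA (unit_fun (tail Q x, [x])) (pcoef (tail Q a, [a])) z =
      (if a = x then pcoef (tail Q a, []) else \<zero>\<^bsub>DA\<^esub> :: ('v \<times> 'e list \<Rightarrow> 'f) \<Rightarrow> 'f) z"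
      using z al[OF that] by (cases "a = x") (simp_all add: dual_bimod_simps pcoef_def mult_short_path unit_fun_def)
  qed (use al[OF that] in \<open>simp_all add: pcoef_closed\<close>)
  have ce: "cut_end ?c a = unit_fun (tail Q a, [a]) \<otimes>\<^bsub>PA\<^esub> h (pcoef (head Q a, []))" if a: "a \<in> arcs Q" for a
    using al[OF a] hD(1)[OF pcoef_closed]
    by (simp add: cut_end_def A.cobd_val[OF h] pcoef_closed l0[OF a] h0)
  have u: "cut_end ?c a (tail Q a, []) = 0" if "a \<in> arcs Q" for a
    by (simp add: ce that mult_short_path unit_fun_def)
  have w2: "cut_end ?c a (tail Q b, [b]) = (if a = b then ?H (head Q a) else 0)" if "a \<in> arcs Q" for a b
    by (auto simp: ce that mult_short_path unit_fun_def)
  have w1: "cut_arrow ?c a x = (if a = x then - ?H (tail Q a) else 0)" if "x \<in> arcs Q" for a x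
  proof -
    have "cut_arrow ?c a x = (unit_fun (tail Q x, [x]) \<otimes>\<^bsub>PA\<^esub> h (pcoef (tail Q a, [a]))) (tail Q x, []) -
        h (lact DA (unit_fun (tail Q x, [x])) (pcoef (tail Q a, [a]))) (tail Q x, [])"
      using al[OF that] by (simp add: cut_arrow_def A.cobd_val[OF h] pcoef_closed)
        (simp add: path_algebra_simps(2,6))
    also have "\<dots> = (if a = x then - ?H (tail Q a) else 0)"
      unfolding l1[OF that] mult_short_path using h0
      by (auto simp: unit_fun_def path_algebra_simps(5))
    finally show ?thesis .
  qed
  have "(\<Sum>a\<in>arcs Q. \<Sum>x\<in>arcs Q. end_kappa \<kappa>0 ij (Inl a) (Inr x) * cut_arrow ?c a x) +
      (\<Sum>a\<in>arcs Q. \<Sum>b\<in>arcs Q. end_kappa \<kappa>0 ij (Inr a) (Inl b) * cut_end ?c a (tail Q b, [b])) = 0" for ij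
  proof -
    obtain i j where ij: "ij = (i, j)" by (cases ij)
    have 1: "(\<Sum>x\<in>arcs Q. end_kappa \<kappa>0 ij (Inl a) (Inr x) * cut_arrow ?c a x) =
        end_kappa \<kappa>0 ij (Inl a) (Inr a) * - ?H (tail Q a)" if a: "a \<in> arcs Q" for a
    proof -
      have "(\<Sum>x\<in>arcs Q. end_kappa \<kappa>0 ij (Inl a) (Inr x) * cut_arrow ?c a x) =
          (\<Sum>x\<in>arcs Q. if x = a then end_kappa \<kappa>0 ij (Inl a) (Inr a) * - ?H (tail Q a) else 0)"
        by (intro sum.cong refl) (auto simp: w1)
      then show ?thesis using a by simp
    qed
    have 2: "(\<Sum>b\<in>arcs Q. end_kappa \<kappa>0 ij (Inr a) (Inl b) * cut_end ?c a (tail Q b, [b])) =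
        end_kappa \<kappa>0 ij (Inr a) (Inl a) * ?H (head Q a)" if a: "a \<in> arcs Q" for a
    proof -
      have "(\<Sum>b\<in>arcs Q. end_kappa \<kappa>0 ij (Inr a) (Inl b) * cut_end ?c a (tail Q b, [b])) =
          (\<Sum>b\<in>arcs Q. if b = a then end_kappa \<kappa>0 ij (Inr a) (Inl a) * ?H (head Q a) else 0)"
        by (intro sum.cong refl) (auto simp: w2 a)
      then show ?thesis using a by simp
    qed
    show ?thesis
    proof (cases "i = j \<and> i \<in> verts Q")
      case False
      have "end_kappa \<kappa>0 ij (Inl a) (Inr a) = 0 \<and> end_kappa \<kappa>0 ij (Inr a) (Inl a) = 0" if "a \<in> arcs Q" for a
        using False that by (auto simp: ij end_kappa_def)
      then show ?thesis by (simp add: 1 2)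
    next
      case True
      have "(\<Sum>a\<in>arcs Q. end_kappa \<kappa>0 ij (Inl a) (Inr a) * - ?H (tail Q a)) =
          - ?H i * (\<Sum>a\<in>arcs Q. if tail Q a = i then \<kappa>0 (Inl a) (Inr a) else 0)"
        unfolding sum_distrib_left by (intro sum.cong refl) (use True in \<open>auto simp: ij end_kappa_def\<close>)
      moreover have "(\<Sum>a\<in>arcs Q. end_kappa \<kappa>0 ij (Inr a) (Inl a) * ?H (head Q a)) =
          ?H i * (\<Sum>a\<in>arcs Q. if head Q a = i then \<kappa>0 (Inr a) (Inl a) else 0)"
        unfolding sum_distrib_left by (intro sum.cong refl) (use True in \<open>auto simp: ij end_kappa_def\<close>)
      ultimately show ?thesis using trace[OF True[THEN conjunct2]] by (simp add: 1 2)
    qed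
  qed
  then show ?thesis
    unfolding class_coords_def by (auto simp: u fun_eq_iff split: sum.splits)
qed

lemma quad_rep_class:
  fixes \<kappa>0 :: "'e + 'e \<Rightarrow> 'e + 'e \<Rightarrow> 'f::field"
  assumes trace: "\<And>i. i \<in> verts Q \<Longrightarrow>
      (\<Sum>a\<in>arcs Q. if head Q a = i then \<kappa>0 (Inr a) (Inl a) else 0) =
      (\<Sum>a\<in>arcs Q. if tail Q a = i then \<kappa>0 (Inl a) (Inr a) else 0)"
    and c: "c \<in> carrier ZA"
  shows "quad_rep \<kappa>0 (Inr (cls c)) = class_coords \<kappa>0 c"
proof -
  interpret A: falgebra "PA :: ('f, _) module" by (rule path_falgebra)
  have al: "unit_fun (tail Q a, [a]) \<in> carrier (PA :: ('f, _) module)" if "a \<in> arcs Q" for a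
    using that by (intro unit_path_closed) simp
  have add: "cut_end (c \<oplus>\<^bsub>ZA\<^esub> d) a p = cut_end c a p + cut_end d a p"
    "cut_arrow (c \<oplus>\<^bsub>ZA\<^esub> d) x a = cut_arrow c x a + cut_arrow d x a"
    if "a \<in> arcs Q" "c \<in> carrier ZA" "d \<in> carrier ZA"
    for a x p and c d :: "('v \<times> 'e list \<Rightarrow> 'f) \<times> (('v \<times> 'e list \<Rightarrow> 'f) \<Rightarrow> 'f) \<Rightarrow> 'v \<times> 'e list \<Rightarrow> 'f"
    using al[OF that(1)]
    by (simp_all add: cut_end_def cut_arrow_def A.cocycle_ops pcoef_closed path_algebra_simps(2))
  note cob = class_coords_coboundary[OF trace, unfolded class_coords_def prod.inject]
  have u: "(\<lambda>c. if a \<in> arcs Q then cut_end c a (tail Q a, []) else 0) (SOME d. d \<in> cls c) =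
      (if a \<in> arcs Q then cut_end c a (tail Q a, []) else 0)" for a
  proof (rule A.ext_functional[OF c])
    show "(if a \<in> arcs Q then cut_end (A.cobd h) a (tail Q a, []) else 0) = 0" if "A.D_linear h" for h
      using fun_cong[OF cob[OF _ that, THEN conjunct2, THEN conjunct1], of "Inr a"] trace by simp
  qed (simp add: add)
  have w: "(\<lambda>c. (\<Sum>a\<in>arcs Q. \<Sum>x\<in>arcs Q. end_kappa \<kappa>0 ij (Inl a) (Inr x) * cut_arrow c a x) +
          (\<Sum>a\<in>arcs Q. \<Sum>b\<in>arcs Q. end_kappa \<kappa>0 ij (Inr a) (Inl b) * cut_end c a (tail Q b, [b])))
      (SOME d. d \<in> cls c) =
      (\<Sum>a\<in>arcs Q. \<Sum>x\<in>arcs Q. end_kappa \<kappa>0 ij (Inl a) (Inr x) * cut_arrow c a x) +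
          (\<Sum>a\<in>arcs Q. \<Sum>b\<in>arcs Q. end_kappa \<kappa>0 ij (Inr a) (Inl b) * cut_end c a (tail Q b, [b]))" for ij
  proof (rule A.ext_functional[OF c])
    show "(\<Sum>a\<in>arcs Q. \<Sum>x\<in>arcs Q. end_kappa \<kappa>0 ij (Inl a) (Inr x) * cut_arrow (A.cobd h) a x) +
          (\<Sum>a\<in>arcs Q. \<Sum>b\<in>arcs Q. end_kappa \<kappa>0 ij (Inr a) (Inl b) * cut_end (A.cobd h) a (tail Q b, [b])) = 0"
      if "A.D_linear h" for h
      using fun_cong[OF cob[OF _ that, THEN conjunct2, THEN conjunct2], of ij] trace by simp
  qed (simp add: add distrib_left sum.distrib add_ac)
  show ?thesis
    using u w unfolding quad_rep_def class_coords_def by (simp add: fun_eq_iff split: sum.splits)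
qed

text \<open>
  This is a representation of the preprojective algebra truncated after degree two. It is the trace condition
  that makes it well defined on extension classes.
\<close>

lemma quad_rep_map:
  fixes \<kappa>0 :: "'e + 'e \<Rightarrow> 'e + 'e \<Rightarrow> 'f::field"
  assumes trace: "\<And>i. i \<in> verts Q \<Longrightarrow>
      (\<Sum>a\<in>arcs Q. if head Q a = i then \<kappa>0 (Inr a) (Inl a) else 0) =
      (\<Sum>a\<in>arcs Q. if tail Q a = i then \<kappa>0 (Inl a) (Inr a) else 0)"
  shows "tensor_map PA (ext_bimod Q) (EB \<kappa>0) (quad_rep \<kappa>0)"
proof -
  interpret A: falgebra "PA :: ('f, _) module" by (rule path_falgebra)
  interpret C: cube_zero "verts Q" arcs2 "verts Q \<times> verts Q" src2 tgt2 fst snd "end_kappa \<kappa>0"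
    by (rule end_cube)
  interpret B: graded_falgebra "EB \<kappa>0" by (rule C.cube_zero_graded)
  interpret T: tensor_data "PA :: ('f, _) module" "ext_bimod Q" by (rule ext_data)
  have cl: "\<exists>c\<in>carrier ZA. X = cls c" if "X \<in> carrier (ext_bimod Q)" for X :: "('f, 'v, 'e) extclass"
    using that unfolding ext_bimod_def A.ext_carrier by blast
  note qr = quad_rep_class[OF trace]
  have al: "unit_fun (tail Q a, [a]) \<in> carrier (PA :: ('f, _) module)" if "a \<in> arcs Q" for a
    using that by (intro unit_path_closed) simp
  have off: "y (tail Q a, a # p) = 0" if "y \<in> carrier PA" "a \<notin> arcs Q" for y a p
  proof -
    have "(tail Q a, a # p) \<notin> quiver_paths Q" using that(2) by simp
    then show ?thesis using that(1) unfolding path_algebra_simps(1) by blast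
  qed
  have off0: "y (i, []) = 0" if "y \<in> carrier PA" "i \<notin> verts Q" for y i
  proof -
    have "(i, []) \<notin> quiver_paths Q" using that(2) by simp
    then show ?thesis using that(1) unfolding path_algebra_simps(1) by blast
  qed
  have kap: "end_kappa \<kappa>0 p b c \<noteq> 0 \<Longrightarrow> p \<in> verts Q \<times> verts Q \<and> src2 b = fst p \<and> tgt2 b = src2 c \<and> tgt2 c = snd p" for p b c
    using C.kappa_support[of p b c] by blast
  have kp: "p \<notin> verts Q \<times> verts Q \<Longrightarrow> end_kappa \<kappa>0 p b c = 0" for p b c
    using kap by blast
  have Kb: "C.K p u v =
    (\<Sum>a\<in>arcs Q. \<Sum>b\<in>arcs Q. end_kappa \<kappa>0 p (Inl a) (Inl b) * u (Inl a) * v (Inl b)) +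
    (\<Sum>a\<in>arcs Q. \<Sum>b\<in>arcs Q. end_kappa \<kappa>0 p (Inl a) (Inr b) * u (Inl a) * v (Inr b)) +
    (\<Sum>a\<in>arcs Q. \<Sum>b\<in>arcs Q. end_kappa \<kappa>0 p (Inr a) (Inl b) * u (Inr a) * v (Inl b)) +
    (\<Sum>a\<in>arcs Q. \<Sum>b\<in>arcs Q. end_kappa \<kappa>0 p (Inr a) (Inr b) * u (Inr a) * v (Inr b))" for p u v
    unfolding C.K_def by (rule double_sum_Plus) simp_all
  have inlC: "quad_rep \<kappa>0 (Inl y) \<in> carrier (EB \<kappa>0)" if "y \<in> carrier PA" for y
    using that by (auto simp: quad_rep_def C.cube_zero_simps off off0 kp split: sum.splits)
  have inrC: "class_coords \<kappa>0 c \<in> carrier (EB \<kappa>0)" for c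
    by (auto simp: class_coords_def C.cube_zero_simps kp split: sum.splits)
  have pv: "pcoef p x = x p" if "x \<in> carrier PA" for p and x :: "'v \<times> 'e list \<Rightarrow> 'f"
    using that by (simp add: pcoef_def)
  have r1: "ract DA (pcoef (i, [])) y = y (i, []) \<odot>\<^bsub>DA\<^esub> pcoef (i, [])" if "y \<in> carrier (PA :: ('f, _) module)" for y i
    by (rule A.D_eqI)
      (use that in \<open>simp_all add: pcoef_closed, simp add: dual_bimod_simps pv mult_short_path\<close>)
  have r2: "ract DA (pcoef (tail Q a, [a])) y =
      y (tail Q a, []) \<odot>\<^bsub>DA\<^esub> pcoef (tail Q a, [a]) \<oplus>\<^bsub>DA\<^esub> y (tail Q a, [a]) \<odot>\<^bsub>DA\<^esub> pcoef (head Q a, [])"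
    if "y \<in> carrier (PA :: ('f, _) module)" for y a
    by (rule A.D_eqI)
      (use that in \<open>simp_all add: pcoef_closed, simp add: dual_bimod_simps pv mult_short_path\<close>)
  have lc: "cut_end (lact ZA y c) a p = y (head Q a, []) * cut_end c a p"
    "cut_arrow (lact ZA y c) x a = y (tail Q x, []) * cut_arrow c x a + y (tail Q x, [x]) *
       c (unit_fun (tail Q a, [a]), pcoef (head Q x, [])) (tail Q a, [])"
    if "y \<in> carrier PA" "a \<in> arcs Q" "c \<in> carrier ZA"
    for y a x p and c :: "('v \<times> 'e list \<Rightarrow> 'f) \<times> (('v \<times> 'e list \<Rightarrow> 'f) \<Rightarrow> 'f) \<Rightarrow> 'v \<times> 'e list \<Rightarrow> 'f"
    using al[OF that(2)] that A.cocycleD(2,3)[OF that(3) al[OF that(2)]]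
    by (simp_all add: cut_end_def cut_arrow_def A.cocycle_ops pcoef_closed r1 r2)
      (simp_all add: path_algebra_simps(2,6))
  have rc: "cut_end (ract ZA c y) a p = (cut_end c a \<otimes>\<^bsub>PA\<^esub> y) p"
    "cut_arrow (ract ZA c y) x a = cut_arrow c x a * y (tail Q a, [])"
    if "y \<in> carrier PA" "a \<in> arcs Q" "c \<in> carrier ZA"
    for y a x p and c :: "('v \<times> 'e list \<Rightarrow> 'f) \<times> (('v \<times> 'e list \<Rightarrow> 'f) \<Rightarrow> 'f) \<Rightarrow> 'v \<times> 'e list \<Rightarrow> 'f"
    using al[OF that(2)] that
    by (simp_all add: cut_end_def cut_arrow_def A.cocycle_ops pcoef_closed mult_short_path)
  have add: "cut_end (c \<oplus>\<^bsub>ZA\<^esub> d) a p = cut_end c a p + cut_end d a p"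
    "cut_arrow (c \<oplus>\<^bsub>ZA\<^esub> d) x a = cut_arrow c x a + cut_arrow d x a"
    "cut_end (k \<odot>\<^bsub>ZA\<^esub> c) a p = k * cut_end c a p"
    "cut_arrow (k \<odot>\<^bsub>ZA\<^esub> c) x a = k * cut_arrow c x a"
    if "a \<in> arcs Q" "c \<in> carrier ZA" "d \<in> carrier ZA"
    for a x p k and c d :: "('v \<times> 'e list \<Rightarrow> 'f) \<times> (('v \<times> 'e list \<Rightarrow> 'f) \<Rightarrow> 'f) \<Rightarrow> 'v \<times> 'e list \<Rightarrow> 'f"
    using al[OF that(1)]
    by (simp_all add: cut_end_def cut_arrow_def A.cocycle_ops pcoef_closed path_algebra_simps(2,6))
  show ?thesis
  proof (unfold_locales, goal_cases)
    case (1 l)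
    then show ?case using inlC inrC cl qr by (cases l) fastforce+
  next
    case (2 y z)
    show ?case
      by (auto simp: quad_rep_def C.cube_zero_simps path_algebra_simps(2) fun_eq_iff distrib_left sum.distrib
          split: sum.splits)
  next
    case (3 y k)
    show ?case
      by (auto simp: quad_rep_def C.cube_zero_simps path_algebra_simps(6) fun_eq_iff sum_distrib_left mult_ac
          split: sum.splits)
  next
    case (4 y z)
    have "(\<Sum>a\<in>arcs Q. \<Sum>b\<in>arcs Q. end_kappa \<kappa>0 p (Inl a) (Inl b) * (y \<otimes>\<^bsub>PA\<^esub> z) (tail Q a, [a, b])) =
        (\<Sum>a\<in>arcs Q. \<Sum>b\<in>arcs Q. y (fst p, []) * (end_kappa \<kappa>0 p (Inl a) (Inl b) * z (tail Q a, [a, b])) +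
          (end_kappa \<kappa>0 p (Inl a) (Inl b) * y (tail Q a, [a, b])) * z (snd p, []) +
          end_kappa \<kappa>0 p (Inl a) (Inl b) * y (tail Q a, [a]) * z (tail Q b, [b]))" for p
    proof (intro sum.cong refl)
      fix a b
      show "end_kappa \<kappa>0 p (Inl a) (Inl b) * (y \<otimes>\<^bsub>PA\<^esub> z) (tail Q a, [a, b]) =
          y (fst p, []) * (end_kappa \<kappa>0 p (Inl a) (Inl b) * z (tail Q a, [a, b])) +
          (end_kappa \<kappa>0 p (Inl a) (Inl b) * y (tail Q a, [a, b])) * z (snd p, []) +
          end_kappa \<kappa>0 p (Inl a) (Inl b) * y (tail Q a, [a]) * z (tail Q b, [b])"
        using kap[of p "Inl a" "Inl b"]
        by (cases "end_kappa \<kappa>0 p (Inl a) (Inl b) = 0") (simp_all add: mult_short_path algebra_simps)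
    qed
    then show ?case
      by (auto simp: quad_rep_def C.cube_zero_simps Kb mult_short_path fun_eq_iff sum.distrib
          sum_distrib_left sum_distrib_right split: sum.splits)
  next
    case 5
    show ?case
      by (auto simp: quad_rep_def C.cube_zero_simps path_algebra_simps(4) fun_eq_iff split: sum.splits)
  next
    case (6 X Y)
    then obtain c d where cd: "c \<in> carrier ZA" "d \<in> carrier ZA" "X = cls c" "Y = cls d" using cl by blast
    have "class_coords \<kappa>0 (c \<oplus>\<^bsub>ZA\<^esub> d) = class_coords \<kappa>0 c \<oplus>\<^bsub>EB \<kappa>0\<^esub> class_coords \<kappa>0 d"
      using cd(1,2)
      by (auto simp: class_coords_def C.cube_zero_simps add fun_eq_iff distrib_left sum.distrib
          split: sum.splits)
    then show ?case using cd by (simp add: cls_ops(2) qr)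
  next
    case (7 X k)
    then obtain c where cd: "c \<in> carrier ZA" "X = cls c" using cl by blast
    have "class_coords \<kappa>0 (k \<odot>\<^bsub>ZA\<^esub> c) = k \<odot>\<^bsub>EB \<kappa>0\<^esub> class_coords \<kappa>0 c"
      using cd(1)
      by (auto simp: class_coords_def C.cube_zero_simps add fun_eq_iff distrib_left sum_distrib_left mult_ac
          split: sum.splits)
    then show ?case using cd by (simp add: cls_ops(3)[OF cd(1) cd(1)] qr)
  next
    case (8 y X)
    then obtain c where cd: "c \<in> carrier ZA" "X = cls c" using cl by blast
    have y: "y \<in> carrier PA" by fact
    have 1: "(\<Sum>a\<in>arcs Q. \<Sum>x\<in>arcs Q. end_kappa \<kappa>0 p (Inl a) (Inr x) * cut_arrow (lact ZA y c) a x) =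
        (\<Sum>a\<in>arcs Q. \<Sum>x\<in>arcs Q. y (fst p, []) * (end_kappa \<kappa>0 p (Inl a) (Inr x) * cut_arrow c a x) +
          end_kappa \<kappa>0 p (Inl a) (Inr x) * y (tail Q a, [a]) * cut_end c x (tail Q x, []))" for p
    proof (intro sum.cong refl)
      fix a x assume x: "x \<in> arcs Q"
      show "end_kappa \<kappa>0 p (Inl a) (Inr x) * cut_arrow (lact ZA y c) a x =
          y (fst p, []) * (end_kappa \<kappa>0 p (Inl a) (Inr x) * cut_arrow c a x) +
          end_kappa \<kappa>0 p (Inl a) (Inr x) * y (tail Q a, [a]) * cut_end c x (tail Q x, [])"
        using kap[of p "Inl a" "Inr x"]
        by (cases "end_kappa \<kappa>0 p (Inl a) (Inr x) = 0")
          (simp_all add: lc(2)[OF y x cd(1)] cut_end_def algebra_simps)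
    qed
    have 2: "(\<Sum>a\<in>arcs Q. \<Sum>b\<in>arcs Q. end_kappa \<kappa>0 p (Inr a) (Inl b) * cut_end (lact ZA y c) a (tail Q b, [b])) =
        (\<Sum>a\<in>arcs Q. \<Sum>b\<in>arcs Q. y (fst p, []) * (end_kappa \<kappa>0 p (Inr a) (Inl b) * cut_end c a (tail Q b, [b])))" for p
    proof (intro sum.cong refl)
      fix a b assume a: "a \<in> arcs Q"
      show "end_kappa \<kappa>0 p (Inr a) (Inl b) * cut_end (lact ZA y c) a (tail Q b, [b]) =
          y (fst p, []) * (end_kappa \<kappa>0 p (Inr a) (Inl b) * cut_end c a (tail Q b, [b]))"
        using kap[of p "Inr a" "Inl b"]
        by (cases "end_kappa \<kappa>0 p (Inr a) (Inl b) = 0")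
          (simp_all add: lc(1)[OF y a cd(1)] algebra_simps)
    qed
    have 3: "cut_end (lact ZA y c) a (tail Q a, []) = y (head Q a, []) * cut_end c a (tail Q a, [])"
      if "a \<in> arcs Q" for a by (rule lc(1)[OF y that cd(1)])
    have "class_coords \<kappa>0 (lact ZA y c) = quad_rep \<kappa>0 (Inl y) \<otimes>\<^bsub>EB \<kappa>0\<^esub> class_coords \<kappa>0 c"
      using cd(1) y
      by (auto simp: class_coords_def quad_rep_def C.cube_zero_simps Kb 1 2 3 fun_eq_iff sum.distrib
          sum_distrib_left distrib_left split: sum.splits)
    then show ?case using cd y by (simp add: cls_ops(4)[OF cd(1) cd(1)] qr)
  next
    case (9 y X)
    then obtain c where cd: "c \<in> carrier ZA" "X = cls c" using cl by blast
    have y: "y \<in> carrier PA" by fact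
    have 1: "(\<Sum>a\<in>arcs Q. \<Sum>x\<in>arcs Q. end_kappa \<kappa>0 p (Inl a) (Inr x) * cut_arrow (ract ZA c y) a x) =
        (\<Sum>a\<in>arcs Q. \<Sum>x\<in>arcs Q. (end_kappa \<kappa>0 p (Inl a) (Inr x) * cut_arrow c a x) * y (snd p, []))" for p
    proof (intro sum.cong refl)
      fix a x assume x: "x \<in> arcs Q"
      show "end_kappa \<kappa>0 p (Inl a) (Inr x) * cut_arrow (ract ZA c y) a x =
          (end_kappa \<kappa>0 p (Inl a) (Inr x) * cut_arrow c a x) * y (snd p, [])"
        using kap[of p "Inl a" "Inr x"]
        by (cases "end_kappa \<kappa>0 p (Inl a) (Inr x) = 0")
          (simp_all add: rc(2)[OF y x cd(1)] algebra_simps)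
    qed
    have 2: "(\<Sum>a\<in>arcs Q. \<Sum>b\<in>arcs Q. end_kappa \<kappa>0 p (Inr a) (Inl b) * cut_end (ract ZA c y) a (tail Q b, [b])) =
        (\<Sum>a\<in>arcs Q. \<Sum>b\<in>arcs Q. (end_kappa \<kappa>0 p (Inr a) (Inl b) * cut_end c a (tail Q b, [b])) * y (snd p, []) +
          end_kappa \<kappa>0 p (Inr a) (Inl b) * cut_end c a (tail Q a, []) * y (tail Q b, [b]))" for p
    proof (intro sum.cong refl)
      fix a b assume a: "a \<in> arcs Q"
      show "end_kappa \<kappa>0 p (Inr a) (Inl b) * cut_end (ract ZA c y) a (tail Q b, [b]) =
          (end_kappa \<kappa>0 p (Inr a) (Inl b) * cut_end c a (tail Q b, [b])) * y (snd p, []) +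
          end_kappa \<kappa>0 p (Inr a) (Inl b) * cut_end c a (tail Q a, []) * y (tail Q b, [b])"
        using kap[of p "Inr a" "Inl b"]
        by (cases "end_kappa \<kappa>0 p (Inr a) (Inl b) = 0")
          (simp_all add: rc(1)[OF y a cd(1)] mult_short_path algebra_simps)
    qed
    have 3: "cut_end (ract ZA c y) a (tail Q a, []) = cut_end c a (tail Q a, []) * y (tail Q a, [])"
      if "a \<in> arcs Q" for a by (simp add: rc(1)[OF y that cd(1)] mult_short_path)
    have "class_coords \<kappa>0 (ract ZA c y) = class_coords \<kappa>0 c \<otimes>\<^bsub>EB \<kappa>0\<^esub> quad_rep \<kappa>0 (Inl y)"
      using cd(1) y
      by (auto simp: class_coords_def quad_rep_def C.cube_zero_simps Kb 1 2 3
          fun_eq_iff sum.distrib sum_distrib_right distrib_right split: sum.splits)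
    then show ?case using cd y by (simp add: cls_ops(5)[OF cd(1) cd(1)] qr)
  qed
qed

text \<open>
  The truncated representation kills every relation, and its value on a sum of words with two
  letters is the pairing of their coordinates with \<^term>\<open>\<kappa>0\<close>.
\<close>

lemma preproj_relations_orthogonal:
  fixes \<kappa>0 :: "'e + 'e \<Rightarrow> 'e + 'e \<Rightarrow> 'f::field"
  assumes trace: "\<And>i. i \<in> verts Q \<Longrightarrow>
      (\<Sum>a\<in>arcs Q. if head Q a = i then \<kappa>0 (Inr a) (Inl a) else 0) =
      (\<Sum>a\<in>arcs Q. if tail Q a = i then \<kappa>0 (Inl a) (Inr a) else 0)"
    and x: "x \<in> two_letter_sums SA U2" "subst (preprojective Q) (preproj_gen Q) x = \<zero>\<^bsub>preprojective Q\<^esub>"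
  shows "(\<Sum>b\<in>arcs2. \<Sum>c\<in>arcs2. end_kappa \<kappa>0 ij b c * coef2 dbl_co x b c) = 0"
proof -
  interpret A: falgebra "PA :: ('f, _) module" by (rule path_falgebra)
  interpret C: cube_zero "verts Q" arcs2 "verts Q \<times> verts Q" src2 tgt2 fst snd "end_kappa \<kappa>0"
    by (rule end_cube)
  interpret B: graded_falgebra "EB \<kappa>0" by (rule C.cube_zero_graded)
  interpret P: falgebra "preprojective Q :: ('f, ('f, 'v, 'e) preproj) graded_algebra"
    by (rule preprojective_falgebra)
  interpret g: tensor_map "SA :: ('f, _) module" U2 "preprojective Q" "preproj_gen Q" by (rule preproj_gen_map)
  interpret t: tensor_map "PA :: ('f, _) module" "ext_bimod Q" "preprojective Q"
    "tensor_letter (path_algebra Q) (ext_bimod Q)" by (rule letter_map_Pi)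
  interpret q: tensor_map "PA :: ('f, _) module" "ext_bimod Q" "EB \<kappa>0" "quad_rep \<kappa>0"
    by (rule quad_rep_map[OF trace])
  obtain h where h: "h \<in> alg_hom (preprojective Q) (EB \<kappa>0)"
    "\<And>l. l \<in> carrier PA <+> carrier (ext_bimod Q) \<Longrightarrow> h (tensor_letter PA (ext_bimod Q) l) = quad_rep \<kappa>0 l"
    using q.tensor_hom unfolding preprojective_def by metis
  note hD = alg_homD[OF h(1)]
  have x': "x \<in> carrier (free_algebra SA U2)" using x(1) by (simp add: two_letter_sums_def)
  have gl: "letter_map (preprojective Q) SA U2 (preproj_gen Q :: _ \<Rightarrow> ('f, 'v, 'e) preproj)"
    by unfold_locales (rule g.letter_closed)
  have hl: "letter_map (EB \<kappa>0) SA U2 (\<lambda>l. h (preproj_gen Q l))"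
    by unfold_locales (intro hD(1) g.letter_closed)
  have "h (subst (preprojective Q) (preproj_gen Q) x) = subst (EB \<kappa>0) (\<lambda>l. h (preproj_gen Q l)) x"
    by (rule hom_subst[OF gl B.falgebra_axioms h(1) x'])
  also have "\<dots> = (\<lambda>i. 0, \<lambda>b. 0, \<lambda>p. \<Sum>b\<in>arcs2. \<Sum>c\<in>arcs2. end_kappa \<kappa>0 p b c * coef2 dbl_co x b c)"
  proof (rule C.subst_two_letter[OF hl x(1)])
    fix m :: "('f, 'v, 'e) dbl" assume "m \<in> carrier U2"
    then obtain y \<theta> where m: "m = (y, \<theta>)" "y \<in> carrier V" "\<theta> \<in> carrier Vd"
      by (auto simp: double_bimod_def direct_sum_def)
    have y: "arrow_incl Q y \<in> carrier PA" by (rule arrow_incl_closed[OF m(2)])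
    have c: "arc_cocycle (eco \<theta>) \<in> carrier ZA" by (rule arc_cocycle_closed)
    have "h (preproj_gen Q (Inr m)) = quad_rep \<kappa>0 (Inl (arrow_incl Q y)) \<oplus>\<^bsub>EB \<kappa>0\<^esub> class_coords \<kappa>0 (arc_cocycle (eco \<theta>))"
      using m y cls_ops(1)[OF c c]
      by (simp add: preproj_gen_simps hD(2) h(2) quad_rep_class[OF trace c])
    moreover have "cut_end (arc_cocycle (eco \<theta>)) a (tail Q a, []) = eco \<theta> a" if a: "a \<in> arcs Q" for a
    proof -
      have "unit_fun (head Q a, []) \<in> carrier (PA :: ('f, _) module)" using a by (intro unit_path_closed) simp
      then have "pcoef (head Q a, []) (vertex_incl (unit_fun (head Q a))) = (1 :: 'f)"
        by (simp add: pcoef_def incl_unit)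
      then show ?thesis
        using arc_cocycle_unit[OF a pcoef_closed, of "eco \<theta>" "(head Q a, [])"]
        by (simp add: cut_end_def incl_unit(2)) (simp add: vertex_incl_def)
    qed
    moreover have "eco \<theta> a = 0" if "a \<notin> arcs Q" for a using that by (simp add: eco_def)
    moreover have "arrow_incl Q y (i, []) = 0" "arrow_incl Q y (tail Q a, [a]) = y a" for i a
      by (simp_all add: arrow_incl_def)
    ultimately show "\<exists>w. h (preproj_gen Q (Inr m)) = (\<lambda>i. 0, dbl_co m, w)"
      by (auto simp: quad_rep_def class_coords_def C.cube_zero_simps dbl_co_def m fun_eq_iff split: sum.splits)
  qed
  finally have "(\<lambda>p. \<Sum>b\<in>arcs2. \<Sum>c\<in>arcs2. end_kappa \<kappa>0 p b c * coef2 dbl_co x b c) = (\<lambda>p. 0)"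
    using x(2) alg_hom_zero[OF P.falgebra_axioms B.falgebra_axioms h(1)]
    by (simp add: C.cube_zero_simps(5))
  then show ?thesis by (rule fun_cong)
qed

end


section \<open>The quadratic duals of the two algebras\<close>

context quadratic_presentation
begin

lemma product_subst:
  assumes "f \<in> carrier U.W" "g \<in> carrier U.W"
  shows "dl (Inr f) \<otimes>\<^bsub>QD\<^esub> dl (Inr g) = subst QD dl (word [Inr f, Inr g])"
  using assms by (simp add: L.subst_word)

lemma two_letter_zero_iff:
  assumes "\<xi> \<in> two_letter_sums U.S U.W" "subst B (coord_letter U.dco) \<xi> = \<zero>\<^bsub>B\<^esub>"
  shows "subst QD dl \<xi> = \<zero>\<^bsub>QD\<^esub>"
proof -
  interpret I: ideal U.I U.F by (rule W.tensor_ideal_ideal)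
  interpret J: ideal J U.T by (rule U.quadratic_ideal_ideal)
  interpret T: graded_falgebra U.T by (rule W.tensor_graded)
  have \<xi>: "\<xi> \<in> carrier U.F" using assms(1) by (simp add: two_letter_sums_def)
  let ?Y = "U.I +>\<^bsub>U.F\<^esub> \<xi>"
  have Y: "?Y \<in> degs U.T 2" using two_letter_degs[OF assms(1)] by (simp add: W.tensor_simps)
  interpret c: tensor_map U.S U.W B "coord_letter U.dco" by (rule W.coord_letter_map)
  obtain k where k: "\<And>x. x \<in> carrier U.F \<Longrightarrow> k (U.I +>\<^bsub>U.F\<^esub> x) = subst B (coord_letter U.dco) x"
    using c.tensor_hom by metis
  have "subst B (coord_letter U.dco) \<xi>' = \<zero>\<^bsub>B\<^esub>" if "\<xi>' \<in> ?Y" "\<xi>' \<in> two_letter_sums U.S U.W" for \<xi>'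
  proof -
    have "\<xi>' \<in> carrier U.F" using that(2) by (simp add: two_letter_sums_def)
    moreover have "U.I +>\<^bsub>U.F\<^esub> \<xi>' = ?Y" using I.a_repr_independence'[OF that(1) \<xi>] by simp
    ultimately show ?thesis using k[of \<xi>'] k[OF \<xi>] assms(2) by simp
  qed
  then have "?Y \<in> quadratic_perp U.S M R" using perp_iff[OF Y] by blast
  then have "?Y \<in> J" using U.quadratic_perp_ideal by blast
  then have "J +>\<^bsub>U.T\<^esub> ?Y = \<zero>\<^bsub>QD\<^esub>"
    using J.a_rcos_const U.quadratic_dual_simps(5) by simp
  then show ?thesis using U.dual_coset_subst[OF \<xi>] by simp
qed

text \<open>
  All relations in degree two can be checked in the coordinate algebra, in particular those between two
  products of basis elements.
\<close>

lemma product_relation: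
  assumes bc: "b \<in> D" "c \<in> D" "b' \<in> D" "c' \<in> D"
    and rel: "\<And>p. r * \<kappa> p b c + r' * \<kappa> p b' c' = 0"
  shows "r \<odot>\<^bsub>QD\<^esub> (dl (Inr (W.basis b)) \<otimes>\<^bsub>QD\<^esub> dl (Inr (W.basis c))) \<oplus>\<^bsub>QD\<^esub>
    r' \<odot>\<^bsub>QD\<^esub> (dl (Inr (W.basis b')) \<otimes>\<^bsub>QD\<^esub> dl (Inr (W.basis c'))) = \<zero>\<^bsub>QD\<^esub>"
proof -
  interpret B: graded_falgebra B by (rule cube_zero_graded)
  interpret c: tensor_map U.S U.W B "coord_letter U.dco" by (rule W.coord_letter_map)
  interpret F: falgebra U.F by (rule free_falgebra)
  note cD = alg_homD[OF c.subst_hom] and lD = alg_homD[OF L.subst_hom]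
  let ?w = "word [Inr (W.basis b), Inr (W.basis c)]" and ?w' = "word [Inr (W.basis b'), Inr (W.basis c')]"
  let ?\<xi> = "r \<odot>\<^bsub>U.F\<^esub> ?w \<oplus>\<^bsub>U.F\<^esub> r' \<odot>\<^bsub>U.F\<^esub> ?w'"
  have w: "?w \<in> carrier U.F" "?w' \<in> carrier U.F" using W.basis bc by simp_all
  have sw: "subst B (coord_letter U.dco) (word [Inr (W.basis d), Inr (W.basis e)]) = (\<lambda>i. 0, \<lambda>b. 0, \<lambda>p. \<kappa> p d e)"
    if "d \<in> D" "e \<in> D" for d e
    using that W.basis by (simp add: c.subst_word) (simp add: coord_letter_def cube_zero_simps K_unit K_simps)
  have "subst B (coord_letter U.dco) ?\<xi> = \<zero>\<^bsub>B\<^esub>"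
    using w bc rel by (simp add: cD(2,5) sw cube_zero_simps)
  moreover have "?\<xi> \<in> two_letter_sums U.S U.W"
    using bc W.basis by (intro two_letter_add two_letter_smult two_letter_word) auto
  ultimately have "subst QD dl ?\<xi> = \<zero>\<^bsub>QD\<^esub>" by (intro two_letter_zero_iff)
  then show ?thesis using w bc W.basis by (simp add: lD(2,5) product_subst)
qed

lemma product_zero:
  assumes "b \<in> D" "c \<in> D" "\<And>p. \<kappa> p b c = 0"
  shows "dl (Inr (W.basis b)) \<otimes>\<^bsub>QD\<^esub> dl (Inr (W.basis c)) = \<zero>\<^bsub>QD\<^esub>"
proof -
  interpret QD: graded_falgebra QD by (rule U.quadratic_dual_graded)
  have "dl (Inr (W.basis b)) \<otimes>\<^bsub>QD\<^esub> dl (Inr (W.basis c)) \<in> carrier QD"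
    using assms W.basis by simp
  then show ?thesis using product_relation[OF assms(1,2,1,2), of 1 0] assms(3) by simp
qed

end

context finite_quiver
begin

abbreviation "PD \<equiv> path_algebra_dual Q"
abbreviation "GB \<equiv> cube_zero_algebra (verts Q) (arcs Q) ({} :: unit set) (head Q) (tail Q) undefined undefined (\<lambda>p b c. 0)"

text \<open>
  Without relations everything of degree two is orthogonal to the relations, so the algebra of the
  presentation has nothing in degree two.
\<close>

lemma path_presentation:
  "quadratic_presentation (verts Q) (arcs Q) (tail Q) (head Q) (V :: ('f::field, _, _) bimod) (\<lambda>x. x)
    ({} :: unit set) undefined undefined (\<lambda>p b c. 0) (path_relations Q)"
proof -
  interpret U: coord_bimod "verts Q" "arcs Q" "tail Q" "head Q" "V :: ('f, _, _) bimod" "\<lambda>x. x"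
    by (rule arrow_coord)
  interpret C: cube_zero "verts Q" "arcs Q" "{} :: unit set" "head Q" "tail Q" undefined undefined "\<lambda>p b c. 0 :: 'f"
    by unfold_locales auto
  interpret W: coord_cube_zero "verts Q" "arcs Q" "head Q" "tail Q" U.W U.dco "{} :: unit set" undefined undefined "\<lambda>p b c. 0 :: 'f"
    using U.left_dual_coord C.cube_zero_axioms by (rule coord_cube_zero.intro)
  show ?thesis
  proof unfold_locales
    fix Y assume Y: "Y \<in> degs U.T 2"
    have "quadratic_pairing U.S V \<xi> x k = 0"
      if \<xi>: "\<xi> \<in> two_letter_sums U.S U.W" and x: "x \<in> two_letter_sums U.S V" "x \<in> tensor_ideal U.S V" for \<xi> x k
      unfolding U.quadratic_pairing_coord[OF \<xi> x(1)]
      using U.coef2_tensor_ideal[OF _ _ _ x] by (intro sum.neutral ballI) auto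
    moreover have "path_relations Q = {tensor_ideal U.S V}"
      by (simp add: path_relations_def tensor_algebra_def quot_algebra_def)
    ultimately have "Y \<in> quadratic_perp U.S V (path_relations Q)"
      using Y by (auto simp: quadratic_perp_def fun_algebra_simps(5) fun_eq_iff)
    moreover have "\<forall>\<xi>\<in>Y \<inter> two_letter_sums U.S U.W. subst C.B (coord_letter U.dco) \<xi> = \<zero>\<^bsub>C.B\<^esub>"
      by (simp add: W.subst_coord_letter C.cube_zero_simps)
    ultimately show "Y \<in> quadratic_perp U.S V (path_relations Q) \<longleftrightarrow>
        (\<forall>\<xi>\<in>Y \<inter> two_letter_sums U.S U.W. subst C.B (coord_letter U.dco) \<xi> = \<zero>\<^bsub>C.B\<^esub>)" by blast
  qed
qed

lemma vertex_kappa_simps [simp]: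
  "vertex_kappa i (Inl a) (Inr b) = (if a = b \<and> a \<in> arcs Q \<and> head Q a = i then 1 else 0 :: 'f::field)"
  "vertex_kappa i (Inr a) (Inl b) = (if a = b \<and> a \<in> arcs Q \<and> tail Q a = i then - 1 else 0 :: 'f)"
  "vertex_kappa i (Inl a) (Inl b) = (0 :: 'f)"
  "vertex_kappa i (Inr a) (Inr b) = (0 :: 'f)"
proof -
  have "vertex_kappa i (Inl a) (Inr b) = (\<Sum>c\<in>arcs Q. if c = a then (if a = b \<and> head Q a = i then 1 else 0 :: 'f) else 0)"
    unfolding vertex_kappa_def by (intro sum.cong refl) (auto simp: unit_fun_def)
  then show "vertex_kappa i (Inl a) (Inr b) = (if a = b \<and> a \<in> arcs Q \<and> head Q a = i then 1 else 0 :: 'f)" by auto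
  have "vertex_kappa i (Inr a) (Inl b) = (\<Sum>c\<in>arcs Q. if c = a then (if a = b \<and> tail Q a = i then - 1 else 0 :: 'f) else 0)"
    unfolding vertex_kappa_def by (intro sum.cong refl) (auto simp: unit_fun_def)
  then show "vertex_kappa i (Inr a) (Inl b) = (if a = b \<and> a \<in> arcs Q \<and> tail Q a = i then - 1 else 0 :: 'f)" by auto
  show "vertex_kappa i (Inl a) (Inl b) = (0 :: 'f)" "vertex_kappa i (Inr a) (Inr b) = (0 :: 'f)"
    unfolding vertex_kappa_def by (auto simp: unit_fun_def)
qed

lemma vertex_kappa_sum:
  "(\<Sum>c\<in>arcs2. \<Sum>b\<in>arcs2. vertex_kappa i c b * C c b) =
    (\<Sum>a\<in>arcs Q. if head Q a = i then C (Inl a) (Inr a) else 0) -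
    (\<Sum>a\<in>arcs Q. if tail Q a = i then C (Inr a) (Inl a) else (0 :: 'f::field))"
proof -
  have 1: "(\<Sum>b\<in>arcs Q. vertex_kappa i (Inl a) (Inr b) * C (Inl a) (Inr b)) =
      (if head Q a = i then C (Inl a) (Inr a) else 0)" if "a \<in> arcs Q" for a
  proof -
    have "(\<Sum>b\<in>arcs Q. vertex_kappa i (Inl a) (Inr b) * C (Inl a) (Inr b)) =
        (\<Sum>b\<in>arcs Q. if b = a then (if head Q a = i then C (Inl a) (Inr a) else 0) else 0)"
      using that by (intro sum.cong refl) auto
    then show ?thesis using that by simp
  qed
  have 2: "(\<Sum>b\<in>arcs Q. vertex_kappa i (Inr a) (Inl b) * C (Inr a) (Inl b)) =
      - (if tail Q a = i then C (Inr a) (Inl a) else 0)" if "a \<in> arcs Q" for a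
  proof -
    have "(\<Sum>b\<in>arcs Q. vertex_kappa i (Inr a) (Inl b) * C (Inr a) (Inl b)) =
        (\<Sum>b\<in>arcs Q. if b = a then - (if tail Q a = i then C (Inr a) (Inl a) else 0) else 0)"
      using that by (intro sum.cong refl) auto
    then show ?thesis using that by simp
  qed
  show ?thesis
    by (simp add: sum.Plus comp_def 1 2 sum_negf del: vertex_kappa_simps(1,2))
qed

abbreviation "HB \<equiv> cube_zero_algebra (verts Q) arcs2 (verts Q) tgt2 src2 (\<lambda>i. i) (\<lambda>i. i) vertex_kappa"

text \<open>
  Orthogonality to the vertex relations gives one direction. For the other one, a tensor with the trace
  condition is orthogonal to every relation by \<open>preproj_relations_orthogonal\<close>, applied for each pair of
  outer ends.
\<close>

lemma preprojective_presentation: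
  "quadratic_presentation (verts Q) arcs2 src2 tgt2 (U2 :: ('f::field, _, ('f, 'v, 'e) dbl) bimod) dbl_co
    (verts Q) (\<lambda>i. i) (\<lambda>i. i) vertex_kappa (preproj_relations Q)"
proof -
  interpret U: coord_bimod "verts Q" arcs2 src2 tgt2 "U2 :: ('f, _, ('f, 'v, 'e) dbl) bimod" dbl_co
    by (rule double_coord)
  interpret C: cube_zero "verts Q" arcs2 "verts Q" tgt2 src2 "\<lambda>i. i" "\<lambda>i. i" "vertex_kappa :: _ \<Rightarrow> _ \<Rightarrow> _ \<Rightarrow> 'f"
  proof unfold_locales
    fix p :: 'v and b c :: "'e + 'e" assume "vertex_kappa p b c \<noteq> (0 :: 'f)"
    then show "p \<in> verts Q \<and> b \<in> arcs2 \<and> c \<in> arcs2 \<and> tgt2 b = p \<and> src2 b = tgt2 c \<and> src2 c = p"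
      by (cases b; cases c) (auto split: if_splits)
  qed auto
  interpret W: coord_cube_zero "verts Q" arcs2 tgt2 src2 U.W U.dco "verts Q" "\<lambda>i. i" "\<lambda>i. i"
    "vertex_kappa :: _ \<Rightarrow> _ \<Rightarrow> _ \<Rightarrow> 'f"
    using U.left_dual_coord C.cube_zero_axioms by (rule coord_cube_zero.intro)
  interpret P: falgebra "preprojective Q :: ('f, ('f, 'v, 'e) preproj) graded_algebra"
    by (rule preprojective_falgebra)
  interpret g: tensor_map "SA :: ('f, _) module" U2 "preprojective Q" "preproj_gen Q" by (rule preproj_gen_map)
  interpret F2: falgebra "free_algebra SA (U2 :: ('f, _, ('f, 'v, 'e) dbl) bimod)" by (rule free_falgebra)
  interpret I2: ideal "tensor_ideal SA (U2 :: ('f, _, ('f, 'v, 'e) dbl) bimod)" "free_algebra SA U2"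
    by (rule U.tensor_ideal_ideal)
  note gD = alg_homD[OF g.subst_hom]
  have rho_rel: "tensor_ideal SA U2 +>\<^bsub>free_algebra SA U2\<^esub> rho i \<in> (preproj_relations Q :: ((('v \<Rightarrow> 'f) + ('f, 'v, 'e) dbl) list \<Rightarrow> 'f) set set)"
    and rho_mem: "rho i \<in> tensor_ideal SA U2 +>\<^bsub>free_algebra SA (U2 :: ('f, _, ('f, 'v, 'e) dbl) bimod)\<^esub> rho i"
    if i: "i \<in> verts Q" for i
  proof -
    have rc: "rho i \<in> carrier (free_algebra SA (U2 :: ('f, _, ('f, 'v, 'e) dbl) bimod))"
      using rho_two_letter(1)[of i] unfolding two_letter_sums_def mem_Collect_eq by (rule conjunct1)
    have rt: "rho i \<in> two_letter_sums SA (U2 :: ('f, _, ('f, 'v, 'e) dbl) bimod)" by (rule rho_two_letter(1))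
    show "rho i \<in> tensor_ideal SA U2 +>\<^bsub>free_algebra SA (U2 :: ('f, _, ('f, 'v, 'e) dbl) bimod)\<^esub> rho i"
      by (rule I2.a_rcos_self[OF rc])
    have "subst (preprojective Q) (preproj_gen Q) x = \<zero>\<^bsub>preprojective Q\<^esub>"
      if x: "x \<in> tensor_ideal SA (U2 :: ('f, _, ('f, 'v, 'e) dbl) bimod) +>\<^bsub>free_algebra SA U2\<^esub> rho i" for x
    proof -
      obtain n where n: "n \<in> tensor_ideal SA (U2 :: ('f, _, ('f, 'v, 'e) dbl) bimod)"
        "x = n \<oplus>\<^bsub>free_algebra SA U2\<^esub> rho i"
        using x by (auto simp: a_r_coset_def')
      have "subst (preprojective Q) (preproj_gen Q) (rho i) =
          \<zero>\<^bsub>preprojective Q :: ('f, ('f, 'v, 'e) preproj) graded_algebra\<^esub>" by (rule rho_relation[OF i])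
      then show ?thesis
        using gD(2)[OF I2.a_Hcarr[OF n(1)] rc] g.subst_tensor_ideal[OF n(1)] n(2) by simp
    qed
    then show "tensor_ideal SA U2 +>\<^bsub>free_algebra SA U2\<^esub> rho i \<in> (preproj_relations Q :: ((('v \<Rightarrow> 'f) + ('f, 'v, 'e) dbl) list \<Rightarrow> 'f) set set)"
      unfolding preproj_relations_def quadratic_relations_def
      using two_letter_degs[OF rt] by (simp add: U.tensor_simps)
  qed
  show ?thesis
  proof unfold_locales
    fix Y assume Y: "Y \<in> degs U.T 2"
    show "Y \<in> quadratic_perp U.S U2 (preproj_relations Q) \<longleftrightarrow>
        (\<forall>\<xi>\<in>Y \<inter> two_letter_sums U.S U.W. subst C.B (coord_letter U.dco) \<xi> = \<zero>\<^bsub>C.B\<^esub>)"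
    proof
      assume P: "Y \<in> quadratic_perp U.S U2 (preproj_relations Q)"
      show "\<forall>\<xi>\<in>Y \<inter> two_letter_sums U.S U.W. subst C.B (coord_letter U.dco) \<xi> = \<zero>\<^bsub>C.B\<^esub>"
      proof
        fix \<xi> assume "\<xi> \<in> Y \<inter> two_letter_sums U.S U.W"
        then have \<xi>: "\<xi> \<in> Y" "\<xi> \<in> two_letter_sums U.S U.W" by auto
        have "(\<Sum>b\<in>arcs2. \<Sum>c\<in>arcs2. vertex_kappa i b c * coef2 U.dco \<xi> b c) = 0" for i
        proof (cases "i \<in> verts Q")
          case True
          have rt: "rho i \<in> two_letter_sums SA (U2 :: ('f, _, ('f, 'v, 'e) dbl) bimod)" by (rule rho_two_letter(1))
          have "quadratic_pairing U.S U2 \<xi> (rho i) = \<zero>\<^bsub>U.S\<^esub>"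
            using P rho_rel[OF True] rho_mem[OF True] rt \<xi>
            unfolding quadratic_perp_def by blast
          then have "quadratic_pairing U.S U2 \<xi> (rho i) i = 0" by (simp add: fun_algebra_simps)
          then have "(\<Sum>b\<in>arcs2. \<Sum>c\<in>arcs2. if src2 b = i \<and> tgt2 b = src2 c then
              vertex_kappa i c b * coef2 U.dco \<xi> c b else 0) = 0"
            unfolding U.quadratic_pairing_coord[OF \<xi>(2) rho_two_letter(1)] rho_two_letter(2) .
          moreover have "(if src2 b = i \<and> tgt2 b = src2 c then vertex_kappa i c b * coef2 U.dco \<xi> c b else 0) =
              vertex_kappa i c b * coef2 U.dco \<xi> c b" for b c
            by (cases b; cases c) auto
          ultimately have "(\<Sum>b\<in>arcs2. \<Sum>c\<in>arcs2. vertex_kappa i c b * coef2 U.dco \<xi> c b) = 0" by simp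
          then show ?thesis by (subst sum.swap)
        next
          case False
          have "vertex_kappa i b c = (0 :: 'f)" for b c
            using C.kappa_support[of i b c] False by blast
          then show ?thesis by simp
        qed
        then show "subst C.B (coord_letter U.dco) \<xi> = \<zero>\<^bsub>C.B\<^esub>"
          by (simp add: W.subst_coord_letter[OF \<xi>(2)] C.cube_zero_simps)
      qed
    next
      assume K: "\<forall>\<xi>\<in>Y \<inter> two_letter_sums U.S U.W. subst C.B (coord_letter U.dco) \<xi> = \<zero>\<^bsub>C.B\<^esub>"
      have "quadratic_pairing U.S U2 \<xi> x = \<zero>\<^bsub>U.S\<^esub>"
        if X: "X \<in> preproj_relations Q" and \<xi>: "\<xi> \<in> Y \<inter> two_letter_sums U.S U.W"
          and x: "x \<in> X \<inter> two_letter_sums U.S U2" for X \<xi> x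
      proof
        fix k
        let ?\<kappa> = "\<lambda>b c. coef2 U.dco \<xi> c b"
        have \<xi>2: "\<xi> \<in> two_letter_sums U.S U.W" and x2: "x \<in> two_letter_sums U.S U2" using \<xi> x by auto
        have trace: "(\<Sum>a\<in>arcs Q. if head Q a = i then ?\<kappa> (Inr a) (Inl a) else 0) =
            (\<Sum>a\<in>arcs Q. if tail Q a = i then ?\<kappa> (Inl a) (Inr a) else 0)" for i
        proof -
          have "subst C.B (coord_letter U.dco) \<xi> = \<zero>\<^bsub>C.B\<^esub>" using K \<xi> by blast
          then have "(\<Sum>b\<in>arcs2. \<Sum>c\<in>arcs2. vertex_kappa i b c * coef2 U.dco \<xi> b c) = 0"
            by (simp add: W.subst_coord_letter[OF \<xi>2] C.cube_zero_simps fun_eq_iff)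
          then show ?thesis unfolding vertex_kappa_sum by simp
        qed
        have sub: "subst (preprojective Q) (preproj_gen Q) x = \<zero>\<^bsub>preprojective Q\<^esub>"
          using X x unfolding preproj_relations_def quadratic_relations_def by blast
        have z: "(\<Sum>b\<in>arcs2. \<Sum>c\<in>arcs2. end_kappa ?\<kappa> (k, j) b c * coef2 dbl_co x b c) = 0" for j
          by (rule preproj_relations_orthogonal[OF trace x2 sub])
        have e: "(\<Sum>j\<in>verts Q. end_kappa ?\<kappa> (k, j) b c * coef2 dbl_co x b c) =
            (if src2 b = k \<and> tgt2 b = src2 c then coef2 dbl_co x b c * ?\<kappa> b c else 0)"
          if "b \<in> arcs2" "c \<in> arcs2" for b c
        proof -
          have "(\<Sum>j\<in>verts Q. end_kappa ?\<kappa> (k, j) b c * coef2 dbl_co x b c) =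
              (\<Sum>j\<in>verts Q. if j = tgt2 c then
                (if src2 b = k \<and> tgt2 b = src2 c then coef2 dbl_co x b c * ?\<kappa> b c else 0) else 0)"
            using that by (intro sum.cong refl) (auto simp: end_kappa_def)
          moreover have "tgt2 c \<in> verts Q" using that by auto
          ultimately show ?thesis by simp
        qed
        have "quadratic_pairing U.S U2 \<xi> x k =
            (\<Sum>b\<in>arcs2. \<Sum>c\<in>arcs2. \<Sum>j\<in>verts Q. end_kappa ?\<kappa> (k, j) b c * coef2 dbl_co x b c)"
          unfolding U.quadratic_pairing_coord[OF \<xi>2 x2] by (intro sum.cong refl) (simp only: e)
        also have "\<dots> = (\<Sum>j\<in>verts Q. \<Sum>b\<in>arcs2. \<Sum>c\<in>arcs2. end_kappa ?\<kappa> (k, j) b c * coef2 dbl_co x b c)"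
          by (simp only: sum.swap[of _ "verts Q" arcs2])
        finally show "quadratic_pairing U.S U2 \<xi> x k = \<zero>\<^bsub>U.S\<^esub> k"
          by (simp only: z fun_algebra_simps(5)) simp
      qed
      then show "Y \<in> quadratic_perp U.S U2 (preproj_relations Q)"
        using Y unfolding quadratic_perp_def by blast
    qed
  qed
qed

section \<open>The graded trivial extension in coordinates\<close>

lemma path_dual_iso:
  obtains h where "h \<in> graded_iso (PD :: ('f::field, ('f, 'v, 'e) pathalg_dual) graded_algebra) GB"
    and "\<And>l. l \<in> carrier SA <+> carrier (left_dual SA V) \<Longrightarrow>
      h (path_dual_letter Q l) = coord_letter (coord_bimod.dco (arcs Q) (tail Q) V (\<lambda>x. x)) l"
proof -
  interpret G: quadratic_presentation "verts Q" "arcs Q" "tail Q" "head Q" "V :: ('f, _, _) bimod" "\<lambda>x. x"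
    "{} :: unit set" undefined undefined "\<lambda>p b c. 0" "path_relations Q" by (rule path_presentation)
  interpret QD: graded_falgebra G.QD by (rule G.U.quadratic_dual_graded)
  obtain h where h: "h \<in> graded_hom G.QD G.B"
    "\<And>x. x \<in> carrier G.U.F \<Longrightarrow> h (G.J +>\<^bsub>G.U.T\<^esub> (G.U.I +>\<^bsub>G.U.F\<^esub> x)) = subst G.B (coord_letter G.U.dco) x"
    "\<And>l. l \<in> carrier G.U.S <+> carrier G.U.W \<Longrightarrow> h (G.dl l) = coord_letter G.U.dco l"
    by (rule G.cube_hom) blast
  have two: "G.dl (Inr g) \<otimes>\<^bsub>G.QD\<^esub> G.dl (Inr k) = \<zero>\<^bsub>G.QD\<^esub>" if "g \<in> carrier G.U.W" "k \<in> carrier G.U.W" for g k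
  proof -
    have "subst G.B (coord_letter G.U.dco) (word [Inr g, Inr k]) = \<zero>\<^bsub>G.B\<^esub>"
      by (simp add: G.W.subst_coord_letter[OF two_letter_word[OF that]] G.cube_zero_simps)
    then show ?thesis
      unfolding G.product_subst[OF that] by (rule G.two_letter_zero_iff[OF two_letter_word[OF that]])
  qed
  have "h \<in> graded_iso G.QD G.B"
    by (rule G.cube_iso[OF _ _ _ h]) (simp_all add: two)
  then show thesis
    using that[of h] h(3) unfolding path_algebra_dual_def path_dual_letter_def by blast
qed

end


text \<open>
  An algebra isomorphic to the algebra of a quiver with radical square zero. Its linear dual has
  the vertices and the arrows as coordinates as well.
\<close>

locale radical_square_zero = finite_quiver Q + graded_falgebra \<Gamma>
  for Q :: "('v, 'e) pre_digraph" and \<Gamma> :: "('f::field, 'c) graded_algebra" +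
  fixes h :: "'c \<Rightarrow> ('v \<Rightarrow> 'f) \<times> ('e \<Rightarrow> 'f) \<times> (unit \<Rightarrow> 'f)"
  assumes iso: "h \<in> graded_iso \<Gamma> GB"
begin

abbreviation "p0 z \<equiv> fst (h z)"
abbreviation "p1 z \<equiv> fst (snd (h z))"

sublocale G: cube_zero "verts Q" "arcs Q" "{} :: unit set" "head Q" "tail Q" undefined undefined
  "\<lambda>p b c. 0 :: 'f"
  by unfold_locales auto

lemma h_hom: "h \<in> alg_hom \<Gamma> GB"
  using iso by (simp add: graded_iso_def graded_hom_iff)

lemma coord_ops [simp]:
  "x \<in> carrier \<Gamma> \<Longrightarrow> y \<in> carrier \<Gamma> \<Longrightarrow> p0 (x \<oplus>\<^bsub>\<Gamma>\<^esub> y) = (\<lambda>i. p0 x i + p0 y i)"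
  "x \<in> carrier \<Gamma> \<Longrightarrow> y \<in> carrier \<Gamma> \<Longrightarrow> p1 (x \<oplus>\<^bsub>\<Gamma>\<^esub> y) = (\<lambda>a. p1 x a + p1 y a)"
  "x \<in> carrier \<Gamma> \<Longrightarrow> p0 (c \<odot>\<^bsub>\<Gamma>\<^esub> x) = (\<lambda>i. c * p0 x i)"
  "x \<in> carrier \<Gamma> \<Longrightarrow> p1 (c \<odot>\<^bsub>\<Gamma>\<^esub> x) = (\<lambda>a. c * p1 x a)"
  "x \<in> carrier \<Gamma> \<Longrightarrow> y \<in> carrier \<Gamma> \<Longrightarrow> p0 (x \<otimes>\<^bsub>\<Gamma>\<^esub> y) = (\<lambda>i. p0 x i * p0 y i)"
  "x \<in> carrier \<Gamma> \<Longrightarrow> y \<in> carrier \<Gamma> \<Longrightarrow>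
    p1 (x \<otimes>\<^bsub>\<Gamma>\<^esub> y) = (\<lambda>a. p0 x (head Q a) * p1 y a + p1 x a * p0 y (tail Q a))"
  "p0 \<one>\<^bsub>\<Gamma>\<^esub> = (\<lambda>i. if i \<in> verts Q then 1 else 0)" "p1 \<one>\<^bsub>\<Gamma>\<^esub> = (\<lambda>a. 0)"
  "p0 \<zero>\<^bsub>\<Gamma>\<^esub> = (\<lambda>i. 0)" "p1 \<zero>\<^bsub>\<Gamma>\<^esub> = (\<lambda>a. 0)"
proof -
  note hD = alg_homD[OF h_hom]
  show "x \<in> carrier \<Gamma> \<Longrightarrow> y \<in> carrier \<Gamma> \<Longrightarrow> p0 (x \<oplus>\<^bsub>\<Gamma>\<^esub> y) = (\<lambda>i. p0 x i + p0 y i)"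
    "x \<in> carrier \<Gamma> \<Longrightarrow> y \<in> carrier \<Gamma> \<Longrightarrow> p1 (x \<oplus>\<^bsub>\<Gamma>\<^esub> y) = (\<lambda>a. p1 x a + p1 y a)"
    "x \<in> carrier \<Gamma> \<Longrightarrow> y \<in> carrier \<Gamma> \<Longrightarrow> p0 (x \<otimes>\<^bsub>\<Gamma>\<^esub> y) = (\<lambda>i. p0 x i * p0 y i)"
    "x \<in> carrier \<Gamma> \<Longrightarrow> y \<in> carrier \<Gamma> \<Longrightarrow>
      p1 (x \<otimes>\<^bsub>\<Gamma>\<^esub> y) = (\<lambda>a. p0 x (head Q a) * p1 y a + p1 x a * p0 y (tail Q a))"
    by (cases "h x"; cases "h y"; simp add: hD G.cube_zero_simps)+
  show "x \<in> carrier \<Gamma> \<Longrightarrow> p0 (c \<odot>\<^bsub>\<Gamma>\<^esub> x) = (\<lambda>i. c * p0 x i)"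
    "x \<in> carrier \<Gamma> \<Longrightarrow> p1 (c \<odot>\<^bsub>\<Gamma>\<^esub> x) = (\<lambda>a. c * p1 x a)"
    by (cases "h x"; simp add: hD G.cube_zero_simps)+
  show "p0 \<one>\<^bsub>\<Gamma>\<^esub> = (\<lambda>i. if i \<in> verts Q then 1 else 0)" "p1 \<one>\<^bsub>\<Gamma>\<^esub> = (\<lambda>a. 0)"
    by (simp_all add: hD G.cube_zero_simps)
  show "p0 \<zero>\<^bsub>\<Gamma>\<^esub> = (\<lambda>i. 0)" "p1 \<zero>\<^bsub>\<Gamma>\<^esub> = (\<lambda>a. 0)"
    using alg_hom_zero[OF falgebra_axioms graded_falgebra.axioms(1)[OF G.cube_zero_graded] h_hom]
    by (simp_all add: G.cube_zero_simps)
qed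

lemma coord_outside [simp]:
  assumes "x \<in> carrier \<Gamma>"
  shows "i \<notin> verts Q \<Longrightarrow> p0 x i = 0" "a \<notin> arcs Q \<Longrightarrow> p1 x a = 0"
  using alg_homD(1)[OF h_hom assms] by (cases "h x"; auto simp: G.cube_zero_simps)+

lemma h_triple: "x \<in> carrier \<Gamma> \<Longrightarrow> h x = (p0 x, p1 x, \<lambda>p. 0)"
  using alg_homD(1)[OF h_hom, of x] by (cases "h x") (auto simp: G.cube_zero_simps)

lemma coord_eqI:
  assumes "x \<in> carrier \<Gamma>" "y \<in> carrier \<Gamma>" "\<And>i. p0 x i = p0 y i" "\<And>a. p1 x a = p1 y a"
  shows "x = y"
proof -
  have "p0 x = p0 y" "p1 x = p1 y" using assms(3,4) by auto
  then have "h x = h y" using h_triple assms(1,2) by metis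
  then show ?thesis using iso assms(1,2) by (auto simp: graded_iso_def bij_betw_def dest: inj_onD)
qed

definition elem :: "('v \<Rightarrow> 'f) \<Rightarrow> ('e \<Rightarrow> 'f) \<Rightarrow> 'c" where
  "elem s \<alpha> = inv_into (carrier \<Gamma>) h (s, \<alpha>, \<lambda>p. 0)"

lemma elem:
  assumes "\<And>i. i \<notin> verts Q \<Longrightarrow> s i = 0" "\<And>a. a \<notin> arcs Q \<Longrightarrow> \<alpha> a = 0"
  shows "elem s \<alpha> \<in> carrier \<Gamma>" "p0 (elem s \<alpha>) = s" "p1 (elem s \<alpha>) = \<alpha>"
proof -
  have im: "h ` carrier \<Gamma> = carrier GB" using iso by (simp add: graded_iso_def bij_betw_def)
  have "(s, \<alpha>, \<lambda>p. 0) \<in> carrier GB" using assms by (simp add: G.cube_zero_simps)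
  then have "(s, \<alpha>, \<lambda>p. 0) \<in> h ` carrier \<Gamma>" unfolding im .
  then show "elem s \<alpha> \<in> carrier \<Gamma>" "p0 (elem s \<alpha>) = s" "p1 (elem s \<alpha>) = \<alpha>"
    unfolding elem_def by (simp_all add: inv_into_into f_inv_into_f)
qed

lemma degs_iff:
  "x \<in> degs \<Gamma> n \<longleftrightarrow> x \<in> carrier \<Gamma> \<and> (n \<noteq> 0 \<longrightarrow> p0 x = (\<lambda>i. 0)) \<and> (n \<noteq> 1 \<longrightarrow> p1 x = (\<lambda>a. 0))"
proof -
  have im: "h ` degs \<Gamma> n = degs GB n" and inj: "inj_on h (carrier \<Gamma>)"
    using iso by (simp_all add: graded_iso_def bij_betw_def)
  have "x \<in> degs \<Gamma> n \<longleftrightarrow> h x \<in> degs GB n" if x: "x \<in> carrier \<Gamma>"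
    unfolding im[symmetric] using inj x degs_carrier by (auto dest: inj_onD)
  moreover have "h x \<in> degs GB n \<longleftrightarrow> (n \<noteq> 0 \<longrightarrow> p0 x = (\<lambda>i. 0)) \<and> (n \<noteq> 1 \<longrightarrow> p1 x = (\<lambda>a. 0))"
    if x: "x \<in> carrier \<Gamma>"
    using alg_homD(1)[OF h_hom x] h_triple[OF x] by (metis G.cube_zero_simps(7))
  ultimately show ?thesis using degs_carrier by blast
qed

lemma coord_finsum:
  assumes "f \<in> I \<rightarrow> carrier \<Gamma>"
  shows "p0 (finsum \<Gamma> f I) i = (\<Sum>j\<in>I. p0 (f j) i)" "p1 (finsum \<Gamma> f I) a = (\<Sum>j\<in>I. p1 (f j) a)"
proof -
  note af = additive_finsum[OF abelian_group_axioms _ _ assms]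
  show "p0 (finsum \<Gamma> f I) i = (\<Sum>j\<in>I. p0 (f j) i)" by (rule af[of "\<lambda>z. p0 z i"]) simp_all
  show "p1 (finsum \<Gamma> f I) a = (\<Sum>j\<in>I. p1 (f j) a)" by (rule af[of "\<lambda>z. p1 z a"]) simp_all
qed

text \<open>
  The coordinates of degree zero and one of a sum of homogeneous elements only depend on its terms in
  these degrees, so that the description of the twist determines it.
\<close>

lemma sign_twist_coord:
  assumes x: "x \<in> carrier \<Gamma>"
  shows "sign_twist \<Gamma> x = elem (p0 x) (\<lambda>a. - p1 x a)"
proof -
  let ?P = "\<lambda>c. \<exists>I k. finite I \<and> (\<forall>i\<in>I. k i \<in> degs \<Gamma> i) \<and> x = finsum \<Gamma> k I \<and>
     c = finsum \<Gamma> (\<lambda>i. (if even i then 1 else - 1) \<odot>\<^bsub>\<Gamma>\<^esub> k i) I"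
  have el: "elem (p0 x) (\<lambda>a. - p1 x a) \<in> carrier \<Gamma>" "p0 (elem (p0 x) (\<lambda>a. - p1 x a)) = p0 x"
    "p1 (elem (p0 x) (\<lambda>a. - p1 x a)) = (\<lambda>a. - p1 x a)"
    by (rule elem; use x in simp)+
  have uniq: "c = elem (p0 x) (\<lambda>a. - p1 x a)" if c: "?P c" for c
  proof -
    obtain I :: "int set" and k where k: "finite I" "\<forall>i\<in>I. k i \<in> degs \<Gamma> i" "x = finsum \<Gamma> k I"
      "c = finsum \<Gamma> (\<lambda>i. (if even i then 1 else - 1) \<odot>\<^bsub>\<Gamma>\<^esub> k i) I" using c by blast
    have kc: "k j \<in> carrier \<Gamma>" if "j \<in> I" for j using k(2) that degs_carrier by blast
    then have kI: "k \<in> I \<rightarrow> carrier \<Gamma>" "(\<lambda>i. (if even i then 1 else - 1) \<odot>\<^bsub>\<Gamma>\<^esub> k i) \<in> I \<rightarrow> carrier \<Gamma>" by auto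
    have cc: "c \<in> carrier \<Gamma>" unfolding k(4) using kI(2) by (rule finsum_closed)
    have "p0 c i = p0 x i" for i
      unfolding k(3,4) coord_finsum[OF kI(1)] coord_finsum[OF kI(2)]
    proof (rule sum.cong[OF refl])
      fix j assume j: "j \<in> I"
      show "p0 ((if even j then 1 else - 1) \<odot>\<^bsub>\<Gamma>\<^esub> k j) i = p0 (k j) i"
        using k(2) j kc[OF j] by (cases "j = 0") (auto simp: degs_iff)
    qed
    moreover have "p1 c a = - p1 x a" for a
      unfolding k(3,4) coord_finsum[OF kI(1)] coord_finsum[OF kI(2)] sum_negf[symmetric]
    proof (rule sum.cong[OF refl])
      fix j assume j: "j \<in> I"
      show "p1 ((if even j then 1 else - 1) \<odot>\<^bsub>\<Gamma>\<^esub> k j) a = - p1 (k j) a"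
        using k(2) j kc[OF j] by (cases "j = 1") (auto simp: degs_iff)
    qed
    ultimately show ?thesis using cc el by (intro coord_eqI) simp_all
  qed
  have "?P (elem (p0 x) (\<lambda>a. - p1 x a))"
  proof -
    define k where "k = (\<lambda>j :: int. if j = 0 then elem (p0 x) (\<lambda>a. 0) else elem (\<lambda>i. 0) (p1 x))"
    have e0: "elem (p0 x) (\<lambda>a. 0) \<in> carrier \<Gamma>" "p0 (elem (p0 x) (\<lambda>a. 0)) = p0 x"
      "p1 (elem (p0 x) (\<lambda>a. 0)) = (\<lambda>a. 0)" by (rule elem; use x in simp)+
    have e1: "elem (\<lambda>i. 0) (p1 x) \<in> carrier \<Gamma>" "p0 (elem (\<lambda>i. 0) (p1 x)) = (\<lambda>i. 0)"
      "p1 (elem (\<lambda>i. 0) (p1 x)) = p1 x" by (rule elem; use x in simp)+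
    have deg: "\<forall>i\<in>{0, 1}. k i \<in> degs \<Gamma> i" using e0 e1 by (simp add: k_def degs_iff)
    have kI: "k \<in> {0, 1} \<rightarrow> carrier \<Gamma>" "(\<lambda>i. (if even i then 1 else - 1) \<odot>\<^bsub>\<Gamma>\<^esub> k i) \<in> {0, 1} \<rightarrow> carrier \<Gamma>"
      using e0 e1 by (auto simp: k_def)
    have "x = finsum \<Gamma> k {0, 1}"
      by (rule coord_eqI[OF x finsum_closed[OF kI(1)]])
        (simp_all add: coord_finsum[OF kI(1)] k_def e0 e1)
    moreover have "elem (p0 x) (\<lambda>a. - p1 x a) = finsum \<Gamma> (\<lambda>i. (if even i then 1 else - 1) \<odot>\<^bsub>\<Gamma>\<^esub> k i) {0, 1}"
      by (rule coord_eqI[OF el(1) finsum_closed[OF kI(2)]])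
        (simp_all add: coord_finsum[OF kI(2)] el(2,3), simp_all add: k_def e0 e1)
    ultimately show ?thesis using deg by (intro exI[of _ "{0, 1} :: int set"] exI[of _ k]) simp
  qed
  then show ?thesis unfolding sign_twist_def using uniq by (rule the_equality)
qed

definition functional :: "('v \<Rightarrow> 'f) \<Rightarrow> ('e \<Rightarrow> 'f) \<Rightarrow> 'c \<Rightarrow> 'f" where
  "functional w \<beta> = (\<lambda>z\<in>carrier \<Gamma>. (\<Sum>i\<in>verts Q. w i * p0 z i) + (\<Sum>a\<in>arcs Q. \<beta> a * p1 z a))"

lemma functional_closed: "functional w \<beta> \<in> carrier D"
  unfolding functional_def
  by (rule dual_bimodI) (simp_all add: distrib_left sum.distrib sum_distrib_left mult_ac add_ac)

lemma unit_elem: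
  "i \<in> verts Q \<Longrightarrow> elem (unit_fun i) (\<lambda>a. 0) \<in> carrier \<Gamma>"
  "i \<in> verts Q \<Longrightarrow> p0 (elem (unit_fun i) (\<lambda>a. 0)) = unit_fun i"
  "i \<in> verts Q \<Longrightarrow> p1 (elem (unit_fun i) (\<lambda>a. 0)) = (\<lambda>a. 0)"
  "b \<in> arcs Q \<Longrightarrow> elem (\<lambda>i. 0) (unit_fun b) \<in> carrier \<Gamma>"
  "b \<in> arcs Q \<Longrightarrow> p0 (elem (\<lambda>i. 0) (unit_fun b)) = (\<lambda>i. 0)"
  "b \<in> arcs Q \<Longrightarrow> p1 (elem (\<lambda>i. 0) (unit_fun b)) = unit_fun b"
  by (rule elem; auto simp: unit_fun_def)+

lemma unit_fun_sum:
  "finite X \<Longrightarrow> i \<in> X \<Longrightarrow> (\<Sum>j\<in>X. w j * unit_fun i j) = (w i :: 'f)"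
  "finite X \<Longrightarrow> i \<in> X \<Longrightarrow> (\<Sum>j\<in>X. unit_fun j i * w j) = (w i :: 'f)"
  by (simp_all add: unit_fun_def if_distrib[of "\<lambda>c. _ * c"] if_distrib[of "\<lambda>c. c * _"] cong: if_cong)

lemma functional_unit:
  "i \<in> verts Q \<Longrightarrow> functional w \<beta> (elem (unit_fun i) (\<lambda>a. 0)) = w i"
  "b \<in> arcs Q \<Longrightarrow> functional w \<beta> (elem (\<lambda>i. 0) (unit_fun b)) = \<beta> b"
  by (simp_all add: functional_def unit_elem unit_fun_sum)

lemma functional_expand:
  assumes f: "f \<in> carrier D"
  shows "f = functional (\<lambda>i. if i \<in> verts Q then f (elem (unit_fun i) (\<lambda>a. 0)) else 0)
    (\<lambda>b. if b \<in> arcs Q then f (elem (\<lambda>i. 0) (unit_fun b)) else 0)"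
proof (rule D_eqI[OF f functional_closed])
  fix z assume z: "z \<in> carrier \<Gamma>"
  let ?E = "case_sum (\<lambda>i. p0 z i \<odot>\<^bsub>\<Gamma>\<^esub> elem (unit_fun i) (\<lambda>a. 0)) (\<lambda>b. p1 z b \<odot>\<^bsub>\<Gamma>\<^esub> elem (\<lambda>i. 0) (unit_fun b))"
  let ?X = "verts Q <+> arcs Q"
  have E: "?E \<in> ?X \<rightarrow> carrier \<Gamma>" using unit_elem by auto
  have fin: "finite ?X" by simp
  have "z = finsum \<Gamma> ?E ?X"
  proof (rule coord_eqI[OF z finsum_closed[OF E]])
    show "p0 z i = p0 (finsum \<Gamma> ?E ?X) i" for i
    proof -
      have "(\<Sum>j\<in>verts Q. p0 z j * unit_fun j i) = p0 z i"
        using z by (cases "i \<in> verts Q") (auto simp: unit_fun_def if_distrib[of "\<lambda>c. _ * c"] cong: if_cong)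
      then show ?thesis by (simp add: coord_finsum[OF E] sum.Plus comp_def unit_elem)
    qed
    show "p1 z i = p1 (finsum \<Gamma> ?E ?X) i" for i
    proof -
      have "(\<Sum>j\<in>arcs Q. p1 z j * unit_fun j i) = p1 z i"
        using z by (cases "i \<in> arcs Q") (auto simp: unit_fun_def if_distrib[of "\<lambda>c. _ * c"] cong: if_cong)
      then show ?thesis by (simp add: coord_finsum[OF E] sum.Plus comp_def unit_elem)
    qed
  qed
  moreover have "f \<zero>\<^bsub>\<Gamma>\<^esub> = 0"
    using dual_bimodD(2)[OF f zero_closed, of 0] by simp
  moreover note additive_finsum[OF abelian_group_axioms _ _ E, of f]
  ultimately have "f z = (\<Sum>j\<in>?X. f (?E j))" using dual_bimodD(1)[OF f] by simp
  then show "f z = functional (\<lambda>i. if i \<in> verts Q then f (elem (unit_fun i) (\<lambda>a. 0)) else 0)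
    (\<lambda>b. if b \<in> arcs Q then f (elem (\<lambda>i. 0) (unit_fun b)) else 0) z"
    using z by (simp add: functional_def sum.Plus comp_def dual_bimodD(2)[OF f] unit_elem mult.commute)
qed

lemma triv2_simps:
  "carrier (triv2 \<Gamma>) = carrier \<Gamma> \<times> carrier D"
  "(x, f) \<oplus>\<^bsub>triv2 \<Gamma>\<^esub> (y, g) = (x \<oplus>\<^bsub>\<Gamma>\<^esub> y, f \<oplus>\<^bsub>D\<^esub> g)"
  "(x, f) \<otimes>\<^bsub>triv2 \<Gamma>\<^esub> (y, g) = (x \<otimes>\<^bsub>\<Gamma>\<^esub> y, lact D x g \<oplus>\<^bsub>D\<^esub> ract D f (sign_twist \<Gamma> y))"
  "\<one>\<^bsub>triv2 \<Gamma>\<^esub> = (\<one>\<^bsub>\<Gamma>\<^esub>, \<zero>\<^bsub>D\<^esub>)" "c \<odot>\<^bsub>triv2 \<Gamma>\<^esub> (x, f) = (c \<odot>\<^bsub>\<Gamma>\<^esub> x, c \<odot>\<^bsub>D\<^esub> f)"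
  "degs (triv2 \<Gamma>) n = degs \<Gamma> n \<times> {f \<in> carrier D. \<forall>i. i \<noteq> 2 - n \<longrightarrow> (\<forall>x\<in>degs \<Gamma> i. f x = 0)}"
  by (simp_all add: triv2_def Let_def)

text \<open>
  Arrows give elements of degree one of the algebra, dual arrows functionals on its degree one, and the
  elements of degree two functionals on its degree zero.
\<close>

definition triv2_elem :: "('v \<Rightarrow> 'f) \<times> ('e + 'e \<Rightarrow> 'f) \<times> ('v \<Rightarrow> 'f) \<Rightarrow> 'c \<times> ('c \<Rightarrow> 'f)" where
  "triv2_elem = (\<lambda>(s, u, w). (elem s (\<lambda>a. u (Inl a)), functional w (\<lambda>a. u (Inr a))))"

lemma functional_degs:
  assumes out: "\<And>i. i \<notin> verts Q \<Longrightarrow> w i = 0" "\<And>a. a \<notin> arcs Q \<Longrightarrow> \<beta> a = 0"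
  shows "(\<forall>i. i \<noteq> 2 - n \<longrightarrow> (\<forall>x\<in>degs \<Gamma> i. functional w \<beta> x = 0)) \<longleftrightarrow>
    (n \<noteq> 2 \<longrightarrow> w = (\<lambda>i. 0)) \<and> (n \<noteq> 1 \<longrightarrow> \<beta> = (\<lambda>a. 0))"
proof (intro iffI conjI impI allI ballI)
  assume z: "\<forall>i. i \<noteq> 2 - n \<longrightarrow> (\<forall>x\<in>degs \<Gamma> i. functional w \<beta> x = 0)"
  show "w = (\<lambda>i. 0)" if n: "n \<noteq> 2"
  proof
    fix i show "w i = 0"
    proof (cases "i \<in> verts Q")
      case True
      then have "elem (unit_fun i) (\<lambda>a. 0) \<in> degs \<Gamma> 0" by (simp add: degs_iff unit_elem)
      then have "functional w \<beta> (elem (unit_fun i) (\<lambda>a. 0)) = 0" using z n by force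
      then show ?thesis using True by (simp add: functional_unit)
    qed (rule out)
  qed
  show "\<beta> = (\<lambda>a. 0)" if n: "n \<noteq> 1"
  proof
    fix b show "\<beta> b = 0"
    proof (cases "b \<in> arcs Q")
      case True
      then have "elem (\<lambda>i. 0) (unit_fun b) \<in> degs \<Gamma> 1" by (simp add: degs_iff unit_elem)
      then have "functional w \<beta> (elem (\<lambda>i. 0) (unit_fun b)) = 0" using z n by force
      then show ?thesis using True by (simp add: functional_unit)
    qed (rule out)
  qed
next
  fix i x assume c: "(n \<noteq> 2 \<longrightarrow> w = (\<lambda>i. 0)) \<and> (n \<noteq> 1 \<longrightarrow> \<beta> = (\<lambda>a. 0))" and i: "i \<noteq> 2 - n" and x: "x \<in> degs \<Gamma> i"
  have "w = (\<lambda>i. 0) \<or> p0 x = (\<lambda>i. 0)" "\<beta> = (\<lambda>a. 0) \<or> p1 x = (\<lambda>a. 0)"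
    using c i x unfolding degs_iff by (cases "n = 2"; cases "n = 1"; auto)+
  then show "functional w \<beta> x = 0" using x by (auto simp: functional_def degs_iff)
qed

lemma functional_eqI:
  assumes f: "f \<in> carrier D"
    and "\<And>i. i \<in> verts Q \<Longrightarrow> f (elem (unit_fun i) (\<lambda>a. 0)) = w i"
    and "\<And>b. b \<in> arcs Q \<Longrightarrow> f (elem (\<lambda>i. 0) (unit_fun b)) = \<beta> b"
  shows "f = functional w \<beta>"
  by (subst functional_expand[OF f]) (simp add: functional_def assms(2,3) cong: restrict_cong)

lemma vertex_pairing:
  "cube_zero.K arcs2 vertex_kappa i u v =
    (\<Sum>a\<in>arcs Q. if head Q a = i then u (Inl a) * v (Inr a) else 0) -
    (\<Sum>a\<in>arcs Q. if tail Q a = i then u (Inr a) * v (Inl a) else (0 :: 'f))"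
proof -
  interpret H: quadratic_presentation "verts Q" arcs2 src2 tgt2 "U2 :: ('f, _, ('f, 'v, 'e) dbl) bimod" dbl_co
    "verts Q" "\<lambda>i. i" "\<lambda>i. i" vertex_kappa "preproj_relations Q" by (rule preprojective_presentation)
  show ?thesis unfolding H.K_def mult.assoc by (rule vertex_kappa_sum)
qed

text \<open>
  The products of two elements of degree one compare as follows: an arrow times the dual of the
  same arrow is the dual of the idempotent at its head, and in the opposite order it is
  the dual of the idempotent at its tail, with the sign coming from the trivial extension.
\<close>

lemma triv2_elem_mult:
  assumes x: "x \<in> carrier HB" and y: "y \<in> carrier HB"
  shows "triv2_elem (x \<otimes>\<^bsub>HB\<^esub> y) = triv2_elem x \<otimes>\<^bsub>triv2 \<Gamma>\<^esub> triv2_elem y"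
proof -
  interpret H: quadratic_presentation "verts Q" arcs2 src2 tgt2 "U2 :: ('f, _, ('f, 'v, 'e) dbl) bimod" dbl_co
    "verts Q" "\<lambda>i. i" "\<lambda>i. i" vertex_kappa "preproj_relations Q" by (rule preprojective_presentation)
  obtain s u w s' u' w' where xy: "x = (s, u, w)" "y = (s', u', w')" by (cases x; cases y) auto
  have out: "i \<notin> verts Q \<Longrightarrow> s i = 0" "i \<notin> verts Q \<Longrightarrow> s' i = 0" "i \<notin> verts Q \<Longrightarrow> w i = 0" "i \<notin> verts Q \<Longrightarrow> w' i = 0"
    "b \<notin> arcs2 \<Longrightarrow> u b = 0" "b \<notin> arcs2 \<Longrightarrow> u' b = 0" for i b
    using x y by (simp_all add: xy H.cube_zero_simps(1))
  have outa: "u (Inl a) = 0" "u' (Inl a) = 0" "u (Inr a) = 0" "u' (Inr a) = 0" if "a \<notin> arcs Q" for a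
    using out(5,6) that by auto
  let ?x = "elem s (\<lambda>a. u (Inl a))" and ?y = "elem s' (\<lambda>a. u' (Inl a))" and ?t = "elem s' (\<lambda>a. - u' (Inl a))"
  have X: "?x \<in> carrier \<Gamma>" "p0 ?x = s" "p1 ?x = (\<lambda>a. u (Inl a))" by (rule elem; simp add: out outa)+
  have Y: "?y \<in> carrier \<Gamma>" "p0 ?y = s'" "p1 ?y = (\<lambda>a. u' (Inl a))" by (rule elem; simp add: out outa)+
  have T: "?t \<in> carrier \<Gamma>" "p0 ?t = s'" "p1 ?t = (\<lambda>a. - u' (Inl a))" by (rule elem; simp add: out outa)+
  have tw: "sign_twist \<Gamma> ?y = ?t" using sign_twist_coord[OF Y(1)] by (simp add: Y)
  let ?f = "functional w (\<lambda>a. u (Inr a))" and ?g = "functional w' (\<lambda>a. u' (Inr a))"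
  let ?s = "\<lambda>i. s i * s' i" and ?\<alpha> = "\<lambda>a. s (head Q a) * u' (Inl a) + u (Inl a) * s' (tail Q a)"
  let ?w = "\<lambda>i. s i * w' i + w i * s' i +
      ((\<Sum>a\<in>arcs Q. if head Q a = i then u (Inl a) * u' (Inr a) else 0) -
       (\<Sum>a\<in>arcs Q. if tail Q a = i then u (Inr a) * u' (Inl a) else 0))"
  have E: "elem ?s ?\<alpha> \<in> carrier \<Gamma>" "p0 (elem ?s ?\<alpha>) = ?s" "p1 (elem ?s ?\<alpha>) = ?\<alpha>"
    by (rule elem; simp add: out outa)+
  have e: "elem ?s ?\<alpha> = ?x \<otimes>\<^bsub>\<Gamma>\<^esub> ?y"
    by (rule coord_eqI) (simp_all add: E X Y)
  have "lact D ?x ?g \<oplus>\<^bsub>D\<^esub> ract D ?f ?t =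
      functional ?w (\<lambda>a. s (tail Q a) * u' (Inr a) + u (Inr a) * s' (head Q a))"
  proof (rule functional_eqI)
    show "lact D ?x ?g \<oplus>\<^bsub>D\<^esub> ract D ?f ?t \<in> carrier D" using X T functional_closed by simp
    show "(lact D ?x ?g \<oplus>\<^bsub>D\<^esub> ract D ?f ?t) (elem (unit_fun i) (\<lambda>a. 0)) = ?w i" if i: "i \<in> verts Q" for i
    proof -
      have 1: "(\<Sum>j\<in>verts Q. w' j * (unit_fun i j * s j)) = s i * w' i"
        "(\<Sum>j\<in>verts Q. w j * (s' j * unit_fun i j)) = w i * s' i"
        using unit_fun_sum(1)[OF _ i, of "\<lambda>j. w' j * s j"] unit_fun_sum(1)[OF _ i, of "\<lambda>j. w j * s' j"]
        by (simp_all add: mult_ac)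
      have 2: "(\<Sum>a\<in>arcs Q. u' (Inr a) * (unit_fun i (head Q a) * u (Inl a))) =
          (\<Sum>a\<in>arcs Q. if head Q a = i then u (Inl a) * u' (Inr a) else 0)"
        "(\<Sum>a\<in>arcs Q. - (u (Inr a) * (u' (Inl a) * unit_fun i (tail Q a)))) =
          - (\<Sum>a\<in>arcs Q. if tail Q a = i then u (Inr a) * u' (Inl a) else 0)"
        unfolding sum_negf[symmetric] by (intro sum.cong refl; simp add: unit_fun_def)+
      show ?thesis using i X T
        by (simp add: dual_bimod_simps unit_elem) (simp add: functional_def unit_elem 1 2)
    qed
    show "(lact D ?x ?g \<oplus>\<^bsub>D\<^esub> ract D ?f ?t) (elem (\<lambda>i. 0) (unit_fun b)) =
        s (tail Q b) * u' (Inr b) + u (Inr b) * s' (head Q b)" if b: "b \<in> arcs Q" for b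
    proof -
      have 1: "(\<Sum>a\<in>arcs Q. u' (Inr a) * (unit_fun b a * s (tail Q a))) = s (tail Q b) * u' (Inr b)"
        "(\<Sum>a\<in>arcs Q. u (Inr a) * (s' (head Q a) * unit_fun b a)) = u (Inr b) * s' (head Q b)"
        using unit_fun_sum(1)[OF _ b, of "\<lambda>a. u' (Inr a) * s (tail Q a)"]
          unit_fun_sum(1)[OF _ b, of "\<lambda>a. u (Inr a) * s' (head Q a)"]
        by (simp_all add: mult_ac)
      show ?thesis using b X T
        by (simp add: dual_bimod_simps unit_elem) (simp add: functional_def unit_elem 1)
    qed
  qed
  then show ?thesis
    by (simp add: xy H.cube_zero_simps(3) triv2_elem_def triv2_simps(3) tw e[symmetric] vertex_pairing)
qed

lemma triv2_elem_iso: "triv2_elem \<in> graded_iso HB (triv2 \<Gamma>)"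
proof -
  interpret H: quadratic_presentation "verts Q" arcs2 src2 tgt2 "U2 :: ('f, _, ('f, 'v, 'e) dbl) bimod" dbl_co
    "verts Q" "\<lambda>i. i" "\<lambda>i. i" vertex_kappa "preproj_relations Q" by (rule preprojective_presentation)
  have HB: "(s, u, w) \<in> carrier HB \<longleftrightarrow> (\<forall>i. i \<notin> verts Q \<longrightarrow> s i = 0) \<and>
      (\<forall>a. a \<notin> arcs Q \<longrightarrow> u (Inl a) = 0 \<and> u (Inr a) = 0) \<and> (\<forall>i. i \<notin> verts Q \<longrightarrow> w i = (0 :: 'f))" for s u w
  proof -
    have "(\<forall>b. b \<notin> arcs2 \<longrightarrow> u b = 0) \<longleftrightarrow> (\<forall>a. a \<notin> arcs Q \<longrightarrow> u (Inl a) = 0 \<and> u (Inr a) = 0)"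
      by (simp add: split_sum_all) blast
    then show ?thesis by (simp add: H.cube_zero_simps(1))
  qed
  have el: "elem s (\<lambda>a. u (Inl a)) \<in> carrier \<Gamma>" "p0 (elem s (\<lambda>a. u (Inl a))) = s"
    "p1 (elem s (\<lambda>a. u (Inl a))) = (\<lambda>a. u (Inl a))" if "(s, u, w) \<in> carrier HB" for s u w
    using that unfolding HB by (auto intro: elem)
  have el0: "elem s \<alpha> \<in> carrier \<Gamma>" "p0 (elem s \<alpha>) = s" "p1 (elem s \<alpha>) = \<alpha>"
    if "\<forall>i. i \<notin> verts Q \<longrightarrow> s i = 0" "\<forall>a. a \<notin> arcs Q \<longrightarrow> \<alpha> a = 0" for s \<alpha>
    using that by (auto intro: elem)
  have hom: "triv2_elem \<in> alg_hom HB (triv2 \<Gamma>)"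
  proof (rule alg_homI)
    fix x :: "('v \<Rightarrow> 'f) \<times> ('e + 'e \<Rightarrow> 'f) \<times> ('v \<Rightarrow> 'f)" assume x: "x \<in> carrier HB"
    obtain s u w where xs: "x = (s, u, w)" by (cases x)
    show "triv2_elem x \<in> carrier (triv2 \<Gamma>)"
      using x by (simp add: xs triv2_elem_def triv2_simps el functional_closed)
    fix c
    have "elem (\<lambda>i. c * s i) (\<lambda>a. c * u (Inl a)) = c \<odot>\<^bsub>\<Gamma>\<^esub> elem s (\<lambda>a. u (Inl a))"
      using x by (intro coord_eqI) (simp_all add: xs HB el0)
    moreover have "c \<odot>\<^bsub>D\<^esub> functional w (\<lambda>a. u (Inr a)) = functional (\<lambda>i. c * w i) (\<lambda>a. c * u (Inr a))"
      by (rule functional_eqI[OF D_closed(2)[OF functional_closed]])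
        (simp_all add: dual_bimod_simps(3) unit_elem functional_unit)
    ultimately show "triv2_elem (c \<odot>\<^bsub>HB\<^esub> x) = c \<odot>\<^bsub>triv2 \<Gamma>\<^esub> triv2_elem x"
      by (simp add: xs triv2_elem_def triv2_simps H.cube_zero_simps)
  next
    fix x y :: "('v \<Rightarrow> 'f) \<times> ('e + 'e \<Rightarrow> 'f) \<times> ('v \<Rightarrow> 'f)" assume x: "x \<in> carrier HB" and y: "y \<in> carrier HB"
    obtain s u w s' u' w' where xy: "x = (s, u, w)" "y = (s', u', w')" by (cases x; cases y) auto
    have "elem (\<lambda>i. s i + s' i) (\<lambda>a. u (Inl a) + u' (Inl a)) =
        elem s (\<lambda>a. u (Inl a)) \<oplus>\<^bsub>\<Gamma>\<^esub> elem s' (\<lambda>a. u' (Inl a))"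
      using x y by (intro coord_eqI) (simp_all add: xy HB el0)
    moreover have "functional w (\<lambda>a. u (Inr a)) \<oplus>\<^bsub>D\<^esub> functional w' (\<lambda>a. u' (Inr a)) =
        functional (\<lambda>i. w i + w' i) (\<lambda>a. u (Inr a) + u' (Inr a))"
      by (rule functional_eqI[OF D_closed(1)[OF functional_closed functional_closed]])
        (simp_all add: dual_bimod_simps(1) unit_elem functional_unit)
    ultimately show "triv2_elem (x \<oplus>\<^bsub>HB\<^esub> y) = triv2_elem x \<oplus>\<^bsub>triv2 \<Gamma>\<^esub> triv2_elem y"
      by (simp add: xy triv2_elem_def triv2_simps H.cube_zero_simps)
    show "triv2_elem (x \<otimes>\<^bsub>HB\<^esub> y) = triv2_elem x \<otimes>\<^bsub>triv2 \<Gamma>\<^esub> triv2_elem y" by (rule triv2_elem_mult[OF x y])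
  next
    have "elem (\<lambda>i. if i \<in> verts Q then 1 else 0) (\<lambda>a. 0) = \<one>\<^bsub>\<Gamma>\<^esub>"
      by (rule coord_eqI) (simp_all add: el0)
    moreover have "functional (\<lambda>i. 0) (\<lambda>a. 0) = \<zero>\<^bsub>D\<^esub>"
      by (simp add: functional_def dual_bimod_simps(2))
    ultimately show "triv2_elem \<one>\<^bsub>HB\<^esub> = \<one>\<^bsub>triv2 \<Gamma>\<^esub>"
      by (simp add: triv2_elem_def triv2_simps H.cube_zero_simps)
  qed
  have inj: "inj_on triv2_elem (carrier HB)"
  proof (rule inj_onI)
    fix x y assume x: "x \<in> carrier HB" and y: "y \<in> carrier HB" and eq: "triv2_elem x = triv2_elem y"
    obtain s u w s' u' w' where xy: "x = (s, u, w)" "y = (s', u', w')" by (cases x; cases y) auto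
    have e: "elem s (\<lambda>a. u (Inl a)) = elem s' (\<lambda>a. u' (Inl a))"
      and f: "functional w (\<lambda>a. u (Inr a)) = functional w' (\<lambda>a. u' (Inr a))"
      using eq by (simp_all add: xy triv2_elem_def)
    have "s = s'" "(\<lambda>a. u (Inl a)) = (\<lambda>a. u' (Inl a))"
      using el(2,3)[OF x[unfolded xy(1)]] el(2,3)[OF y[unfolded xy(2)]] e by metis+
    moreover have "w i = w' i" for i
      using functional_unit(1)[of i w "\<lambda>a. u (Inr a)"] functional_unit(1)[of i w' "\<lambda>a. u' (Inr a)"] f x y
      by (cases "i \<in> verts Q") (simp_all add: xy HB)
    moreover have "u (Inr a) = u' (Inr a)" for a
      using functional_unit(2)[of a w "\<lambda>a. u (Inr a)"] functional_unit(2)[of a w' "\<lambda>a. u' (Inr a)"] f x y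
      by (cases "a \<in> arcs Q") (simp_all add: xy HB)
    ultimately have "s = s'" "u (Inl a) = u' (Inl a)" "u (Inr a) = u' (Inr a)" "w i = w' i" for a i
      by (auto dest: fun_cong)
    then show "x = y" by (auto simp: xy fun_eq_iff split_sum_all)
  qed
  have surj: "\<exists>x\<in>carrier HB. triv2_elem x = z" if z: "z \<in> carrier (triv2 \<Gamma>)" for z
  proof -
    obtain y f where yf: "z = (y, f)" "y \<in> carrier \<Gamma>" "f \<in> carrier D" using z by (auto simp: triv2_simps)
    let ?w = "\<lambda>i. if i \<in> verts Q then f (elem (unit_fun i) (\<lambda>a. 0)) else 0"
    let ?\<beta> = "\<lambda>b. if b \<in> arcs Q then f (elem (\<lambda>i. 0) (unit_fun b)) else 0"
    let ?x = "(p0 y, case_sum (p1 y) ?\<beta>, ?w)"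
    have "elem (p0 y) (p1 y) = y" by (rule coord_eqI) (use yf(2) in \<open>simp_all add: el0\<close>)
    then have "triv2_elem ?x = z" using functional_expand[OF yf(3)] by (simp add: triv2_elem_def yf(1))
    moreover have "?x \<in> carrier HB" using yf(2) by (simp add: HB)
    ultimately show ?thesis by blast
  qed
  have bij: "bij_betw triv2_elem (carrier HB) (carrier (triv2 \<Gamma>))"
    unfolding bij_betw_def using inj surj alg_homD(1)[OF hom] by blast
  have deg: "triv2_elem x \<in> degs (triv2 \<Gamma>) n \<longleftrightarrow> x \<in> degs HB n" if x: "x \<in> carrier HB" for x n
  proof -
    obtain s u w where xs: "x = (s, u, w)" by (cases x)
    have u: "u = (\<lambda>b. 0) \<longleftrightarrow> (\<lambda>a. u (Inl a)) = (\<lambda>a. 0) \<and> (\<lambda>a. u (Inr a)) = (\<lambda>a. 0)"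
      by (simp add: fun_eq_iff split_sum_all)
    have "(\<forall>i. i \<noteq> 2 - n \<longrightarrow> (\<forall>x\<in>degs \<Gamma> i. functional w (\<lambda>a. u (Inr a)) x = 0)) \<longleftrightarrow>
        (n \<noteq> 2 \<longrightarrow> w = (\<lambda>i. 0)) \<and> (n \<noteq> 1 \<longrightarrow> (\<lambda>a. u (Inr a)) = (\<lambda>a. 0))"
      using x by (intro functional_degs) (simp_all add: xs HB)
    moreover have "elem s (\<lambda>a. u (Inl a)) \<in> degs \<Gamma> n \<longleftrightarrow>
        (n \<noteq> 0 \<longrightarrow> s = (\<lambda>i. 0)) \<and> (n \<noteq> 1 \<longrightarrow> (\<lambda>a. u (Inl a)) = (\<lambda>a. 0))"
      using el[OF x[unfolded xs]] by (simp add: degs_iff)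
    ultimately show ?thesis
      using x unfolding xs H.cube_zero_simps(7) u
      by (simp add: triv2_elem_def triv2_simps functional_closed) blast
  qed
  have "triv2_elem ` degs HB n = degs (triv2 \<Gamma>) n" for n
  proof -
    have 1: "degs (HB :: ('f, ('v \<Rightarrow> 'f) \<times> ('e + 'e \<Rightarrow> 'f) \<times> ('v \<Rightarrow> 'f)) graded_algebra) n \<subseteq> carrier HB" by (rule subsetI) (rule graded_falgebra.degs_carrier[OF H.cube_zero_graded])
    have 2: "degs (triv2 \<Gamma>) n \<subseteq> carrier (triv2 \<Gamma>)" using degs_carrier by (auto simp: triv2_simps)
    show ?thesis
    proof
      show "triv2_elem ` degs HB n \<subseteq> degs (triv2 \<Gamma>) n" using deg 1 by blast
      show "degs (triv2 \<Gamma>) n \<subseteq> triv2_elem ` degs HB n" 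
      proof
        fix z assume z: "z \<in> degs (triv2 \<Gamma>) n"
        then obtain x where x: "x \<in> carrier HB" "triv2_elem x = z" using surj 2 by blast
        then have "x \<in> degs HB n" using deg[OF x(1), of n] z by simp
        then show "z \<in> triv2_elem ` degs HB n" using x(2) by blast
      qed
    qed
  qed
  then show ?thesis using hom bij by (simp add: graded_iso_def graded_hom_iff)
qed

end


section \<open>The natural morphism in coordinates\<close>

lemma sum_fibres:
  assumes "finite X" "finite A" "\<And>a. a \<in> A \<Longrightarrow> f a \<in> X"
  shows "(\<Sum>i\<in>X. \<Sum>a\<in>A. if f a = i then g a else 0) = (\<Sum>a\<in>A. g a :: 'b::comm_monoid_add)"
proof -
  have "(\<Sum>i\<in>X. \<Sum>a\<in>A. if f a = i then g a else 0) = (\<Sum>a\<in>A. \<Sum>i\<in>X. if f a = i then g a else 0)"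
    by (rule sum.swap)
  also have "\<dots> = (\<Sum>a\<in>A. g a)" using assms by (intro sum.cong refl) simp
  finally show ?thesis .
qed

context finite_quiver
begin

lemma path_dual_graded: "graded_falgebra (PD :: ('f::field, ('f, 'v, 'e) pathalg_dual) graded_algebra)"
  unfolding path_algebra_dual_def by (rule coord_bimod.quadratic_dual_graded[OF arrow_coord])

abbreviation "dco1 \<equiv> coord_bimod.dco (arcs Q) (tail Q) V (\<lambda>x. x)"
abbreviation "dco2 \<equiv> coord_bimod.dco arcs2 src2 U2 dbl_co"

text \<open>
  Both restrictions of a functional on the direct sum keep its coordinates.
\<close>

lemma left_dual_summands:
  fixes k :: "('f::field, 'v, 'e) dbl \<Rightarrow> 'v \<Rightarrow> 'f"
  assumes k: "k \<in> carrier (left_dual SA U2)"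
  shows "x \<in> carrier V \<Longrightarrow> k (x, \<zero>\<^bsub>Vd\<^esub>) i = (\<Sum>a\<in>arcs Q. if tail Q a = i then x a * dco2 k (Inl a) else 0)"
    and "\<theta> \<in> carrier Vd \<Longrightarrow> k (\<zero>\<^bsub>V\<^esub>, \<theta>) i = (\<Sum>a\<in>arcs Q. if head Q a = i then eco \<theta> a * dco2 k (Inr a) else 0)"
proof -
  interpret U: coord_bimod "verts Q" arcs2 src2 tgt2 "U2 :: ('f, _, ('f, 'v, 'e) dbl) bimod" dbl_co
    by (rule double_coord)
  interpret V: coord_bimod "verts Q" "arcs Q" "tail Q" "head Q" "V :: ('f, _, _) bimod" "\<lambda>x. x"
    by (rule arrow_coord)
  interpret E: coord_bimod "verts Q" "arcs Q" "head Q" "tail Q" "Vd :: ('f, _, _) bimod" eco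
    by (rule env_coord)
  have c: "carrier U2 = carrier (V :: ('f, _, _) bimod) \<times> carrier Vd"
    by (simp add: double_bimod_def direct_sum_def)
  have z: "eco \<zero>\<^bsub>Vd\<^esub> a = (0 :: 'f)" for a
    by (simp add: eco_def env_simps(1) unit_arrow_closed)
  show "k (x, \<zero>\<^bsub>Vd\<^esub>) i = (\<Sum>a\<in>arcs Q. if tail Q a = i then x a * dco2 k (Inl a) else 0)" if "x \<in> carrier V"
    using that E.zero_closed c
    by (subst U.left_dual_expand[OF k]) (simp_all add: sum.Plus comp_def dbl_co_def z cong: if_cong)
  show "k (\<zero>\<^bsub>V\<^esub>, \<theta>) i = (\<Sum>a\<in>arcs Q. if head Q a = i then eco \<theta> a * dco2 k (Inr a) else 0)"
    if "\<theta> \<in> carrier Vd"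
    using that V.zero_closed c
    by (subst U.left_dual_expand[OF k]) (simp_all add: sum.Plus comp_def dbl_co_def arrow_simps(2) cong: if_cong)
qed

lemma restrict_fst_coord:
  fixes k :: "('f::field, 'v, 'e) dbl \<Rightarrow> 'v \<Rightarrow> 'f"
  assumes k: "k \<in> carrier (left_dual SA U2)"
  shows "restrict_fst Q k \<in> carrier (left_dual SA V)"
    and "dco1 (restrict_fst Q k) = (\<lambda>a. dco2 k (Inl a))"
proof -
  interpret U: coord_bimod "verts Q" arcs2 src2 tgt2 "U2 :: ('f, _, ('f, 'v, 'e) dbl) bimod" dbl_co
    by (rule double_coord)
  interpret V: coord_bimod "verts Q" "arcs Q" "tail Q" "head Q" "V :: ('f, _, _) bimod" "\<lambda>x. x"
    by (rule arrow_coord)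
  note kx = left_dual_summands(1)[OF k]
  show "restrict_fst Q k \<in> carrier (left_dual SA V)"
    unfolding restrict_fst_def
  proof (rule V.left_dualI)
    fix m i assume m: "m \<in> carrier (V :: ('f, _, _) bimod)"
    show "k (m, \<zero>\<^bsub>Vd\<^esub>) \<in> carrier SA"
      using m by (auto simp: fun_algebra_simps kx intro!: sum.neutral)
    show "k (m \<oplus>\<^bsub>V\<^esub> n, \<zero>\<^bsub>Vd\<^esub>) i = k (m, \<zero>\<^bsub>Vd\<^esub>) i + k (n, \<zero>\<^bsub>Vd\<^esub>) i"
      if "n \<in> carrier V" for n
      using m that V.add_closed[OF m that]
      by (simp add: kx arrow_simps(3) sum.distrib[symmetric] distrib_right if_distrib cong: if_cong)
    show "k (c \<odot>\<^bsub>V\<^esub> m, \<zero>\<^bsub>Vd\<^esub>) i = c * k (m, \<zero>\<^bsub>Vd\<^esub>) i" for c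
      using m V.smult_closed[OF m]
      by (auto simp: kx arrow_simps(4) sum_distrib_left mult.assoc intro!: sum.cong)
    show "k (lact V s m, \<zero>\<^bsub>Vd\<^esub>) i = s i * k (m, \<zero>\<^bsub>Vd\<^esub>) i" if "s \<in> carrier SA" for s
      using m V.lact_closed[OF that m]
      by (auto simp: kx arrow_simps(5) sum_distrib_left mult.assoc intro!: sum.cong)
  qed
  have "dco1 (restrict_fst Q k) a = dco2 k (Inl a)" for a
  proof (cases "a \<in> arcs Q")
    case True
    have "(\<Sum>c\<in>arcs Q. if tail Q c = tail Q a then unit_fun a c * dco2 k (Inl c) else 0) =
        (\<Sum>c\<in>arcs Q. if c = a then dco2 k (Inl c) else 0)"
      by (intro sum.cong refl) (auto simp: unit_fun_def)
    moreover have "unit_fun a \<in> carrier (V :: ('f, _, _) bimod)" by (rule unit_arrow_closed[OF True])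
    ultimately show ?thesis
      using True by (simp add: V.dco_def arrow_lift restrict_fst_def kx)
  qed (simp add: V.dco_def U.dco_def)
  then show "dco1 (restrict_fst Q k) = (\<lambda>a. dco2 k (Inl a))" by auto
qed

text \<open>
  The form on the enveloping algebra adds up the coefficients of all pairs of vertices, so both sides are the pairing
  of coordinates, which is nondegenerate.
\<close>

lemma bidual_elem_coord:
  fixes k :: "('f::field, 'v, 'e) dbl \<Rightarrow> 'v \<Rightarrow> 'f"
  assumes k: "k \<in> carrier (left_dual SA U2)"
  shows "bidual_elem Q (restrict_snd Q k) = (\<lambda>a. dco2 k (Inr a))"
proof -
  interpret U: coord_bimod "verts Q" arcs2 src2 tgt2 "U2 :: ('f, _, ('f, 'v, 'e) dbl) bimod" dbl_co
    by (rule double_coord)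
  interpret E: coord_bimod "verts Q" "arcs Q" "head Q" "tail Q" "Vd :: ('f, _, _) bimod" eco
    by (rule env_coord)
  let ?y = "\<lambda>a. dco2 k (Inr a)"
  have left: "symm_form (verts Q) (restrict_snd Q k \<theta>) = (\<Sum>a\<in>arcs Q. eco \<theta> a * ?y a)"
    if "\<theta> \<in> carrier Vd" for \<theta>
    using that by (simp add: symm_form_def restrict_snd_def left_dual_summands(2)[OF k] sum_fibres)
  have right: "symm_form (verts Q \<times> verts Q) (\<theta> x) = (\<Sum>a\<in>arcs Q. x a * eco \<theta> a)"
    if "\<theta> \<in> carrier (Vd :: ('f, _, _) bimod)" "x \<in> carrier V" for \<theta> x
  proof -
    have "\<theta> x ij = (\<Sum>a\<in>arcs Q. if (tail Q a, head Q a) = ij then x a * eco \<theta> a else 0)" for ij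
      by (cases ij) (simp add: env_expand[OF that])
    then show ?thesis by (simp add: symm_form_def sum_fibres)
  qed
  have y: "?y \<in> carrier V" by (simp add: arrow_simps(1) U.dco_def)
  show ?thesis
    unfolding bidual_elem_def
  proof (rule the_equality)
    show "?y \<in> carrier V \<and> (\<forall>\<theta>\<in>carrier Vd. symm_form (verts Q) (restrict_snd Q k \<theta>) =
        symm_form (verts Q \<times> verts Q) (\<theta> ?y))"
      using y by (simp add: left right mult.commute)
  next
    fix x :: "'e \<Rightarrow> 'f"
    assume x: "x \<in> carrier V \<and> (\<forall>\<theta>\<in>carrier Vd. symm_form (verts Q) (restrict_snd Q k \<theta>) =
        symm_form (verts Q \<times> verts Q) (\<theta> x))"
    show "x = ?y"
    proof
      fix b
      show "x b = ?y b"
      proof (cases "b \<in> arcs Q")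
        case True
        have "(\<Sum>a\<in>arcs Q. unit_fun b a * ?y a) = (\<Sum>a\<in>arcs Q. x a * unit_fun b a)"
          using x left[OF E.basis(1)[OF True]] right[OF E.basis(1)[OF True], of x] E.basis[OF True] by simp
        then show ?thesis using True
          by (simp add: unit_fun_def if_distrib[of "\<lambda>c. _ * c"] if_distrib[of "\<lambda>c. c * _"] cong: if_cong)
      next
        case False
        then show ?thesis using x y by (simp add: arrow_simps(1))
      qed
    qed
  qed
qed

context
  fixes h :: "('f::field, 'v, 'e) pathalg_dual \<Rightarrow> ('v \<Rightarrow> 'f) \<times> ('e \<Rightarrow> 'f) \<times> (unit \<Rightarrow> 'f)"
  assumes h: "h \<in> graded_iso PD GB"
    "\<And>l. l \<in> carrier SA <+> carrier (left_dual SA V) \<Longrightarrow> h (path_dual_letter Q l) = coord_letter dco1 l"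
begin

interpretation R: radical_square_zero Q "PD :: ('f, ('f, 'v, 'e) pathalg_dual) graded_algebra" h
  using path_dual_graded h(1)
  by (intro radical_square_zero.intro radical_square_zero_axioms.intro finite_quiver_axioms)

lemma path_dual_letter_elem:
  "s \<in> carrier SA \<Longrightarrow> path_dual_letter Q (Inl s) = R.elem s (\<lambda>a. 0)"
  "g \<in> carrier (left_dual SA V) \<Longrightarrow> path_dual_letter Q (Inr g) = R.elem (\<lambda>i. 0) (dco1 g)"
proof -
  interpret V: coord_bimod "verts Q" "arcs Q" "tail Q" "head Q" "V :: ('f, _, _) bimod" "\<lambda>x. x"
    by (rule arrow_coord)
  interpret m: tensor_map V.S V.W PD "path_dual_letter Q"
    unfolding path_algebra_dual_def path_dual_letter_def by (rule V.dual_letter_map)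
  have cl: "path_dual_letter Q l \<in> carrier PD" if "l \<in> carrier SA <+> carrier (left_dual SA V)"
    for l :: "('v \<Rightarrow> 'f) + (('e \<Rightarrow> 'f) \<Rightarrow> 'v \<Rightarrow> 'f)"
    using that m.g_closed by auto
  show "path_dual_letter Q (Inl s) = R.elem s (\<lambda>a. 0)" if s: "s \<in> carrier SA"
  proof -
    have e: "R.elem s (\<lambda>a. 0) \<in> carrier PD" "R.p0 (R.elem s (\<lambda>a. 0)) = s" "R.p1 (R.elem s (\<lambda>a. 0)) = (\<lambda>a. 0)"
      by (rule R.elem; use s in \<open>simp add: fun_algebra_simps\<close>)+
    show ?thesis by (rule R.coord_eqI[OF cl e(1)]) (use s in \<open>simp_all add: h(2) coord_letter_def e\<close>)
  qed
  show "path_dual_letter Q (Inr g) = R.elem (\<lambda>i. 0) (dco1 g)" if g: "g \<in> carrier (left_dual SA V)"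
  proof -
    have e: "R.elem (\<lambda>i. 0) (dco1 g) \<in> carrier PD" "R.p0 (R.elem (\<lambda>i. 0) (dco1 g)) = (\<lambda>i. 0)"
      "R.p1 (R.elem (\<lambda>i. 0) (dco1 g)) = dco1 g"
      by (rule R.elem; simp add: V.dco_def)+
    show ?thesis by (rule R.coord_eqI[OF cl e(1)]) (use g in \<open>simp_all add: h(2) coord_letter_def e\<close>)
  qed
qed

text \<open>
  A functional vanishing outside degree one is given by its values on the letters of the dual arrows.
\<close>

lemma eval_functional_coord:
  fixes x :: "'e \<Rightarrow> 'f"
  assumes x: "x \<in> carrier V"
  shows "eval_functional Q x = R.functional (\<lambda>i. 0) x"
proof -
  interpret V: coord_bimod "verts Q" "arcs Q" "tail Q" "head Q" "V :: ('f, _, _) bimod" "\<lambda>x. x"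
    by (rule arrow_coord)
  interpret W: coord_bimod "verts Q" "arcs Q" "head Q" "tail Q" "left_dual SA (V :: ('f, _, _) bimod)" dco1
    by (rule V.left_dual_coord)
  have val: "symm_form (verts Q) (g x) = (\<Sum>a\<in>arcs Q. x a * dco1 g a)" if "g \<in> carrier (left_dual SA V)" for g
    by (simp add: symm_form_def V.left_dual_expand[OF that x] sum_fibres)
  have x0: "a \<notin> arcs Q \<Longrightarrow> x a = 0" for a using x by (simp add: arrow_simps(1))
  have e: "R.p1 (R.elem (\<lambda>i. 0) (dco1 g)) = dco1 g" "R.p0 (R.elem (\<lambda>i. 0) (dco1 g)) = (\<lambda>i. 0)"
    "R.elem (\<lambda>i. 0) (dco1 g) \<in> carrier PD" for g
    by (rule R.elem; simp add: V.dco_def)+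
  show ?thesis
    unfolding eval_functional_def Let_def
  proof (rule the_equality)
    show "R.functional (\<lambda>i. 0) x \<in> carrier (dual_bimod PD) \<and>
        (\<forall>i. i \<noteq> 1 \<longrightarrow> (\<forall>y\<in>degs PD i. R.functional (\<lambda>i. 0) x y = 0)) \<and>
        (\<forall>g\<in>carrier (left_dual SA V). R.functional (\<lambda>i. 0) x (path_dual_letter Q (Inr g)) =
           symm_form (verts Q) (g x))"
    proof (intro conjI)
      have "\<forall>i. i \<noteq> 2 - 1 \<longrightarrow> (\<forall>y\<in>degs PD i. R.functional (\<lambda>i. 0) x y = 0)"
        by (subst R.functional_degs) (simp_all add: x0)
      then show "\<forall>i. i \<noteq> 1 \<longrightarrow> (\<forall>y\<in>degs PD i. R.functional (\<lambda>i. 0) x y = 0)" by simp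
      show "\<forall>g\<in>carrier (left_dual SA V). R.functional (\<lambda>i. 0) x (path_dual_letter Q (Inr g)) =
           symm_form (verts Q) (g x)"
        by (simp add: path_dual_letter_elem val R.functional_def e)
    qed (rule R.functional_closed)
  next
    fix f
    assume f: "f \<in> carrier (dual_bimod PD) \<and> (\<forall>i. i \<noteq> 1 \<longrightarrow> (\<forall>y\<in>degs PD i. f y = 0)) \<and>
        (\<forall>g\<in>carrier (left_dual SA V). f (path_dual_letter Q (Inr g)) = symm_form (verts Q) (g x))"
    show "f = R.functional (\<lambda>i. 0) x"
    proof (rule R.functional_eqI)
      show "f \<in> carrier (dual_bimod PD)" using f by blast
      show "f (R.elem (unit_fun i) (\<lambda>a. 0)) = 0" if "i \<in> verts Q" for i
      proof -
        have "R.elem (unit_fun i) (\<lambda>a. 0) \<in> degs PD 0" using that by (simp add: R.degs_iff R.unit_elem)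
        moreover have "\<forall>i. i \<noteq> 1 \<longrightarrow> (\<forall>y\<in>degs PD i. f y = 0)" using f by blast
        ultimately show ?thesis by (metis zero_neq_one)
      qed
      show "f (R.elem (\<lambda>i. 0) (unit_fun b)) = x b" if b: "b \<in> arcs Q" for b
      proof -
        note wb = W.basis[OF b]
        have "f (path_dual_letter Q (Inr (W.basis b))) = symm_form (verts Q) (W.basis b x)"
          using f wb(1) by blast
        then show ?thesis
          using b by (simp add: path_dual_letter_elem(2)[OF wb(1)] val[OF wb(1)] wb(2) R.unit_fun_sum(1))
      qed
    qed
  qed
qed

lemma natural_morphism_coord:
  assumes \<Phi>: "\<Phi> \<in> graded_hom (preprojective_dual Q :: ('f, ('f, 'v, 'e) preproj_dual) graded_algebra) HB"
    and letters: "\<And>l. l \<in> carrier SA <+> carrier (left_dual SA U2) \<Longrightarrow>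
      \<Phi> (dual_letter SA U2 (preproj_relations Q) l) = coord_letter dco2 l"
  shows "natural_morphism Q (\<lambda>z\<in>carrier (preprojective_dual Q). R.triv2_elem (\<Phi> z))"
proof -
  let ?A = "preprojective_dual Q :: ('f, ('f, 'v, 'e) preproj_dual) graded_algebra"
  interpret U: coord_bimod "verts Q" arcs2 src2 tgt2 "U2 :: ('f, _, ('f, 'v, 'e) dbl) bimod" dbl_co
    by (rule double_coord)
  interpret A: graded_falgebra ?A
    unfolding preprojective_dual_def by (rule U.quadratic_dual_graded)
  interpret m: tensor_map U.S U.W ?A "dual_letter SA U2 (preproj_relations Q)"
    unfolding preprojective_dual_def by (rule U.dual_letter_map)
  let ?\<phi> = "\<lambda>z\<in>carrier ?A. R.triv2_elem (\<Phi> z)"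
  have T: "R.triv2_elem \<in> alg_hom HB (triv2 PD)" "R.triv2_elem ` degs HB n = degs (triv2 PD) n" for n
    using R.triv2_elem_iso by (simp_all add: graded_iso_def graded_hom_iff)
  have \<Phi>h: "\<Phi> \<in> alg_hom ?A HB" "\<Phi> ` degs ?A n \<subseteq> degs HB n" for n
    using \<Phi> by (simp_all add: graded_hom_iff)
  have comp: "(\<lambda>z. R.triv2_elem (\<Phi> z)) \<in> alg_hom ?A (triv2 PD)" by (rule alg_hom_comp[OF \<Phi>h(1) T(1)])
  have "?\<phi> \<in> alg_hom ?A (triv2 PD)"
    by (rule alg_homI) (simp_all add: alg_homD[OF comp])
  moreover have "?\<phi> ` degs ?A n \<subseteq> degs (triv2 PD) n" for n
    using \<Phi>h(2)[of n] T(2)[of n] A.degs_carrier by auto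
  moreover have "?\<phi> (dual_letter SA U2 (preproj_relations Q) (Inl s)) =
      (path_dual_letter Q (Inl s), \<zero>\<^bsub>dual_bimod PD\<^esub>)" if s: "s \<in> carrier SA" for s
  proof -
    have "dual_letter SA U2 (preproj_relations Q) (Inl s) \<in> carrier ?A" using s m.g_closed by simp
    moreover have "R.functional (\<lambda>i. 0) (\<lambda>a. 0) = \<zero>\<^bsub>dual_bimod PD\<^esub>"
      by (simp add: R.functional_def dual_bimod_simps(2))
    ultimately show ?thesis
      using s by (simp add: letters coord_letter_def R.triv2_elem_def path_dual_letter_elem)
  qed
  moreover have "?\<phi> (dual_letter SA U2 (preproj_relations Q) (Inr k)) =
      (path_dual_letter Q (Inr (restrict_fst Q k)), eval_functional Q (bidual_elem Q (restrict_snd Q k)))"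
    if k: "k \<in> carrier (left_dual SA U2)" for k
  proof -
    have "dual_letter SA U2 (preproj_relations Q) (Inr k) \<in> carrier ?A" using k m.g_closed by simp
    moreover have "(\<lambda>a. dco2 k (Inr a)) \<in> carrier V" by (simp add: arrow_simps(1) U.dco_def)
    ultimately show ?thesis
      using k by (simp add: letters coord_letter_def R.triv2_elem_def path_dual_letter_elem
          restrict_fst_coord bidual_elem_coord eval_functional_coord)
  qed
  ultimately show ?thesis
    unfolding natural_morphism_def Let_def graded_hom_iff by auto
qed

end

end


section \<open>Products of three generators\<close>

context finite_quiver
begin

text \<open>A walk of the symmetrized quiver cannot leave a set of vertices that is closed under adjacency.\<close>

lemma connected_closed:
  assumes conn: "connected Q" and W: "W \<subseteq> verts Q" "W \<noteq> {}"
    and closed: "\<And>a. a \<in> arcs Q \<Longrightarrow> tail Q a \<in> W \<longleftrightarrow> head Q a \<in> W"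
  shows "W = verts Q"
proof
  interpret S: pair_wf_digraph "mk_symmetric Q" by (rule wellformed_mk_symmetric)
  obtain w where w: "w \<in> W" using W(2) by blast
  show "verts Q \<subseteq> W"
  proof
    fix v assume v: "v \<in> verts Q"
    have "w \<rightarrow>\<^sup>*\<^bsub>with_proj (mk_symmetric Q)\<^esub> v"
      using conn w v W(1) unfolding connected_def strongly_connected_def by auto
    then show "v \<in> W"
    proof (induction rule: S.reachable_induct)
      case base
      show ?case by (rule w)
    next
      case (step x y)
      then have "(x, y) \<in> parcs (mk_symmetric Q)" by simp
      then show ?case using step.IH closed unfolding parcs_mk_symmetric by auto
    qed
  qed
qed (rule W(1))

text \<open>
  A vertex without arcs is closed under adjacency, hence the only vertex.
\<close>

lemma not_A1_incident:
  assumes "connected Q" "\<not> of_type_A 1 Q" "i \<in> verts Q"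
  shows "\<exists>b\<in>arcs2. tgt2 b = i"
proof (rule ccontr)
  assume no: "\<not> (\<exists>b\<in>arcs2. tgt2 b = i)"
  have n: "head Q a \<noteq> i" "tail Q a \<noteq> i" if "a \<in> arcs Q" for a
    using no that by (auto dest: bspec[of _ _ "Inl a"] bspec[of _ _ "Inr a"])
  have v: "{i} = verts Q"
    by (rule connected_closed[OF assms(1)]) (use assms(3) n in auto)
  have "arcs Q = {}"
  proof (rule ccontr)
    assume "arcs Q \<noteq> {}"
    then obtain a where a: "a \<in> arcs Q" by blast
    then show False using n[OF a] tail_in_verts[OF a] v by blast
  qed
  then have "of_type_A 1 Q"
    unfolding of_type_A_def using v
    by (intro exI[of _ "\<lambda>_. i"] exI[of _ "\<lambda>_. undefined"]) (auto simp: bij_betw_def inj_on_def lessThan_Suc)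
  then show False using assms(2) by blast
qed

definition opp :: "'e + 'e \<Rightarrow> 'e + 'e" where "opp = case_sum Inr Inl"

definition dsign :: "'e + 'e \<Rightarrow> 'f::field" where "dsign = case_sum (\<lambda>_. 1) (\<lambda>_. - 1)"

lemma opp_simps [simp]:
  "opp (opp b) = b" "opp b \<in> arcs2 \<longleftrightarrow> b \<in> arcs2" "tgt2 (opp b) = src2 b" "src2 (opp b) = tgt2 b"
  "dsign b \<noteq> (0 :: 'f::field)"
  by (cases b; auto simp: opp_def dsign_def)+

lemma vertex_kappa_opp:
  "vertex_kappa i b c = (if c = opp b \<and> b \<in> arcs2 \<and> tgt2 b = i then dsign b else (0 :: 'f::field))"
  by (cases b; cases c) (auto simp: opp_def dsign_def)

text \<open>
  The two ends of an arc that meets no other arc are closed under adjacency, hence are all vertices.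
\<close>

lemma isolated_arc_A2:
  assumes conn: "connected Q" and b: "b \<in> arcs2"
    and iso: "\<And>c. c \<in> arcs2 \<Longrightarrow> tgt2 c = tgt2 b \<Longrightarrow> c = b" "\<And>c. c \<in> arcs2 \<Longrightarrow> tgt2 c = src2 b \<Longrightarrow> c = opp b"
  shows "of_type_A 2 Q"
proof -
  obtain a where a: "a \<in> arcs Q" "b = Inl a \<or> b = Inr a" using b by auto
  have ends: "{tgt2 b, src2 b} = {tail Q a, head Q a}" using a(2) by auto
  have only: "c = a" if c: "c \<in> arcs Q" "tail Q c \<in> {tail Q a, head Q a} \<or> head Q c \<in> {tail Q a, head Q a}" for c
  proof -
    obtain d where d: "d \<in> arcs2" "d = Inl c \<or> d = Inr c" "tgt2 d \<in> {tgt2 b, src2 b}"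
      unfolding ends using c by (cases "head Q c \<in> {tail Q a, head Q a}") (force intro: that[of "Inl c"] that[of "Inr c"])+
    then have "d = b \<or> d = opp b" using iso by blast
    then show ?thesis using a(2) d(2) by (auto simp: opp_def)
  qed
  have v: "{tail Q a, head Q a} = verts Q"
    by (rule connected_closed[OF conn]) (use a only in auto)
  have "arcs Q = {a}"
    using only a(1) tail_in_verts unfolding v by blast
  moreover have "tail Q a \<noteq> head Q a"
  proof
    assume "tail Q a = head Q a"
    then have "opp b = b" using a(2) iso(1)[of "opp b"] b by auto
    then show False by (cases b) (simp_all add: opp_def)
  qed
  ultimately show ?thesis
    unfolding of_type_A_def using v
    by (intro exI[of _ "\<lambda>k. if k = 0 then tail Q a else head Q a"] exI[of _ "\<lambda>_. a"])
      (auto simp: bij_betw_def inj_on_def numeral_2_eq_2 lessThan_Suc)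
qed

lemma A2_arc:
  assumes "of_type_A 2 Q"
  obtains a where "arcs Q = {a}" "verts Q = {tail Q a, head Q a}" "tail Q a \<noteq> head Q a"
proof -
  obtain f g where fg: "bij_betw f {..<2 :: nat} (verts Q)" "bij_betw g {..<2 - 1 :: nat} (arcs Q)"
    "\<forall>k<2 - 1. {tail Q (g k), head Q (g k)} = {f k, f (Suc k)}"
    using assms unfolding of_type_A_def by blast
  have "verts Q = f ` {..<2}" "arcs Q = g ` {..<1}" "inj_on f {..<2}" using fg(1,2) by (auto simp: bij_betw_def)
  moreover have "{..<2 :: nat} = {0, 1}" "{..<1 :: nat} = {0}" by auto
  ultimately have *: "verts Q = {f 0, f 1}" "arcs Q = {g 0}" "f 0 \<noteq> f 1" by (auto simp: inj_on_def)
  have "{tail Q (g 0), head Q (g 0)} = {f 0, f 1}" using fg(3) by simp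
  then show thesis using * that[of "g 0"] by (auto simp: doubleton_eq_iff)
qed

text \<open>
  For basis elements this is the exchange argument: \<open>b b*\<close> may be replaced by \<open>c c*\<close> for any
  other \<open>c\<close> with the same target, and \<open>c* b\<close> is zero. Linearity in each of the factors gives the rest.
\<close>

lemma triple_products_vanish:
  fixes f g k :: "('f::field, 'v, 'e) dbl \<Rightarrow> 'v \<Rightarrow> 'f"
  assumes conn: "connected Q" and nA: "\<not> of_type_A 2 Q"
    and fgk: "f \<in> carrier (left_dual SA U2)" "g \<in> carrier (left_dual SA U2)" "k \<in> carrier (left_dual SA U2)"
  defines "dl \<equiv> dual_letter SA U2 (preproj_relations Q)"
    and "A \<equiv> quadratic_dual SA U2 (preproj_relations Q)"
  shows "dl (Inr f) \<otimes>\<^bsub>A\<^esub> (dl (Inr g) \<otimes>\<^bsub>A\<^esub> dl (Inr k)) = \<zero>\<^bsub>A\<^esub>"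
proof -
  interpret H: quadratic_presentation "verts Q" arcs2 src2 tgt2 "U2 :: ('f, _, ('f, 'v, 'e) dbl) bimod" dbl_co
    "verts Q" "\<lambda>i. i" "\<lambda>i. i" vertex_kappa "preproj_relations Q" by (rule preprojective_presentation)
  interpret A: graded_falgebra A unfolding A_def by (rule H.U.quadratic_dual_graded)
  interpret m: tensor_map H.U.S H.U.W A dl unfolding A_def dl_def by (rule H.U.dual_letter_map)
  let ?x = "\<lambda>b. dl (Inr (H.W.basis b))"
  have xc: "?x b \<in> carrier A" if "b \<in> arcs2" for b using H.W.basis(1)[OF that] by simp
  have zero: "?x b \<otimes>\<^bsub>A\<^esub> ?x c = \<zero>\<^bsub>A\<^esub>" if "b \<in> arcs2" "c \<in> arcs2" "c \<noteq> opp b" for b c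
    unfolding A_def dl_def by (rule H.product_zero[OF that(1,2)]) (simp add: vertex_kappa_opp that(3))
  have exchange: "\<exists>r. ?x b \<otimes>\<^bsub>A\<^esub> ?x (opp b) = r \<odot>\<^bsub>A\<^esub> (?x c \<otimes>\<^bsub>A\<^esub> ?x (opp c))"
    if bc: "b \<in> arcs2" "c \<in> arcs2" "tgt2 c = tgt2 b" for b c
  proof -
    have ob: "opp b \<in> arcs2" "opp c \<in> arcs2" using bc by simp_all
    let ?p = "?x b \<otimes>\<^bsub>A\<^esub> ?x (opp b)" and ?q = "?x c \<otimes>\<^bsub>A\<^esub> ?x (opp c)"
    have pq: "?p \<in> carrier A" "?q \<in> carrier A" using xc bc ob by simp_all
    have "dsign c \<odot>\<^bsub>A\<^esub> ?p \<oplus>\<^bsub>A\<^esub> (- dsign b) \<odot>\<^bsub>A\<^esub> ?q = \<zero>\<^bsub>A\<^esub>"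
      unfolding A_def dl_def
      by (rule H.product_relation[OF bc(1) ob(1) bc(2) ob(2)]) (use bc in \<open>simp add: vertex_kappa_opp\<close>)
    moreover have "dsign b \<odot>\<^bsub>A\<^esub> ?q \<oplus>\<^bsub>A\<^esub> (- dsign b) \<odot>\<^bsub>A\<^esub> ?q = \<zero>\<^bsub>A\<^esub>"
      using A.smult_l_distr[OF pq(2), of "dsign b" "- dsign b"] A.smult_zero_l[OF pq(2)] by simp
    ultimately have "dsign c \<odot>\<^bsub>A\<^esub> ?p \<oplus>\<^bsub>A\<^esub> (- dsign b) \<odot>\<^bsub>A\<^esub> ?q = dsign b \<odot>\<^bsub>A\<^esub> ?q \<oplus>\<^bsub>A\<^esub> (- dsign b) \<odot>\<^bsub>A\<^esub> ?q"
      by (rule trans[OF _ sym])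
    then have "dsign c \<odot>\<^bsub>A\<^esub> ?p = dsign b \<odot>\<^bsub>A\<^esub> ?q"
      by (rule A.add.right_cancel[THEN iffD1, rotated 3]) (intro A.smult_closed pq)+
    then have "inverse (dsign c) \<odot>\<^bsub>A\<^esub> (dsign c \<odot>\<^bsub>A\<^esub> ?p) = inverse (dsign c) \<odot>\<^bsub>A\<^esub> (dsign b \<odot>\<^bsub>A\<^esub> ?q)" by simp
    then have "(inverse (dsign c) * dsign c) \<odot>\<^bsub>A\<^esub> ?p = (inverse (dsign c) * dsign b) \<odot>\<^bsub>A\<^esub> ?q"
      unfolding A.smult_smult[OF pq(1)] A.smult_smult[OF pq(2)] .
    then have "?p = (inverse (dsign c) * dsign b) \<odot>\<^bsub>A\<^esub> ?q"
      using A.smult_one[OF pq(1)] by (simp only: left_inverse[OF opp_simps(5)])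
    then show ?thesis by blast
  qed
  have basis: "?x b \<otimes>\<^bsub>A\<^esub> (?x c \<otimes>\<^bsub>A\<^esub> ?x d) = \<zero>\<^bsub>A\<^esub>" if bcd: "b \<in> arcs2" "c \<in> arcs2" "d \<in> arcs2" for b c d
  proof (cases "c = opp b \<and> d = b")
    case False
    then consider "c \<noteq> opp b" | "d \<noteq> opp c" by (metis opp_simps(1))
    then show ?thesis
    proof cases
      case 1
      then show ?thesis using zero[OF bcd(1,2)] xc bcd by (simp add: A.m_assoc[symmetric])
    next
      case 2
      then show ?thesis using zero[OF bcd(2,3)] xc bcd by simp
    qed
  next
    case True
    have ob: "opp b \<in> arcs2" using bcd by simp
    have "(\<exists>e\<in>arcs2. tgt2 e = tgt2 b \<and> e \<noteq> b) \<or> (\<exists>e\<in>arcs2. tgt2 e = src2 b \<and> e \<noteq> opp b)"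
      using isolated_arc_A2[OF conn bcd(1)] nA by blast
    then show ?thesis
    proof
      assume "\<exists>e\<in>arcs2. tgt2 e = tgt2 b \<and> e \<noteq> b"
      then obtain e where e: "e \<in> arcs2" "tgt2 e = tgt2 b" "e \<noteq> b" by blast
      have oe: "opp e \<in> arcs2" using e by simp
      obtain r where r: "?x b \<otimes>\<^bsub>A\<^esub> ?x (opp b) = r \<odot>\<^bsub>A\<^esub> (?x e \<otimes>\<^bsub>A\<^esub> ?x (opp e))"
        using exchange[OF bcd(1) e(1,2)] by blast
      have "?x (opp e) \<otimes>\<^bsub>A\<^esub> ?x b = \<zero>\<^bsub>A\<^esub>" by (rule zero[OF oe bcd(1)]) (use e(3) in simp)
      moreover have "?x b \<otimes>\<^bsub>A\<^esub> (?x c \<otimes>\<^bsub>A\<^esub> ?x d) = r \<odot>\<^bsub>A\<^esub> (?x e \<otimes>\<^bsub>A\<^esub> (?x (opp e) \<otimes>\<^bsub>A\<^esub> ?x b))"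
        using True r xc[OF bcd(1)] xc[OF ob] xc[OF e(1)] xc[OF oe]
        by (simp add: A.m_assoc[symmetric] A.smult_mult_l)
      ultimately show ?thesis using xc[OF e(1)] by (simp add: A.smult_zero_r)
    next
      assume "\<exists>e\<in>arcs2. tgt2 e = src2 b \<and> e \<noteq> opp b"
      then obtain e where e: "e \<in> arcs2" "tgt2 e = src2 b" "e \<noteq> opp b" by blast
      have oe: "opp e \<in> arcs2" using e by simp
      obtain r where r: "?x (opp b) \<otimes>\<^bsub>A\<^esub> ?x (opp (opp b)) = r \<odot>\<^bsub>A\<^esub> (?x e \<otimes>\<^bsub>A\<^esub> ?x (opp e))"
        using exchange[OF ob e(1)] e(2) by auto
      have "?x b \<otimes>\<^bsub>A\<^esub> ?x e = \<zero>\<^bsub>A\<^esub>" by (rule zero[OF bcd(1) e(1,3)])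
      moreover have "?x b \<otimes>\<^bsub>A\<^esub> (?x c \<otimes>\<^bsub>A\<^esub> ?x d) = r \<odot>\<^bsub>A\<^esub> ((?x b \<otimes>\<^bsub>A\<^esub> ?x e) \<otimes>\<^bsub>A\<^esub> ?x (opp e))"
        using True r xc[OF bcd(1)] xc[OF ob] xc[OF e(1)] xc[OF oe]
        by (simp add: A.m_assoc A.smult_mult_r)
      ultimately show ?thesis using xc[OF oe] by (simp add: A.smult_zero_r)
    qed
  qed
  have lc: "dl (Inr h) \<in> carrier A" if "h \<in> carrier (left_dual SA U2)" for h using that by simp
  have lz: "dl (Inr \<zero>\<^bsub>left_dual SA U2\<^esub>) = \<zero>\<^bsub>A\<^esub>"
    unfolding dl_def A_def by (rule H.letter_zero(2))
  have 1: "?x b \<otimes>\<^bsub>A\<^esub> (?x c \<otimes>\<^bsub>A\<^esub> dl (Inr h)) = \<zero>\<^bsub>A\<^esub>"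
    if bc: "b \<in> arcs2" "c \<in> arcs2" and h: "h \<in> carrier (left_dual SA U2)" for b c h
    using h
  proof (induction rule: H.W.coord_induct)
    case (add h h')
    then show ?case using xc bc lc by (simp add: m.g_Madd A.r_distr)
  next
    case (smult r h)
    then show ?case using xc bc lc by (simp add: m.g_Msmult A.smult_mult_r A.smult_zero_r)
  qed (use xc bc basis lz in simp_all)
  have 2: "?x b \<otimes>\<^bsub>A\<^esub> (dl (Inr h') \<otimes>\<^bsub>A\<^esub> dl (Inr h)) = \<zero>\<^bsub>A\<^esub>"
    if b: "b \<in> arcs2" and h: "h' \<in> carrier (left_dual SA U2)" "h \<in> carrier (left_dual SA U2)" for b h h'
    using h(1)
  proof (induction rule: H.W.coord_induct)
    case (add h' h'')
    then show ?case using xc b lc h(2) by (simp add: m.g_Madd A.r_distr A.l_distr)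
  next
    case (smult r h')
    then show ?case using xc b lc h(2)
      by (simp add: m.g_Msmult A.smult_mult_r A.smult_mult_l A.smult_zero_r)
  qed (use xc b 1 lz h(2) lc in simp_all)
  show ?thesis
    using fgk(1)
  proof (induction rule: H.W.coord_induct)
    case (add h' h'')
    then show ?case using lc fgk by (simp add: m.g_Madd A.l_distr)
  next
    case (smult r h')
    then show ?case using lc fgk by (simp add: m.g_Msmult A.smult_mult_l A.smult_zero_r)
  qed (use 2 lz fgk lc in simp_all)
qed

end

section \<open>The quiver with one arc\<close>

text \<open>
  The four entries of a two by two matrix, row by row.
\<close>

definition mat2 :: "('f::field, 'f \<times> 'f \<times> 'f \<times> 'f) module" where
  "mat2 = \<lparr>carrier = UNIV,
    mult = (\<lambda>(a, b, c, d) (a', b', c', d').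
      (a * a' + b * c', a * b' + b * d', c * a' + d * c', c * b' + d * d')),
    one = (1, 0, 0, 1), zero = (0, 0, 0, 0),
    add = (\<lambda>(a, b, c, d) (a', b', c', d'). (a + a', b + b', c + c', d + d')),
    smult = (\<lambda>r (a, b, c, d). (r * a, r * b, r * c, r * d))\<rparr>"

lemma mat2_simps:
  "carrier mat2 = UNIV" "\<one>\<^bsub>mat2\<^esub> = (1, 0, 0, 1)" "\<zero>\<^bsub>mat2\<^esub> = (0, 0, 0, 0)"
  "(a, b, c, d) \<otimes>\<^bsub>mat2\<^esub> (a', b', c', d') =
    (a * a' + b * c', a * b' + b * d', c * a' + d * c', c * b' + d * d')"
  "(a, b, c, d) \<oplus>\<^bsub>mat2\<^esub> (a', b', c', d') = (a + a', b + b', c + c', d + d')"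
  "r \<odot>\<^bsub>mat2\<^esub> (a, b, c, d) = (r * a, r * b, r * c, r * d)"
  by (simp_all add: mat2_def)

lemma mat2_falgebra: "falgebra (mat2 :: ('f::field, _) module)"
proof -
  have ab: "abelian_group (mat2 :: ('f, _) module)"
  proof (rule abelian_groupI)
    fix x :: "'f \<times> 'f \<times> 'f \<times> 'f"
    obtain a b c d where x: "x = (a, b, c, d)" by (cases x)
    show "\<exists>y\<in>carrier mat2. y \<oplus>\<^bsub>mat2\<^esub> x = \<zero>\<^bsub>mat2\<^esub>"
      by (rule bexI[of _ "(- a, - b, - c, - d)"]) (simp_all add: x mat2_simps)
  qed (auto simp: mat2_simps)
  have mon: "monoid (mat2 :: ('f, _) module)"
    by (rule monoidI) (auto simp: mat2_simps algebra_simps)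
  have "ring (mat2 :: ('f, _) module)"
    by (rule ringI[OF ab mon]) (auto simp: mat2_simps algebra_simps)
  then show ?thesis
    by (intro falgebra.intro falgebra_axioms.intro) (auto simp: mat2_simps algebra_simps)
qed

context finite_quiver
begin

text \<open>
  Over the quiver with one arc, the quadratic dual of the preprojective algebra is the path algebra of
  a cycle of length two, which acts on the plane by sending the two arrows to the two
  off-diagonal matrix units.
\<close>

lemma A2_triple_product:
  assumes a: "arcs Q = {a}" "verts Q = {tail Q a, head Q a}" "tail Q a \<noteq> head Q a"
  shows "\<exists>f\<in>carrier (left_dual SA U2). \<exists>g\<in>carrier (left_dual SA U2). \<exists>k\<in>carrier (left_dual SA U2).
    dual_letter SA U2 (preproj_relations Q) (Inr f) \<otimes>\<^bsub>preprojective_dual Q\<^esub>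
      (dual_letter SA U2 (preproj_relations Q) (Inr g) \<otimes>\<^bsub>preprojective_dual Q\<^esub>
        dual_letter SA U2 (preproj_relations Q) (Inr k)) \<noteq>
    \<zero>\<^bsub>preprojective_dual Q :: ('f::field, ('f, 'v, 'e) preproj_dual) graded_algebra\<^esub>"
proof -
  interpret H: quadratic_presentation "verts Q" arcs2 src2 tgt2 "U2 :: ('f, _, ('f, 'v, 'e) dbl) bimod" dbl_co
    "verts Q" "\<lambda>i. i" "\<lambda>i. i" vertex_kappa "preproj_relations Q" by (rule preprojective_presentation)
  interpret A: graded_falgebra H.QD by (rule H.U.quadratic_dual_graded)
  interpret M2: falgebra "mat2 :: ('f, _) module" by (rule mat2_falgebra)
  interpret I: ideal H.U.I H.U.F by (rule H.W.tensor_ideal_ideal)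
  define g0 :: "('v \<Rightarrow> 'f) + (('f, 'v, 'e) dbl \<Rightarrow> 'v \<Rightarrow> 'f) \<Rightarrow> 'f \<times> 'f \<times> 'f \<times> 'f" where
    "g0 = case_sum (\<lambda>s. (s (head Q a), 0, 0, s (tail Q a))) (\<lambda>k. (0, dco2 k (Inl a), dco2 k (Inr a), 0))"
  have g0: "g0 (Inl s) = (s (head Q a), 0, 0, s (tail Q a))" "g0 (Inr k) = (0, dco2 k (Inl a), dco2 k (Inr a), 0)" for s k
    by (simp_all add: g0_def)
  have ends: "head Q a \<in> verts Q" "tail Q a \<in> verts Q" "a \<in> arcs Q" using a(1,2) by auto
  have tm: "tensor_map H.U.S H.U.W mat2 g0"
    by unfold_locales
      (auto simp: g0 mat2_simps fun_algebra_simps ends H.W.co_add H.W.co_smult H.W.co_lact H.W.co_ract)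
  interpret m: tensor_map H.U.S H.U.W mat2 g0 by (rule tm)
  have two: "subst mat2 g0 \<xi> = (coef2 dco2 \<xi> (Inl a) (Inr a), 0, 0, coef2 dco2 \<xi> (Inr a) (Inl a))"
    if \<xi>: "\<xi> \<in> two_letter_sums H.U.S H.U.W" for \<xi>
  proof -
    note supp = two_letter_support[OF \<xi>]
    define F where "F = (\<lambda>w. \<xi> w \<odot>\<^bsub>mat2\<^esub> foldr (mult mat2) (map g0 w) \<one>\<^bsub>mat2\<^esub>)"
    let ?N = "{w. \<xi> w \<noteq> 0}"
    have cl: "F \<in> ?N \<rightarrow> carrier mat2" by (simp add: mat2_simps(1))
    have re: "(\<Sum>w\<in>?N. h w) = (\<Sum>(u, v)\<in>pair_support \<xi>. h [Inr u, Inr v])" for h :: "_ \<Rightarrow> 'f"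
      using sum.reindex_bij_betw[OF supp(2), of h] by (simp add: case_prod_unfold)
    have val: "F [Inr u, Inr v] = (\<xi> [Inr u, Inr v] * (dco2 u (Inl a) * dco2 v (Inr a)), 0, 0,
        \<xi> [Inr u, Inr v] * (dco2 u (Inr a) * dco2 v (Inl a)))" for u v
      by (simp add: F_def g0 mat2_simps)
    note af = additive_finsum[OF M2.abelian_group_axioms _ _ cl]
    have "fst (finsum mat2 F ?N) = (\<Sum>w\<in>?N. fst (F w))"
      by (rule af) (auto simp: mat2_simps)
    moreover have "fst (snd (finsum mat2 F ?N)) = (\<Sum>w\<in>?N. fst (snd (F w)))"
      by (rule af[of "\<lambda>x. fst (snd x)"]) (auto simp: mat2_simps)
    moreover have "fst (snd (snd (finsum mat2 F ?N))) = (\<Sum>w\<in>?N. fst (snd (snd (F w))))"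
      by (rule af[of "\<lambda>x. fst (snd (snd x))"]) (auto simp: mat2_simps)
    moreover have "snd (snd (snd (finsum mat2 F ?N))) = (\<Sum>w\<in>?N. snd (snd (snd (F w))))"
      by (rule af[of "\<lambda>x. snd (snd (snd x))"]) (auto simp: mat2_simps)
    moreover have "subst mat2 g0 \<xi> = finsum mat2 F ?N" by (simp only: subst_def F_def)
    ultimately show ?thesis
      by (simp add: prod_eq_iff re val coef2_def mult.assoc case_prod_unfold)
  qed
  have kills: "subst mat2 g0 \<xi> = \<zero>\<^bsub>mat2\<^esub>"
    if \<xi>: "\<xi> \<in> two_letter_sums H.U.S H.U.W" and perp: "H.U.I +>\<^bsub>H.U.F\<^esub> \<xi> \<in> quadratic_perp H.U.S U2 (preproj_relations Q)" for \<xi>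
  proof -
    have "\<xi> \<in> H.U.I +>\<^bsub>H.U.F\<^esub> \<xi>"
      by (rule I.a_rcos_self) (use \<xi> in \<open>simp add: two_letter_sums_def\<close>)
    moreover have "H.U.I +>\<^bsub>H.U.F\<^esub> \<xi> \<in> degs H.U.T 2" using perp by (simp add: quadratic_perp_def)
    ultimately have "subst H.B (coord_letter dco2) \<xi> = \<zero>\<^bsub>H.B\<^esub>" using H.perp_iff perp \<xi> by blast
    then have z: "(\<Sum>b\<in>arcs2. \<Sum>c\<in>arcs2. vertex_kappa i b c * coef2 dco2 \<xi> b c) = 0" for i
      by (simp add: H.W.subst_coord_letter[OF \<xi>] H.cube_zero_simps fun_eq_iff)
    have "coef2 dco2 \<xi> (Inl a) (Inr a) = 0" "coef2 dco2 \<xi> (Inr a) (Inl a) = 0"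
      using z[of "head Q a"] z[of "tail Q a"] a(3) unfolding vertex_kappa_sum by (simp_all add: a(1))
    then show ?thesis by (simp add: two[OF \<xi>] mat2_simps)
  qed
  obtain r where r: "r \<in> alg_hom H.QD mat2" "\<And>l. l \<in> carrier H.U.S <+> carrier H.U.W \<Longrightarrow> r (H.dl l) = g0 l"
    using H.U.quadratic_dual_hom[OF tm kills] by blast
  have D: "Inl a \<in> arcs2" "Inr a \<in> arcs2" using a(1) by auto
  note b1 = H.W.basis[OF D(1)] and b2 = H.W.basis[OF D(2)]
  let ?t = "H.dl (Inr (H.W.basis (Inl a))) \<otimes>\<^bsub>H.QD\<^esub>
    (H.dl (Inr (H.W.basis (Inr a))) \<otimes>\<^bsub>H.QD\<^esub> H.dl (Inr (H.W.basis (Inl a))))"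
  have "r ?t = (0, 1, 0, 0)"
    using b1 b2 by (simp add: alg_homD[OF r(1)] r(2)) (simp add: g0 b1(2) b2(2) mat2_simps)
  moreover have "r \<zero>\<^bsub>H.QD\<^esub> = (0, 0, 0, 0)"
    using alg_hom_zero[OF H.L.B.falgebra_axioms mat2_falgebra r(1)] by (simp add: mat2_simps)
  ultimately have "?t \<noteq> \<zero>\<^bsub>H.QD\<^esub>" by auto
  then show ?thesis using b1(1) b2(1) unfolding preprojective_dual_def by blast
qed

section \<open>The natural morphism\<close>

text \<open>
  Uniqueness holds because letters generate. The isomorphism from the coordinate algebra to the trivial extension
  reduces both directions to the map from the quadratic dual to the coordinate algebra.
\<close>

lemma natural_morphism_iso_iff:
  assumes conn: "connected Q" and nA1: "\<not> of_type_A 1 Q"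
  shows "(\<exists>!\<phi> :: ('f::field, 'v, 'e) preproj_dual \<Rightarrow> ('f, 'v, 'e) triv_pathalg_dual. natural_morphism Q \<phi>) \<and>
    (\<forall>\<phi> :: ('f, 'v, 'e) preproj_dual \<Rightarrow> ('f, 'v, 'e) triv_pathalg_dual. natural_morphism Q \<phi> \<longrightarrow>
      (\<phi> \<in> graded_iso (preprojective_dual Q) (triv2 PD) \<longleftrightarrow> \<not> of_type_A 2 Q))"
proof -
  interpret H: quadratic_presentation "verts Q" arcs2 src2 tgt2 "U2 :: ('f, _, ('f, 'v, 'e) dbl) bimod" dbl_co
    "verts Q" "\<lambda>i. i" "\<lambda>i. i" vertex_kappa "preproj_relations Q" by (rule preprojective_presentation)
  let ?A = "preprojective_dual Q :: ('f, ('f, 'v, 'e) preproj_dual) graded_algebra"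
  have A: "?A = H.QD" by (rule preprojective_dual_def)
  interpret A: graded_falgebra H.QD by (rule H.U.quadratic_dual_graded)
  obtain h where h: "h \<in> graded_iso (PD :: ('f, ('f, 'v, 'e) pathalg_dual) graded_algebra) GB"
    "\<And>l. l \<in> carrier SA <+> carrier (left_dual SA V) \<Longrightarrow> h (path_dual_letter Q l) = coord_letter dco1 l"
    using path_dual_iso by blast
  interpret R: radical_square_zero Q "PD :: ('f, ('f, 'v, 'e) pathalg_dual) graded_algebra" h
    using path_dual_graded h(1)
    by (intro radical_square_zero.intro radical_square_zero_axioms.intro finite_quiver_axioms)
  obtain \<Phi> where \<Phi>: "\<Phi> \<in> graded_hom H.QD H.B"
    "\<And>x. x \<in> carrier H.U.F \<Longrightarrow> \<Phi> (H.J +>\<^bsub>H.U.T\<^esub> (H.U.I +>\<^bsub>H.U.F\<^esub> x)) = subst H.B (coord_letter dco2) x"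
    "\<And>l. l \<in> carrier H.U.S <+> carrier H.U.W \<Longrightarrow> \<Phi> (H.dl l) = coord_letter dco2 l"
    using H.cube_hom by blast
  let ?\<phi> = "\<lambda>z\<in>carrier ?A. R.triv2_elem (\<Phi> z)"
  have nat: "natural_morphism Q ?\<phi>"
    by (rule natural_morphism_coord[OF h]) (use \<Phi> in \<open>simp_all add: A\<close>)
  have uniq: "\<phi> = ?\<phi>" if \<phi>: "natural_morphism Q \<phi>" for \<phi> :: "('f, 'v, 'e) preproj_dual \<Rightarrow> ('f, 'v, 'e) triv_pathalg_dual"
  proof
    fix z
    note n = \<phi>[unfolded natural_morphism_def Let_def] nat[unfolded natural_morphism_def Let_def]
    show "\<phi> z = ?\<phi> z"
    proof (cases "z \<in> carrier ?A")
      case True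
      show ?thesis
      proof (rule H.U.quadratic_dual_unique)
        show "\<phi> \<in> alg_hom H.QD (triv2 PD)" "?\<phi> \<in> alg_hom H.QD (triv2 PD)"
          using n unfolding graded_hom_iff A by blast+
        show "\<phi> (H.dl l) = ?\<phi> (H.dl l)" if "l \<in> carrier H.U.S <+> carrier H.U.W" for l
        proof (cases l)
          case (Inl s)
          then have "s \<in> carrier SA" using that by simp
          then show ?thesis using n unfolding Inl by metis
        next
          case (Inr k)
          then have "k \<in> carrier (left_dual SA U2)" using that by simp
          then show ?thesis using n unfolding Inr by metis
        qed
        show "z \<in> carrier H.QD" using True unfolding A .
      qed
    next
      case False
      have "\<phi> \<in> extensional (carrier ?A)" using n by blast
      then show ?thesis using False by (simp add: extensional_def)
    qed
  qed
  have \<Theta>: "bij_betw R.triv2_elem (carrier H.B) (carrier (triv2 PD))" "R.triv2_elem ` degs H.B n = degs (triv2 PD) n" for n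
    using R.triv2_elem_iso by (simp_all add: graded_iso_def)
  have iso: "?\<phi> \<in> graded_iso ?A (triv2 PD)" if nA2: "\<not> of_type_A 2 Q"
  proof -
    have "\<Phi> \<in> graded_iso H.QD H.B"
    proof (rule H.cube_iso[OF _ _ _ \<Phi>])
      show "H.dl (Inr f) \<otimes>\<^bsub>H.QD\<^esub> (H.dl (Inr g) \<otimes>\<^bsub>H.QD\<^esub> H.dl (Inr k)) = \<zero>\<^bsub>H.QD\<^esub>"
        if "f \<in> carrier H.U.W" "g \<in> carrier H.U.W" "k \<in> carrier H.U.W" for f g k
        by (rule triple_products_vanish[OF conn nA2 that])
      show "\<exists>b\<in>arcs2. \<exists>c\<in>arcs2. \<exists>r. r \<noteq> 0 \<and> (\<forall>q. vertex_kappa q b c = (if q = i then r else (0 :: 'f)))"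
        if i: "i \<in> verts Q" for i
      proof -
        obtain b where b: "b \<in> arcs2" "tgt2 b = i" using not_A1_incident[OF conn nA1 i] by blast
        moreover have "opp b \<in> arcs2" "dsign b \<noteq> (0 :: 'f)" using b(1) by simp_all
        ultimately show ?thesis
          by (intro bexI[of _ b] bexI[of _ "opp b"] exI[of _ "dsign b"]) (auto simp: vertex_kappa_opp)
      qed
    qed simp
    then have \<Phi>i: "bij_betw \<Phi> (carrier ?A) (carrier H.B)" "\<Phi> ` degs ?A n = degs H.B n" for n
      by (simp_all add: graded_iso_def A)
    have "bij_betw (R.triv2_elem \<circ> \<Phi>) (carrier ?A) (carrier (triv2 PD))"
      by (rule bij_betw_trans[OF \<Phi>i(1) \<Theta>(1)])
    then have "bij_betw ?\<phi> (carrier ?A) (carrier (triv2 PD))"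
      by (rule bij_betw_cong[THEN iffD1, rotated]) simp
    moreover have "?\<phi> ` degs ?A n = degs (triv2 PD) n" for n
    proof -
      have "?\<phi> ` degs ?A n = R.triv2_elem ` \<Phi> ` degs ?A n"
        unfolding image_image by (rule image_cong) (use A.degs_carrier in \<open>simp_all add: A\<close>)
      then show ?thesis unfolding \<Phi>i(2) \<Theta>(2) .
    qed
    moreover have "?\<phi> \<in> graded_hom ?A (triv2 PD)"
      using nat unfolding natural_morphism_def Let_def by blast
    ultimately show ?thesis by (simp add: graded_iso_def)
  qed
  have not_iso: "?\<phi> \<notin> graded_iso ?A (triv2 PD)" if A2: "of_type_A 2 Q"
  proof
    assume "?\<phi> \<in> graded_iso ?A (triv2 PD)"
    then have inj: "inj_on ?\<phi> (carrier ?A)" by (simp add: graded_iso_def bij_betw_def)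
    obtain a where a: "arcs Q = {a}" "verts Q = {tail Q a, head Q a}" "tail Q a \<noteq> head Q a"
      by (rule A2_arc[OF A2])
    let ?P = "\<lambda>f g k. H.dl (Inr f) \<otimes>\<^bsub>?A\<^esub> (H.dl (Inr g) \<otimes>\<^bsub>?A\<^esub> H.dl (Inr k)) \<noteq> \<zero>\<^bsub>?A\<^esub>"
    have ne: "\<exists>f\<in>carrier H.U.W. \<exists>g\<in>carrier H.U.W. \<exists>k\<in>carrier H.U.W. ?P f g k"
      by (rule A2_triple_product[OF a])
    obtain f where f: "f \<in> carrier H.U.W" "\<exists>g\<in>carrier H.U.W. \<exists>k\<in>carrier H.U.W. ?P f g k" using ne by (rule bexE)
    obtain g where g: "g \<in> carrier H.U.W" "\<exists>k\<in>carrier H.U.W. ?P f g k" using f(2) by (rule bexE)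
    obtain k where k: "k \<in> carrier H.U.W" "?P f g k" using g(2) by (rule bexE)
    note fgk = f(1) g(1) k(1) and nz = k(2)[unfolded A]
    let ?t = "H.dl (Inr f) \<otimes>\<^bsub>H.QD\<^esub> (H.dl (Inr g) \<otimes>\<^bsub>H.QD\<^esub> H.dl (Inr k))"
    have \<Phi>h: "\<Phi> \<in> alg_hom H.QD H.B" using \<Phi>(1) by (simp add: graded_hom_iff)
    have t: "\<Phi> ?t = \<zero>\<^bsub>H.B\<^esub>"
      using fgk by (simp add: alg_homD[OF \<Phi>h] \<Phi>(3)) (simp add: coord_letter_def H.cube_zero_simps H.K_simps)
    have z: "\<Phi> \<zero>\<^bsub>H.QD\<^esub> = \<zero>\<^bsub>H.B\<^esub>"
      by (rule alg_hom_zero[OF H.L.B.falgebra_axioms graded_falgebra.axioms(1)[OF H.cube_zero_graded] \<Phi>h])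
    have c: "?t \<in> carrier ?A" "\<zero>\<^bsub>H.QD\<^esub> \<in> carrier ?A"
      unfolding A by (intro H.L.B.m_closed H.L.B.zero_closed H.L.g_closed fgk)+
    have "?\<phi> ?t = ?\<phi> \<zero>\<^bsub>H.QD\<^esub>"
      unfolding restrict_apply'[OF c(1)] restrict_apply'[OF c(2)] t z ..
    then have "?t = \<zero>\<^bsub>H.QD\<^esub>" by (rule inj_onD[OF inj _ c])
    with nz show False by (rule notE)
  qed
  show ?thesis
  proof (intro conjI allI impI)
    show "\<exists>!\<phi> :: ('f, 'v, 'e) preproj_dual \<Rightarrow> ('f, 'v, 'e) triv_pathalg_dual. natural_morphism Q \<phi>"
      using nat uniq by blast
    show "\<phi> \<in> graded_iso ?A (triv2 PD) \<longleftrightarrow> \<not> of_type_A 2 Q" if "natural_morphism Q \<phi>" for \<phi>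
      unfolding uniq[OF that] using iso not_iso by blast
  qed
qed

end

theorem theorem5p7:
  fixes Q :: "('v, 'e) pre_digraph"
  assumes "fin_digraph Q" and "connected Q" and "acyclic_quiver Q"
    and "\<not> of_type_A 1 Q"
  shows "(\<exists>!\<phi> :: ('f::field, 'v, 'e) preproj_dual \<Rightarrow> ('f, 'v, 'e) triv_pathalg_dual.
            natural_morphism Q \<phi>) \<and>
         (\<forall>\<phi> :: ('f, 'v, 'e) preproj_dual \<Rightarrow> ('f, 'v, 'e) triv_pathalg_dual.
            natural_morphism Q \<phi> \<longrightarrow>
            (\<phi> \<in> graded_iso (preprojective_dual Q) (triv2 (path_algebra_dual Q)) \<longleftrightarrow>
             \<not> of_type_A 2 Q))"
proof -
  interpret finite_quiver Q using assms(1) by (rule finite_quiver.intro)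
  show ?thesis using assms(2,4) by (rule natural_morphism_iso_iff)
qed

end
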